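(* Let $p$ be a prime and let $b,\sigma\in(0,\infty)$. For $m\in\mathbb N_0$, let $\mathrm P^m$ be the probability measure on the Skorohod space $D([0,\infty)\colon\mathbb Q_p)$ that is the law of the scaled random walk $\tilde Y^m$, where $\tilde Y^m_t=\Gamma_m\big(S_{\lfloor t\lambda(m)\rfloor}\big)$, and let $\mathrm P$ be the probability measure on $D([0,\infty)\colon\mathbb Q_p)$ of the $p$-adic Brownian motion with parameters $b$ and $\sigma$ (all defined in the context). Then the sequence of measures $(\mathrm P^m)_{m\in\mathbb N_0}$ converges weakly to $\mathrm P$.
   Context: $\mathbb N_0=\{0,1,2,\dots\}$, $\mathbb N=\{1,2,\dots\}$. $|\cdot|$ is the $p$-adic absolute value on $\mathbb Q_p$, $\mathbb Z_p$ is the ring of $p$-adic integers, $\mu$ is the Haar measure on $(\mathbb Q_p,+)$ with $\mu(\mathbb Z_p)=1$. Every $x\in\mathbb Q_p$ has a unique expansion $x=\sum_{k\in\mathbb Z}a_x(k)p^k$ with $a_x(k)\in\{0,\dots,p-1\}$; $\{x\}=\sum_{k<0}a_x(k)p^k\in\mathbb Q$ and $\chi(x)=e^{2\pi\sqrt{-1}\{x\}}$. $D([0,\infty)\colon\mathbb Q_p)$ is the space of càdlàg functions $[0,\infty)\to\mathbb Q_p$ with the Skorohod metric. Brownian motion. For $(t,x)\in(0,\infty)\times\mathbb Q_p$ let $\rho(t,x)=\int_{\mathbb Q_p}\chi(xy)e^{-\sigma t|y|^b}\,d\mu(y)$; $\{\rho(t,\cdot)\}_{t>0}$ is a convolution semigroup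 of probability densities on $\mathbb Q_p$. $\mathrm P$ is the probability measure on $D([0,\infty)\colon\mathbb Q_p)$ such that for all $0=t_0<t_1<\dots<t_N$ and Borel sets $U_0,\dots,U_N\subseteq\mathbb Q_p$, $\mathrm P(\omega(t_i)\in U_i,\ 0\le i\le N)=\int_{U_1}\cdots\int_{U_N}\prod_{i=1}^N\rho(t_i-t_{i-1},x_i-x_{i-1})\,d\mu(x_N)\cdots d\mu(x_1)$ with $x_0=0$ if $0\in U_0$, and $=0$ if $0\notin U_0$. Primitive random walk. $G=\mathbb Q_p/\mathbb Z_p$ (discrete group), $[x]=x+\mathbb Z_p$, $|[x]|=|x|$ if $x\notin\mathbb Z_p$ and $|[0]|=0$. $X$ is a $G$-valued random variable with $\mathrm{Prob}(X=[0])=0$ and $\mathrm{Prob}(X=g)=\frac{p^b-1}{p^{ib}}\cdot\frac1{p^i-p^{i-1}}$ if $|g|=p^i$, $i\in\mathbb N$. $X_1,X_2,\dots$ are i.i.d. copies of $X$, $S_0=[0]$, $S_n=X_1+\dots+X_n$. Scaling. $\alpha=\frac{p^{b+1}-1}{p^{b+1}-p^b}$, $\lambda(m)=\frac{\sigma}{\alpha}p^{mb}$ (time step $\tau_m=1/\lambda(m)$). $\Gamma_m\colon G\to\mathbb Q_p$ is $\Gamma_m([x])=p^m\sum_{k<0}a_x(k)p^k$ (independent of the representative $x$). $\mathrm P^m$ is the unique probability measure on $D([0,\infty)\colon\mathbb Q_p)$ under which the coordinate process $Y_t(\omega)=\omega(t)$ has the same finite dimensional distributions as $\tilde Y^m$.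 *)

theory Defs
  imports "HOL-Probability.Probability" "Berlekamp_Zassenhaus.Finite_Field"
begin

subsection \<open>The \<open>p\<close>-adic absolute value on the rationals\<close>

definition rat_padic_abs :: "nat \<Rightarrow> rat \<Rightarrow> real" where
  "rat_padic_abs p q = (if q = 0 then 0 else
     real p powi (int (multiplicity (int p) (snd (quotient_of q)))
                - int (multiplicity (int p) (fst (quotient_of q)))))"

lemma rat_int_quotient_cases:
  obtains a b where "(q::rat) = of_int a / of_int b" "b > (0::int)"
proof -
  obtain c d where "quotient_of q = (c, d)" by fastforce
  thus ?thesis using quotient_of_denom_pos quotient_of_div that by blast
qed

context
  fixes p :: nat
  assumes p: "prime p"
begin

lemma rat_padic_abs_0 [simp]: "rat_padic_abs p 0 = 0"
  by (simp add: rat_padic_abs_def)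

lemma rat_padic_abs_frac:
  assumes "a \<noteq> 0" "b \<noteq> 0"
  shows "rat_padic_abs p (of_int a / of_int b)
           = real p powi (int (multiplicity (int p) b) - int (multiplicity (int p) a))"
proof -
  define q :: rat where "q = of_int a / of_int b"
  obtain c d where cd: "quotient_of q = (c, d)" by fastforce
  have d: "d > 0" using quotient_of_denom_pos[OF cd] .
  have qcd: "q = of_int c / of_int d" using quotient_of_div[OF cd] .
  have q0: "q \<noteq> 0" using assms by (simp add: q_def)
  hence c: "c \<noteq> 0" using qcd by auto
  have "(of_int (a * d) :: rat) = of_int (c * b)"
    using qcd q_def assms d by (simp add: field_simps)
  hence e: "a * d = c * b" by (simp only: of_int_eq_iff)
  have pe: "prime_elem (int p)" using p by simp
  have "multiplicity (int p) a + multiplicity (int p) d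
      = multiplicity (int p) c + multiplicity (int p) b"
    using prime_elem_multiplicity_mult_distrib[OF pe, of a d]
      prime_elem_multiplicity_mult_distrib[OF pe, of c b] e assms c d by simp
  hence eq: "int (multiplicity (int p) d) - int (multiplicity (int p) c)
       = int (multiplicity (int p) b) - int (multiplicity (int p) a)" by linarith
  have "rat_padic_abs p q
      = real p powi (int (multiplicity (int p) d) - int (multiplicity (int p) c))"
    using q0 cd unfolding rat_padic_abs_def by simp
  thus ?thesis unfolding eq q_def .
qed

lemma rat_padic_abs_nonneg [simp]: "rat_padic_abs p q \<ge> 0"
  by (simp add: rat_padic_abs_def)

lemma rat_padic_abs_eq_0 [simp]: "rat_padic_abs p q = 0 \<longleftrightarrow> q = 0"
  using p by (simp add: rat_padic_abs_def)

lemma rat_padic_abs_mult: "rat_padic_abs p (q * r) = rat_padic_abs p q * rat_padic_abs p r"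
proof (cases "q = 0 \<or> r = 0")
  case False
  obtain a b where q: "q = of_int a / of_int b" "b > (0::int)" by (rule rat_int_quotient_cases)
  obtain c d where r: "r = of_int c / of_int d" "d > (0::int)" by (rule rat_int_quotient_cases)
  have ac: "a \<noteq> 0" "c \<noteq> 0" using False q r by auto
  have pe: "prime_elem (int p)" using p by simp
  have "q * r = of_int (a * c) / of_int (b * d)" using q r by simp
  moreover have "real p \<noteq> 0" using p by auto
  ultimately show ?thesis
    using q r ac rat_padic_abs_frac[of "a*c" "b*d"] rat_padic_abs_frac[of a b]
      rat_padic_abs_frac[of c d]
    by (simp add: prime_elem_multiplicity_mult_distrib[OF pe] power_int_add [symmetric] algebra_simps)
qed auto

lemma rat_padic_abs_1 [simp]: "rat_padic_abs p 1 = 1"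
  by (simp add: rat_padic_abs_def)

lemma rat_padic_abs_minus [simp]: "rat_padic_abs p (- q) = rat_padic_abs p q"
proof -
  have "rat_padic_abs p (-1) = rat_padic_abs p (of_int (-1) / of_int 1)" by simp
  also have "\<dots> = 1" by (subst rat_padic_abs_frac) (auto simp: multiplicity_unit_right)
  finally have "rat_padic_abs p (-1) = 1" .
  thus ?thesis using rat_padic_abs_mult[of "-1" q] by simp
qed

lemma rat_padic_abs_ultra: "rat_padic_abs p (q + r) \<le> max (rat_padic_abs p q) (rat_padic_abs p r)"
proof (cases "q = 0 \<or> r = 0 \<or> q + r = 0")
  case False
  obtain a b where q: "q = of_int a / of_int b" "b > (0::int)" by (rule rat_int_quotient_cases)
  obtain c d where r: "r = of_int c / of_int d" "d > (0::int)" by (rule rat_int_quotient_cases)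
  have q': "q = of_int (a * d) / of_int (b * d)" and r': "r = of_int (c * b) / of_int (b * d)"
    using q r by simp_all
  have qr: "q + r = of_int (a * d + c * b) / of_int (b * d)"
    using q r by (simp add: field_simps)
  define m where "m = min (multiplicity (int p) (a*d)) (multiplicity (int p) (c*b))"
  have "a * d + c * b \<noteq> 0" using False qr by (metis div_0 of_int_0)
  hence nz: "a * d \<noteq> 0" "c * b \<noteq> 0" "a * d + c * b \<noteq> 0" "b * d \<noteq> 0"
    using False q r by auto
  have "int p ^ m dvd a * d" "int p ^ m dvd c * b"
    by (auto simp: m_def intro!: multiplicity_dvd')
  hence "int p ^ m dvd a * d + c * b" by simp
  moreover have "\<not> is_unit (int p)" using p by auto
  ultimately have m: "m \<le> multiplicity (int p) (a * d + c * b)"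
    using nz by (intro multiplicity_geI) auto
  have p1: "real p \<ge> 1" using p prime_ge_1_nat by auto
  have "rat_padic_abs p (q + r) \<le> real p powi (int (multiplicity (int p) (b*d)) - int m)"
    unfolding qr rat_padic_abs_frac[OF nz(3,4)] using m p1 by (intro power_int_increasing) auto
  also have "\<dots> \<le> max (rat_padic_abs p q) (rat_padic_abs p r)"
    unfolding q' r' rat_padic_abs_frac[OF nz(1,4)] rat_padic_abs_frac[OF nz(2,4)]
    by (auto simp: m_def min_def le_max_iff_disj)
  finally show ?thesis .
qed (auto simp: le_max_iff_disj)

lemma rat_padic_abs_triangle: "rat_padic_abs p (q + r) \<le> rat_padic_abs p q + rat_padic_abs p r"
  using rat_padic_abs_ultra[of q r] rat_padic_abs_nonneg[of q] rat_padic_abs_nonneg[of r] by linarith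

lemma rat_padic_abs_commute: "rat_padic_abs p (q - r) = rat_padic_abs p (r - q)"
  using rat_padic_abs_minus[of "q - r"] by simp

lemma rat_padic_abs_diff: "\<bar>rat_padic_abs p q - rat_padic_abs p r\<bar> \<le> rat_padic_abs p (q - r)"
  using rat_padic_abs_triangle[of "q - r" r] rat_padic_abs_triangle[of "r - q" q]
    rat_padic_abs_commute[of q r] by simp

lemma rat_padic_abs_inverse: "rat_padic_abs p (inverse q) = inverse (rat_padic_abs p q)"
proof (cases "q = 0")
  case False
  hence "rat_padic_abs p q * rat_padic_abs p (inverse q) = 1"
    unfolding rat_padic_abs_mult[symmetric] by simp
  thus ?thesis using inverse_unique by fastforce
qed auto

end

subsection \<open>The field of \<open>p\<close>-adic numbers as completion of the rationals\<close>

text \<open>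
  Throughout, the prime is \<open>p = CARD('p)\<close> for a type \<open>'p\<close> of class \<^class>\<open>prime_card\<close>; every prime
  arises in this way, and only the cardinality of \<open>'p\<close> matters.
\<close>

definition rat_padic_cauchy :: "nat \<Rightarrow> (nat \<Rightarrow> rat) \<Rightarrow> bool" where
  "rat_padic_cauchy p X \<longleftrightarrow> (\<forall>e>0. \<exists>N. \<forall>m\<ge>N. \<forall>n\<ge>N. rat_padic_abs p (X m - X n) < e)"

definition rat_padic_null :: "nat \<Rightarrow> (nat \<Rightarrow> rat) \<Rightarrow> bool" where
  "rat_padic_null p X \<longleftrightarrow> (\<lambda>n. rat_padic_abs p (X n)) \<longlonglongrightarrow> 0"

definition rat_padic_rel :: "nat \<Rightarrow> (nat \<Rightarrow> rat) \<Rightarrow> (nat \<Rightarrow> rat) \<Rightarrow> bool" where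
  "rat_padic_rel p X Y \<longleftrightarrow>
     rat_padic_cauchy p X \<and> rat_padic_cauchy p Y \<and> rat_padic_null p (\<lambda>n. X n - Y n)"

context
  fixes p :: nat
  assumes p: "prime p"
begin

lemma rat_padic_null_bound:
  assumes "\<And>n. rat_padic_abs p (X n) \<le> Y n" "Y \<longlonglongrightarrow> 0"
  shows "rat_padic_null p X"
  unfolding rat_padic_null_def
  by (rule tendsto_sandwich[OF _ _ tendsto_const assms(2)])
     (intro always_eventually allI assms(1) rat_padic_abs_nonneg[OF p])+

lemma rat_padic_null_0: "rat_padic_null p (\<lambda>n. 0)"
  using p by (simp add: rat_padic_null_def)

lemma rat_padic_null_add:
  assumes "rat_padic_null p X" "rat_padic_null p Y"
  shows "rat_padic_null p (\<lambda>n. X n + Y n)"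
  using tendsto_add[OF assms[unfolded rat_padic_null_def]]
  by (intro rat_padic_null_bound[where Y = "\<lambda>n. rat_padic_abs p (X n) + rat_padic_abs p (Y n)"])
     (auto intro: rat_padic_abs_triangle[OF p])

lemma rat_padic_null_minus: "rat_padic_null p X \<Longrightarrow> rat_padic_null p (\<lambda>n. - X n)"
  using p by (simp add: rat_padic_null_def)

lemma rat_padic_null_diff:
  assumes "rat_padic_null p X" "rat_padic_null p Y"
  shows "rat_padic_null p (\<lambda>n. X n - Y n)"
  using rat_padic_null_add[OF assms(1) rat_padic_null_minus[OF assms(2)]] by simp

lemma rat_padic_cauchy_const: "rat_padic_cauchy p (\<lambda>n. c)"
  using p by (simp add: rat_padic_cauchy_def)

lemma rat_padic_cauchy_abs:
  assumes "rat_padic_cauchy p X"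
  shows "convergent (\<lambda>n. rat_padic_abs p (X n))"
proof -
  have "Cauchy (\<lambda>n. rat_padic_abs p (X n))"
    unfolding Cauchy_def dist_real_def
  proof (intro allI impI)
    fix e :: real assume "e > 0"
    then obtain N where "\<And>m n. m \<ge> N \<Longrightarrow> n \<ge> N \<Longrightarrow> rat_padic_abs p (X m - X n) < e"
      using assms unfolding rat_padic_cauchy_def by blast
    thus "\<exists>N. \<forall>m\<ge>N. \<forall>n\<ge>N. \<bar>rat_padic_abs p (X m) - rat_padic_abs p (X n)\<bar> < e"
      using le_less_trans[OF rat_padic_abs_diff[OF p]] by blast
  qed
  thus ?thesis by (simp add: Cauchy_convergent_iff)
qed

lemma rat_padic_cauchy_bounded:
  assumes "rat_padic_cauchy p X"
  obtains B where "B > 0" "\<And>n. rat_padic_abs p (X n) \<le> B"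
proof -
  have "Bseq (\<lambda>n. rat_padic_abs p (X n))"
    using rat_padic_cauchy_abs[OF assms] convergent_imp_Bseq by blast
  thus ?thesis using that p by (auto simp: Bseq_def)
qed

lemma rat_padic_null_mult:
  assumes "rat_padic_cauchy p X" "rat_padic_null p Y"
  shows "rat_padic_null p (\<lambda>n. X n * Y n)"
proof -
  obtain B where B: "B > 0" "\<And>n. rat_padic_abs p (X n) \<le> B"
    by (rule rat_padic_cauchy_bounded[OF assms(1)]) blast+
  show ?thesis
    by (rule rat_padic_null_bound[where Y = "\<lambda>n. B * rat_padic_abs p (Y n)"])
       (use B p tendsto_mult_left[OF assms(2)[unfolded rat_padic_null_def], of B] in
         \<open>auto simp: rat_padic_abs_mult intro!: mult_right_mono\<close>)
qed

lemma rat_padic_cauchy_add: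
  assumes "rat_padic_cauchy p X" "rat_padic_cauchy p Y"
  shows "rat_padic_cauchy p (\<lambda>n. X n + Y n)"
  unfolding rat_padic_cauchy_def
proof (intro allI impI)
  fix e :: real assume "e > 0"
  then obtain M N where M: "\<And>m n. m \<ge> M \<Longrightarrow> n \<ge> M \<Longrightarrow> rat_padic_abs p (X m - X n) < e"
    and N: "\<And>m n. m \<ge> N \<Longrightarrow> n \<ge> N \<Longrightarrow> rat_padic_abs p (Y m - Y n) < e"
    using assms unfolding rat_padic_cauchy_def by meson
  have "rat_padic_abs p ((X m + Y m) - (X n + Y n)) < e" if "m \<ge> max M N" "n \<ge> max M N" for m n
    using M[of m n] N[of m n] that rat_padic_abs_ultra[OF p, of "X m - X n" "Y m - Y n"]
    by (simp add: algebra_simps)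
  thus "\<exists>N. \<forall>m\<ge>N. \<forall>n\<ge>N. rat_padic_abs p ((X m + Y m) - (X n + Y n)) < e" by blast
qed

lemma rat_padic_cauchy_minus: "rat_padic_cauchy p X \<Longrightarrow> rat_padic_cauchy p (\<lambda>n. - X n)"
  unfolding rat_padic_cauchy_def using rat_padic_abs_commute[OF p] by (simp add: add.commute)

lemma rat_padic_cauchy_diff:
  assumes "rat_padic_cauchy p X" "rat_padic_cauchy p Y"
  shows "rat_padic_cauchy p (\<lambda>n. X n - Y n)"
  using rat_padic_cauchy_add[OF assms(1) rat_padic_cauchy_minus[OF assms(2)]] by simp

lemma rat_padic_cauchy_mult:
  assumes "rat_padic_cauchy p X" "rat_padic_cauchy p Y"
  shows "rat_padic_cauchy p (\<lambda>n. X n * Y n)"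
  unfolding rat_padic_cauchy_def
proof (intro allI impI)
  fix e :: real assume e: "e > 0"
  obtain A where A: "A > 0" "\<And>n. rat_padic_abs p (X n) \<le> A"
    by (rule rat_padic_cauchy_bounded[OF assms(1)]) blast+
  obtain B where B: "B > 0" "\<And>n. rat_padic_abs p (Y n) \<le> B"
    by (rule rat_padic_cauchy_bounded[OF assms(2)]) blast+
  obtain M where M: "\<And>m n. m \<ge> M \<Longrightarrow> n \<ge> M \<Longrightarrow> rat_padic_abs p (X m - X n) < e / B"
    using assms(1) e B unfolding rat_padic_cauchy_def by (meson divide_pos_pos)
  obtain N where N: "\<And>m n. m \<ge> N \<Longrightarrow> n \<ge> N \<Longrightarrow> rat_padic_abs p (Y m - Y n) < e / A"
    using assms(2) e A unfolding rat_padic_cauchy_def by (meson divide_pos_pos)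
  have "rat_padic_abs p (X m * Y m - X n * Y n) < e" if mn: "m \<ge> max M N" "n \<ge> max M N" for m n
  proof -
    have "rat_padic_abs p (X m * (Y m - Y n)) \<le> A * rat_padic_abs p (Y m - Y n)"
      unfolding rat_padic_abs_mult[OF p] using A p by (intro mult_right_mono) auto
    also have "\<dots> < A * (e / A)" using N mn A by (intro mult_strict_left_mono) auto
    finally have 1: "rat_padic_abs p (X m * (Y m - Y n)) < e" using A by simp
    have "rat_padic_abs p ((X m - X n) * Y n) \<le> rat_padic_abs p (X m - X n) * B"
      unfolding rat_padic_abs_mult[OF p] using B p by (intro mult_left_mono) auto
    also have "\<dots> < (e / B) * B" using M mn B by (intro mult_strict_right_mono) auto
    finally have 2: "rat_padic_abs p ((X m - X n) * Y n) < e" using B by simp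
    have "X m * Y m - X n * Y n = X m * (Y m - Y n) + (X m - X n) * Y n" by (simp add: algebra_simps)
    thus ?thesis using 1 2 rat_padic_abs_ultra[OF p] by (metis le_less_trans max_less_iff_conj)
  qed
  thus "\<exists>N. \<forall>m\<ge>N. \<forall>n\<ge>N. rat_padic_abs p (X m * Y m - X n * Y n) < e" by blast
qed

lemma rat_padic_cauchy_not_null:
  assumes "rat_padic_cauchy p X" "\<not> rat_padic_null p X"
  obtains b k where "b > 0" "\<And>n. n \<ge> k \<Longrightarrow> rat_padic_abs p (X n) > b"
proof -
  obtain L where L: "(\<lambda>n. rat_padic_abs p (X n)) \<longlonglongrightarrow> L"
    using rat_padic_cauchy_abs[OF assms(1)] by (auto simp: convergent_def)
  have "L \<ge> 0" using L p by (intro LIMSEQ_le_const[OF L]) auto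
  moreover have "L \<noteq> 0" using assms(2) L by (auto simp: rat_padic_null_def)
  ultimately have L0: "L > 0" by simp
  hence "eventually (\<lambda>n. rat_padic_abs p (X n) > L / 2) sequentially"
    using order_tendstoD(1)[OF L, of "L / 2"] by simp
  thus ?thesis using that[of "L / 2"] L0 by (auto simp: eventually_sequentially)
qed

lemma rat_padic_inverse_diff:
  assumes "b > 0" "rat_padic_abs p x > b" "rat_padic_abs p y > b"
  shows "rat_padic_abs p (inverse x - inverse y) \<le> rat_padic_abs p (x - y) / b\<^sup>2"
proof -
  have nz: "x \<noteq> 0" "y \<noteq> 0" using assms p by auto
  have "inverse x - inverse y = (y - x) * inverse x * inverse y"
    using nz by (simp add: field_simps)
  hence "rat_padic_abs p (inverse x - inverse y)
       = rat_padic_abs p (x - y) * (inverse (rat_padic_abs p x) * inverse (rat_padic_abs p y))"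
    using rat_padic_abs_commute[OF p, of x y] by (simp add: rat_padic_abs_mult[OF p] rat_padic_abs_inverse[OF p])
  also have "\<dots> \<le> rat_padic_abs p (x - y) * (inverse b * inverse b)"
    using assms p by (intro mult_left_mono mult_mono le_imp_inverse_le) auto
  finally show ?thesis by (simp add: power2_eq_square divide_inverse)
qed

lemma rat_padic_cauchy_inverse:
  assumes "rat_padic_cauchy p X" "\<not> rat_padic_null p X"
  shows "rat_padic_cauchy p (\<lambda>n. inverse (X n))"
  unfolding rat_padic_cauchy_def
proof (intro allI impI)
  fix e :: real assume e: "e > 0"
  obtain b k where b: "b > 0" "\<And>n. n \<ge> k \<Longrightarrow> rat_padic_abs p (X n) > b"
    by (rule rat_padic_cauchy_not_null[OF assms]) blast+
  obtain M where M: "\<And>m n. m \<ge> M \<Longrightarrow> n \<ge> M \<Longrightarrow> rat_padic_abs p (X m - X n) < e * b\<^sup>2"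
    using assms(1) e b(1) unfolding rat_padic_cauchy_def by (metis mult_pos_pos zero_less_power)
  have "rat_padic_abs p (inverse (X m) - inverse (X n)) < e" if mn: "m \<ge> max M k" "n \<ge> max M k" for m n
  proof -
    have "rat_padic_abs p (inverse (X m) - inverse (X n)) \<le> rat_padic_abs p (X m - X n) / b\<^sup>2"
      using mn b by (intro rat_padic_inverse_diff) auto
    also have "\<dots> < e" using M[of m n] mn b by (simp add: field_simps)
    finally show ?thesis .
  qed
  thus "\<exists>N. \<forall>m\<ge>N. \<forall>n\<ge>N. rat_padic_abs p (inverse (X m) - inverse (X n)) < e" by blast
qed

lemma rat_padic_null_inverse_diff:
  assumes X: "rat_padic_cauchy p X" "\<not> rat_padic_null p X"
    and Y: "rat_padic_cauchy p Y" "\<not> rat_padic_null p Y"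
    and XY: "rat_padic_null p (\<lambda>n. X n - Y n)"
  shows "rat_padic_null p (\<lambda>n. inverse (X n) - inverse (Y n))"
proof -
  obtain b k where b: "b > 0" "\<And>n. n \<ge> k \<Longrightarrow> rat_padic_abs p (X n) > b"
    by (rule rat_padic_cauchy_not_null[OF X]) blast+
  obtain c l where c: "c > 0" "\<And>n. n \<ge> l \<Longrightarrow> rat_padic_abs p (Y n) > c"
    by (rule rat_padic_cauchy_not_null[OF Y]) blast+
  define d where "d = min b c"
  have d: "d > 0" using b c by (simp add: d_def)
  have "eventually (\<lambda>n. rat_padic_abs p (inverse (X n) - inverse (Y n))
          \<le> rat_padic_abs p (X n - Y n) / d\<^sup>2) sequentially"
    unfolding eventually_sequentially
  proof (intro exI allI impI)
    fix n assume "n \<ge> max k l"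
    thus "rat_padic_abs p (inverse (X n) - inverse (Y n)) \<le> rat_padic_abs p (X n - Y n) / d\<^sup>2"
      using b(2)[of n] c(2)[of n] by (intro rat_padic_inverse_diff[OF d]) (auto simp: d_def)
  qed
  moreover have "(\<lambda>n. rat_padic_abs p (X n - Y n) / d\<^sup>2) \<longlonglongrightarrow> 0"
    using tendsto_divide[OF XY[unfolded rat_padic_null_def] tendsto_const, of "d\<^sup>2"] d by simp
  ultimately show ?thesis unfolding rat_padic_null_def
    by (rule tendsto_sandwich[OF _ _ tendsto_const, rotated]) (simp add: p)
qed

lemma part_equivp_rat_padic_rel: "part_equivp (rat_padic_rel p)"
proof (rule part_equivpI)
  show "\<exists>X. rat_padic_rel p X X"
    by (rule exI[of _ "\<lambda>n. 0"]) (simp add: rat_padic_rel_def rat_padic_cauchy_const rat_padic_null_0)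
  show "symp (rat_padic_rel p)"
    unfolding symp_def rat_padic_rel_def using rat_padic_null_minus by fastforce
  show "transp (rat_padic_rel p)"
    unfolding transp_def rat_padic_rel_def
    using rat_padic_null_add[of "\<lambda>n. X n - Y n" "\<lambda>n. Y n - Z n" for X Y Z] by fastforce
qed

lemma rat_padic_rel_refl: "rat_padic_cauchy p X \<Longrightarrow> rat_padic_rel p X X"
  by (simp add: rat_padic_rel_def rat_padic_null_0)

lemma rat_padic_rel_null: "rat_padic_rel p X Y \<Longrightarrow> rat_padic_null p X \<longleftrightarrow> rat_padic_null p Y"
  using rat_padic_null_add[of "\<lambda>n. X n - Y n" Y] rat_padic_null_diff[of X "\<lambda>n. X n - Y n"]
  by (auto simp: rat_padic_rel_def)

lemma rat_padic_rel_lim: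
  assumes "rat_padic_rel p X Y"
  shows "lim (\<lambda>n. rat_padic_abs p (X n)) = lim (\<lambda>n. rat_padic_abs p (Y n))"
proof -
  have Y: "(\<lambda>n. rat_padic_abs p (Y n)) \<longlonglongrightarrow> lim (\<lambda>n. rat_padic_abs p (Y n))"
    using assms rat_padic_cauchy_abs convergent_LIMSEQ_iff by (auto simp: rat_padic_rel_def)
  have "(\<lambda>n. rat_padic_abs p (X n) - rat_padic_abs p (Y n)) \<longlonglongrightarrow> 0"
  proof (rule Lim_null_comparison)
    show "(\<lambda>n. rat_padic_abs p (X n - Y n)) \<longlonglongrightarrow> 0"
      using assms by (simp add: rat_padic_rel_def rat_padic_null_def)
  qed (simp add: rat_padic_abs_diff[OF p])
  from tendsto_add[OF this Y] show ?thesis by (simp add: limI)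
qed

end

text \<open>
  The quotient is set up by hand because \<^verbatim>\<open>quotient_type\<close> does not support type parameters
  such as \<open>'p\<close> that do not occur in the representation type.
\<close>

typedef 'p padic = "{c. \<exists>X. rat_padic_rel CARD('p::prime_card) X X \<and> c = Collect (rat_padic_rel CARD('p) X)}"
  morphisms padic_class padic_of_class
proof -
  have "rat_padic_rel CARD('p) (\<lambda>n. 0) (\<lambda>n. 0)"
    by (intro rat_padic_rel_refl rat_padic_cauchy_const prime_card)
  thus ?thesis by blast
qed

definition abs_padic :: "(nat \<Rightarrow> rat) \<Rightarrow> 'p::prime_card padic" where
  "abs_padic X = padic_of_class (Collect (rat_padic_rel CARD('p) X))"

definition rep_padic :: "'p::prime_card padic \<Rightarrow> (nat \<Rightarrow> rat)" where
  "rep_padic x = (SOME X. X \<in> padic_class x)"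

definition cr_padic :: "(nat \<Rightarrow> rat) \<Rightarrow> 'p::prime_card padic \<Rightarrow> bool" where
  "cr_padic = (\<lambda>X x. rat_padic_rel CARD('p) X X \<and> abs_padic X = x)"

lemma Quotient_padic:
  "Quotient (rat_padic_rel CARD('p)) abs_padic rep_padic (cr_padic :: _ \<Rightarrow> 'p::prime_card padic \<Rightarrow> bool)"
proof -
  interpret quot_type "rat_padic_rel CARD('p)" "padic_of_class :: _ \<Rightarrow> 'p padic" padic_class
    using part_equivp_rat_padic_rel[OF prime_card, where 'a1 = 'p] padic_class[where 'p = 'p]
    by unfold_locales (auto simp: padic_class_inverse padic_class_inject intro!: padic_of_class_inverse)
  have "abs = abs_padic" "rep = rep_padic"
    by (auto simp: fun_eq_iff abs_def rep_def abs_padic_def rep_padic_def)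
  thus ?thesis using Quotient3_to_Quotient[OF Quotient] by (simp add: cr_padic_def)
qed

setup_lifting Quotient_padic

instantiation padic :: (prime_card) field
begin

lift_definition zero_padic :: "'a padic" is "\<lambda>n. 0"
  by (simp add: rat_padic_rel_refl rat_padic_cauchy_const prime_card)

lift_definition one_padic :: "'a padic" is "\<lambda>n. 1"
  by (simp add: rat_padic_rel_refl rat_padic_cauchy_const prime_card)

lift_definition plus_padic :: "'a padic \<Rightarrow> 'a padic \<Rightarrow> 'a padic" is "\<lambda>X Y n. X n + Y n"
  unfolding rat_padic_rel_def add_diff_add
  by (intro conjI rat_padic_cauchy_add rat_padic_null_add prime_card; simp)

lift_definition uminus_padic :: "'a padic \<Rightarrow> 'a padic" is "\<lambda>X n. - X n"
  unfolding rat_padic_rel_def minus_diff_minus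
  by (intro conjI rat_padic_cauchy_minus rat_padic_null_minus prime_card; simp)

lift_definition minus_padic :: "'a padic \<Rightarrow> 'a padic \<Rightarrow> 'a padic" is "\<lambda>X Y n. X n - Y n"
proof -
  fix X X' Y Y' assume *: "rat_padic_rel CARD('a) X X'" "rat_padic_rel CARD('a) Y Y'"
  have "(\<lambda>n. X n - Y n - (X' n - Y' n)) = (\<lambda>n. (X n - X' n) - (Y n - Y' n))" by (simp add: algebra_simps)
  thus "rat_padic_rel CARD('a) (\<lambda>n. X n - Y n) (\<lambda>n. X' n - Y' n)"
    using * by (simp add: rat_padic_rel_def rat_padic_cauchy_diff rat_padic_null_diff prime_card)
qed

lift_definition times_padic :: "'a padic \<Rightarrow> 'a padic \<Rightarrow> 'a padic" is "\<lambda>X Y n. X n * Y n"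
proof -
  fix X X' Y Y' assume *: "rat_padic_rel CARD('a) X X'" "rat_padic_rel CARD('a) Y Y'"
  have "(\<lambda>n. X n * Y n - X' n * Y' n) = (\<lambda>n. X n * (Y n - Y' n) + Y' n * (X n - X' n))"
    by (simp add: algebra_simps)
  moreover have "rat_padic_null CARD('a) (\<lambda>n. X n * (Y n - Y' n) + Y' n * (X n - X' n))"
    using * unfolding rat_padic_rel_def
    by (intro rat_padic_null_add rat_padic_null_mult prime_card; simp)
  ultimately show "rat_padic_rel CARD('a) (\<lambda>n. X n * Y n) (\<lambda>n. X' n * Y' n)"
    using * unfolding rat_padic_rel_def by (intro conjI rat_padic_cauchy_mult prime_card) simp_all
qed

lift_definition inverse_padic :: "'a padic \<Rightarrow> 'a padic"
  is "\<lambda>X. if rat_padic_null CARD('a) X then (\<lambda>n. 0) else (\<lambda>n. inverse (X n))"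
proof -
  fix X Y assume *: "rat_padic_rel CARD('a) X Y"
  show "rat_padic_rel CARD('a)
      (if rat_padic_null CARD('a) X then (\<lambda>n. 0) else (\<lambda>n. inverse (X n)))
      (if rat_padic_null CARD('a) Y then (\<lambda>n. 0) else (\<lambda>n. inverse (Y n)))"
  proof (cases "rat_padic_null CARD('a) X")
    case True
    hence "rat_padic_null CARD('a) Y" using rat_padic_rel_null[OF prime_card *] by simp
    with True show ?thesis by (simp add: rat_padic_rel_refl rat_padic_cauchy_const prime_card)
  next
    case False
    hence "\<not> rat_padic_null CARD('a) Y" using rat_padic_rel_null[OF prime_card *] by simp
    with False * show ?thesis unfolding rat_padic_rel_def
      by (simp add: rat_padic_cauchy_inverse rat_padic_null_inverse_diff prime_card)
  qed
qed

definition divide_padic :: "'a padic \<Rightarrow> 'a padic \<Rightarrow> 'a padic"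
  where "divide_padic x y = x * inverse y"

instance
proof
  note [simp] = prime_card rat_padic_rel_refl rat_padic_cauchy_const rat_padic_cauchy_add
     rat_padic_cauchy_minus rat_padic_cauchy_diff rat_padic_cauchy_mult rat_padic_null_0
  have refl: "rat_padic_cauchy CARD('a) X" if "rat_padic_rel CARD('a) X X" for X
    using that by (simp add: rat_padic_rel_def)
  fix a b c :: "'a padic"
  show "a * b * c = a * (b * c)" by transfer (simp add: refl mult.assoc)
  show "a * b = b * a" by transfer (simp add: refl mult.commute)
  show "1 * a = a" by transfer simp
  show "a + b + c = a + (b + c)" by transfer (simp add: refl add.assoc)
  show "a + b = b + a" by transfer (simp add: refl add.commute)
  show "0 + a = a" by transfer simp
  show "- a + a = 0" by transfer simp
  show "a - b = a + - b" by transfer (simp add: refl)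
  show "(a + b) * c = a * c + b * c" by transfer (simp add: refl distrib_right)
  show "(0 :: 'a padic) \<noteq> 1" by transfer (simp add: rat_padic_rel_def rat_padic_null_def LIMSEQ_const_iff)
  show "inverse 0 = (0 :: 'a padic)" by transfer simp
  show "a div b = a * inverse b" by (simp add: divide_padic_def)
  show "a \<noteq> 0 \<Longrightarrow> inverse a * a = 1"
  proof transfer
    fix X assume X: "rat_padic_rel CARD('a) X X" "\<not> rat_padic_rel CARD('a) X (\<lambda>n. 0)"
    hence cX: "rat_padic_cauchy CARD('a) X" and nX: "\<not> rat_padic_null CARD('a) X"
      by (auto simp: rat_padic_rel_def)
    obtain b k where b: "b > 0" "\<And>n. n \<ge> k \<Longrightarrow> rat_padic_abs CARD('a) (X n) > b"
      using rat_padic_cauchy_not_null[OF prime_card cX nX] by metis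
    have "eventually (\<lambda>n. rat_padic_abs CARD('a) (inverse (X n) * X n - 1) = 0) sequentially"
      unfolding eventually_sequentially
    proof (intro exI allI impI)
      fix n assume "n \<ge> k"
      hence "X n \<noteq> 0" using b by force
      thus "rat_padic_abs CARD('a) (inverse (X n) * X n - 1) = 0" by simp
    qed
    hence "rat_padic_null CARD('a) (\<lambda>n. inverse (X n) * X n - 1)"
      unfolding rat_padic_null_def by (rule tendsto_eventually)
    thus "rat_padic_rel CARD('a) (\<lambda>n. (if rat_padic_null CARD('a) X then \<lambda>n. 0
             else (\<lambda>n. inverse (X n))) n * X n) (\<lambda>n. 1)"
      using nX cX rat_padic_cauchy_inverse[OF prime_card cX nX] by (simp add: rat_padic_rel_def)
  qed
qed

end

lift_definition padic_abs :: "'p::prime_card padic \<Rightarrow> real" is "\<lambda>X. lim (\<lambda>n. rat_padic_abs CARD('p) (X n))"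
  by (rule rat_padic_rel_lim[OF prime_card])

lemma rat_padic_rel_LIMSEQ:
  assumes "rat_padic_rel CARD('p::prime_card) X X"
  shows "(\<lambda>n. rat_padic_abs CARD('p) (X n)) \<longlonglongrightarrow> lim (\<lambda>n. rat_padic_abs CARD('p) (X n))"
  using assms rat_padic_cauchy_abs[OF prime_card] convergent_LIMSEQ_iff by (auto simp: rat_padic_rel_def)

lemma padic_abs_mult: "padic_abs (x * y) = padic_abs x * padic_abs (y :: 'p::prime_card padic)"
proof transfer
  fix X Y assume "rat_padic_rel CARD('p) X X" "rat_padic_rel CARD('p) Y Y"
  from tendsto_mult[OF this[THEN rat_padic_rel_LIMSEQ]]
  show "lim (\<lambda>n. rat_padic_abs CARD('p) (X n * Y n)) =
        lim (\<lambda>n. rat_padic_abs CARD('p) (X n)) * lim (\<lambda>n. rat_padic_abs CARD('p) (Y n))"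
    by (intro limI) (simp add: rat_padic_abs_mult prime_card)
qed

lemma padic_abs_ultra: "padic_abs (x + y) \<le> max (padic_abs x) (padic_abs (y :: 'p::prime_card padic))"
proof transfer
  fix X Y assume *: "rat_padic_rel CARD('p) X X" "rat_padic_rel CARD('p) Y Y"
  hence "rat_padic_rel CARD('p) (\<lambda>n. X n + Y n) (\<lambda>n. X n + Y n)"
    by (simp add: rat_padic_rel_def rat_padic_cauchy_add prime_card rat_padic_null_0)
  from rat_padic_rel_LIMSEQ[OF this] tendsto_max[OF *[THEN rat_padic_rel_LIMSEQ]]
  show "lim (\<lambda>n. rat_padic_abs CARD('p) (X n + Y n)) \<le>
        max (lim (\<lambda>n. rat_padic_abs CARD('p) (X n))) (lim (\<lambda>n. rat_padic_abs CARD('p) (Y n)))"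
    by (rule LIMSEQ_le) (use rat_padic_abs_ultra[OF prime_card, where 'a1 = 'p] in auto)
qed

lemma padic_abs_nonneg [simp]: "padic_abs (x :: 'p::prime_card padic) \<ge> 0"
proof transfer
  fix X assume *: "rat_padic_rel CARD('p) X X"
  show "lim (\<lambda>n. rat_padic_abs CARD('p) (X n)) \<ge> 0"
    by (rule LIMSEQ_le_const[OF rat_padic_rel_LIMSEQ[OF *]]) (auto simp: prime_card)
qed

lemma padic_abs_eq_0 [simp]: "padic_abs (x :: 'p::prime_card padic) = 0 \<longleftrightarrow> x = 0"
proof transfer
  fix X assume *: "rat_padic_rel CARD('p) X X"
  show "(lim (\<lambda>n. rat_padic_abs CARD('p) (X n)) = 0) = rat_padic_rel CARD('p) X (\<lambda>n. 0)"
    using rat_padic_rel_LIMSEQ[OF *] * limI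
    by (auto simp: rat_padic_rel_def rat_padic_null_def rat_padic_cauchy_const prime_card)
qed

lemma padic_abs_0 [simp]: "padic_abs (0 :: 'p::prime_card padic) = 0"
  by simp

lemma padic_abs_minus [simp]: "padic_abs (- x) = padic_abs (x :: 'p::prime_card padic)"
  by transfer (simp add: prime_card)

lemma padic_abs_commute: "padic_abs (x - y) = padic_abs (y - x :: 'p::prime_card padic)"
  using padic_abs_minus[of "x - y"] by simp

instantiation padic :: (prime_card) metric_space
begin

definition dist_padic :: "'a padic \<Rightarrow> 'a padic \<Rightarrow> real" where "dist_padic x y = padic_abs (x - y)"

definition uniformity_padic :: "('a padic \<times> 'a padic) filter"
  where "uniformity_padic = (INF e\<in>{0 <..}. principal {(x, y). dist x y < e})"

definition open_padic :: "'a padic set \<Rightarrow> bool"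
  where "open_padic U \<longleftrightarrow> (\<forall>x\<in>U. eventually (\<lambda>(x', y). x' = x \<longrightarrow> y \<in> U) uniformity)"

instance
proof
  fix x y z :: "'a padic" and U :: "'a padic set"
  show "dist x y = 0 \<longleftrightarrow> x = y" by (simp add: dist_padic_def)
  have "padic_abs (x - y) \<le> max (padic_abs (x - z)) (padic_abs (z - y))"
    using padic_abs_ultra[of "x - z" "z - y"] by simp
  moreover have "padic_abs (z - y) = padic_abs (y - z)" using padic_abs_minus[of "y - z"] by simp
  ultimately show "dist x y \<le> dist x z + dist y z"
    unfolding dist_padic_def using padic_abs_nonneg[of "x - z"] padic_abs_nonneg[of "y - z"] by linarith
qed (auto simp: uniformity_padic_def open_padic_def)

end

lemma of_nat_padic: "(of_nat k :: 'p::prime_card padic) = abs_padic (\<lambda>n. of_nat k)"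
proof (induction k)
  case 0
  show ?case by (simp add: zero_padic_def)
next
  case (Suc k)
  show ?case unfolding of_nat_Suc Suc one_padic_def
    by (subst plus_padic.abs_eq) (simp_all add: rat_padic_rel_refl rat_padic_cauchy_const prime_card)
qed

lemma padic_abs_of_nat: "padic_abs (of_nat k :: 'p::prime_card padic) = rat_padic_abs CARD('p) (of_nat k)"
  unfolding of_nat_padic
  by (subst padic_abs.abs_eq) (simp_all add: rat_padic_rel_refl rat_padic_cauchy_const prime_card)

instance padic :: (prime_card) field_char_0
proof
  have "k = l" if "(of_nat k :: 'a padic) = of_nat l" "k \<le> l" for k l
  proof -
    have "(of_nat (l - k) :: 'a padic) = 0" using that by (simp add: of_nat_diff)
    hence "rat_padic_abs CARD('a) (of_nat (l - k)) = 0" 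
      using padic_abs_of_nat[where 'p = 'a, of "l - k"] by (metis padic_abs_0)
    thus "k = l" using that by (simp add: prime_card)
  qed
  thus "inj (of_nat :: nat \<Rightarrow> 'a padic)" by (metis injI nat_le_linear)
qed

lemma of_rat_padic: "(of_rat q :: 'p::prime_card padic) = abs_padic (\<lambda>n. q)"
proof -
  define f :: "rat \<Rightarrow> 'p padic" where "f = (\<lambda>q. abs_padic (\<lambda>n. q))"
  have mult: "f (x * y) = f x * f y" for x y unfolding f_def
    by (subst times_padic.abs_eq) (simp_all add: rat_padic_rel_refl rat_padic_cauchy_const prime_card)
  have minus: "f (- x) = - f x" for x unfolding f_def
    by (subst uminus_padic.abs_eq) (simp_all add: rat_padic_rel_refl rat_padic_cauchy_const prime_card)
  have of_nat: "f (of_nat k) = of_nat k" for k by (simp add: f_def of_nat_padic)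
  have of_int: "f (of_int k) = of_int k" for k
    by (cases k) (simp_all add: of_nat minus del: of_nat_Suc)
  obtain a b where q: "q = of_int a / of_int b" "b > (0::int)" by (rule rat_int_quotient_cases)
  have "f q * of_int b = of_int a" using mult[of q "of_int b"] q by (simp add: of_int)
  moreover have "of_rat q * of_int b = (of_int a :: 'p padic)"
    using q by (simp add: of_rat_divide)
  ultimately have "f q * of_int b = of_rat q * of_int b" by simp
  thus ?thesis using q(2) by (simp add: f_def)
qed

lemma padic_abs_of_rat: "padic_abs (of_rat q :: 'p::prime_card padic) = rat_padic_abs CARD('p) q"
  unfolding of_rat_padic
  by (subst padic_abs.abs_eq) (simp_all add: rat_padic_rel_refl rat_padic_cauchy_const prime_card)

subsection \<open>The Skorohod space\<close>

text \<open>
  A path on \<open>[0,\<infinity>)\<close> is represented by its extension to the real line that is constant on \<open>(-\<infinity>,0]\<close>.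
\<close>

typedef (overloaded) 'a cadlag = "{x :: real \<Rightarrow> 'a::metric_space.
    (\<forall>t\<ge>0. (x \<longlongrightarrow> x t) (at_right t)) \<and> (\<forall>t>0. \<exists>l. (x \<longlongrightarrow> l) (at_left t)) \<and> (\<forall>t<0. x t = x 0)}"
  morphisms sample_path Abs_cadlag
  by (rule exI[of _ "\<lambda>_. undefined"]) auto

definition time_changes :: "(real \<Rightarrow> real) set" where
  "time_changes = {l. strict_mono_on {0..} l \<and> l ` {0..} = {0..} \<and>
     bdd_above ((\<lambda>(s, t). \<bar>ln ((l t - l s) / (t - s))\<bar>) ` {(s, t). 0 \<le> s \<and> s < t})}"

definition time_change_size :: "(real \<Rightarrow> real) \<Rightarrow> real" where
  "time_change_size l = (SUP (s, t)\<in>{(s, t). 0 \<le> s \<and> s < t}. \<bar>ln ((l t - l s) / (t - s))\<bar>)"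

definition stopped_path_dist ::
    "'a::metric_space cadlag \<Rightarrow> 'a cadlag \<Rightarrow> (real \<Rightarrow> real) \<Rightarrow> real \<Rightarrow> real" where
  "stopped_path_dist x y l u =
     (SUP t\<in>{0..}. min 1 (dist (sample_path x (min t u)) (sample_path y (min (l t) u))))"

text \<open>
  The metric of Ethier and Kurtz (Markov Processes, Section 3.5), which induces the \<open>J\<^sub>1\<close>
  topology on paths with values in an arbitrary metric space:
  \<open>d(x,y) = inf\<^sub>l max (\<gamma>(l)) (\<integral>\<^sub>0\<^sup>\<infinity> e\<^sup>-\<^sup>u sup\<^sub>t\<^sub>\<ge>\<^sub>0 min 1 (dist (x(t \<and> u)) (y(l(t) \<and> u))) du)\<close>,
  where \<open>\<gamma>(l)\<close> is the supremum of \<open>|ln ((l(t) - l(s)) / (t - s))|\<close> over \<open>t > s \<ge> 0\<close>, and the time changes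
  \<open>l\<close> are the increasing surjections of \<open>[0,\<infinity>)\<close> with \<open>\<gamma>(l) < \<infinity>\<close> (hence Lipschitz).
\<close>

definition skorohod_dist :: "'a::metric_space cadlag \<Rightarrow> 'a cadlag \<Rightarrow> real" where
  "skorohod_dist x y = (INF l\<in>time_changes.
     max (time_change_size l) (LINT u:{0..}|lborel. exp (- u) * stopped_path_dist x y l u))"

lemma time_changes_id: "(\<lambda>t. t) \<in> time_changes" and time_change_size_id: "time_change_size (\<lambda>t. t) = 0"
proof -
  have *: "(\<lambda>(s::real, t). \<bar>ln ((t - s) / (t - s))\<bar>) ` {(s, t). 0 \<le> s \<and> s < t} = {0}"
    by (auto intro!: rev_image_eqI[of "(0, 1)"])
  show "(\<lambda>t. t) \<in> time_changes" unfolding time_changes_def mem_Collect_eq *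
    by (auto simp: strict_mono_on_def)
  show "time_change_size (\<lambda>t. t) = 0" unfolding time_change_size_def * by simp
qed

context
  fixes l assumes l: "l \<in> time_changes"
begin

lemma time_change_less: "0 \<le> s \<Longrightarrow> s < t \<Longrightarrow> l s < l t"
  using l by (auto simp: time_changes_def strict_mono_on_def)

lemma time_change_nonneg: "0 \<le> s \<Longrightarrow> 0 \<le> l s"
  using l by (auto simp: time_changes_def)

lemma time_change_ratio_pos: "0 \<le> s \<Longrightarrow> s < t \<Longrightarrow> (l t - l s) / (t - s) > 0"
  using time_change_less[of s t] by simp

lemma time_change_size_ge: "0 \<le> s \<Longrightarrow> s < t \<Longrightarrow> \<bar>ln ((l t - l s) / (t - s))\<bar> \<le> time_change_size l"
  unfolding time_change_size_def using l
  by (intro cSUP_upper2[where x = "(s, t)"]) (auto simp: time_changes_def)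

lemma time_change_size_nonneg: "time_change_size l \<ge> 0"
  using time_change_size_ge[of 0 1] by linarith

lemma time_change_bounds:
  assumes "0 \<le> s" "s < t"
  shows "l t - l s \<le> exp (time_change_size l) * (t - s)"
    and "l t - l s \<ge> exp (- time_change_size l) * (t - s)"
proof -
  have r: "(l t - l s) / (t - s) > 0" by (rule time_change_ratio_pos[OF assms])
  have "ln ((l t - l s) / (t - s)) \<le> time_change_size l" "ln ((l t - l s) / (t - s)) \<ge> - time_change_size l"
    using time_change_size_ge[OF assms] by linarith+
  hence "(l t - l s) / (t - s) \<le> exp (time_change_size l)" "(l t - l s) / (t - s) \<ge> exp (- time_change_size l)"
    using r by (metis exp_ln exp_le_cancel_iff)+
  thus "l t - l s \<le> exp (time_change_size l) * (t - s)" "l t - l s \<ge> exp (- time_change_size l) * (t - s)"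
    using assms by (simp_all add: field_simps)
qed

lemma time_change_0: "l 0 = 0"
proof -
  have "0 \<in> l ` {0..}" using l by (simp add: time_changes_def)
  then obtain a where a: "a \<ge> 0" "l a = 0" by auto
  show ?thesis using time_change_less[of 0 a] time_change_nonneg[of 0] a by (cases "a = 0") auto
qed

lemma time_change_at_right:
  assumes "0 \<le> t" shows "filterlim l (at_right (l t)) (at_right t)"
proof (rule filterlim_at_withinI)
  have "((\<lambda>s. exp (time_change_size l) * (s - t)) \<longlongrightarrow> exp (time_change_size l) * (t - t)) (at_right t)"
    by (intro tendsto_intros)
  hence lim: "((\<lambda>s. exp (time_change_size l) * (s - t)) \<longlongrightarrow> 0) (at_right t)" by simp
  have gt: "eventually (\<lambda>s. s > t) (at_right t)" by (rule eventually_at_right_less)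
  have "eventually (\<lambda>s. 0 \<le> l s - l t) (at_right t)"
    by (rule eventually_mono[OF gt]) (simp add: less_imp_le time_change_less[OF assms])
  moreover have "eventually (\<lambda>s. l s - l t \<le> exp (time_change_size l) * (s - t)) (at_right t)"
    by (rule eventually_mono[OF gt]) (rule time_change_bounds(1)[OF assms])
  ultimately have "((\<lambda>s. l s - l t) \<longlongrightarrow> 0) (at_right t)"
    by (rule tendsto_sandwich[OF _ _ tendsto_const lim])
  thus "(l \<longlongrightarrow> l t) (at_right t)" using LIM_zero_iff by blast
  show "\<forall>\<^sub>F s in at_right t. l s \<in> {l t<..} - {l t}"
    by (rule eventually_mono[OF gt]) (auto dest: time_change_less[OF assms])
qed

end

lemma time_changes_inverse:
  assumes "l \<in> time_changes"
  defines "k \<equiv> the_inv_into {0..} l"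
  shows "k \<in> time_changes" "time_change_size k = time_change_size l" "\<And>t. t \<ge> 0 \<Longrightarrow> k (l t) = t"
proof -
  let ?D = "{(s::real, t). 0 \<le> s \<and> s < t}"
  have inj: "inj_on l {0..}" and im: "l ` {0..} = {0..}"
    using assms(1) by (auto simp: time_changes_def strict_mono_on_imp_inj_on)
  show kl: "k (l t) = t" if "t \<ge> 0" for t unfolding k_def using the_inv_into_f_f[OF inj] that by simp
  have surj: "\<exists>s\<ge>0. t = l s" if "t \<ge> 0" for t using im that by (auto simp: set_eq_iff image_iff)
  have mono_iff: "l s < l t \<longleftrightarrow> s < t" if "s \<ge> 0" "t \<ge> 0" for s t
    using time_change_less[OF assms(1)] that by (metis linorder_neqE_linordered_idom order_less_asym)
  have "?D = (\<lambda>(s, t). (l s, l t)) ` ?D"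
  proof (intro equalityI subsetI)
    fix z assume "z \<in> ?D"
    then obtain s t where z: "z = (s, t)" "0 \<le> s" "s < t" by auto
    obtain s' where s': "s' \<ge> 0" "s = l s'" using surj z by blast
    obtain t' where t': "t' \<ge> 0" "t = l t'" using surj z by (meson less_imp_le order_trans)
    show "z \<in> (\<lambda>(s, t). (l s, l t)) ` ?D"
      using z s' t' mono_iff by (auto intro!: rev_image_eqI[of "(s', t')"])
  qed (use mono_iff time_change_nonneg[OF assms(1)] in auto)
  hence "(\<lambda>(s, t). \<bar>ln ((k t - k s) / (t - s))\<bar>) ` ?D
       = (\<lambda>(s, t). \<bar>ln ((k t - k s) / (t - s))\<bar>) ` ((\<lambda>(s, t). (l s, l t)) ` ?D)" by simp
  also have "\<dots> = (\<lambda>(s, t). \<bar>ln ((l t - l s) / (t - s))\<bar>) ` ?D"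
    unfolding image_image
  proof (rule image_cong[OF refl], clarsimp)
    fix s t :: real assume st: "0 \<le> s" "s < t"
    have "(t - s) / (l t - l s) = inverse ((l t - l s) / (t - s))" by simp
    thus "\<bar>ln ((k (l t) - k (l s)) / (l t - l s))\<bar> = \<bar>ln ((l t - l s) / (t - s))\<bar>"
      using st kl time_change_ratio_pos[OF assms(1) st] by (simp only: ln_inverse)
  qed
  finally have eq: "(\<lambda>(s, t). \<bar>ln ((k t - k s) / (t - s))\<bar>) ` ?D
      = (\<lambda>(s, t). \<bar>ln ((l t - l s) / (t - s))\<bar>) ` ?D" .
  show "time_change_size k = time_change_size l" unfolding time_change_size_def eq ..
  have "strict_mono_on {0..} k"
    unfolding strict_mono_on_def using surj kl mono_iff by (metis atLeast_iff)
  moreover have "k ` {0..} = {0..}"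
  proof (intro equalityI subsetI)
    fix t assume "t \<in> k ` {0..}" thus "t \<in> {0..}" using surj kl by fastforce
  next
    fix t :: real assume "t \<in> {0..}" thus "t \<in> k ` {0..}"
      using kl[of t] time_change_nonneg[OF assms(1), of t] by (metis atLeast_iff image_eqI)
  qed
  ultimately show "k \<in> time_changes" using assms(1) eq by (auto simp: time_changes_def)
qed

lemma time_changes_compose:
  assumes l: "l \<in> time_changes" and k: "k \<in> time_changes"
  shows "k \<circ> l \<in> time_changes" "time_change_size (k \<circ> l) \<le> time_change_size l + time_change_size k"
proof -
  have bound: "\<bar>ln (((k \<circ> l) t - (k \<circ> l) s) / (t - s))\<bar> \<le> time_change_size l + time_change_size k"
    if st: "0 \<le> s" "s < t" for s t
  proof -
    have ls: "0 \<le> l s" "l s < l t"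
      using time_change_nonneg[OF l] time_change_less[OF l] st by auto
    have "((k \<circ> l) t - (k \<circ> l) s) / (t - s) = ((k (l t) - k (l s)) / (l t - l s)) * ((l t - l s) / (t - s))"
      using ls by simp
    hence "ln (((k \<circ> l) t - (k \<circ> l) s) / (t - s))
      = ln ((k (l t) - k (l s)) / (l t - l s)) + ln ((l t - l s) / (t - s))"
      using time_change_ratio_pos[OF k ls] time_change_ratio_pos[OF l st] by (metis ln_mult_pos)
    thus ?thesis using time_change_size_ge[OF k ls] time_change_size_ge[OF l st] by linarith
  qed
  have "strict_mono_on {0..} (k \<circ> l)" unfolding strict_mono_on_def
    using time_change_nonneg[OF l] time_change_less[OF l] time_change_less[OF k] by auto
  moreover have "(k \<circ> l) ` {0..} = {0..}" using l k unfolding time_changes_def image_comp[symmetric] by simp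
  moreover have "bdd_above ((\<lambda>(s, t). \<bar>ln (((k \<circ> l) t - (k \<circ> l) s) / (t - s))\<bar>) ` {(s, t). 0 \<le> s \<and> s < t})"
    using bound by (intro bdd_aboveI2[where M = "time_change_size l + time_change_size k"]) auto
  ultimately show "k \<circ> l \<in> time_changes" by (simp add: time_changes_def)
  show "time_change_size (k \<circ> l) \<le> time_change_size l + time_change_size k"
    unfolding time_change_size_def[of "k \<circ> l"]
  proof (rule cSUP_least)
    have "(0, 1) \<in> {(s::real, t). 0 \<le> s \<and> s < t}" by simp
    thus "{(s::real, t). 0 \<le> s \<and> s < t} \<noteq> {}" by blast
  qed (use bound in auto)
qed

lemma path_right_continuous: "(sample_path x \<longlongrightarrow> sample_path x t) (at_right t)"
proof (cases "t \<ge> 0")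
  case True thus ?thesis using sample_path[of x] by auto
next
  case False
  have "eventually (\<lambda>s. sample_path x s = sample_path x t) (at_right t)"
    unfolding eventually_at_right_field using False sample_path[of x] by (intro exI[of _ 0]) auto
  thus ?thesis by (rule tendsto_eventually)
qed

lemma right_continuous_min:
  fixes f :: "real \<Rightarrow> 'a::topological_space"
  assumes "\<And>t. (f \<longlongrightarrow> f t) (at_right t)"
  shows "((\<lambda>s. f (min s u)) \<longlongrightarrow> f (min t u)) (at_right t)"
proof (cases "t < u")
  case True
  have "eventually (\<lambda>s. f s = f (min s u)) (at_right t)"
    unfolding eventually_at_right_field using True by (intro exI[of _ u]) auto
  thus ?thesis using assms[of t] True by (auto intro: Lim_transform_eventually)
next
  case False
  have "eventually (\<lambda>s. f (min s u) = f (min t u)) (at_right t)"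
    unfolding eventually_at_right_field using False by (intro exI[of _ "t + 1"]) (auto simp: min_def)
  thus ?thesis by (rule tendsto_eventually)
qed

lemma right_continuous_borel_measurable:
  fixes f :: "real \<Rightarrow> real"
  assumes "\<And>t. (f \<longlongrightarrow> f t) (at_right t)"
  shows "f \<in> borel_measurable borel"
proof (rule borel_measurable_LIMSEQ_real)
  define r where "r = (\<lambda>n u. (of_int \<lfloor>u * real (Suc n)\<rfloor> + 1) / real (Suc n))"
  show "(\<lambda>n. f (r n u)) \<longlonglongrightarrow> f u" for u
  proof (rule filterlim_compose[OF assms])
    have gt: "r n u > u" for n
      unfolding r_def by (simp only: pos_less_divide_eq of_nat_0_less_iff zero_less_Suc) linarith
    have le: "r n u \<le> u + 1 / real (Suc n)" for n
    proof -
      have "of_int \<lfloor>u * real (Suc n)\<rfloor> + 1 \<le> u * real (Suc n) + 1" by linarith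
      hence "r n u \<le> (u * real (Suc n) + 1) / real (Suc n)" unfolding r_def by (intro divide_right_mono) auto
      thus ?thesis by (simp add: add_divide_distrib)
    qed
    have lim: "(\<lambda>n. u + 1 / real (Suc n)) \<longlonglongrightarrow> u"
      using tendsto_add[OF tendsto_const LIMSEQ_Suc[OF lim_1_over_n], of u] by simp
    have "(\<lambda>n. r n u) \<longlonglongrightarrow> u"
      by (rule tendsto_sandwich[OF _ _ tendsto_const lim]) (simp_all add: le gt less_imp_le del: of_nat_Suc)
    thus "filterlim (\<lambda>n. r n u) (at_right u) sequentially"
      by (rule filterlim_at_withinI) (simp add: gt less_imp_neq[OF gt, THEN not_sym])
  qed
  show "(\<lambda>u. f (r n u)) \<in> borel_measurable borel" for n
  proof -
    have "(\<lambda>u::real. \<lfloor>u * real (Suc n)\<rfloor>) \<in> borel \<rightarrow>\<^sub>M count_space UNIV" by measurable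
    from measurable_compose[OF this, of "\<lambda>i. f ((of_int i + 1) / real (Suc n))" borel]
    show ?thesis by (simp add: r_def)
  qed
qed

lemma min_1_dist_triangle: "min 1 (dist a c) \<le> min 1 (dist a b) + min 1 (dist b (c::'a::metric_space))"
  unfolding min_def using dist_triangle[of a c b] zero_le_dist[of a b] zero_le_dist[of b c]
  by (smt (verit))

lemma stopped_dist_bdd: "bdd_above ((\<lambda>t. min 1 (dist (sample_path x (min t u)) (sample_path y (min (l t) u)))) ` A)"
  by (intro bdd_aboveI2[where M = 1]) auto

lemma stopped_path_dist_ge:
  "t \<ge> 0 \<Longrightarrow> min 1 (dist (sample_path x (min t u)) (sample_path y (min (l t) u))) \<le> stopped_path_dist x y l u"
  unfolding stopped_path_dist_def by (intro cSUP_upper stopped_dist_bdd) auto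

lemma stopped_path_dist_le:
  "(\<And>t. t \<ge> 0 \<Longrightarrow> min 1 (dist (sample_path x (min t u)) (sample_path y (min (l t) u))) \<le> c) \<Longrightarrow> stopped_path_dist x y l u \<le> c"
  unfolding stopped_path_dist_def by (intro cSUP_least) auto

lemma stopped_path_dist_nonneg: "stopped_path_dist x y l u \<ge> 0"
  by (rule order_trans[OF _ stopped_path_dist_ge[of 0]]) auto

lemma stopped_path_dist_le_1: "stopped_path_dist x y l u \<le> 1"
  by (rule stopped_path_dist_le) auto

lemma stopped_path_dist_measurable:
  assumes l: "l \<in> time_changes"
  shows "stopped_path_dist x y l \<in> borel_measurable borel"
proof -
  let ?f = "\<lambda>t u. min 1 (dist (sample_path x (min t u)) (sample_path y (min (l t) u)))"
  have "stopped_path_dist x y l u = (SUP t\<in>{0..} \<inter> \<rat>. ?f t u)" for u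
  proof (rule antisym)
    show "(SUP t\<in>{0..} \<inter> \<rat>. ?f t u) \<le> stopped_path_dist x y l u"
      unfolding stopped_path_dist_def by (rule cSUP_subset_mono) (auto simp: stopped_dist_bdd)
    show "stopped_path_dist x y l u \<le> (SUP t\<in>{0..} \<inter> \<rat>. ?f t u)"
    proof (rule stopped_path_dist_le, rule ccontr)
      fix t :: real assume t: "t \<ge> 0" and n: "\<not> ?f t u \<le> (SUP t\<in>{0..} \<inter> \<rat>. ?f t u)"
      have "((\<lambda>s. sample_path y (min (l s) u)) \<longlongrightarrow> sample_path y (min (l t) u)) (at_right t)"
        by (rule filterlim_compose[OF right_continuous_min[OF path_right_continuous] time_change_at_right[OF l t]])
      hence "((\<lambda>s. ?f s u) \<longlongrightarrow> ?f t u) (at_right t)"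
        by (intro tendsto_intros right_continuous_min[OF path_right_continuous])
      hence "eventually (\<lambda>s. ?f s u > (SUP t\<in>{0..} \<inter> \<rat>. ?f t u)) (at_right t)"
        using n by (intro order_tendstoD) auto
      then obtain c where c: "c > t" "\<And>s. t < s \<Longrightarrow> s < c \<Longrightarrow> ?f s u > (SUP t\<in>{0..} \<inter> \<rat>. ?f t u)"
        unfolding eventually_at_right_field by blast
      obtain q where q: "q \<in> \<rat>" "t < q" "q < c" using Rats_dense_in_real[OF c(1)] by blast
      have "?f q u \<le> (SUP t\<in>{0..} \<inter> \<rat>. ?f t u)"
        using q t by (intro cSUP_upper stopped_dist_bdd) auto
      with c(2)[OF q(2,3)] show False by (meson leD)
    qed
  qed
  moreover have "(\<lambda>u. SUP t\<in>{0..} \<inter> \<rat>. ?f t u) \<in> borel_measurable borel"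
  proof (rule borel_measurable_cSUP)
    show "countable ({0..} \<inter> \<rat> :: real set)" using countable_rat by blast
    show "(\<lambda>u. ?f t u) \<in> borel_measurable borel" for t
      by (rule right_continuous_borel_measurable)
         (auto simp: min.commute[of t] min.commute[of "l t"]
           intro!: tendsto_intros right_continuous_min[OF path_right_continuous])
  qed (auto simp: stopped_dist_bdd)
  ultimately show ?thesis by (simp add: fun_eq_iff cong: measurable_cong)
qed

lemma exp_integrable: "set_integrable lborel {0..} (\<lambda>u. exp (- u) :: real)"
proof -
  have "integrable lborel (\<lambda>u::real. exp (- u) * indicator {0<..} u)"
    using has_bochner_integral_I0i_power_exp_m[of 0] by (auto simp: has_bochner_integral_iff)
  moreover have "AE u in lborel. exp (- u) * indicator {0<..} u = indicator {0..} u *\<^sub>R exp (- u :: real)"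
    using AE_lborel_singleton[of "0::real"] by eventually_elim (auto simp: indicator_def)
  ultimately show ?thesis unfolding set_integrable_def
    by (subst (asm) integrable_cong_AE) auto
qed

lemma stopped_path_dist_integrable:
  assumes "l \<in> time_changes"
  shows "set_integrable lborel {0..} (\<lambda>u. exp (- u) * stopped_path_dist x y l u)"
  unfolding set_integrable_def
proof (rule Bochner_Integration.integrable_bound[OF exp_integrable[unfolded set_integrable_def]])
  note [measurable] = stopped_path_dist_measurable[OF assms]
  show "(\<lambda>u. indicator {0..} u *\<^sub>R (exp (- u) * stopped_path_dist x y l u)) \<in> borel_measurable lborel"
    by measurable
qed (auto simp: indicator_def abs_mult stopped_path_dist_nonneg stopped_path_dist_le_1 mult_left_le)

abbreviation stopped_path_integral :: "'a::metric_space cadlag \<Rightarrow> 'a cadlag \<Rightarrow> (real \<Rightarrow> real) \<Rightarrow> real" where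
  "stopped_path_integral x y l \<equiv> (LINT u:{0..}|lborel. exp (- u) * stopped_path_dist x y l u)"

lemma skorohod_dist_le:
  assumes "l \<in> time_changes"
  shows "skorohod_dist x y \<le> max (time_change_size l) (stopped_path_integral x y l)"
  unfolding skorohod_dist_def
  by (intro cINF_lower assms bdd_belowI2[where m = 0]) (auto simp: le_max_iff_disj time_change_size_nonneg)

lemma skorohod_dist_nonneg: "skorohod_dist x y \<ge> 0"
  unfolding skorohod_dist_def using time_changes_id
  by (intro cINF_greatest) (auto simp: le_max_iff_disj time_change_size_nonneg)

lemma skorohod_dist_less:
  assumes "skorohod_dist x y < e"
  obtains l where "l \<in> time_changes" "time_change_size l < e" "stopped_path_integral x y l < e"
proof -
  have "\<exists>l\<in>time_changes. max (time_change_size l) (stopped_path_integral x y l) < e"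
    using assms time_changes_id unfolding skorohod_dist_def
    by (subst (asm) cInf_less_iff)
       (auto intro!: bdd_belowI2[where m = 0] simp: le_max_iff_disj time_change_size_nonneg)
  thus ?thesis using that by auto
qed

lemma skorohod_dist_refl: "skorohod_dist x x = 0"
proof -
  have "stopped_path_dist x x (\<lambda>t. t) = (\<lambda>u. 0)" by (auto simp: stopped_path_dist_def fun_eq_iff)
  hence "skorohod_dist x x \<le> 0"
    using skorohod_dist_le[OF time_changes_id, of x x] by (simp add: time_change_size_id)
  thus ?thesis using skorohod_dist_nonneg[of x x] by linarith
qed

lemma skorohod_dist_sym_le: "skorohod_dist y x \<le> skorohod_dist x y"
proof (rule dense_ge)
  fix e assume "skorohod_dist x y < e"
  then obtain l where l: "l \<in> time_changes" "time_change_size l < e" "stopped_path_integral x y l < e"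
    by (rule skorohod_dist_less)
  define k where "k = the_inv_into {0..} l"
  note k = time_changes_inverse[OF l(1), folded k_def]
  have im: "{0..} = l ` {0..}" using l(1) by (simp add: time_changes_def)
  have "stopped_path_dist y x k u = stopped_path_dist x y l u" for u
  proof -
    have "(\<lambda>t. min 1 (dist (sample_path y (min t u)) (sample_path x (min (k t) u)))) ` {0..}
        = (\<lambda>t. min 1 (dist (sample_path x (min t u)) (sample_path y (min (l t) u)))) ` {0..}"
      by (subst (1) im, unfold image_image) (auto simp: k(3) dist_commute intro!: image_cong)
    thus ?thesis by (simp add: stopped_path_dist_def)
  qed
  hence "stopped_path_integral y x k = stopped_path_integral x y l" by simp
  thus "skorohod_dist y x \<le> e" using skorohod_dist_le[OF k(1), of y x] l k(2) by auto
qed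

lemma skorohod_dist_triangle: "skorohod_dist x z \<le> skorohod_dist x y + skorohod_dist y z"
proof (rule field_le_epsilon)
  fix e :: real assume e: "e > 0"
  obtain l where l: "l \<in> time_changes" "time_change_size l < skorohod_dist x y + e / 2"
      "stopped_path_integral x y l < skorohod_dist x y + e / 2"
    by (rule skorohod_dist_less[of x y "skorohod_dist x y + e / 2"]) (use e in auto)
  obtain k where k: "k \<in> time_changes" "time_change_size k < skorohod_dist y z + e / 2"
      "stopped_path_integral y z k < skorohod_dist y z + e / 2"
    by (rule skorohod_dist_less[of y z "skorohod_dist y z + e / 2"]) (use e in auto)
  note kl = time_changes_compose[OF l(1) k(1)]
  have "stopped_path_dist x z (k \<circ> l) u \<le> stopped_path_dist x y l u + stopped_path_dist y z k u" for u
  proof (rule stopped_path_dist_le)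
    fix t :: real assume t: "t \<ge> 0"
    have "min 1 (dist (sample_path x (min t u)) (sample_path y (min (l t) u))) \<le> stopped_path_dist x y l u"
      by (rule stopped_path_dist_ge[OF t])
    moreover have "min 1 (dist (sample_path y (min (l t) u)) (sample_path z (min (k (l t)) u))) \<le> stopped_path_dist y z k u"
      by (rule stopped_path_dist_ge) (rule time_change_nonneg[OF l(1) t])
    ultimately show "min 1 (dist (sample_path x (min t u)) (sample_path z (min ((k \<circ> l) t) u)))
        \<le> stopped_path_dist x y l u + stopped_path_dist y z k u"
      using min_1_dist_triangle unfolding o_def by (meson add_mono order_trans)
  qed
  hence "stopped_path_integral x z (k \<circ> l)
      \<le> (LINT u:{0..}|lborel. exp (- u) * stopped_path_dist x y l u + exp (- u) * stopped_path_dist y z k u)"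
    by (intro set_integral_mono set_integral_add stopped_path_dist_integrable kl l(1) k(1))
       (simp add: distrib_left[symmetric])
  also have "\<dots> = stopped_path_integral x y l + stopped_path_integral y z k"
    by (intro set_integral_add stopped_path_dist_integrable l(1) k(1))
  finally show "skorohod_dist x z \<le> skorohod_dist x y + skorohod_dist y z + e"
    using skorohod_dist_le[OF kl(1), of x z] kl(2) l k by linarith
qed

lemma skorohod_dist_eq_0_near:
  assumes "skorohod_dist x y = 0" "t \<ge> 0" "d > 0" "e > 0"
  shows "\<exists>s. \<bar>s - t\<bar> < d \<and> dist (sample_path x t) (sample_path y s) < e"
proof -
  define c where "c = min e 1"
  define g where "g = ln (1 + min d 1 / (t + 1))"
  have c: "c > 0" "c \<le> 1" "c \<le> e" using assms by (auto simp: c_def)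
  have g: "g > 0" using assms by (auto simp: g_def intro!: ln_gt_zero)
  have "skorohod_dist x y < min g (exp (- (t + 2)) * c)" using assms(1) g c by simp
  then obtain l where l: "l \<in> time_changes" "time_change_size l < min g (exp (- (t + 2)) * c)"
      "stopped_path_integral x y l < min g (exp (- (t + 2)) * c)"
    by (rule skorohod_dist_less)
  have near: "\<bar>l t - t\<bar> < min d 1"
  proof (cases "t = 0")
    case True thus ?thesis using time_change_0[OF l(1)] assms by simp
  next
    case False
    hence t: "t > 0" using assms by simp
    define E where "E = exp (time_change_size l)"
    have "E < exp g" using l(2) by (simp add: E_def)
    hence E: "E < 1 + min d 1 / (t + 1)" using assms by (simp add: g_def add_pos_nonneg)
    have E1: "E \<ge> 1" using time_change_size_nonneg[OF l(1)] by (simp add: E_def)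
    have "(E - 1) * t \<le> (min d 1 / (t + 1)) * t" using E t by (intro mult_right_mono) auto
    also have "\<dots> = min d 1 * (t / (t + 1))" by simp
    also have "\<dots> < min d 1 * 1" using t assms by (intro mult_strict_left_mono) auto
    also have "\<dots> = min d 1" by simp
    finally have small: "(E - 1) * t < min d 1" .
    have "l t \<le> E * t" "l t \<ge> inverse E * t"
      using time_change_bounds[OF l(1) order_refl t] time_change_0[OF l(1)] by (auto simp: E_def exp_minus)
    moreover have "inverse E \<ge> 2 - E"
    proof -
      have "0 \<le> (E - 1)\<^sup>2" by simp
      thus ?thesis using E1 by (simp add: field_simps power2_eq_square)
    qed
    hence "inverse E * t \<ge> (2 - E) * t" using t by (intro mult_right_mono) auto
    ultimately show ?thesis using small by (simp add: algebra_simps abs_less_iff)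
  qed
  have "\<exists>u\<in>{t+1..t+2}. stopped_path_dist x y l u < c"
  proof (rule ccontr)
    assume "\<not> ?thesis"
    hence ge: "stopped_path_dist x y l u \<ge> c" if "u \<in> {t+1..t+2}" for u using that by (auto simp: not_less)
    have int: "set_integrable lborel {t+1..t+2} (\<lambda>u. exp (- u) * stopped_path_dist x y l u)"
      by (rule set_integrable_subset[OF stopped_path_dist_integrable[OF l(1)]]) (use assms in auto)
    have "exp (- (t + 2)) * c = (LINT u:{t+1..t+2}|lborel. exp (- (t + 2)) * c)"
      by (simp add: set_integral_const measure_def) 
    also have "\<dots> \<le> (LINT u:{t+1..t+2}|lborel. exp (- u) * stopped_path_dist x y l u)"
    proof (rule set_integral_mono)
      show "set_integrable lborel {t+1..t+2} (\<lambda>u. exp (- (t + 2)) * c)" by (simp add: set_integrable_def)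
      show "set_integrable lborel {t+1..t+2} (\<lambda>u. exp (- u) * stopped_path_dist x y l u)" by (rule int)
      show "exp (- (t + 2)) * c \<le> exp (- u) * stopped_path_dist x y l u" if "u \<in> {t+1..t+2}" for u
        using that ge[OF that] c by (intro mult_mono) auto
    qed
    also have "\<dots> \<le> stopped_path_integral x y l"
      unfolding set_lebesgue_integral_def
    proof (rule integral_mono)
      show "integrable lborel (\<lambda>u. indicator {0..} u *\<^sub>R (exp (- u) * stopped_path_dist x y l u))"
        using stopped_path_dist_integrable[OF l(1)] by (simp add: set_integrable_def)
      show "integrable lborel (\<lambda>u. indicator {t+1..t+2} u *\<^sub>R (exp (- u) * stopped_path_dist x y l u))"
        using int by (simp add: set_integrable_def)
    qed (use assms in \<open>auto simp: indicator_def stopped_path_dist_nonneg\<close>)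
    finally show False using l(3) by simp
  qed
  then obtain u where u: "u \<in> {t+1..t+2}" "stopped_path_dist x y l u < c" by blast
  have "min 1 (dist (sample_path x (min t u)) (sample_path y (min (l t) u))) < c"
    using stopped_path_dist_ge[OF assms(2)] u(2) by (rule le_less_trans)
  moreover have "min t u = t" "min (l t) u = l t" using u near by auto
  ultimately have "dist (sample_path x t) (sample_path y (l t)) < e" using c by auto
  thus ?thesis using near by auto
qed

lemma skorohod_dist_eq_0:
  assumes "skorohod_dist x y = 0" shows "x = y"
proof -
  have nonneg: "sample_path x t = sample_path y t" if t: "t \<ge> 0" for t
  proof (rule ccontr)
    assume "sample_path x t \<noteq> sample_path y t"
    define e where "e = dist (sample_path x t) (sample_path y t) / 3"
    have e: "e > 0" using \<open>sample_path x t \<noteq> sample_path y t\<close> by (simp add: e_def)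
    have "eventually (\<lambda>s. dist (sample_path x s) (sample_path x t) < e \<and> dist (sample_path y s) (sample_path y t) < e) (at_right t)"
      using tendstoD[OF path_right_continuous e] by (intro eventually_conj) auto
    then obtain c where c: "c > t"
      "\<And>s. t < s \<Longrightarrow> s < c \<Longrightarrow> dist (sample_path x s) (sample_path x t) < e \<and> dist (sample_path y s) (sample_path y t) < e"
      unfolding eventually_at_right_field by blast
    define t' where "t' = (t + c) / 2"
    have "\<exists>s. \<bar>s - t'\<bar> < (c - t) / 2 \<and> dist (sample_path x t') (sample_path y s) < e"
      using t c e by (intro skorohod_dist_eq_0_near[OF assms]) (auto simp: t'_def)
    then obtain s where s: "\<bar>s - t'\<bar> < (c - t) / 2" "dist (sample_path x t') (sample_path y s) < e" by blast
    have "t < s" "s < c" "t < t'" "t' < c" using s c(1) by (auto simp: t'_def field_simps abs_less_iff)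
    hence "dist (sample_path x t') (sample_path x t) < e" "dist (sample_path y s) (sample_path y t) < e" using c by auto
    hence "dist (sample_path x t) (sample_path y t) < 3 * e"
      using s(2) dist_triangle[of "sample_path x t" "sample_path y t" "sample_path x t'"] dist_triangle[of "sample_path x t'" "sample_path y t" "sample_path y s"]
      by (simp add: dist_commute)
    thus False by (simp add: e_def)
  qed
  have "sample_path x t = sample_path y t" for t
  proof (cases "t \<ge> 0")
    case False
    hence "sample_path x t = sample_path x 0" "sample_path y t = sample_path y 0" using sample_path[of x] sample_path[of y] by auto
    thus ?thesis using nonneg[of 0] by simp
  qed (rule nonneg)
  thus ?thesis by (simp add: sample_path_inject[symmetric] fun_eq_iff)
qed

instantiation cadlag :: (metric_space) metric_space
begin

definition dist_cadlag :: "'a cadlag \<Rightarrow> 'a cadlag \<Rightarrow> real" where "dist_cadlag = skorohod_dist"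

definition uniformity_cadlag :: "('a cadlag \<times> 'a cadlag) filter"
  where "uniformity_cadlag = (INF e\<in>{0 <..}. principal {(x, y). dist x y < e})"

definition open_cadlag :: "'a cadlag set \<Rightarrow> bool"
  where "open_cadlag U \<longleftrightarrow> (\<forall>x\<in>U. eventually (\<lambda>(x', y). x' = x \<longrightarrow> y \<in> U) uniformity)"

instance
proof
  fix x y z :: "'a cadlag"
  show "dist x y = 0 \<longleftrightarrow> x = y"
    unfolding dist_cadlag_def using skorohod_dist_eq_0 skorohod_dist_refl by blast
  show "dist x y \<le> dist x z + dist y z"
    unfolding dist_cadlag_def using skorohod_dist_triangle[of x y z] skorohod_dist_sym_le[of z y] by linarith
qed (auto simp: uniformity_cadlag_def open_cadlag_def)

end

subsection \<open>Expansions, the additive character and Haar measure\<close>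

definition padic_expansion :: "'p::prime_card padic \<Rightarrow> (int \<Rightarrow> nat) \<Rightarrow> bool" where
  "padic_expansion x a \<longleftrightarrow> (\<forall>k. a k < CARD('p)) \<and> (\<exists>N. \<forall>k<N. a k = 0) \<and>
     (\<lambda>n::nat. \<Sum>k = - int n..int n. of_nat (a k) * of_nat CARD('p) powi k) \<longlonglongrightarrow> x"

definition padic_digit :: "'p::prime_card padic \<Rightarrow> int \<Rightarrow> nat" where
  "padic_digit x = (THE a. padic_expansion x a)"

definition padic_frac :: "'p::prime_card padic \<Rightarrow> rat" where
  "padic_frac x = (\<Sum>k | k < 0 \<and> padic_digit x k \<noteq> 0. of_nat (padic_digit x k) * of_nat CARD('p) powi k)"

definition padic_char :: "'p::prime_card padic \<Rightarrow> complex" where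
  "padic_char x = exp (2 * of_real pi * \<i> * of_rat (padic_frac x))"

definition is_padic_haar :: "'p::prime_card padic measure \<Rightarrow> bool" where
  "is_padic_haar \<mu> \<longleftrightarrow> sets \<mu> = sets borel \<and>
     (\<forall>x. \<forall>A\<in>sets borel. emeasure \<mu> ((\<lambda>y. x + y) ` A) = emeasure \<mu> A) \<and>
     (\<forall>K. compact K \<longrightarrow> emeasure \<mu> K < \<infinity>) \<and>
     emeasure \<mu> {x. padic_abs x \<le> 1} = 1"

subsection \<open>Brownian motion\<close>

definition padic_heat_kernel ::
    "'p::prime_card padic measure \<Rightarrow> real \<Rightarrow> real \<Rightarrow> real \<Rightarrow> 'p padic \<Rightarrow> complex" where
  "padic_heat_kernel \<mu> b \<sigma> t x =
     (LINT y|\<mu>. padic_char (x * y) * of_real (exp (- \<sigma> * t * padic_abs y powr b)))"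

text \<open>
  \<open>iterated_nn_integral \<mu> U n k f x\<close> is
  \<open>\<integral>\<^bsub>U k\<^esub> \<dots> \<integral>\<^bsub>U (k + n - 1)\<^esub> f x d\<mu>(x\<^bsub>k + n - 1\<^esub>) \<dots> d\<mu>(x\<^bsub>k\<^esub>)\<close>,
  where the coordinates of \<open>x\<close> outside \<open>{k..<k + n}\<close> are fixed.
\<close>

primrec iterated_nn_integral :: "'a measure \<Rightarrow> (nat \<Rightarrow> 'a set) \<Rightarrow> nat \<Rightarrow> nat \<Rightarrow>
    ((nat \<Rightarrow> 'a) \<Rightarrow> ennreal) \<Rightarrow> (nat \<Rightarrow> 'a) \<Rightarrow> ennreal" where
  "iterated_nn_integral \<mu> U 0 k f x = f x"
| "iterated_nn_integral \<mu> U (Suc n) k f x =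
     (\<integral>\<^sup>+y\<in>U k. iterated_nn_integral \<mu> U n (Suc k) f (x(k := y)) \<partial>\<mu>)"

text \<open>
  The heat kernel is a probability density for \<open>t > 0\<close>; \<open>Re\<close> and \<open>ennreal\<close> below only
  change the type of its nonnegative real values.
\<close>

definition is_padic_brownian_motion ::
    "'p::prime_card padic measure \<Rightarrow> real \<Rightarrow> real \<Rightarrow> 'p padic cadlag measure \<Rightarrow> bool" where
  "is_padic_brownian_motion \<mu> b \<sigma> P \<longleftrightarrow> prob_space P \<and> sets P = sets borel \<and>
     (\<forall>(N::nat) (t::nat \<Rightarrow> real) (U::nat \<Rightarrow> 'p padic set).
        t 0 = 0 \<and> (\<forall>i<N. t i < t (Suc i)) \<and> (\<forall>i\<le>N. U i \<in> sets borel) \<longrightarrow>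
        emeasure P {\<omega>. \<forall>i\<le>N. sample_path \<omega> (t i) \<in> U i} =
          (if 0 \<in> U 0
           then iterated_nn_integral \<mu> U N 1
             (\<lambda>x. \<Prod>i=1..N. ennreal (Re (padic_heat_kernel \<mu> b \<sigma> (t i - t (i - 1)) (x i - x (i - 1)))))
             (\<lambda>_. 0)
           else 0))"

subsection \<open>The primitive random walk on \<open>\<rat>\<^sub>p / \<int>\<^sub>p\<close>\<close>

quotient_type 'p padic_quot = "'p::prime_card padic" / "\<lambda>x y. padic_abs (x - y) \<le> 1"
proof (rule equivpI)
  show "reflp (\<lambda>x y :: 'p padic. padic_abs (x - y) \<le> 1)" by (simp add: reflp_def)
  show "symp (\<lambda>x y :: 'p padic. padic_abs (x - y) \<le> 1)"
    by (rule sympI) (subst padic_abs_commute)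
  show "transp (\<lambda>x y :: 'p padic. padic_abs (x - y) \<le> 1)"
  proof (rule transpI)
    fix x y z :: "'p padic" assume "padic_abs (x - y) \<le> 1" "padic_abs (y - z) \<le> 1"
    thus "padic_abs (x - z) \<le> 1" using padic_abs_ultra[of "x - y" "y - z"] by simp
  qed
qed

instantiation padic_quot :: (prime_card) ab_group_add
begin

lift_definition zero_padic_quot :: "'a padic_quot" is 0 .

lift_definition plus_padic_quot :: "'a padic_quot \<Rightarrow> 'a padic_quot \<Rightarrow> 'a padic_quot" is "(+)"
proof -
  fix x x' y y' :: "'a padic" assume "padic_abs (x - x') \<le> 1" "padic_abs (y - y') \<le> 1"
  thus "padic_abs (x + y - (x' + y')) \<le> 1"
    using padic_abs_ultra[of "x - x'" "y - y'"] by (simp add: algebra_simps)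
qed

lift_definition uminus_padic_quot :: "'a padic_quot \<Rightarrow> 'a padic_quot" is uminus
  by (simp add: padic_abs_commute)

definition minus_padic_quot :: "'a padic_quot \<Rightarrow> 'a padic_quot \<Rightarrow> 'a padic_quot"
  where "minus_padic_quot g h = g + - h"

instance
proof
  fix a b c :: "'a padic_quot"
  show "a + b + c = a + (b + c)" by transfer (simp add: add.assoc)
  show "a + b = b + a" by transfer (simp add: add.commute)
  show "0 + a = a" by transfer simp
  show "- a + a = 0" by transfer simp
  show "a - b = a + - b" by (simp add: minus_padic_quot_def)
qed

end

lift_definition padic_quot_abs :: "'p::prime_card padic_quot \<Rightarrow> real"
  is "\<lambda>x. if padic_abs x \<le> 1 then 0 else padic_abs x"
proof -
  have le: "padic_abs x \<le> max 1 (padic_abs y)" if "padic_abs (x - y) \<le> 1" for x y :: "'p padic"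
    using padic_abs_ultra[of "x - y" y] that by simp
  fix x y :: "'p padic" assume xy: "padic_abs (x - y) \<le> 1"
  hence "padic_abs (y - x) \<le> 1" using padic_abs_minus[of "x - y"] by simp
  with xy show "(if padic_abs x \<le> 1 then 0 else padic_abs x) = (if padic_abs y \<le> 1 then 0 else padic_abs y)"
    using le[of x y] le[of y x] by auto
qed

text \<open>The group is discrete, hence the \<open>\<sigma>\<close>-algebra \<^term>\<open>count_space UNIV\<close>.\<close>

definition is_primitive_walk ::
    "real \<Rightarrow> 's measure \<Rightarrow> (nat \<Rightarrow> 's \<Rightarrow> 'p::prime_card padic_quot) \<Rightarrow> bool" where
  "is_primitive_walk b M X \<longleftrightarrow> prob_space M \<and>
     prob_space.indep_vars M (\<lambda>_. count_space UNIV) X {1..} \<and>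
     (\<forall>n\<ge>1. measure M {s \<in> space M. X n s = 0} = 0 \<and>
       (\<forall>g. \<forall>i\<ge>1. padic_quot_abs g = real CARD('p) ^ i \<longrightarrow>
          measure M {s \<in> space M. X n s = g} =
            (real CARD('p) powr b - 1) / real CARD('p) powr (real i * b)
              * (1 / (real CARD('p) ^ i - real CARD('p) ^ (i - 1)))))"

definition walk :: "(nat \<Rightarrow> 's \<Rightarrow> 'p::prime_card padic_quot) \<Rightarrow> nat \<Rightarrow> 's \<Rightarrow> 'p padic_quot" where
  "walk X n s = (\<Sum>i=1..n. X i s)"

subsection \<open>Scaling\<close>

definition scaling_alpha :: "nat \<Rightarrow> real \<Rightarrow> real" where
  "scaling_alpha p b = (real p powr (b + 1) - 1) / (real p powr (b + 1) - real p powr b)"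

definition scaling_lambda :: "nat \<Rightarrow> real \<Rightarrow> real \<Rightarrow> nat \<Rightarrow> real" where
  "scaling_lambda p b \<sigma> m = \<sigma> / scaling_alpha p b * real p powr (real m * b)"

text \<open>
  \<open>\<Gamma>\<^sub>m\<close> in the literature. The fractional part only depends on the coset, so the choice of representative made by
  \<^const>\<open>rep_padic_quot\<close> is irrelevant.
\<close>

definition padic_quot_embed :: "nat \<Rightarrow> 'p::prime_card padic_quot \<Rightarrow> 'p padic" where
  "padic_quot_embed m g = of_nat CARD('p) ^ m * of_rat (padic_frac (rep_padic_quot g))"

definition scaled_walk ::
    "real \<Rightarrow> real \<Rightarrow> (nat \<Rightarrow> 's \<Rightarrow> 'p::prime_card padic_quot) \<Rightarrow> nat \<Rightarrow> real \<Rightarrow> 's \<Rightarrow> 'p padic" where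
  "scaled_walk b \<sigma> X m t s =
     padic_quot_embed m (walk X (nat \<lfloor>t * scaling_lambda CARD('p) b \<sigma> m\<rfloor>) s)"

definition is_scaled_walk_law :: "real \<Rightarrow> real \<Rightarrow> 's measure \<Rightarrow>
    (nat \<Rightarrow> 's \<Rightarrow> 'p::prime_card padic_quot) \<Rightarrow> nat \<Rightarrow> 'p padic cadlag measure \<Rightarrow> bool" where
  "is_scaled_walk_law b \<sigma> M X m Q \<longleftrightarrow> prob_space Q \<and> sets Q = sets borel \<and>
     (\<forall>J. finite J \<and> J \<subseteq> {0..} \<longrightarrow>
        distr Q (\<Pi>\<^sub>M t\<in>J. borel) (\<lambda>\<omega>. \<lambda>t\<in>J. sample_path \<omega> t) =
        distr M (\<Pi>\<^sub>M t\<in>J. borel) (\<lambda>s. \<lambda>t\<in>J. scaled_walk b \<sigma> X m t s))"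

subsection \<open>Weak convergence\<close>

definition weakly_converges :: "(nat \<Rightarrow> 'a::topological_space measure) \<Rightarrow> 'a measure \<Rightarrow> bool" where
  "weakly_converges Q P \<longleftrightarrow> (\<forall>f::'a \<Rightarrow> real. continuous_on UNIV f \<and> bounded (range f) \<longrightarrow>
     (\<lambda>m. \<integral>\<omega>. f \<omega> \<partial>Q m) \<longlonglongrightarrow> (\<integral>\<omega>. f \<omega> \<partial>P))"

end

(*
  No tightness argument is needed. Projecting to Q_p / p^n Z_p moves a path by at most p^-n
  in the Skorohod distance, and turns both processes into pure jump processes on a countable group.
  On a time grid, the projected laws are products of masses of balls. For the walk these masses are
  computed from the eigenfunctions p^-i 1_{H_i} - p^-(i+1) 1_{H_(i+1)} (H_i the subgroup of elements
  of norm at most p^i), with eigenvalues 1 - alpha p^(-ib); for Brownian motion from writing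
  exp(-c |y|^b) as a mixture of indicators of balls. The two answers match in the limit, and
  Fatou's lemma on a countable set upgrades this to convergence of expectations of all bounded
  functions of the grid skeleton. Finally, outside the event that two jumps are closer than delta a
  path is close to its grid skeleton (move each jump to the next grid time by a time change); this
  event is a monotone limit of grid events, so its probability under Brownian motion is bounded by
  the limit of its probabilities under the walks, where a union bound applies.
*)
theory Submission
  imports Defs "HOL-Real_Asymp.Real_Asymp"
begin

subsection \<open>Expansions and the additive character\<close>

text \<open>The ultrametric inequality replaces tightness. Lying in the same coset of p^n Z_p is an
  equivalence relation, so a projected cadlag path is constant just to the right of every time, and
  whether a step changes the coset depends only on the step. Hence the projections still have
  independent increments, and the masses of balls determine their grid laws. Rescaling by p^m turns
  the eigenfunctions of the walk into functions that do not depend on m, and \<lambda>(m) is tuned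
  so that each eigenvalue becomes 1 - \<sigma> p^((n-s)b) / \<lambda>(m); compounding about h
  \<lambda>(m) such factors gives exp(-\<sigma> h p^((n-s)b)), the factor that Fourier inversion
  produces for Brownian motion. The obstacle is that grid values say nothing about a path between
  grid times. About the limit only its finite-dimensional distributions and its cadlag paths are
  known, so close jumps must be excluded by events on ever finer grids. This is why the bound for
  the walks has to be uniform in the mesh and the events monotone under refinement.\<close>

lemma rat_padic_abs_of_int_less_1:
  assumes "prime p" shows "rat_padic_abs p (of_int z) < 1 \<longleftrightarrow> int p dvd z"
proof (cases "z = 0")
  case False
  have p1: "real p > 1" using assms prime_gt_1_nat by auto
  have "rat_padic_abs p (of_int z) = real p powi (- int (multiplicity (int p) z))"
    using rat_padic_abs_frac[OF assms False, of 1] by simp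
  also have "\<dots> < 1 \<longleftrightarrow> multiplicity (int p) z > 0"
    using p1 power_int_strict_increasing[of "- int (multiplicity (int p) z)" 0 "real p"] 
    by (cases "multiplicity (int p) z") auto
  also have "\<dots> \<longleftrightarrow> int p dvd z"
    using False assms by (simp add: prime_multiplicity_gt_zero_iff)
  finally show ?thesis .
qed (simp add: assms)

lemma rat_padic_abs_of_int_le_1:
  assumes "prime p" shows "rat_padic_abs p (of_int z) \<le> 1"
proof (cases "z = 0")
  case False
  have p1: "real p > 1" using assms prime_gt_1_nat by auto
  have "rat_padic_abs p (of_int z) = real p powi (- int (multiplicity (int p) z))"
    using rat_padic_abs_frac[OF assms False, of 1] by simp
  also have "\<dots> \<le> real p powi 0" using p1 by (intro power_int_increasing) auto
  finally show ?thesis by simp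
qed (simp add: assms)

lemma rat_padic_abs_prime:
  assumes "prime p" shows "rat_padic_abs p (of_nat p) = 1 / real p"
proof -
  have "rat_padic_abs p (of_int (int p) / of_int 1) = real p powi (- 1)"
    using assms by (subst rat_padic_abs_frac) auto
  thus ?thesis by (simp add: power_int_minus field_simps)
qed

lemma rat_padic_abs_power:
  assumes "prime p" shows "rat_padic_abs p (q ^ n) = rat_padic_abs p q ^ n"
  by (induction n) (simp_all add: assms rat_padic_abs_mult)

text \<open>The denominator has no prime factor other than \<open>p\<close>, so integrality at
  \<open>p\<close> alone forces an integer. Fractional parts lie in Z[1/p], and this is how their
  differences are recognised as integers.\<close>

lemma rat_padic_integral_power_quotient:
  assumes p: "prime p" and q: "q = of_int z / of_nat p ^ j" and le: "rat_padic_abs p q \<le> 1"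
  shows "q \<in> \<int>"
proof -
  have p0: "(of_nat p :: rat) \<noteq> 0" using p by auto
  have "rat_padic_abs p (of_int z) = rat_padic_abs p q * rat_padic_abs p (of_nat p ^ j)"
    using q p0 by (simp add: rat_padic_abs_mult[OF p, symmetric])
  also have "\<dots> \<le> 1 * (1 / real p) ^ j"
    using le p by (intro mult_mono) (auto simp: rat_padic_abs_power rat_padic_abs_prime)
  finally have *: "rat_padic_abs p (of_int z) \<le> (1 / real p) ^ j" by simp
  have "int p ^ j dvd z"
  proof (cases "z = 0")
    case False
    have p1: "real p > 1" using p prime_gt_1_nat by auto
    have "rat_padic_abs p (of_int z) = real p powi (- int (multiplicity (int p) z))"
      using rat_padic_abs_frac[OF p False, of 1] by simp
    moreover have "(1 / real p) ^ j = real p powi (- int j)"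
      by (simp add: power_int_minus power_divide field_simps)
    ultimately have "real p powi (- int (multiplicity (int p) z)) \<le> real p powi (- int j)"
      using * by simp
    hence "j \<le> multiplicity (int p) z"
      using power_int_strict_increasing[of "- int j" "- int (multiplicity (int p) z)", OF _ p1] by fastforce
    thus ?thesis by (rule multiplicity_dvd')
  qed auto
  then obtain w where "z = int p ^ j * w" by auto
  hence "q = of_int w" using q p0 by simp
  thus ?thesis by simp
qed

section \<open>The absolute value on Q_p: value group, density of the rationals, residues\<close>

lemma card_gt_1: "real CARD('p::prime_card) > 1"
  using prime_gt_1_nat[OF prime_card[where 'a = 'p]] by simp

lemma card_pos: "real CARD('p::prime_card) > 0"
  using card_gt_1[where 'p = 'p] by linarith

lemma padic_abs_1 [simp]: "padic_abs (1 :: 'p::prime_card padic) = 1"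
  using padic_abs_of_nat[of 1, where 'p = 'p] by (simp add: prime_card)

lemma padic_abs_inverse: "padic_abs (inverse x) = inverse (padic_abs (x :: 'p::prime_card padic))"
proof (cases "x = 0")
  case False
  hence "padic_abs x * padic_abs (inverse x) = 1" by (simp flip: padic_abs_mult)
  thus ?thesis by (metis inverse_unique)
qed auto

lemma padic_abs_divide: "padic_abs (x / y) = padic_abs x / padic_abs (y :: 'p::prime_card padic)"
  by (simp add: divide_inverse padic_abs_mult padic_abs_inverse)

lemma padic_abs_power: "padic_abs (x ^ n) = padic_abs (x :: 'p::prime_card padic) ^ n"
  by (induction n) (simp_all add: padic_abs_mult)

lemma padic_abs_power_int: "padic_abs (x powi n) = padic_abs (x :: 'p::prime_card padic) powi n"
  by (simp add: power_int_def padic_abs_power padic_abs_inverse)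

lemma padic_abs_p: "padic_abs (of_nat CARD('p) :: 'p::prime_card padic) = 1 / real CARD('p)"
  by (simp add: padic_abs_of_nat rat_padic_abs_prime prime_card)

lemma padic_abs_p_powi:
  "padic_abs (of_nat CARD('p) powi k :: 'p::prime_card padic) = real CARD('p) powi (- k)"
  by (simp add: padic_abs_power_int padic_abs_p power_int_minus power_int_divide_distrib field_simps)

lemma padic_abs_of_nat_le_1: "padic_abs (of_nat n :: 'p::prime_card padic) \<le> 1"
  using rat_padic_abs_of_int_le_1[OF prime_card[where 'a = 'p], of "int n"] by (simp add: padic_abs_of_nat)

lemma padic_abs_diff_le: "padic_abs (x - y) \<le> max (padic_abs x) (padic_abs (y :: 'p::prime_card padic))"
  using padic_abs_ultra[of x "- y"] by simp

lemma padic_abs_trans: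
  "padic_abs (x - y) \<le> r \<Longrightarrow> padic_abs (y - z) \<le> r \<Longrightarrow> padic_abs (x - z :: 'p::prime_card padic) \<le> r"
  using padic_abs_ultra[of "x - y" "y - z"] by simp

lemma padic_abs_sum_le:
  assumes "\<And>i. i \<in> A \<Longrightarrow> padic_abs (f i) \<le> r" "r \<ge> 0"
  shows "padic_abs (\<Sum>i\<in>A. f i :: 'p::prime_card padic) \<le> r"
  using assms
proof (induction A rule: infinite_finite_induct)
  case (insert a A)
  thus ?case using padic_abs_ultra[of "f a" "sum f A"] by (auto simp: le_max_iff_disj intro: order_trans)
qed auto

lemma padic_abs_eqI:
  assumes "padic_abs (x - y) < padic_abs (y :: 'p::prime_card padic)" shows "padic_abs x = padic_abs y"
  using assms padic_abs_ultra[of "x - y" y] padic_abs_diff_le[of x "x - y"] by (auto simp: max_def split: if_splits)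

text \<open>A point is the class of a Cauchy sequence of rationals, and a late term of that sequence
  is close to it.\<close>

lemma padic_rat_dense:
  assumes "e > 0" shows "\<exists>q. padic_abs (x - of_rat q :: 'p::prime_card padic) < e"
proof -
  have "\<forall>x. x \<in> {x :: 'p padic. \<exists>q. padic_abs (x - of_rat q) < e}"
  proof
    fix x :: "'p padic"
    define X where "X = rep_padic x"
    have X: "rat_padic_rel CARD('p) X X" "abs_padic X = x"
      unfolding X_def by (rule Quotient_rep_reflp[OF Quotient_padic], rule Quotient_abs_rep[OF Quotient_padic])
    hence cX: "rat_padic_cauchy CARD('p) X" by (simp add: rat_padic_rel_def)
    then obtain N where N: "\<And>m n. m \<ge> N \<Longrightarrow> n \<ge> N \<Longrightarrow> rat_padic_abs CARD('p) (X m - X n) < e / 2"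
      using assms unfolding rat_padic_cauchy_def by (meson half_gt_zero)
    have rel: "rat_padic_rel CARD('p) (\<lambda>n. X n - X N) (\<lambda>n. X n - X N)"
      by (intro rat_padic_rel_refl prime_card rat_padic_cauchy_diff cX rat_padic_cauchy_const)
    have "x - of_rat (X N) = abs_padic (\<lambda>n. X n - X N)"
      unfolding of_rat_padic X(2)[symmetric]
      by (rule minus_padic.abs_eq) (simp_all add: X rat_padic_rel_refl rat_padic_cauchy_const prime_card)
    hence "padic_abs (x - of_rat (X N)) = lim (\<lambda>n. rat_padic_abs CARD('p) (X n - X N))"
      using padic_abs.abs_eq[OF rel] by simp
    also have "\<dots> \<le> e / 2"
      by (rule LIMSEQ_le_const2[OF rat_padic_rel_LIMSEQ[OF rel]]) (use N less_imp_le in blast)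
    also have "e / 2 < e" using assms by simp
    finally show "x \<in> {x. \<exists>q. padic_abs (x - of_rat q) < e}" by blast
  qed
  thus ?thesis by blast
qed

text \<open>A rational closer to \<open>x\<close> than the size of \<open>x\<close> has the same
  absolute value, so the completion creates no new values.\<close>

lemma padic_abs_value:
  assumes "x \<noteq> (0 :: 'p::prime_card padic)"
  obtains k where "padic_abs x = real CARD('p) powi k"
proof -
  have "padic_abs x > 0" using assms padic_abs_nonneg[of x] padic_abs_eq_0[of x] by linarith
  then obtain q where q: "padic_abs (x - of_rat q) < padic_abs x" using padic_rat_dense by blast
  have "padic_abs (of_rat q :: 'p padic) = padic_abs x"
    by (intro padic_abs_eqI) (use q in \<open>simp add: padic_abs_commute\<close>)
  hence "padic_abs x = rat_padic_abs CARD('p) q" by (simp add: padic_abs_of_rat)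
  moreover have "q \<noteq> 0" using q by auto
  ultimately show ?thesis using that unfolding rat_padic_abs_def by auto
qed

text \<open>The value group is discrete: a strict bound by a power of p is a weak bound by the next
  smaller power.\<close>

lemma padic_abs_less_powi:
  "padic_abs (x :: 'p::prime_card padic) < real CARD('p) powi k \<longleftrightarrow> padic_abs x \<le> real CARD('p) powi (k - 1)"
proof (cases "x = 0")
  case False
  obtain j where j: "padic_abs x = real CARD('p) powi j" using padic_abs_value[OF False] .
  show ?thesis unfolding j using card_gt_1[where 'p = 'p]
    by (metis (no_types, opaque_lifting) linorder_not_less power_int_increasing power_int_strict_increasing
        less_imp_le zle_diff1_eq)
next
  case True
  thus ?thesis using card_pos[where 'p = 'p] by (simp add: zero_le_power_int)
qed

text \<open>A rational near \<open>x\<close> has denominator prime to \<open>p\<close>; the digit is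
  the numerator times the inverse of the denominator modulo \<open>p\<close>.\<close>

lemma padic_residue_exists:
  assumes "padic_abs (x :: 'p::prime_card padic) \<le> 1"
  shows "\<exists>d<CARD('p). padic_abs (x - of_nat d) < 1"
proof -
  let ?p = "int CARD('p)"
  have pr: "prime CARD('p)" by (rule prime_card)
  obtain q where q: "padic_abs (x - of_rat q) < 1" using padic_rat_dense[of 1 x] by auto
  hence "padic_abs (of_rat q - x) \<le> 1" by (simp add: padic_abs_commute)
  hence "padic_abs (of_rat q :: 'p padic) \<le> 1"
    using padic_abs_trans[of "of_rat q" x 1 0] assms by simp
  hence q1: "rat_padic_abs CARD('p) q \<le> 1" by (simp add: padic_abs_of_rat)
  obtain a b where ab: "quotient_of q = (a, b)" by fastforce
  have b: "b > 0" "coprime a b" "q = of_int a / of_int b"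
    using ab quotient_of_denom_pos quotient_of_coprime quotient_of_div by auto
  have nb: "\<not> ?p dvd b"
  proof
    assume pb: "?p dvd b"
    hence "\<not> ?p dvd a" using b(2) pr
      by (metis coprime_common_divisor not_prime_unit prime_nat_int_transfer)
    hence "a \<noteq> 0" "multiplicity ?p a = 0" by (auto simp: not_dvd_imp_multiplicity_0)
    moreover have "multiplicity ?p b > 0" using pb b(1) pr by (simp add: prime_multiplicity_gt_zero_iff)
    ultimately have "rat_padic_abs CARD('p) q = real CARD('p) ^ multiplicity ?p b"
      using rat_padic_abs_frac[OF pr \<open>a \<noteq> 0\<close>, of b] b by simp
    also have "\<dots> > 1" using \<open>multiplicity ?p b > 0\<close> card_gt_1[where 'p = 'p] by simp
    finally show False using q1 by simp
  qed
  hence "coprime b ?p" using pr by (metis coprime_commute prime_imp_coprime prime_nat_int_transfer)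
  then obtain c where c: "[b * c = 1] (mod ?p)" using cong_solve_coprime_int by blast
  define d where "d = nat ((a * c) mod ?p)"
  have p0: "?p > 0" using card_pos[where 'p = 'p] by simp
  have d: "d < CARD('p)" "int d = (a * c) mod ?p" using p0 by (simp_all add: d_def nat_less_iff)
  have "[int d * b = a * c * b] (mod ?p)" unfolding d(2) by (intro cong_mult) (auto simp: cong_def)
  also have "[a * c * b = a * (b * c)] (mod ?p)" by (simp add: mult_ac)
  also have "[a * (b * c) = a * 1] (mod ?p)" by (intro cong_mult c) auto
  finally have "?p dvd int d * b - a" by (simp add: cong_iff_dvd_diff)
  hence "rat_padic_abs CARD('p) (of_int (int d * b - a)) < 1"
    by (subst rat_padic_abs_of_int_less_1[OF pr])
  moreover have "rat_padic_abs CARD('p) (of_int b) = 1"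
    using rat_padic_abs_of_int_le_1[OF pr, of b] rat_padic_abs_of_int_less_1[OF pr, of b] nb by linarith
  moreover have "of_nat d - q = of_int (int d * b - a) / of_int b" using b by (simp add: field_simps)
  hence "rat_padic_abs CARD('p) (of_nat d - q) * rat_padic_abs CARD('p) (of_int b)
       = rat_padic_abs CARD('p) (of_int (int d * b - a))"
    using b(1) by (simp flip: rat_padic_abs_mult[OF pr])
  ultimately have "rat_padic_abs CARD('p) (of_nat d - q) < 1" by simp
  hence "padic_abs (of_rat (of_nat d - q) :: 'p padic) < 1" by (simp add: padic_abs_of_rat)
  hence "padic_abs (of_rat q - of_nat d :: 'p padic) < 1" by (subst padic_abs_commute) (simp add: of_rat_diff)
  hence "padic_abs (x - of_nat d) < 1" using q padic_abs_ultra[of "x - of_rat q" "of_rat q - of_nat d"] by simp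
  thus ?thesis using d(1) by blast
qed

lemma padic_residue_unique:
  assumes "padic_abs (of_nat d - of_nat d' :: 'p::prime_card padic) < 1" "d < CARD('p)" "d' < CARD('p)"
  shows "d = d'"
proof -
  have "(of_nat d - of_nat d' :: 'p padic) = of_rat (of_int (int d - int d'))" by (simp add: of_rat_diff)
  hence "rat_padic_abs CARD('p) (of_int (int d - int d')) < 1"
    using assms(1) padic_abs_of_rat[where 'p = 'p, of "of_int (int d - int d')"] by simp
  hence "int CARD('p) dvd int d - int d'" using rat_padic_abs_of_int_less_1[OF prime_card[where 'a = 'p]] by blast
  hence "\<bar>int d - int d'\<bar> = 0 \<or> \<bar>int d - int d'\<bar> \<ge> int CARD('p)" by (metis abs_of_nat dvd_abs_iff dvd_imp_le_int abs_ge_zero abs_eq_0)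
  thus ?thesis using assms(2,3) by linarith
qed

section \<open>Digits and expansions\<close>

lemma padic_digit_exists:
  assumes "padic_abs (x :: 'p::prime_card padic) \<le> real CARD('p) powi (- k)"
  shows "\<exists>d<CARD('p). padic_abs (x - of_nat d * of_nat CARD('p) powi k) \<le> real CARD('p) powi (- k - 1)"
proof -
  let ?q = "of_nat CARD('p) :: 'p padic"
  have q0: "?q \<noteq> 0" by simp
  have P0: "real CARD('p) \<noteq> 0" by simp
  have "padic_abs (x * ?q powi (- k)) \<le> 1"
    using mult_right_mono[OF assms, of "real CARD('p) powi k"]
    by (simp add: padic_abs_mult padic_abs_p_powi flip: power_int_add)
  then obtain d where d: "d < CARD('p)" "padic_abs (x * ?q powi (- k) - of_nat d) < 1"
    using padic_residue_exists by blast
  have "x - of_nat d * ?q powi k = (x * ?q powi (- k) - of_nat d) * ?q powi k"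
    using q0 by (simp add: left_diff_distrib mult.assoc flip: power_int_add)
  hence "padic_abs (x - of_nat d * ?q powi k) = padic_abs (x * ?q powi (- k) - of_nat d) * real CARD('p) powi (- k)"
    by (simp add: padic_abs_mult padic_abs_p_powi)
  also have "\<dots> < 1 * real CARD('p) powi (- k)"
    using d(2) card_pos[where 'p = 'p] by (intro mult_strict_right_mono) auto
  finally have "padic_abs (x - of_nat d * ?q powi k) < real CARD('p) powi (- k)" by simp
  thus ?thesis using d(1) padic_abs_less_powi by blast
qed
lemma padic_abs_le_powi: "\<exists>N::nat. padic_abs (x :: 'p::prime_card padic) \<le> real CARD('p) powi (int N)"
  using real_arch_pow[OF card_gt_1[where 'p = 'p], of "padic_abs x"] by (auto intro: less_imp_le)

text \<open>Greedy choice: strip off one digit after another, starting at position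
  \<open>- N\<close>, below which all digits are 0.\<close>

lemma padic_expansion_exists: "\<exists>a. padic_expansion (x :: 'p::prime_card padic) a"
proof -
  let ?q = "of_nat CARD('p) :: 'p padic" and ?p = "real CARD('p)"
  obtain N :: nat where N: "padic_abs x \<le> ?p powi (int N)" using padic_abs_le_powi by blast
  let ?step = "\<lambda>j y z. \<exists>d<CARD('p). z = y - of_nat d * ?q powi (int j - int N)"
  \<comment> \<open>\<open>r j\<close> is the remainder after \<open>j\<close> digits. The bound
    p^(N - j) is the invariant that makes the next digit exist and the remainders tend to 0.\<close>
  have "\<exists>r. r 0 = x \<and> (\<forall>j. padic_abs (r j) \<le> ?p powi (int N - int j) \<and> ?step j (r j) (r (Suc j)))"
  proof (rule dependent_nat_choice[of "\<lambda>j y. (j = 0 \<longrightarrow> y = x) \<and> padic_abs y \<le> ?p powi (int N - int j)" ?step, simplified all_conj_distrib, THEN exE])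
    show "\<exists>y. (0 = (0::nat) \<longrightarrow> y = x) \<and> padic_abs y \<le> ?p powi (int N - int 0)" using N by simp
  next
    fix y j assume "(j = (0::nat) \<longrightarrow> y = x) \<and> padic_abs y \<le> ?p powi (int N - int j)"
    hence "padic_abs y \<le> ?p powi (- (int j - int N))" by simp
    from padic_digit_exists[OF this]
    obtain d where "d < CARD('p)" "padic_abs (y - of_nat d * ?q powi (int j - int N)) \<le> ?p powi (- (int j - int N) - 1)" by blast
    moreover have "- (int j - int N) - 1 = int N - int (Suc j)" by simp
    ultimately have "padic_abs (y - of_nat d * ?q powi (int j - int N)) \<le> ?p powi (int N - int (Suc j))" by metis
    with \<open>d < CARD('p)\<close> show "\<exists>z. ((Suc j = 0 \<longrightarrow> z = x) \<and> padic_abs z \<le> ?p powi (int N - int (Suc j))) \<and> ?step j y z"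
      by auto
  qed auto
  then obtain r where r: "r 0 = x" "\<And>j. padic_abs (r j) \<le> ?p powi (int N - int j)" "\<And>j. ?step j (r j) (r (Suc j))"
    by blast
  then obtain d where d: "\<And>j. d j < CARD('p)" "\<And>j. r (Suc j) = r j - of_nat (d j) * ?q powi (int j - int N)"
    by metis
  define a where "a k = (if k < - int N then 0 else d (nat (k + int N)))" for k
  have sum: "(\<Sum>j<n. of_nat (d j) * ?q powi (int j - int N)) = x - r n" for n
    by (induction n) (simp_all add: r(1) d(2))
  have S: "(\<Sum>k = - int n..int n. of_nat (a k) * ?q powi k) = x - r (n + N + 1)" if "n \<ge> N" for n
  proof -
    have "(\<Sum>k = - int n..int n. of_nat (a k) * ?q powi k) = (\<Sum>k = - int N..int n. of_nat (a k) * ?q powi k)"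
      by (rule sum.mono_neutral_right) (use that in \<open>auto simp: a_def\<close>)
    also have "\<dots> = (\<Sum>j<n + N + 1. of_nat (d j) * ?q powi (int j - int N))"
      by (rule sum.reindex_bij_witness[of _ "\<lambda>j. int j - int N" "\<lambda>k. nat (k + int N)"]) (auto simp: a_def)
    finally show ?thesis using sum by simp
  qed
  have "(\<lambda>n::nat. \<Sum>k = - int n..int n. of_nat (a k) * ?q powi k) \<longlonglongrightarrow> x"
  proof (rule metric_tendsto_imp_tendsto)
    have "(\<lambda>n. (1 / ?p) ^ n) \<longlonglongrightarrow> 0" using card_gt_1[where 'p = 'p] by (intro LIMSEQ_realpow_zero) auto
    thus "(\<lambda>n. (1 / ?p) ^ Suc n) \<longlonglongrightarrow> 0" by (rule LIMSEQ_Suc)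
    show "\<forall>\<^sub>F n in sequentially. dist (\<Sum>k = - int n..int n. of_nat (a k) * ?q powi k) x \<le> dist ((1 / ?p) ^ Suc n) 0"
      using eventually_ge_at_top[of N]
    proof eventually_elim
      case (elim n)
      have "dist (\<Sum>k = - int n..int n. of_nat (a k) * ?q powi k) x = padic_abs (r (n + N + 1))"
        by (simp add: S[OF elim] dist_padic_def)
      also have "\<dots> \<le> ?p powi (int N - int (n + N + 1))" by (rule r(2))
      also have "int N - int (n + N + 1) = - int (Suc n)" by simp
      also have "?p powi (- int (Suc n)) = (1 / ?p) ^ Suc n"
        by (simp only: power_int_minus power_int_of_nat) (simp add: power_divide field_simps)
      finally show ?case by simp
    qed
  qed
  moreover have "\<forall>k. a k < CARD('p)" using d(1) by (auto simp: a_def)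
  moreover have "\<forall>k < - int N. a k = 0" by (simp add: a_def)
  ultimately show ?thesis unfolding padic_expansion_def by blast
qed

text \<open>A finite sum is no larger than its largest term, so the digits from position
  \<open>K\<close> on contribute at most p^(-K).\<close>

lemma padic_expansion_truncate:
  fixes x :: "'p::prime_card padic"
  assumes a: "padic_expansion x a" and L: "\<And>k. k < L \<Longrightarrow> a k = 0"
  shows "padic_abs (x - (\<Sum>k = L..<K. of_nat (a k) * of_nat CARD('p) powi k)) \<le> real CARD('p) powi (- K)"
proof -
  let ?q = "of_nat CARD('p) :: 'p padic" and ?p = "real CARD('p)"
  let ?t = "\<lambda>k. of_nat (a k) * ?q powi k"
  have "(\<lambda>n::nat. \<Sum>k = - int n..int n. ?t k) \<longlonglongrightarrow> x" using a by (simp add: padic_expansion_def)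
  moreover have pos: "?p powi (- K) > 0" using card_pos[where 'p = 'p] by simp
  ultimately have "eventually (\<lambda>n. dist (\<Sum>k = - int n..int n. ?t k) x < ?p powi (- K)) sequentially"
    by (rule tendstoD)
  moreover have "eventually (\<lambda>n. n \<ge> nat (\<bar>L\<bar> + \<bar>K\<bar>)) sequentially" by (rule eventually_ge_at_top)
  ultimately have "eventually (\<lambda>n. dist (\<Sum>k = - int n..int n. ?t k) x < ?p powi (- K) \<and> n \<ge> nat (\<bar>L\<bar> + \<bar>K\<bar>)) sequentially"
    by (rule eventually_conj)
  then obtain n where n: "dist (\<Sum>k = - int n..int n. ?t k) x < ?p powi (- K)" "n \<ge> nat (\<bar>L\<bar> + \<bar>K\<bar>)"
    using eventually_happens'[OF sequentially_bot] by blast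
  have "(\<Sum>k = - int n..int n. ?t k) = (\<Sum>k \<in> {L..<K} \<union> {max L K..int n}. ?t k)"
  proof (rule sum.mono_neutral_right)
    show "\<forall>i\<in>{- int n..int n} - ({L..<K} \<union> {max L K..int n}). ?t i = 0"
    proof
      fix i assume "i \<in> {- int n..int n} - ({L..<K} \<union> {max L K..int n})"
      hence "i < L" by (auto simp: not_le)
      thus "?t i = 0" by (simp add: L)
    qed
  qed (use n in auto)
  also have "\<dots> = (\<Sum>k = L..<K. ?t k) + (\<Sum>k = max L K..int n. ?t k)"
    by (rule sum.union_disjoint) auto
  finally have eq: "(\<Sum>k = - int n..int n. ?t k) - (\<Sum>k = L..<K. ?t k) = (\<Sum>k = max L K..int n. ?t k)" by simp
  have "padic_abs (\<Sum>k = max L K..int n. ?t k) \<le> ?p powi (- K)"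
  proof (rule padic_abs_sum_le)
    fix k assume "k \<in> {max L K..int n}"
    hence "?p powi (- k) \<le> ?p powi (- K)" using card_gt_1[where 'p = 'p] by (intro power_int_increasing) auto
    moreover have "padic_abs (of_nat (a k) :: 'p padic) * ?p powi (- k) \<le> 1 * ?p powi (- k)"
      by (intro mult_right_mono padic_abs_of_nat_le_1) (simp add: zero_le_power_int)
    ultimately show "padic_abs (?t k) \<le> ?p powi (- K)" unfolding padic_abs_mult padic_abs_p_powi by linarith
  qed (use pos in simp)
  thus ?thesis
    using padic_abs_trans[of x "\<Sum>k = - int n..int n. ?t k" "?p powi (- K)" "\<Sum>k = L..<K. ?t k"] n(1) eq
    by (simp add: dist_padic_def padic_abs_commute)
qed

text \<open>At the first position \<open>k\<close> where the digits could differ, both truncations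
  are within p^(-k-1) of \<open>x\<close>, so the two digits agree modulo \<open>p\<close> and hence
  are equal.\<close>

lemma padic_expansion_unique:
  fixes x :: "'p::prime_card padic"
  assumes "padic_expansion x a" "padic_expansion x b"
  shows "a = b"
proof
  let ?q = "of_nat CARD('p) :: 'p padic" and ?p = "real CARD('p)"
  obtain M N where "\<And>k. k < M \<Longrightarrow> a k = 0" "\<And>k. k < N \<Longrightarrow> b k = 0"
    using assms unfolding padic_expansion_def by blast
  then obtain L where L: "\<And>k. k < L \<Longrightarrow> a k = 0" "\<And>k. k < L \<Longrightarrow> b k = 0"
    using that[of "min M N"] by auto
  have step: "a k = b k" if eq: "\<And>i. i < k \<Longrightarrow> a i = b i" and k: "k \<ge> L" for k
  proof -
    let ?A = "\<Sum>i = L..<k. of_nat (a i) * ?q powi i"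
    have ins: "{L..<k + 1} = insert k {L..<k}" using k by auto
    have A: "(\<Sum>i = L..<k. of_nat (b i) * ?q powi i) = ?A" using eq by (intro sum.cong) auto
    have "padic_abs (x - (of_nat (a k) * ?q powi k + ?A)) \<le> ?p powi (- (k + 1))"
      using padic_expansion_truncate[OF assms(1), of L "k + 1"] L(1) by (simp add: ins)
    moreover have "padic_abs (x - (of_nat (b k) * ?q powi k + ?A)) \<le> ?p powi (- (k + 1))"
      using padic_expansion_truncate[OF assms(2), of L "k + 1"] L(2) by (simp add: ins A)
    ultimately have "padic_abs (of_nat (a k) * ?q powi k + ?A - (of_nat (b k) * ?q powi k + ?A)) \<le> ?p powi (- (k + 1))"
      by (subst (asm) padic_abs_commute) (rule padic_abs_trans)
    also have "of_nat (a k) * ?q powi k + ?A - (of_nat (b k) * ?q powi k + ?A) = (of_nat (a k) - of_nat (b k)) * ?q powi k"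
      by (simp add: algebra_simps)
    finally have "padic_abs (of_nat (a k) - of_nat (b k) :: 'p padic) * ?p powi (- k) \<le> ?p powi (- k - 1)"
      by (simp add: padic_abs_mult padic_abs_p_powi)
    also have "\<dots> < 1 * ?p powi (- k)" using card_gt_1[where 'p = 'p] by (simp add: power_int_strict_increasing)
    finally have "padic_abs (of_nat (a k) - of_nat (b k) :: 'p padic) < 1"
      using card_pos[where 'p = 'p] by (simp add: mult_less_cancel_right)
    thus ?thesis using assms by (intro padic_residue_unique) (auto simp: padic_expansion_def)
  qed
  have "\<forall>i < L + int n. a i = b i" for n
  proof (induction n)
    case (Suc n)
    have "a (L + int n) = b (L + int n)" by (rule step) (use Suc in blast, simp)
    moreover have "i < L + int n \<or> i = L + int n" if "i < L + int (Suc n)" for i using that by linarith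
    ultimately show ?case using Suc by metis
  next
    case 0
    show ?case using L by simp
  qed
  moreover fix k
  have "k < L + int (nat (k - L + 1))" by linarith
  ultimately show "a k = b k" by blast
qed

lemma padic_digit_expansion: "padic_expansion x (padic_digit (x :: 'p::prime_card padic))"
  unfolding padic_digit_def using padic_expansion_exists padic_expansion_unique by (metis theI)

lemma padic_digit_less: "padic_digit (x :: 'p::prime_card padic) k < CARD('p)"
  using padic_digit_expansion[of x] by (simp add: padic_expansion_def)

section \<open>Fractional parts and the additive character\<close>

lemma padic_frac_truncate:
  obtains N :: nat where "\<And>k. k < - int N \<Longrightarrow> padic_digit (x :: 'p::prime_card padic) k = 0"
    "padic_frac x = (\<Sum>k = - int N..<0. of_nat (padic_digit x k) * of_nat CARD('p) powi k)"
proof -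
  obtain M where M: "\<And>k. k < M \<Longrightarrow> padic_digit x k = 0"
    using padic_digit_expansion[of x] unfolding padic_expansion_def by blast
  have N: "\<And>k. k < - int (nat (- M)) \<Longrightarrow> padic_digit x k = 0" by (rule M) linarith
  have "padic_frac x = (\<Sum>k = - int (nat (- M))..<0. of_nat (padic_digit x k) * of_nat CARD('p) powi k)"
    unfolding padic_frac_def
  proof (rule sum.mono_neutral_left)
    show "{k. k < 0 \<and> padic_digit x k \<noteq> 0} \<subseteq> {- int (nat (- M))..<0}"
    proof
      fix k assume k: "k \<in> {k. k < 0 \<and> padic_digit x k \<noteq> 0}"
      have "\<not> k < - int (nat (- M))"
      proof
        assume "k < - int (nat (- M))"
        thus False using N[of k] k by simp
      qed
      thus "k \<in> {- int (nat (- M))..<0}" using k by simp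
    qed
    show "\<forall>k\<in>{- int (nat (- M))..<0} - {k. k < 0 \<and> padic_digit x k \<noteq> 0}.
        of_nat (padic_digit x k) * of_nat CARD('p) powi k = (0::rat)" by simp
  qed simp
  with N show ?thesis by (rule that)
qed

lemma of_rat_power_int: "of_rat (q powi k) = (of_rat q powi k :: 'a::field_char_0)"
  by (simp add: power_int_def of_rat_power of_rat_inverse)

lemma padic_frac_near: "padic_abs (x - of_rat (padic_frac x) :: 'p::prime_card padic) \<le> 1"
proof -
  obtain N where N: "\<And>k. k < - int N \<Longrightarrow> padic_digit x k = 0"
    "padic_frac x = (\<Sum>k = - int N..<0. of_nat (padic_digit x k) * of_nat CARD('p) powi k)"
    by (rule padic_frac_truncate[of x]) blast
  have "(of_rat (padic_frac x) :: 'p padic) = (\<Sum>k = - int N..<0. of_nat (padic_digit x k) * of_nat CARD('p) powi k)"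
    unfolding N(2) by (simp add: of_rat_sum of_rat_mult of_rat_power_int)
  thus ?thesis using padic_expansion_truncate[OF padic_digit_expansion, of "- int N" x 0] N(1) by simp
qed

text \<open>Horner's scheme: one more digit to the left of the ones already used turns the numerator
  n into d + p n. The bound on the numerator is what places fractional parts in [0,1).\<close>

lemma padic_frac_quotient:
  obtains n j where "n < CARD('p) ^ j" "padic_frac (x :: 'p::prime_card padic) = of_nat n / of_nat CARD('p) ^ j"
proof -
  let ?d = "padic_digit x"
  have "\<exists>n < CARD('p) ^ j. (\<Sum>k = - int j..<0. of_nat (?d k) * of_nat CARD('p) powi k :: rat) = of_nat n / of_nat CARD('p) ^ j" for j
  proof (induction j)
    case (Suc j)
    then obtain n where n: "n < CARD('p) ^ j"
      "(\<Sum>k = - int j..<0. of_nat (?d k) * of_nat CARD('p) powi k :: rat) = of_nat n / of_nat CARD('p) ^ j" by blast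
    let ?k = "- int (Suc j)"
    have "{- int (Suc j)..<0} = insert ?k {- int j..<0}" by auto
    hence "(\<Sum>k = - int (Suc j)..<0. of_nat (?d k) * of_nat CARD('p) powi k :: rat)
        = of_nat (?d ?k) * of_nat CARD('p) powi ?k + of_nat n / of_nat CARD('p) ^ j"
      using n(2) by simp
    also have "of_nat CARD('p) powi ?k = (1 / of_nat CARD('p) ^ Suc j :: rat)"
      by (simp only: power_int_minus power_int_of_nat divide_inverse mult_1_left)
    also have "of_nat (?d ?k) * (1 / of_nat CARD('p) ^ Suc j) + of_nat n / of_nat CARD('p) ^ j
        = (of_nat (?d ?k + CARD('p) * n) / of_nat CARD('p) ^ Suc j :: rat)"
      by (simp add: field_simps)
    finally have "(\<Sum>k = - int (Suc j)..<0. of_nat (?d k) * of_nat CARD('p) powi k :: rat)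
       = of_nat (?d ?k + CARD('p) * n) / of_nat CARD('p) ^ Suc j" .
    moreover have "?d ?k + CARD('p) * n < CARD('p) ^ Suc j"
    proof -
      have "?d ?k + CARD('p) * n < CARD('p) * (n + 1)" using padic_digit_less[of x ?k] by simp
      also have "\<dots> \<le> CARD('p) * CARD('p) ^ j" using n(1) by (intro mult_left_mono) auto
      finally show ?thesis by simp
    qed
    ultimately show ?case by blast
  qed auto
  moreover obtain N :: nat where
    "padic_frac x = (\<Sum>k = - int N..<0. of_nat (?d k) * of_nat CARD('p) powi k)"
    by (rule padic_frac_truncate[of x])
  ultimately show ?thesis using that by force
qed

lemma padic_frac_bounds: "0 \<le> padic_frac (x :: 'p::prime_card padic)" "padic_frac x < 1"
proof -
  obtain n j where *: "n < CARD('p) ^ j" "padic_frac x = of_nat n / of_nat CARD('p) ^ j"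
    by (rule padic_frac_quotient)
  have "rat_of_nat n < of_nat (CARD('p) ^ j)" using *(1) by (simp only: of_nat_less_iff)
  thus "0 \<le> padic_frac x" "padic_frac x < 1" unfolding *(2) by (simp_all add: field_simps)
qed

lemma padic_frac_common_denom:
  obtains a j where "padic_frac (x :: 'p::prime_card padic) = of_int a / of_nat CARD('p) ^ j"
proof -
  obtain n j where "padic_frac x = of_nat n / of_nat CARD('p) ^ j" by (rule padic_frac_quotient)
  thus ?thesis using that[of "int n" j] by simp
qed

lemma padic_frac_diff_denom:
  obtains c k where "padic_frac (x :: 'p::prime_card padic) - padic_frac (y :: 'p padic) = of_int c / of_nat CARD('p) ^ k"
proof -
  obtain a i where a: "padic_frac x = of_int a / of_nat CARD('p) ^ i" by (rule padic_frac_common_denom)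
  obtain b j where b: "padic_frac y = of_int b / of_nat CARD('p) ^ j" by (rule padic_frac_common_denom[of y])
  have "padic_frac x - padic_frac y = of_int (a * int CARD('p) ^ j - b * int CARD('p) ^ i) / of_nat CARD('p) ^ (i + j)"
    unfolding a b by (simp add: field_simps power_add)
  thus ?thesis by (rule that)
qed

lemma padic_frac_add_denom:
  obtains c k where
    "padic_frac (z :: 'p::prime_card padic) - (padic_frac (x :: 'p padic) + padic_frac (y :: 'p padic)) = of_int c / of_nat CARD('p) ^ k"
proof -
  obtain a i where a: "padic_frac z - padic_frac x = of_int a / of_nat CARD('p) ^ i" by (rule padic_frac_diff_denom)
  obtain b j where b: "padic_frac y = of_int b / of_nat CARD('p) ^ j" by (rule padic_frac_common_denom[of y])
  have "padic_frac z - (padic_frac x + padic_frac y) = (padic_frac z - padic_frac x) - padic_frac y" by simp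
  also have "\<dots> = of_int (a * int CARD('p) ^ j - b * int CARD('p) ^ i) / of_nat CARD('p) ^ (i + j)"
    unfolding a b by (simp add: field_simps power_add)
  finally show ?thesis by (rule that)
qed

lemma padic_integral_quotient:
  assumes "padic_abs (of_rat q :: 'p::prime_card padic) \<le> 1" "q = of_int a / of_nat CARD('p) ^ j"
  shows "q \<in> \<int>"
  using rat_padic_integral_power_quotient[OF prime_card assms(2)] assms(1) by (simp add: padic_abs_of_rat)

text \<open>The difference of the two fractional parts lies in Z[1/p] and is a p-adic integer, hence
  an integer; since both lie in [0,1), it is 0.\<close>

lemma padic_frac_cong:
  assumes "padic_abs (x - y :: 'p::prime_card padic) \<le> 1"
  shows "padic_frac x = padic_frac y"
proof -
  let ?q = "padic_frac x - padic_frac y"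
  have "padic_abs (of_rat (padic_frac x) - y) \<le> 1"
    by (rule padic_abs_trans[OF _ assms]) (subst padic_abs_commute, rule padic_frac_near)
  hence "padic_abs (of_rat ?q :: 'p padic) \<le> 1"
    unfolding of_rat_diff by (rule padic_abs_trans[OF _ padic_frac_near])
  moreover obtain c k where "?q = of_int c / of_nat CARD('p) ^ k" by (rule padic_frac_diff_denom)
  ultimately have "?q \<in> \<int>" by (rule padic_integral_quotient)
  moreover have "\<bar>?q\<bar> < 1" using padic_frac_bounds[of x] padic_frac_bounds[of y] by linarith
  ultimately show ?thesis by (metis Ints_nonzero_abs_less1 eq_iff_diff_eq_0)
qed

lemma padic_frac_eq_0: "padic_abs (x :: 'p::prime_card padic) \<le> 1 \<Longrightarrow> padic_frac x = 0"
proof -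
  assume "padic_abs x \<le> 1"
  hence "padic_abs (of_rat (padic_frac x) :: 'p padic) \<le> 1"
    using padic_abs_trans[of "of_rat (padic_frac x)" x 1 0] padic_frac_near[of x] by (simp add: padic_abs_commute)
  moreover obtain c k where "padic_frac x = of_int c / of_nat CARD('p) ^ k" by (rule padic_frac_common_denom)
  ultimately have "padic_frac x \<in> \<int>" by (rule padic_integral_quotient)
  thus "padic_frac x = 0" using padic_frac_bounds[of x] by (metis Ints_nonzero_abs_less1 abs_of_nonneg)
qed

lemma exp_2pi_Ints: "q \<in> \<int> \<Longrightarrow> exp (2 * of_real pi * \<i> * of_rat q) = 1"
  using exp_integer_2pi[of "of_rat q"] by (elim Ints_cases) (simp add: mult_ac)

text \<open>Fractional parts add up only modulo integers: the defect lies in Z[1/p] and in Z_p, and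
  the exponential does not see it.\<close>

lemma padic_char_add: "padic_char (x + y) = padic_char x * padic_char (y :: 'p::prime_card padic)"
proof -
  let ?q = "padic_frac (x + y) - (padic_frac x + padic_frac y)"
  let ?R = "\<lambda>x. of_rat (padic_frac x) :: 'p padic"
  have "(of_rat ?q :: 'p padic) = (x - ?R x) + (y - ?R y) - (x + y - ?R (x + y))"
    by (simp add: of_rat_diff of_rat_add)
  moreover have "padic_abs ((x - ?R x) + (y - ?R y)) \<le> 1"
    using padic_frac_near[of x] padic_frac_near[of y] by (intro order_trans[OF padic_abs_ultra]) simp
  hence "padic_abs ((x - ?R x) + (y - ?R y) - (x + y - ?R (x + y))) \<le> 1"
    using padic_frac_near[of "x + y"] by (intro order_trans[OF padic_abs_diff_le]) simp
  ultimately have "padic_abs (of_rat ?q :: 'p padic) \<le> 1" by simp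
  moreover obtain c k where "?q = of_int c / of_nat CARD('p) ^ k" by (rule padic_frac_add_denom)
  ultimately have "?q \<in> \<int>" by (rule padic_integral_quotient)
  hence "exp (2 * of_real pi * \<i> * of_rat ?q) = 1" by (rule exp_2pi_Ints)
  hence "padic_char (x + y) / (padic_char x * padic_char y) = 1"
    unfolding padic_char_def by (simp add: of_rat_diff of_rat_add algebra_simps exp_add exp_diff)
  moreover have "padic_char x * padic_char y \<noteq> 0" by (simp add: padic_char_def)
  ultimately show ?thesis by simp
qed

lemma padic_char_eq_1: "padic_abs (x :: 'p::prime_card padic) \<le> 1 \<Longrightarrow> padic_char x = 1"
  by (simp add: padic_char_def padic_frac_eq_0)

lemma of_rat_complex: "of_rat q = complex_of_real (of_rat q)"
  by (cases q) (simp add: of_rat_rat)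

text \<open>A fractional part that is an integer is 0, which puts \<open>x\<close> into Z_p. This
  makes the dual of a ball exactly a ball.\<close>

lemma padic_char_neq_1:
  assumes "padic_abs (x :: 'p::prime_card padic) > 1" shows "padic_char x \<noteq> 1"
proof
  assume "padic_char x = 1"
  hence "exp (of_real (2 * pi * of_rat (padic_frac x)) * \<i>) = 1"
    unfolding padic_char_def by (simp add: of_rat_complex mult_ac)
  then obtain n :: int where "2 * pi * real_of_rat (padic_frac x) = 2 * n * pi"
    by (auto simp: exp_eq_1)
  hence "real_of_rat (padic_frac x) = real_of_rat (of_int n)" by simp
  hence "padic_frac x = of_int n" by (simp only: of_rat_eq_iff)
  hence "padic_frac x = 0" using padic_frac_bounds[of x] by auto
  hence "padic_abs x \<le> 1" using padic_frac_near[of x] by simp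
  thus False using assms by simp
qed

lemma norm_padic_char [simp]: "norm (padic_char x) = 1"
proof -
  have "padic_char x = exp (\<i> * of_real (2 * pi * of_rat (padic_frac x)))"
    unfolding padic_char_def by (simp add: of_rat_complex mult_ac)
  thus ?thesis by (simp only: norm_exp_i_times)
qed

section \<open>The finite subgroups of Q_p / Z_p\<close>

lemma padic_quot_abs_abs_le:
  "padic_quot_abs (abs_padic_quot x) \<le> real CARD('p) ^ i \<longleftrightarrow> padic_abs (x :: 'p::prime_card padic) \<le> real CARD('p) ^ i"
proof -
  have "real CARD('p) ^ i \<ge> 1" using card_gt_1[where 'p = 'p] by (intro one_le_power) auto
  thus ?thesis by (auto simp: padic_quot_abs.abs_eq intro: order_trans)
qed

text \<open>The subgroup p^(-i) Z_p / Z_p. For \<open>i = 0\<close> it is trivial, since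
  \<open>padic_quot_abs\<close> takes no value in the interval (0,1].\<close>

definition quot_ball :: "nat \<Rightarrow> 'p::prime_card padic_quot set" where
  "quot_ball i = {g. padic_quot_abs g \<le> real CARD('p) ^ i}"

lemma quot_ball_abs: "abs_padic_quot x \<in> quot_ball i \<longleftrightarrow> padic_abs (x :: 'p::prime_card padic) \<le> real CARD('p) ^ i"
  by (simp add: quot_ball_def padic_quot_abs_abs_le)

text \<open>The subgroup is cyclic of order p^i, generated by 1 / p^i. For surjectivity, the
  fractional part of an element, multiplied by p^i, is a p-adic integer in Z[1/p] and therefore an
  integer below p^i.\<close>

lemma bij_betw_quot_ball:
  "bij_betw (\<lambda>k. abs_padic_quot (of_rat (of_nat k / of_nat CARD('p) ^ i))) {..<CARD('p) ^ i} (quot_ball i :: 'p::prime_card padic_quot set)"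
  unfolding bij_betw_def
proof
  let ?P = "real CARD('p)" and ?Q = "of_nat CARD('p) :: rat"
  let ?f = "\<lambda>k. abs_padic_quot (of_rat (of_nat k / ?Q ^ i)) :: 'p padic_quot"
  have Q0: "?Q > 0" by simp
  show "inj_on ?f {..<CARD('p) ^ i}"
  proof
    fix k l assume kl: "k \<in> {..<CARD('p) ^ i}" "l \<in> {..<CARD('p) ^ i}" "?f k = ?f l"
    let ?q = "of_nat k / ?Q ^ i - of_nat l / ?Q ^ i"
    have "padic_abs (of_rat ?q :: 'p padic) \<le> 1"
      using kl(3) by (simp only: padic_quot.abs_eq_iff of_rat_diff)
    moreover have "?q = of_int (int k - int l) / ?Q ^ i" by (simp add: field_simps)
    ultimately have "?q \<in> \<int>" by (rule padic_integral_quotient)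
    moreover have "of_nat k < ?Q ^ i" "of_nat l < ?Q ^ i"
      using kl by (simp_all only: lessThan_iff flip: of_nat_power of_nat_less_iff)
    hence "of_nat k / ?Q ^ i < 1" "of_nat l / ?Q ^ i < 1" using Q0 by (simp_all add: field_simps)
    moreover have "of_nat k / ?Q ^ i \<ge> 0" "of_nat l / ?Q ^ i \<ge> 0" by simp_all
    ultimately have "?q \<in> \<int>" "\<bar>?q\<bar> < 1" by linarith+
    hence "?q = 0" by (metis Ints_nonzero_abs_less1)
    thus "k = l" using Q0 by (simp add: field_simps)
  qed
  show "?f ` {..<CARD('p) ^ i} = quot_ball i"
  proof (intro equalityI subsetI)
    fix g assume "g \<in> ?f ` {..<CARD('p) ^ i}"
    then obtain k where g: "g = ?f k" by blast
    have "padic_abs (of_rat (of_nat k / ?Q ^ i) :: 'p padic) = padic_abs (of_nat k :: 'p padic) * ?P ^ i"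
      by (simp add: of_rat_divide of_rat_power padic_abs_divide padic_abs_power padic_abs_p power_divide)
    also have "\<dots> \<le> 1 * ?P ^ i" by (intro mult_right_mono padic_abs_of_nat_le_1) simp
    finally show "g \<in> quot_ball i" unfolding g quot_ball_abs by simp
  next
    fix g :: "'p padic_quot" assume g: "g \<in> quot_ball i"
    obtain x where x: "g = abs_padic_quot x" using Quotient_abs_rep[OF Quotient_padic_quot] by metis
    obtain n j where f: "padic_frac x = of_nat n / ?Q ^ j" by (rule padic_frac_quotient)
    have P1: "?P ^ i \<ge> 1" using card_gt_1[where 'p = 'p] by (intro one_le_power) auto
    have "padic_abs x \<le> ?P ^ i" using g by (simp add: x quot_ball_abs)
    hence "padic_abs (of_rat (padic_frac x) :: 'p padic) \<le> ?P ^ i"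
      using padic_abs_trans[of "of_rat (padic_frac x)" x "?P ^ i" 0] padic_frac_near[of x] P1
      by (simp add: padic_abs_commute)
    hence "padic_abs (of_rat (padic_frac x * ?Q ^ i) :: 'p padic) \<le> 1"
      by (simp add: of_rat_mult of_rat_power padic_abs_mult padic_abs_power padic_abs_p power_divide field_simps)
    moreover have "padic_frac x * ?Q ^ i = of_int (int (n * CARD('p) ^ i)) / ?Q ^ j" by (simp add: f)
    ultimately have "padic_frac x * ?Q ^ i \<in> \<int>" by (rule padic_integral_quotient)
    then obtain z where z: "padic_frac x * ?Q ^ i = of_int z" by (elim Ints_cases)
    have "0 \<le> padic_frac x * ?Q ^ i" "padic_frac x * ?Q ^ i < 1 * ?Q ^ i"
      using padic_frac_bounds[of x] Q0 by (auto intro!: mult_nonneg_nonneg mult_strict_right_mono)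
    hence "0 \<le> z" "rat_of_int z < of_int (int CARD('p) ^ i)" unfolding z by simp_all
    hence "0 \<le> z" "z < int CARD('p) ^ i" by (simp_all only: of_int_less_iff)
    hence k: "nat z < CARD('p) ^ i" "of_nat (nat z) = rat_of_int z" by (simp_all add: nat_less_iff)
    have "g = abs_padic_quot (of_rat (padic_frac x))"
      unfolding x padic_quot.abs_eq_iff by (rule padic_frac_near)
    also have "padic_frac x = of_nat (nat z) / ?Q ^ i" unfolding k(2) z[symmetric] using Q0 by simp
    finally show "g \<in> ?f ` {..<CARD('p) ^ i}" using k(1) by blast
  qed
qed

lemma card_quot_ball: "card (quot_ball i :: 'p::prime_card padic_quot set) = CARD('p) ^ i"
  using bij_betw_same_card[OF bij_betw_quot_ball[of i, where 'p = 'p]] by simp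

lemma finite_quot_ball: "finite (quot_ball i :: 'p::prime_card padic_quot set)"
  using bij_betw_finite[OF bij_betw_quot_ball[of i, where 'p = 'p]] by simp

subsection \<open>Haar measure\<close>

lemma power_int_powr: "x > 0 \<Longrightarrow> (x powi k) powr b = (x powr b) powi k" for x :: real
  by (simp add: powr_real_of_int' [symmetric] powr_powr mult.commute)

lemma dist_padic_add: "dist (x + y) (x + z) = dist y (z :: 'p::prime_card padic)"
  by (simp add: dist_padic_def)

lemma dist_padic_mult: "dist (x * y) (x * z) = padic_abs x * dist y (z :: 'p::prime_card padic)"
  by (simp add: dist_padic_def padic_abs_mult flip: right_diff_distrib)

lemma padic_abs_dist: "padic_abs x = dist x (0 :: 'p::prime_card padic)"
  by (simp add: dist_padic_def)

lemma continuous_on_padic_abs: "continuous_on UNIV (padic_abs :: 'p::prime_card padic \<Rightarrow> real)"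
  unfolding padic_abs_dist by (intro continuous_intros)

lemma continuous_on_padic_add: "continuous_on UNIV (\<lambda>y. x + y :: 'p::prime_card padic)"
  by (rule lipschitz_on_continuous_on[of 1]) (rule lipschitz_onI, simp_all add: dist_padic_add)

lemma continuous_on_padic_mult: "continuous_on UNIV (\<lambda>y. x * y :: 'p::prime_card padic)"
  by (rule lipschitz_on_continuous_on[of "padic_abs x"]) (rule lipschitz_onI, simp_all add: dist_padic_mult)

lemma continuous_on_padic_char: "continuous_on UNIV (padic_char :: 'p::prime_card padic \<Rightarrow> complex)"
  unfolding continuous_on_iff
proof (intro ballI allI impI)
  fix x :: "'p padic" and e :: real assume e: "e > 0"
  have *: "padic_char y = padic_char x" if "dist y x < 1" for y
  proof -
    have "padic_frac y = padic_frac x"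
      using that by (intro padic_frac_cong) (simp only: dist_padic_def less_imp_le)
    thus ?thesis by (simp only: padic_char_def)
  qed
  show "\<exists>d>0. \<forall>y\<in>UNIV. dist y x < d \<longrightarrow> dist (padic_char y) (padic_char x) < e"
  proof (intro exI[of _ 1] conjI ballI impI)
    fix y assume "dist y x < 1"
    hence "padic_char y = padic_char x" by (rule *)
    thus "dist (padic_char y) (padic_char x) < e" using e by simp
  qed simp
qed

lemma padic_measurable [measurable]:
  "(padic_abs :: 'p::prime_card padic \<Rightarrow> real) \<in> borel_measurable borel"
  "(\<lambda>y. x + y :: 'p padic) \<in> borel_measurable borel"
  "(\<lambda>y. x * y :: 'p padic) \<in> borel_measurable borel"
  "(padic_char :: 'p padic \<Rightarrow> complex) \<in> borel_measurable borel"
  by (intro borel_measurable_continuous_onI continuous_on_padic_abs continuous_on_padic_add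
      continuous_on_padic_mult continuous_on_padic_char)+

lemma padic_char_mult_measurable [measurable]:
  "(\<lambda>y. padic_char (x * y :: 'p::prime_card padic)) \<in> borel_measurable borel"
  by (rule measurable_compose[OF padic_measurable(3) padic_measurable(4)])

definition pball :: "'p::prime_card padic \<Rightarrow> int \<Rightarrow> 'p padic set" where
  "pball a l = {x. padic_abs (x - a) \<le> real CARD('p) powi l}"

lemma pball_cball: "pball a l = cball a (real CARD('p) powi l)" for a :: "'p::prime_card padic"
  by (auto simp: pball_def dist_padic_def padic_abs_commute)

lemma pball_measurable [measurable]: "pball (a :: 'p::prime_card padic) l \<in> sets borel"
  unfolding pball_cball by simp

text \<open>Every point of an ultrametric ball is a centre of it.\<close>

lemma pball_eq: "x \<in> pball a l \<Longrightarrow> pball x l = pball (a :: 'p::prime_card padic) l"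
  using padic_abs_trans[of _ x "real CARD('p) powi l" a] padic_abs_trans[of _ a "real CARD('p) powi l" x]
    padic_abs_commute[of x a]
  by (auto simp: pball_def)

lemma pball_shift: "pball a l = (\<lambda>y. a + y) ` pball (0 :: 'p::prime_card padic) l"
  by (auto simp: pball_def intro!: image_eqI[of _ _ "_ - a"])

lemma padic_digit_unique:
  assumes "padic_abs (of_nat d * of_nat CARD('p) powi k - of_nat d' * of_nat CARD('p) powi k :: 'p::prime_card padic)
       \<le> real CARD('p) powi (- k - 1)" "d < CARD('p)" "d' < CARD('p)"
  shows "d = d'"
proof -
  have "padic_abs (of_nat d - of_nat d' :: 'p padic) * real CARD('p) powi (- k) \<le> real CARD('p) powi (- k - 1)"
    using assms(1) by (simp add: padic_abs_mult padic_abs_p_powi flip: left_diff_distrib)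
  also have "\<dots> < 1 * real CARD('p) powi (- k)"
    using card_gt_1[where 'p = 'p] by (simp add: power_int_strict_increasing)
  finally have "padic_abs (of_nat d - of_nat d' :: 'p padic) < 1"
    using card_pos[where 'p = 'p] by (simp add: mult_less_cancel_right)
  thus ?thesis using assms(2,3) by (rule padic_residue_unique)
qed

section \<open>Volumes and Fourier transforms of balls\<close>

locale padic_haar =
  fixes \<mu> :: "'p::prime_card padic measure"
  assumes haar: "is_padic_haar \<mu>"
begin

lemma p_gt_1: "real CARD('p) > 1" and p_pos: "real CARD('p) > 0"
  by (rule card_gt_1, rule card_pos)

lemma sets_mu [measurable_cong, simp]: "sets \<mu> = sets borel"
  using haar by (simp add: is_padic_haar_def)

lemma space_mu [simp]: "space \<mu> = UNIV"
  using sets_eq_imp_space_eq[OF sets_mu] by simp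

lemma emeasure_translate: "A \<in> sets borel \<Longrightarrow> emeasure \<mu> ((\<lambda>y. x + y) ` A) = emeasure \<mu> A"
  using haar by (simp add: is_padic_haar_def)

lemma distr_translate: "distr \<mu> \<mu> (\<lambda>y. x + y) = \<mu>"
proof (rule measure_eqI)
  fix A assume "A \<in> sets (distr \<mu> \<mu> (\<lambda>y. x + y))"
  hence A: "A \<in> sets borel" by simp
  have "(\<lambda>y. x + y) -` A = (\<lambda>y. - x + y) ` A"
    by (auto intro!: image_eqI[of _ _ "x + _"])
  moreover have "emeasure (distr \<mu> \<mu> (\<lambda>y. x + y)) A = emeasure \<mu> ((\<lambda>y. x + y) -` A \<inter> space \<mu>)"
    by (rule emeasure_distr) (use A in auto)
  ultimately show "emeasure (distr \<mu> \<mu> (\<lambda>y. x + y)) A = emeasure \<mu> A"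
    by (simp only: emeasure_translate[OF A] space_mu Int_UNIV_right)
qed simp

lemma nn_integral_translate:
  assumes [measurable]: "f \<in> borel_measurable borel"
  shows "(\<integral>\<^sup>+y. f (x + y) \<partial>\<mu>) = (\<integral>\<^sup>+y. f y \<partial>\<mu>)"
proof -
  have "(\<integral>\<^sup>+y. f y \<partial>\<mu>) = (\<integral>\<^sup>+y. f y \<partial>(distr \<mu> \<mu> (\<lambda>y. x + y)))" by (simp add: distr_translate)
  also have "\<dots> = (\<integral>\<^sup>+y. f (x + y) \<partial>\<mu>)" by (subst nn_integral_distr) auto
  finally show ?thesis ..
qed

lemma integral_translate:
  fixes f :: "'p padic \<Rightarrow> complex"
  assumes [measurable]: "f \<in> borel_measurable borel"
  shows "(LINT y|\<mu>. f (x + y)) = (LINT y|\<mu>. f y)"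
proof -
  have "(LINT y|\<mu>. f y) = (LINT y|(distr \<mu> \<mu> (\<lambda>y. x + y)). f y)" by (simp add: distr_translate)
  also have "\<dots> = (LINT y|\<mu>. f (x + y))" by (subst integral_distr) auto
  finally show ?thesis ..
qed

lemma emeasure_pball_center: "emeasure \<mu> (pball a l) = emeasure \<mu> (pball 0 l)"
  by (subst pball_shift) (rule emeasure_translate, measurable)

text \<open>A ball splits into \<open>p\<close> disjoint balls of the next smaller radius, one for
  each value of the leading digit.\<close>

lemma emeasure_pball_step: "emeasure \<mu> (pball 0 l) = ennreal (real CARD('p)) * emeasure \<mu> (pball 0 (l - 1))"
proof -
  let ?c = "\<lambda>d. of_nat d * of_nat CARD('p) powi (- l) :: 'p padic"
  have "pball 0 l = (\<Union>d<CARD('p). pball (?c d) (l - 1))"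
  proof (intro equalityI subsetI)
    fix x :: "'p padic" assume "x \<in> pball 0 l"
    thus "x \<in> (\<Union>d<CARD('p). pball (?c d) (l - 1))"
      using padic_digit_exists[of x "- l"] by (auto simp: pball_def)
  next
    fix x assume "x \<in> (\<Union>d<CARD('p). pball (?c d) (l - 1))"
    then obtain d where d: "padic_abs (x - ?c d) \<le> real CARD('p) powi (l - 1)" by (auto simp: pball_def)
    also have "\<dots> \<le> real CARD('p) powi l" using p_gt_1 by (intro power_int_increasing) auto
    finally have "padic_abs (x - ?c d) \<le> real CARD('p) powi l" .
    moreover have "padic_abs (?c d - 0) \<le> real CARD('p) powi l"
      using mult_right_mono[OF padic_abs_of_nat_le_1[of d, where 'p = 'p], of "real CARD('p) powi l"]
      by (simp add: padic_abs_mult padic_abs_p_powi zero_le_power_int)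
    ultimately show "x \<in> pball 0 l" unfolding pball_def mem_Collect_eq by (rule padic_abs_trans)
  qed
  moreover have "disjoint_family_on (\<lambda>d. pball (?c d) (l - 1)) {..<CARD('p)}"
    unfolding disjoint_family_on_def
  proof (intro ballI impI)
    fix d d' assume dd: "d \<in> {..<CARD('p)}" "d' \<in> {..<CARD('p)}" "d \<noteq> d'"
    show "pball (?c d) (l - 1) \<inter> pball (?c d') (l - 1) = {}"
    proof (rule ccontr)
      assume "pball (?c d) (l - 1) \<inter> pball (?c d') (l - 1) \<noteq> {}"
      then obtain x where "padic_abs (x - ?c d) \<le> real CARD('p) powi (l - 1)" "padic_abs (x - ?c d') \<le> real CARD('p) powi (l - 1)"
        by (auto simp: pball_def)
      hence "padic_abs (?c d - ?c d') \<le> real CARD('p) powi (- (- l) - 1)"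
        using padic_abs_trans[of "?c d" x _ "?c d'"] padic_abs_commute[of x "?c d"] by simp
      thus False using padic_digit_unique dd by blast
    qed
  qed
  ultimately have "emeasure \<mu> (pball 0 l) = (\<Sum>d<CARD('p). emeasure \<mu> (pball (?c d) (l - 1)))"
    by (simp add: sum_emeasure[symmetric] image_subset_iff)
  also have "\<dots> = of_nat CARD('p) * emeasure \<mu> (pball 0 (l - 1))"
    by (subst emeasure_pball_center) simp
  finally show ?thesis by (simp add: ennreal_of_nat_eq_real_of_nat)
qed

lemma emeasure_pball: "emeasure \<mu> (pball a l) = ennreal (real CARD('p) powi l)"
proof -
  have "emeasure \<mu> (pball 0 l) = ennreal (real CARD('p) powi l)"
  proof (induction l rule: int_induct[where k = 0])
    case base
    show ?case using haar by (simp add: is_padic_haar_def pball_def)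
  next
    case (step1 i)
    have "emeasure \<mu> (pball 0 (i + 1)) = ennreal (real CARD('p)) * ennreal (real CARD('p) powi i)"
      using emeasure_pball_step[of "i + 1"] step1 by simp
    also have "\<dots> = ennreal (real CARD('p) powi (i + 1))"
      using p_pos by (simp add: ennreal_mult[symmetric] zero_le_power_int power_int_add mult.commute)
    finally show ?case .
  next
    case (step2 i)
    have "ennreal (real CARD('p)) * ennreal (real CARD('p) powi (i - 1)) = ennreal (real CARD('p)) * emeasure \<mu> (pball 0 (i - 1))"
      using emeasure_pball_step[of i] step2 p_pos
      by (simp add: ennreal_mult[symmetric] zero_le_power_int power_int_diff)
    thus ?case using p_pos by (subst (asm) ennreal_mult_cancel_left) auto
  qed
  thus ?thesis by (simp only: emeasure_pball_center[of a])
qed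

lemma measure_pball: "measure \<mu> (pball a l) = real CARD('p) powi l"
  by (simp add: measure_def emeasure_pball zero_le_power_int)

text \<open>Orthogonality of characters: on the dual ball the character is trivial and the integral
  is the volume; elsewhere a translation shows that the integral vanishes.\<close>

lemma integral_char_pball:
  "(LINT y|\<mu>. indicator (pball 0 l) y *\<^sub>R padic_char (x * y)) = (if padic_abs x \<le> real CARD('p) powi (- l) then of_real (real CARD('p) powi l) else 0)"
proof (cases "padic_abs x \<le> real CARD('p) powi (- l)")
  case True
  have "indicator (pball 0 l) y *\<^sub>R padic_char (x * y) = indicator (pball 0 l) y *\<^sub>R (1 :: complex)" for y
  proof (cases "y \<in> pball 0 l")
    case y: True
    have "padic_abs (x * y) \<le> real CARD('p) powi (- l) * real CARD('p) powi l"
      unfolding padic_abs_mult using True y by (intro mult_mono) (auto simp: pball_def zero_le_power_int)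
    also have "\<dots> = 1" using p_pos by (simp flip: power_int_add)
    finally show ?thesis by (simp add: padic_char_eq_1)
  qed simp
  hence "(LINT y|\<mu>. indicator (pball 0 l) y *\<^sub>R padic_char (x * y)) = (LINT y|\<mu>. indicator (pball 0 l) y *\<^sub>R (1::complex))"
    by (rule Bochner_Integration.integral_cong[OF refl])
  also have "\<dots> = of_real (real CARD('p) powi l)"
    by (subst integral_scaleR_left) (auto simp: emeasure_pball measure_pball scaleR_conv_of_real)
  finally show ?thesis using True by simp
next
  case False
  let ?I = "LINT y|\<mu>. indicator (pball 0 l) y *\<^sub>R padic_char (x * y)"
  \<comment> \<open>\<open>y0\<close> lies on the boundary sphere of the ball. Translation by it
    preserves the ball but multiplies the integral by \<open>padic_char (x * y0)\<close>, which is
    not 1.\<close>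
  define y0 where "y0 = (of_nat CARD('p) powi (- l) :: 'p padic)"
  have y0: "padic_abs y0 = real CARD('p) powi l" by (simp add: y0_def padic_abs_p_powi)
  have "real CARD('p) powi (- l) * real CARD('p) powi l < padic_abs x * real CARD('p) powi l"
    using False p_pos by (intro mult_strict_right_mono) auto
  hence "padic_abs (x * y0) > 1" using p_pos by (simp add: padic_abs_mult y0 flip: power_int_add)
  hence ne: "padic_char (x * y0) \<noteq> 1" by (rule padic_char_neq_1)
  have "(y0 + y \<in> pball 0 l) = (y \<in> pball 0 l)" for y
    using padic_abs_ultra[of y0 y] padic_abs_diff_le[of "y0 + y" y0] y0 by (auto simp: pball_def)
  hence ind: "indicator (pball 0 l) (y0 + y) = (indicator (pball 0 l) y :: real)" for y
    by (simp add: indicator_def)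
  have "?I = (LINT y|\<mu>. indicator (pball 0 l) (y0 + y) *\<^sub>R padic_char (x * (y0 + y)))"
    by (rule integral_translate[symmetric]) measurable
  also have "\<dots> = (LINT y|\<mu>. padic_char (x * y0) * (indicator (pball 0 l) y *\<^sub>R padic_char (x * y)))"
    by (simp add: ind distrib_left padic_char_add)
  also have "\<dots> = padic_char (x * y0) * ?I" by (simp only: integral_mult_right_zero)
  finally have "(padic_char (x * y0) - 1) * ?I = 0" by (simp add: algebra_simps)
  thus ?thesis using ne False by simp
qed

end

subsection \<open>The heat kernel\<close>

text \<open>The value of \<open>exp (- c * \<bar>y\<bar>\<^sup>b)\<close> on the sphere \<open>\<bar>y\<bar> = p\<^sup>l\<close>.\<close>

definition stable_exp :: "real \<Rightarrow> real \<Rightarrow> real \<Rightarrow> int \<Rightarrow> real" where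
  "stable_exp p b c l = exp (- c * (p powr b) powi l)"

text \<open>
  The mass which the uniform distribution on the ball of radius \<open>p\<^sup>s\<^sup>-\<^sup>n\<close> around \<open>0\<close> gives to a ball of
  radius \<open>p\<^sup>-\<^sup>n\<close> whose centre has absolute value \<open>u\<close>.
\<close>

definition cell_weight :: "real \<Rightarrow> int \<Rightarrow> real \<Rightarrow> nat \<Rightarrow> real" where
  "cell_weight p n u s = (if u \<le> p powi (int s - n) then (1 / p) ^ s else 0)"

text \<open>The mass of that ball under the heat kernel at time \<open>t\<close>, for \<open>c = \<sigma> t\<close>.\<close>

definition heat_cell :: "real \<Rightarrow> real \<Rightarrow> real \<Rightarrow> int \<Rightarrow> real \<Rightarrow> real" where
  "heat_cell p b c n u =
     (\<Sum>s. stable_exp p b c (n - int s) * (cell_weight p n u s - cell_weight p n u (Suc s)))"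

lemma sum_int_telescope:
  fixes f :: "int \<Rightarrow> real"
  shows "i \<le> j \<Longrightarrow> (\<Sum>l = i..<j. f l - f (l + 1)) = f i - f j"
proof (induction j rule: int_ge_induct)
  case (step j)
  hence "{i..<j + 1} = insert j {i..<j}" by auto
  thus ?case using step.IH by simp
qed simp

lemma cell_weight_bounds:
  assumes "p > 1" shows "0 \<le> cell_weight p n u s" "cell_weight p n u s \<le> (1 / p) ^ s"
  using assms by (auto simp: cell_weight_def)

lemma cell_weight_diff_bound:
  assumes "p > 1" shows "\<bar>cell_weight p n u s - cell_weight p n u (Suc s)\<bar> \<le> (1 / p) ^ s"
proof -
  have "(1 / p) ^ Suc s \<le> (1 / p) ^ s" using assms by (intro power_decreasing) auto
  thus ?thesis using cell_weight_bounds[OF assms, of n u s] cell_weight_bounds[OF assms, of n u "Suc s"] by linarith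
qed

lemma summable_inverse_power: "p > 1 \<Longrightarrow> summable (\<lambda>s. (1 / p) ^ s :: real)"
  by (rule summable_geometric) simp

context
  fixes p b c :: real
  assumes p: "p > 1" and b: "b > 0" and c: "c > 0"
begin

lemma powr_gt_1: "p powr b > 1"
  using p b by (simp add: gr_one_powr)

lemma stable_exp_pos: "stable_exp p b c l > 0"
  by (simp add: stable_exp_def)

lemma stable_exp_less_1: "stable_exp p b c l < 1"
proof -
  have "(p powr b) powi l > 0" using powr_gt_1 by (intro zero_less_power_int) linarith
  thus ?thesis using c by (simp add: stable_exp_def)
qed

lemma stable_exp_strict_antimono: "k < l \<Longrightarrow> stable_exp p b c l < stable_exp p b c k"
  using c powr_gt_1 by (simp add: stable_exp_def power_int_strict_increasing)

lemma stable_exp_antimono: "k \<le> l \<Longrightarrow> stable_exp p b c l \<le> stable_exp p b c k"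
  using stable_exp_strict_antimono[of k l] by (cases "k = l") auto

lemma stable_exp_at_top: "(\<lambda>N. stable_exp p b c (int N)) \<longlonglongrightarrow> 0"
proof -
  have "(\<lambda>N. exp (- c * B ^ N)) \<longlonglongrightarrow> 0" if "B > 1" for B :: real using that c by real_asymp
  from this[OF powr_gt_1] show ?thesis by (simp add: stable_exp_def)
qed

lemma stable_exp_at_bot: "(\<lambda>N. stable_exp p b c (- int N)) \<longlonglongrightarrow> 1"
proof -
  have "(\<lambda>N. exp (- c * inverse (B ^ N))) \<longlonglongrightarrow> 1" if "B > 1" for B :: real using that c by real_asymp
  from this[OF powr_gt_1] show ?thesis by (simp add: stable_exp_def power_int_minus)
qed

text \<open>The rate p^(-2l) is picked because the ball of radius p^l has volume p^l: the product
  p^(-l) is still summable.\<close>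

lemma stable_exp_bound: "\<exists>C\<ge>0. \<forall>l. stable_exp p b c (int l) \<le> C * (1 / p) ^ (2 * l)"
proof -
  have "(\<lambda>l. exp (- c * B ^ l) * p ^ (2 * l)) \<longlonglongrightarrow> 0" if "B > 1" for B using that c p by real_asymp
  from this[OF powr_gt_1] have "(\<lambda>l. stable_exp p b c (int l) * p ^ (2 * l)) \<longlonglongrightarrow> 0" by (simp add: stable_exp_def)
  hence "Bseq (\<lambda>l. stable_exp p b c (int l) * p ^ (2 * l))" by (intro convergent_imp_Bseq convergentI)
  then obtain C where C: "C > 0" "\<And>l. norm (stable_exp p b c (int l) * p ^ (2 * l)) \<le> C" by (auto simp: Bseq_def)
  have "stable_exp p b c (int l) \<le> C * (1 / p) ^ (2 * l)" for l
    using C(2)[of l] p stable_exp_pos[of "int l"] by (simp add: power_divide field_simps)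
  thus ?thesis using C(1) by (intro exI[of _ C]) auto
qed

lemma heat_cell_summable:
  "summable (\<lambda>s. stable_exp p b c (n - int s) * (cell_weight p n u s - cell_weight p n u (Suc s)))"
proof (rule summable_comparison_test'[OF summable_inverse_power[OF p]])
  fix s :: nat assume "s \<ge> 0"
  have "norm (stable_exp p b c (n - int s) * (cell_weight p n u s - cell_weight p n u (Suc s))) \<le> 1 * (1 / p) ^ s"
    unfolding norm_mult using stable_exp_pos[of "n - int s"] stable_exp_less_1[of "n - int s"]
      cell_weight_diff_bound[OF p, of n u s] by (intro mult_mono) auto
  thus "norm (stable_exp p b c (n - int s) * (cell_weight p n u s - cell_weight p n u (Suc s))) \<le> (1 / p) ^ s" by simp
qed

text \<open>Summation by parts turns the mixture of uniform distributions on balls into \<^const>\<open>heat_cell\<close>.\<close>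

lemma heat_cell_partial:
  "(\<Sum>l = n - int S..<n. (stable_exp p b c l - stable_exp p b c (l + 1)) * cell_weight p n u (nat (n - l)))
     + stable_exp p b c n * cell_weight p n u 0
   = (\<Sum>s<S. stable_exp p b c (n - int s) * (cell_weight p n u s - cell_weight p n u (Suc s)))
     + stable_exp p b c (n - int S) * cell_weight p n u S"
proof (induction S)
  case (Suc S)
  have "{n - int (Suc S)..<n} = insert (n - int (Suc S)) {n - int S..<n}" by auto
  thus ?case using Suc by (simp add: algebra_simps del: of_nat_Suc) (simp add: algebra_simps)
qed simp

text \<open>The term of index \<open>l\<close> is a mixing weight times the share of the ball of
  radius p^(-l) around 0 that falls into a cell of radius p^(-n) with centre of size
  \<open>u\<close>. Both boundary terms of the summation by parts vanish in the limit.\<close>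

lemma heat_cell_LIMSEQ:
  "(\<lambda>N. \<Sum>l = - int N..<int N. (stable_exp p b c l - stable_exp p b c (l + 1)) *
       (if u \<le> p powi (max (- l) (- n)) then p powi (l + min (- l) (- n)) else 0)) \<longlonglongrightarrow> heat_cell p b c n u"
  (is "?S \<longlonglongrightarrow> _")
proof -
  let ?e = "stable_exp p b c" and ?v = "cell_weight p n u"
  let ?t = "\<lambda>s. ?e (n - int s) * (?v s - ?v (Suc s))"
  let ?T = "\<lambda>N. (\<Sum>s<nat (int N + n). ?t s) + ?e (- int N) * ?v (nat (int N + n)) - ?e (int N) * ?v 0"
  have "?S N = ?T N" if N: "N \<ge> nat \<bar>n\<bar>" for N
  proof -
    let ?d = "\<lambda>l. ?e l - ?e (l + 1)"
    let ?f = "\<lambda>l. ?d l * (if u \<le> p powi (max (- l) (- n)) then p powi (l + min (- l) (- n)) else 0)"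
    have n: "- int N \<le> n" "n \<le> int N" using N by auto
    hence "{- int N..<int N} = {- int N..<n} \<union> {n..<int N}" by auto
    hence "?S N = sum ?f {- int N..<n} + sum ?f {n..<int N}" by (simp add: sum.union_disjoint)
    \<comment> \<open>For \<open>l >= n\<close> the mixing ball is no larger than the cell, so its
      share is all or nothing and the weights telescope. For \<open>l < n\<close> the share is
      \<open>cell_weight\<close> at s = n - l.\<close>
    also have "sum ?f {n..<int N} = (\<Sum>l = n..<int N. ?d l * ?v 0)"
      by (intro sum.cong) (auto simp: cell_weight_def max_def min_def)
    also have "\<dots> = (?e n - ?e (int N)) * ?v 0"
      unfolding sum_distrib_right[symmetric] using sum_int_telescope[OF n(2)] by simp
    also have "sum ?f {- int N..<n} = (\<Sum>l = n - int (nat (int N + n))..<n. ?d l * ?v (nat (n - l)))"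
    proof (rule sum.cong)
      show "{- int N..<n} = {n - int (nat (int N + n))..<n}" using n by auto
      fix l assume "l \<in> {n - int (nat (int N + n))..<n}"
      hence l: "l < n" by auto
      have "p powi (l - n) = (1 / p) ^ nat (n - l)"
        using l p by (simp add: power_int_def power_divide field_simps power_inverse)
      thus "?f l = ?d l * ?v (nat (n - l))" using l by (simp add: cell_weight_def max_def min_def)
    qed
    finally show ?thesis using heat_cell_partial[where n = n and S = "nat (int N + n)" and u = u] n by (simp add: algebra_simps)
  qed
  hence eq: "\<forall>\<^sub>F N in sequentially. ?T N = ?S N" by (intro eventually_sequentiallyI[of "nat \<bar>n\<bar>"]) simp
  have "?T \<longlonglongrightarrow> heat_cell p b c n u + 1 * 0 - 0 * ?v 0"
  proof (intro tendsto_intros stable_exp_at_top stable_exp_at_bot)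
    have lim: "filterlim (\<lambda>N. nat (int N + n)) sequentially sequentially"
      unfolding filterlim_at_top
    proof
      fix Z show "\<forall>\<^sub>F N in sequentially. Z \<le> nat (int N + n)"
        by (rule eventually_sequentiallyI[of "nat (int Z + \<bar>n\<bar>)"]) linarith
    qed
    have "(\<lambda>S. \<Sum>s<S. ?t s) \<longlonglongrightarrow> heat_cell p b c n u"
      unfolding heat_cell_def by (rule summable_LIMSEQ[OF heat_cell_summable])
    from filterlim_compose[OF this lim] show "(\<lambda>N. \<Sum>s<nat (int N + n). ?t s) \<longlonglongrightarrow> heat_cell p b c n u" .
    have lim0: "(\<lambda>s. (1 / p) ^ s) \<longlonglongrightarrow> 0" using p by (intro LIMSEQ_realpow_zero) auto
    have "?v \<longlonglongrightarrow> 0"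
      by (rule tendsto_sandwich[OF always_eventually always_eventually tendsto_const lim0]) (simp_all add: cell_weight_bounds[OF p])
    from filterlim_compose[OF this lim] show "(\<lambda>N. ?v (nat (int N + n))) \<longlonglongrightarrow> 0" .
  qed
  from Lim_transform_eventually[OF this eq] show ?thesis by simp
qed

end

context padic_haar
begin

text \<open>Two ultrametric balls are nested or disjoint; they meet exactly if the centre of one
  lies within the larger radius of the other.\<close>

lemma emeasure_pball_Int:
  "emeasure \<mu> (pball 0 k \<inter> pball a r) = (if padic_abs a \<le> real CARD('p) powi (max k r) then ennreal (real CARD('p) powi (min k r)) else 0)"
proof (cases "padic_abs a \<le> real CARD('p) powi (max k r)")
  case True
  have mono: "real CARD('p) powi i \<le> real CARD('p) powi j" if "i \<le> j" for i j
    using that p_gt_1 by (intro power_int_increasing) auto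
  show ?thesis
  proof (cases "k \<le> r")
    case kr: True
    hence "a \<in> pball 0 r" using True by (simp add: pball_def max_def)
    hence "pball a r = pball 0 r" by (rule pball_eq)
    moreover have "pball 0 k \<subseteq> pball (0 :: 'p padic) r"
      unfolding pball_def using mono[OF kr] by (auto intro: order_trans)
    ultimately have "pball 0 k \<inter> pball a r = pball 0 k" by blast
    thus ?thesis using True kr by (simp add: emeasure_pball min_def)
  next
    case kr: False
    hence "a \<in> pball 0 k" using True by (simp add: pball_def max_def)
    hence "pball a k = pball 0 k" by (rule pball_eq)
    moreover have "pball a r \<subseteq> pball a k" 
      unfolding pball_def using mono[of r k] kr by (auto intro: order_trans)
    ultimately have "pball 0 k \<inter> pball a r = pball a r" by blast
    thus ?thesis using True kr by (simp add: emeasure_pball min_def)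
  qed
next
  case False
  have "pball 0 k \<inter> pball a r = {}"
  proof (rule ccontr)
    assume "pball 0 k \<inter> pball a r \<noteq> {}"
    then obtain x where x: "padic_abs (x - 0) \<le> real CARD('p) powi k" "padic_abs (x - a) \<le> real CARD('p) powi r"
      by (auto simp: pball_def)
    have "real CARD('p) powi k \<le> real CARD('p) powi (max k r)" "real CARD('p) powi r \<le> real CARD('p) powi (max k r)"
      using p_gt_1 by (intro power_int_increasing; simp)+
    hence "padic_abs (a - 0) \<le> real CARD('p) powi (max k r)"
      using x padic_abs_trans[of a x "real CARD('p) powi (max k r)" 0] padic_abs_commute[of a x] by simp
    thus False using False by simp
  qed
  thus ?thesis using False by simp
qed

end

section \<open>The kernel as a mixture of uniform densities on balls, with \<open>c\<close> in the
  place of \<open>\<sigma> * t\<close>\<close>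

locale padic_heat = padic_haar \<mu> for \<mu> :: "'p::prime_card padic measure" +
  fixes b c :: real
  assumes b_pos: "b > 0" and c_pos: "c > 0"
begin

lemmas sexp_pos = stable_exp_pos[OF p_gt_1 b_pos c_pos]
lemmas sexp_less_1 = stable_exp_less_1[OF p_gt_1 b_pos c_pos]
lemmas sexp_antimono = stable_exp_antimono[OF p_gt_1 b_pos c_pos]
lemmas sexp_strict = stable_exp_strict_antimono[OF p_gt_1 b_pos c_pos]

lemma exp_padic_abs:
  assumes "padic_abs y = real CARD('p) powi k" shows "exp (- c * padic_abs y powr b) = stable_exp (real CARD('p)) b c k"
  using p_pos by (simp add: stable_exp_def assms power_int_powr)

text \<open>Domination by the indicator of the unit ball plus, for each sphere of radius p^l, the
  indicator of the ball it bounds, weighted with the decay rate p^(-2l).\<close>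

lemma integrable_exp_padic_abs: "integrable \<mu> (\<lambda>y. exp (- c * padic_abs y powr b))"
proof (rule integrableI_bounded)
  obtain C where C: "C \<ge> 0" "\<And>l. stable_exp (real CARD('p)) b c (int l) \<le> C * (1 / real CARD('p)) ^ (2 * l)"
    using stable_exp_bound[OF p_gt_1 b_pos c_pos] by blast
  let ?t = "\<lambda>l y. ennreal (C * (1 / real CARD('p)) ^ (2 * l)) * indicator (pball 0 (int l)) y"
  have single: "sum f {l} = f l" for f :: "nat \<Rightarrow> ennreal" and l by simp
  have le: "ennreal (norm (exp (- c * padic_abs y powr b))) \<le> indicator (pball 0 0) y + (\<Sum>l. ?t l y)" for y :: "'p padic"
  proof (cases "y \<in> pball 0 0")
    case True
    have "exp (- c * padic_abs y powr b) \<le> 1" using c_pos by simp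
    hence "ennreal (exp (- c * padic_abs y powr b)) \<le> 1 + (\<Sum>l. ?t l y)" by (simp add: add_increasing2)
    thus ?thesis using True by simp
  next
    case False
    hence "y \<noteq> 0" by (auto simp: pball_def)
    then obtain k where k: "padic_abs y = real CARD('p) powi k" by (rule padic_abs_value)
    have "k \<ge> 0"
    proof (rule ccontr)
      assume "\<not> k \<ge> 0"
      hence "real CARD('p) powi k \<le> real CARD('p) powi 0" using p_gt_1 by (intro power_int_increasing) auto
      thus False using False k by (simp add: pball_def)
    qed
    then obtain l where l: "k = int l" by (metis nat_0_le)
    have "ennreal (norm (exp (- c * padic_abs y powr b))) = ennreal (stable_exp (real CARD('p)) b c (int l))"
      using exp_padic_abs[OF k] l sexp_pos[of "int l"] by simp
    also have "\<dots> \<le> ennreal (C * (1 / real CARD('p)) ^ (2 * l))" by (intro ennreal_leI C)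
    also have "\<dots> = ?t l y" using k l by (simp add: pball_def)
    also have "\<dots> = sum (\<lambda>l. ?t l y) {l}" by (simp only: single)
    also have "\<dots> \<le> (\<Sum>l. ?t l y)" by (intro sum_le_suminf) auto
    finally show ?thesis by (simp add: add_increasing)
  qed
  have "(\<integral>\<^sup>+y. ennreal (norm (exp (- c * padic_abs y powr b))) \<partial>\<mu>) \<le> (\<integral>\<^sup>+y. indicator (pball 0 0) y + (\<Sum>l. ?t l y) \<partial>\<mu>)"
    by (intro nn_integral_mono le)
  also have "\<dots> = emeasure \<mu> (pball 0 0) + (\<integral>\<^sup>+y. (\<Sum>l. ?t l y) \<partial>\<mu>)"
    by (subst nn_integral_add) auto
  also have "(\<integral>\<^sup>+y. (\<Sum>l. ?t l y) \<partial>\<mu>) = (\<Sum>l. \<integral>\<^sup>+y. ?t l y \<partial>\<mu>)"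
    by (rule nn_integral_suminf) measurable
  also have "(\<lambda>l. \<integral>\<^sup>+y. ?t l y \<partial>\<mu>) = (\<lambda>l. ennreal (C * (1 / real CARD('p)) ^ l))"
  proof
    fix l
    have "(\<integral>\<^sup>+y. ?t l y \<partial>\<mu>) = ennreal (C * (1 / real CARD('p)) ^ (2 * l)) * ennreal (real CARD('p) powi int l)"
      by (subst nn_integral_cmult_indicator) (auto simp: emeasure_pball)
    also have "\<dots> = ennreal (C * (1 / real CARD('p)) ^ (2 * l) * real CARD('p) ^ l)"
      using C(1) by (simp add: ennreal_mult)
    also have "C * (1 / real CARD('p)) ^ (2 * l) * real CARD('p) ^ l = C * (1 / real CARD('p)) ^ l"
      by (simp add: power_mult power2_eq_square power_mult_distrib power_divide field_simps)
    finally show "(\<integral>\<^sup>+y. ?t l y \<partial>\<mu>) = ennreal (C * (1 / real CARD('p)) ^ l)" .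
  qed
  also have "(\<Sum>l. ennreal (C * (1 / real CARD('p)) ^ l)) = ennreal (\<Sum>l. C * (1 / real CARD('p)) ^ l)"
    using C(1) by (intro suminf_ennreal2 summable_mult summable_inverse_power p_gt_1) auto
  also have "emeasure \<mu> (pball 0 0) + ennreal (\<Sum>l. C * (1 / real CARD('p)) ^ l) < \<infinity>"
    by (simp add: emeasure_pball)
  finally show "(\<integral>\<^sup>+y. ennreal (norm (exp (- c * padic_abs y powr b))) \<partial>\<mu>) < \<infinity>" .
qed measurable

text \<open>Abel summation: a decreasing function of the absolute value is a sum of ball indicators
  weighted with its decrements. The truncation keeps radii from p^(-N) to p^(N-1).\<close>

definition ball_mixture :: "nat \<Rightarrow> 'p padic \<Rightarrow> real" where
  "ball_mixture N y = (\<Sum>l = - int N..<int N. (stable_exp (real CARD('p)) b c l - stable_exp (real CARD('p)) b c (l + 1)) * indicator (pball 0 l) y)"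

lemma ball_mixture_nonzero:
  assumes "padic_abs y = real CARD('p) powi k"
  shows "ball_mixture N y = (if k \<le> int N then stable_exp (real CARD('p)) b c (max (- int N) k) - stable_exp (real CARD('p)) b c (int N) else 0)"
proof -
  have iff: "y \<in> pball 0 l \<longleftrightarrow> k \<le> l" for l
    using assms power_int_increasing[of k l "real CARD('p)"] power_int_strict_increasing[of l k "real CARD('p)"] p_gt_1
    by (cases "k \<le> l") (simp_all add: pball_def)
  have "ball_mixture N y = (\<Sum>l \<in> {- int N..<int N}. if k \<le> l then stable_exp (real CARD('p)) b c l - stable_exp (real CARD('p)) b c (l + 1) else 0)"
    unfolding ball_mixture_def by (intro sum.cong) (auto simp: iff)
  also have "\<dots> = (\<Sum>l \<in> {max (- int N) k..<int N}. stable_exp (real CARD('p)) b c l - stable_exp (real CARD('p)) b c (l + 1))"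
    by (intro sum.mono_neutral_cong_right) auto
  also have "\<dots> = (if k \<le> int N then stable_exp (real CARD('p)) b c (max (- int N) k) - stable_exp (real CARD('p)) b c (int N) else 0)"
    using sum_int_telescope[of "max (- int N) k" "int N" "stable_exp (real CARD('p)) b c"] by auto
  finally show ?thesis .
qed

lemma ball_mixture_zero: "ball_mixture N 0 = stable_exp (real CARD('p)) b c (- int N) - stable_exp (real CARD('p)) b c (int N)"
proof -
  have "ball_mixture N 0 = (\<Sum>l = - int N..<int N. stable_exp (real CARD('p)) b c l - stable_exp (real CARD('p)) b c (l + 1))"
    unfolding ball_mixture_def by (intro sum.cong) (auto simp: pball_def zero_le_power_int)
  thus ?thesis using sum_int_telescope[of "- int N" "int N" "stable_exp (real CARD('p)) b c"] by simp
qed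

lemma ball_mixture_nonneg: "ball_mixture N y \<ge> 0"
  unfolding ball_mixture_def using sexp_antimono by (intro sum_nonneg) auto

lemma ball_mixture_le: "ball_mixture N y \<le> exp (- c * padic_abs y powr b)"
proof (cases "y = 0")
  case True
  thus ?thesis using sexp_less_1[of "- int N"] sexp_pos[of "int N"] by (simp add: ball_mixture_zero)
next
  case False
  then obtain k where k: "padic_abs y = real CARD('p) powi k" by (rule padic_abs_value)
  show ?thesis unfolding exp_padic_abs[OF k] ball_mixture_nonzero[OF k]
    using sexp_antimono[of k "max (- int N) k"] sexp_pos[of "int N"] sexp_pos[of k] by auto
qed

lemma ball_mixture_tendsto: "(\<lambda>N. ball_mixture N y) \<longlonglongrightarrow> exp (- c * padic_abs y powr b)"
proof (cases "y = 0")
  case True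
  have "(\<lambda>N. stable_exp (real CARD('p)) b c (- int N) - stable_exp (real CARD('p)) b c (int N)) \<longlonglongrightarrow> 1 - 0"
    by (intro tendsto_diff stable_exp_at_top stable_exp_at_bot p_gt_1 b_pos c_pos)
  thus ?thesis using True by (simp add: ball_mixture_zero)
next
  case False
  then obtain k where k: "padic_abs y = real CARD('p) powi k" by (rule padic_abs_value)
  have "(\<lambda>N. stable_exp (real CARD('p)) b c k - stable_exp (real CARD('p)) b c (int N)) \<longlonglongrightarrow> stable_exp (real CARD('p)) b c k - 0"
    by (intro tendsto_diff tendsto_const stable_exp_at_top p_gt_1 b_pos c_pos)
  moreover have "\<forall>\<^sub>F N in sequentially. stable_exp (real CARD('p)) b c k - stable_exp (real CARD('p)) b c (int N) = ball_mixture N y"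
    by (rule eventually_sequentiallyI[of "nat \<bar>k\<bar>"]) (auto simp: ball_mixture_nonzero[OF k] max_def)
  ultimately have "(\<lambda>N. ball_mixture N y) \<longlonglongrightarrow> stable_exp (real CARD('p)) b c k - 0" by (rule Lim_transform_eventually)
  thus ?thesis by (simp only: exp_padic_abs[OF k] diff_0_right)
qed

text \<open>The Fourier transform of \<open>ball_mixture N\<close>: the indicator of radius p^l
  becomes p^l times the indicator of the dual radius p^(-l), the uniform density there.\<close>

definition heat_mixture :: "nat \<Rightarrow> 'p padic \<Rightarrow> real" where
  "heat_mixture N x = (\<Sum>l = - int N..<int N. (stable_exp (real CARD('p)) b c l - stable_exp (real CARD('p)) b c (l + 1)) * (real CARD('p) powi l * indicator (pball 0 (- l)) x))"

lemma indicator_char_integrable: "integrable \<mu> (\<lambda>y. indicator (pball 0 l) y *\<^sub>R padic_char (x * y))"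
proof (rule Bochner_Integration.integrable_bound)
  show "integrable \<mu> (indicator (pball 0 l) :: _ \<Rightarrow> real)"
    by (intro integrable_real_indicator) (auto simp: emeasure_pball)
qed auto

lemma integral_ball_mixture:
  "(LINT y|\<mu>. padic_char (x * y) * of_real (ball_mixture N y)) = of_real (heat_mixture N x)"
proof -
  have "padic_char (x * y) * of_real (ball_mixture N y) =
      (\<Sum>l = - int N..<int N. (stable_exp (real CARD('p)) b c l - stable_exp (real CARD('p)) b c (l + 1)) *\<^sub>R (indicator (pball 0 l) y *\<^sub>R padic_char (x * y)))" for y
    unfolding ball_mixture_def of_real_sum sum_distrib_left
    by (intro sum.cong) (auto simp: scaleR_conv_of_real)
  hence "(LINT y|\<mu>. padic_char (x * y) * of_real (ball_mixture N y)) =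
      (\<Sum>l = - int N..<int N. (stable_exp (real CARD('p)) b c l - stable_exp (real CARD('p)) b c (l + 1)) *\<^sub>R (LINT y|\<mu>. indicator (pball 0 l) y *\<^sub>R padic_char (x * y)))"
    using indicator_char_integrable
    by (simp only: Bochner_Integration.integral_sum integrable_scaleR_right integral_scaleR_right)
  also have "\<dots> = of_real (heat_mixture N x)"
    unfolding heat_mixture_def of_real_sum integral_char_pball
    by (intro sum.cong) (auto simp: pball_def scaleR_conv_of_real)
  finally show ?thesis .
qed

text \<open>The truncated mixtures are dominated by the integrable function that they approximate,
  so the limit passes through the Fourier integral.\<close>

lemma heat_mixture_tendsto:
  assumes "c = \<sigma> * t"
  shows "(\<lambda>N. heat_mixture N x) \<longlonglongrightarrow> Re (padic_heat_kernel \<mu> b \<sigma> t x)"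
proof -
  have kernel: "padic_heat_kernel \<mu> b \<sigma> t x = (LINT y|\<mu>. padic_char (x * y) * of_real (exp (- c * padic_abs y powr b)))"
    unfolding padic_heat_kernel_def assms by simp
  have "(\<lambda>N. LINT y|\<mu>. padic_char (x * y) * of_real (ball_mixture N y)) \<longlonglongrightarrow>
      (LINT y|\<mu>. padic_char (x * y) * of_real (exp (- c * padic_abs y powr b)))"
  proof (rule integral_dominated_convergence)
    show "(\<lambda>y. padic_char (x * y) * of_real (ball_mixture N y)) \<in> borel_measurable \<mu>" for N
      unfolding ball_mixture_def by measurable
    show "AE y in \<mu>. (\<lambda>N. padic_char (x * y) * of_real (ball_mixture N y)) \<longlonglongrightarrow>
        padic_char (x * y) * of_real (exp (- c * padic_abs y powr b))"
      by (intro AE_I2 tendsto_mult tendsto_of_real tendsto_const ball_mixture_tendsto)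
    show "AE y in \<mu>. norm (padic_char (x * y) * of_real (ball_mixture N y)) \<le> exp (- c * padic_abs y powr b)" for N
      using ball_mixture_le ball_mixture_nonneg by (intro AE_I2) (simp add: norm_mult)
  qed (use integrable_exp_padic_abs in measurable)
  hence "(\<lambda>N. of_real (heat_mixture N x)) \<longlonglongrightarrow> padic_heat_kernel \<mu> b \<sigma> t x"
    by (simp only: integral_ball_mixture kernel)
  from tendsto_Re[OF this] show ?thesis by simp
qed

lemma incseq_heat_mixture: "incseq (\<lambda>N. heat_mixture N x)"
proof (rule incseq_SucI)
  fix N show "heat_mixture N x \<le> heat_mixture (Suc N) x"
    unfolding heat_mixture_def using sexp_antimono
    by (intro sum_mono2) (auto intro!: mult_nonneg_nonneg simp: zero_le_power_int)
qed

text \<open>All terms are nonnegative, and one whose dual ball is large enough to contain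
  \<open>x\<close> is positive because \<open>stable_exp\<close> decreases strictly.\<close>

lemma heat_mixture_pos: "\<exists>N. heat_mixture N x > 0"
proof -
  obtain N where N: "padic_abs x \<le> real CARD('p) powi int N" using padic_abs_le_powi by blast
  have "0 < (stable_exp (real CARD('p)) b c (- int (Suc N)) - stable_exp (real CARD('p)) b c (- int (Suc N) + 1)) * (real CARD('p) powi (- int (Suc N)) * indicator (pball 0 (int (Suc N))) x)"
  proof -
    have "real CARD('p) powi int N \<le> real CARD('p) powi int (Suc N)"
      using p_gt_1 by (intro power_int_increasing) auto
    hence "x \<in> pball 0 (int (Suc N))" using N by (simp add: pball_def del: power_int_of_nat)
    thus ?thesis using sexp_strict[of "- int (Suc N)" "- int (Suc N) + 1"] p_pos by simp
  qed
  also have "\<dots> \<le> heat_mixture (Suc N) x"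
    unfolding heat_mixture_def using sexp_antimono
    by (intro member_le_sum[of "- int (Suc N)" _ "\<lambda>l. (stable_exp (real CARD('p)) b c l - stable_exp (real CARD('p)) b c (l + 1)) * (real CARD('p) powi l * indicator (pball 0 (- l)) x)", simplified minus_minus])
       (auto intro!: mult_nonneg_nonneg simp: zero_le_power_int)
  finally show ?thesis by blast
qed

text \<open>Strict positivity gives every ball positive mass, on which the measurability of
  evaluation at a fixed time is built.\<close>

lemma heat_kernel_pos:
  assumes "c = \<sigma> * t" shows "Re (padic_heat_kernel \<mu> b \<sigma> t x) > 0"
proof -
  obtain N where "heat_mixture N x > 0" using heat_mixture_pos by blast
  also have "\<dots> \<le> Re (padic_heat_kernel \<mu> b \<sigma> t x)"
    by (rule incseq_le[OF incseq_heat_mixture heat_mixture_tendsto[OF assms]])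
  finally show ?thesis .
qed

lemma heat_mixture_measurable [measurable]: "heat_mixture N \<in> borel_measurable borel"
  unfolding heat_mixture_def by measurable

lemma heat_kernel_measurable:
  assumes "c = \<sigma> * t"
  shows "(\<lambda>x. Re (padic_heat_kernel \<mu> b \<sigma> t x)) \<in> borel_measurable borel"
  by (rule borel_measurable_LIMSEQ_real[OF heat_mixture_tendsto[OF assms]]) measurable

text \<open>Monotone convergence along the truncated mixtures; each of their terms integrates to a
  weight times the volume of an intersection of two balls.\<close>

lemma nn_integral_heat_kernel:
  assumes "c = \<sigma> * t"
  shows "(\<integral>\<^sup>+x\<in>pball a (- n). ennreal (Re (padic_heat_kernel \<mu> b \<sigma> t x)) \<partial>\<mu>)
    = ennreal (heat_cell (real CARD('p)) b c n (padic_abs a))"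
proof -
  let ?p = "real CARD('p)"
  have "(\<lambda>N. \<integral>\<^sup>+x\<in>pball a (- n). ennreal (heat_mixture N x) \<partial>\<mu>) \<longlonglongrightarrow>
      (\<integral>\<^sup>+x\<in>pball a (- n). ennreal (Re (padic_heat_kernel \<mu> b \<sigma> t x)) \<partial>\<mu>)"
  proof (rule nn_integral_LIMSEQ)
    show "incseq (\<lambda>N x. ennreal (heat_mixture N x) * indicator (pball a (- n)) x)"
      using incseq_heat_mixture by (auto simp: incseq_def le_fun_def intro!: mult_right_mono ennreal_leI)
    show "(\<lambda>N. ennreal (heat_mixture N x) * indicator (pball a (- n)) x) \<longlonglongrightarrow>
        ennreal (Re (padic_heat_kernel \<mu> b \<sigma> t x)) * indicator (pball a (- n)) x" for x
      using tendsto_ennrealI[OF heat_mixture_tendsto[OF assms, of x]] by (cases "x \<in> pball a (- n)") auto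
  qed measurable
  moreover have "(\<integral>\<^sup>+x\<in>pball a (- n). ennreal (heat_mixture N x) \<partial>\<mu>) =
     ennreal (\<Sum>l = - int N..<int N. (stable_exp (real CARD('p)) b c l - stable_exp (real CARD('p)) b c (l + 1)) *
       (if padic_abs a \<le> ?p powi (max (- l) (- n)) then ?p powi (l + min (- l) (- n)) else 0))" for N
  proof -
    let ?d = "\<lambda>l. (stable_exp (real CARD('p)) b c l - stable_exp (real CARD('p)) b c (l + 1)) * ?p powi l"
    have d: "?d l \<ge> 0" for l using sexp_antimono by (auto simp: zero_le_power_int)
    have "ennreal (heat_mixture N x) * indicator (pball a (- n)) x =
        (\<Sum>l = - int N..<int N. ennreal (?d l) * indicator (pball 0 (- l) \<inter> pball a (- n)) x)" for x
    proof -
      have "heat_mixture N x = (\<Sum>l = - int N..<int N. ?d l * indicator (pball 0 (- l)) x)"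
        unfolding heat_mixture_def by (simp add: mult.assoc)
      hence "ennreal (heat_mixture N x) = (\<Sum>l = - int N..<int N. ennreal (?d l * indicator (pball 0 (- l)) x))"
        using d by (simp add: sum_ennreal)
      also have "\<dots> = (\<Sum>l = - int N..<int N. ennreal (?d l) * indicator (pball 0 (- l)) x)"
        by (intro sum.cong) (auto simp: indicator_def)
      finally show ?thesis by (simp only: sum_distrib_right indicator_inter_arith mult.assoc)
    qed
    hence "(\<integral>\<^sup>+x\<in>pball a (- n). ennreal (heat_mixture N x) \<partial>\<mu>) =
        (\<Sum>l = - int N..<int N. ennreal (?d l) * emeasure \<mu> (pball 0 (- l) \<inter> pball a (- n)))"
      by (simp only:) (subst nn_integral_sum, simp, intro sum.cong refl nn_integral_cmult_indicator, simp)
    also have "\<dots> = (\<Sum>l = - int N..<int N. ennreal ((stable_exp (real CARD('p)) b c l - stable_exp (real CARD('p)) b c (l + 1)) *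
       (if padic_abs a \<le> ?p powi (max (- l) (- n)) then ?p powi (l + min (- l) (- n)) else 0)))"
      using d p_pos
      by (intro sum.cong refl) (simp add: emeasure_pball_Int zero_le_power_int power_int_add ennreal_mult[symmetric] mult.assoc)
    also have "\<dots> = ennreal (\<Sum>l = - int N..<int N. (stable_exp (real CARD('p)) b c l - stable_exp (real CARD('p)) b c (l + 1)) *
       (if padic_abs a \<le> ?p powi (max (- l) (- n)) then ?p powi (l + min (- l) (- n)) else 0))"
      using sexp_antimono by (intro sum_ennreal mult_nonneg_nonneg) (auto simp: zero_le_power_int)
    finally show ?thesis .
  qed
  ultimately show ?thesis
    using tendsto_ennrealI[OF heat_cell_LIMSEQ[OF p_gt_1 b_pos c_pos, of "padic_abs a" n]]
    by (simp add: LIMSEQ_unique)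
qed

end

subsection \<open>Brownian motion on a time grid\<close>

text \<open>If the mass sent from \<open>x\<close> in \<open>U i\<close> to the next set does not
  depend on \<open>x\<close>, the innermost integrals can be pulled out one by one. In the induction
  the first \<open>j\<close> factors are already evaluated at fixed coordinates.\<close>

lemma iterated_nn_integral_product:
  fixes g :: "nat \<Rightarrow> 'a::ab_group_add \<Rightarrow> ennreal"
  assumes meas: "\<And>i x. (\<lambda>y. g i (y - x)) \<in> borel_measurable \<mu>" and U: "\<And>i. U i \<in> sets \<mu>"
    and r: "\<And>i x. x \<in> U i \<Longrightarrow> (\<integral>\<^sup>+y\<in>U (Suc i). g (Suc i) (y - x) \<partial>\<mu>) = r (Suc i)"
  shows "x j \<in> U j \<Longrightarrow> iterated_nn_integral \<mu> U n (Suc j) (\<lambda>x. \<Prod>i=1..j + n. g i (x i - x (i - 1))) x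
     = (\<Prod>i=1..j. g i (x i - x (i - 1))) * (\<Prod>i=Suc j..j + n. r i)"
proof (induction n arbitrary: j x)
  case (Suc n)
  have split: "(\<Prod>i=1..Suc j. f i) = (\<Prod>i=1..j. f i) * f (Suc j)" for f :: "nat \<Rightarrow> ennreal" by simp
  let ?C = "\<Prod>i=1..j. g i (x i - x (i - 1))" and ?R = "\<Prod>i=Suc (Suc j)..j + Suc n. r i"
  have "iterated_nn_integral \<mu> U (Suc n) (Suc j) (\<lambda>x. \<Prod>i=1..j + Suc n. g i (x i - x (i - 1))) x
      = (\<integral>\<^sup>+y. (?C * ?R) * (g (Suc j) (y - x j) * indicator (U (Suc j)) y) \<partial>\<mu>)"
    unfolding iterated_nn_integral.simps
  proof (rule nn_integral_cong)
    fix y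
    show "iterated_nn_integral \<mu> U n (Suc (Suc j)) (\<lambda>x. \<Prod>i=1..j + Suc n. g i (x i - x (i - 1))) (x(Suc j := y))
        * indicator (U (Suc j)) y = (?C * ?R) * (g (Suc j) (y - x j) * indicator (U (Suc j)) y)"
    proof (cases "y \<in> U (Suc j)")
      case True
      have "iterated_nn_integral \<mu> U n (Suc (Suc j)) (\<lambda>x. \<Prod>i=1..Suc j + n. g i (x i - x (i - 1))) (x(Suc j := y))
        = (\<Prod>i=1..Suc j. g i ((x(Suc j := y)) i - (x(Suc j := y)) (i - 1))) * (\<Prod>i=Suc (Suc j)..Suc j + n. r i)"
        by (rule Suc.IH) (simp add: True)
      also have "(\<Prod>i=1..Suc j. g i ((x(Suc j := y)) i - (x(Suc j := y)) (i - 1))) = ?C * g (Suc j) (y - x j)"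
        unfolding split by (intro arg_cong2[where f = "(*)"] prod.cong) auto
      finally have eq: "iterated_nn_integral \<mu> U n (Suc (Suc j)) (\<lambda>x. \<Prod>i=1..j + Suc n. g i (x i - x (i - 1))) (x(Suc j := y))
         = ?C * g (Suc j) (y - x j) * ?R" by (simp only: add_Suc add_Suc_right)
      have "indicator (U (Suc j)) y = (1::ennreal)" using True by simp
      thus ?thesis by (simp only: eq mult_1_right mult_ac)
    qed simp
  qed
  also have "\<dots> = (?C * ?R) * r (Suc j)"
    using meas U by (subst nn_integral_cmult) (auto simp: r[OF Suc.prems])
  also have "\<dots> = ?C * (\<Prod>i=Suc j..j + Suc n. r i)"
  proof -
    have "(\<Prod>i=Suc j..j + Suc n. r i) = r (Suc j) * ?R" by (rule prod.atLeast_Suc_atMost) simp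
    thus ?thesis by (simp only: mult_ac)
  qed
  finally show ?case .
qed simp

lemma pball_diff: "x - y \<in> pball a l \<longleftrightarrow> x \<in> pball (y + a) l"
  by (simp add: pball_def algebra_simps)

context padic_haar
begin

context
  fixes b \<sigma> :: real and P :: "'p padic cadlag measure"
  assumes b: "b > 0" and \<sigma>: "\<sigma> > 0" and bm: "is_padic_brownian_motion \<mu> b \<sigma> P"
begin

lemma bm_sets: "sets P = sets borel"
  using bm by (simp add: is_padic_brownian_motion_def)

lemma bm_grid:
  assumes h: "h > 0" and U: "\<And>i. U i \<in> sets borel"
  shows "emeasure P {\<omega>. \<forall>i\<le>K. sample_path \<omega> (real i * h) \<in> U i} =
    (if 0 \<in> U 0 then iterated_nn_integral \<mu> U K 1
       (\<lambda>x. \<Prod>i=1..K. ennreal (Re (padic_heat_kernel \<mu> b \<sigma> h (x i - x (i - 1))))) (\<lambda>_. 0) else 0)"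
proof -
  have "real i * h - real (i - 1) * h = h" if "i \<ge> 1" for i
    using that by (simp add: of_nat_diff algebra_simps)
  hence *: "(\<lambda>x. \<Prod>i=1..K. ennreal (Re (padic_heat_kernel \<mu> b \<sigma> (real i * h - real (i - 1) * h) (x i - x (i - 1)))))
      = (\<lambda>x. \<Prod>i=1..K. ennreal (Re (padic_heat_kernel \<mu> b \<sigma> h (x i - x (i - 1)))))"
    by (intro ext prod.cong) auto
  have "real i * h < real (Suc i) * h" for i using h by (intro mult_strict_right_mono) auto
  thus ?thesis
    using bm U unfolding is_padic_brownian_motion_def
    by (elim conjE) (erule allE[of _ K], erule allE[of _ "\<lambda>i. real i * h"], erule allE[of _ U], simp add: *[simplified])
qed

text \<open>From any point of one cell, the increments that lead into another cell form the ball
  around the difference of the centres. Transition masses therefore depend on cells only, and the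
  iterated integral factorises.\<close>

lemma bm_grid_pball:
  assumes h: "h > 0"
  shows "emeasure P {\<omega>. \<forall>i\<le>K. sample_path \<omega> (real i * h) \<in> pball (a i) (- n)} =
    (if a 0 \<in> pball 0 (- n) then \<Prod>i=1..K. ennreal (heat_cell (real CARD('p)) b (\<sigma> * h) n (padic_abs (a i - a (i - 1)))) else 0)"
proof -
  interpret padic_heat \<mu> b "\<sigma> * h" by unfold_locales (use b \<sigma> h in auto)
  let ?g = "\<lambda>x. ennreal (Re (padic_heat_kernel \<mu> b \<sigma> h x))" and ?U = "\<lambda>i. pball (a i) (- n)"
  let ?r = "\<lambda>i. ennreal (heat_cell (real CARD('p)) b (\<sigma> * h) n (padic_abs (a i - a (i - 1))))"
  note [measurable] = heat_kernel_measurable[OF refl]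
  have meas: "(\<lambda>y. ?g (y - x)) \<in> borel_measurable borel" for x
  proof -
    have "(\<lambda>y. ?g (- x + y)) \<in> borel_measurable borel"
      by (rule measurable_compose[OF padic_measurable(2)]) measurable
    thus ?thesis by simp
  qed
  have r: "(\<integral>\<^sup>+y\<in>?U (Suc i). ?g (y - x) \<partial>\<mu>) = ?r (Suc i)" if x: "x \<in> ?U i" for i x
  proof -
    have "padic_abs ((a (Suc i) - a i) - (a (Suc i) - x)) \<le> real CARD('p) powi (- n)"
      using x by (simp add: pball_def)
    hence "a (Suc i) - a i \<in> pball (a (Suc i) - x) (- n)" by (simp only: pball_def mem_Collect_eq)
    hence eq: "pball (a (Suc i) - a i) (- n) = pball (a (Suc i) - x) (- n)" by (rule pball_eq)
    have "(\<integral>\<^sup>+y\<in>?U (Suc i). ?g (y - x) \<partial>\<mu>) = (\<integral>\<^sup>+y. ?g (- x + y) * indicator (pball (a (Suc i) - x) (- n)) (- x + y) \<partial>\<mu>)"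
      by (intro nn_integral_cong) (simp add: indicator_def pball_diff)
    also have "\<dots> = (\<integral>\<^sup>+y. ?g y * indicator (pball (a (Suc i) - x) (- n)) y \<partial>\<mu>)"
      by (rule nn_integral_translate) measurable
    also have "\<dots> = ?r (Suc i)" by (subst eq[symmetric]) (simp add: nn_integral_heat_kernel)
    finally show ?thesis .
  qed
  have "iterated_nn_integral \<mu> ?U K (Suc 0) (\<lambda>x. \<Prod>i=1..0 + K. ?g (x i - x (i - 1))) (\<lambda>_. 0)
      = (\<Prod>i=Suc 0..0 + K. ?r i)" if "0 \<in> ?U 0"
    by (rule trans[OF iterated_nn_integral_product[where g = "\<lambda>_. ?g" and r = ?r and U = ?U and x = "\<lambda>_. 0" and j = 0]])
       (use r that meas in \<open>auto simp: measurable_cong_sets[OF sets_mu refl]\<close>)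
  moreover have "0 \<in> ?U 0 \<longleftrightarrow> a 0 \<in> pball 0 (- n)" by (simp add: pball_def)
  ultimately show ?thesis using bm_grid[OF h, of ?U K] by simp
qed

text \<open>
  This avoids the Skorohod topology: \<^const>\<open>emeasure\<close> vanishes on nonmeasurable sets, whereas the
  finite-dimensional distributions of Brownian motion give positive mass to every nonempty open set.
\<close>

lemma sample_path_measurable:
  assumes "t \<ge> 0"
  shows "(\<lambda>\<omega>. sample_path \<omega> t) \<in> borel_measurable (borel :: 'p padic cadlag measure)"
proof (rule borel_measurableI)
  fix S :: "'p padic set" assume S: "open S"
  show "(\<lambda>\<omega>. sample_path \<omega> t) -` S \<inter> space borel \<in> sets (borel :: 'p padic cadlag measure)"
  proof (cases "t = 0")
    case True
    \<comment> \<open>At time 0 the law is the point mass at 0, so only sets containing 0 have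
      positive mass; the remaining ones are handled by complements.\<close>
    have *: "{\<omega>. sample_path \<omega> 0 \<in> U} \<in> sets (borel :: 'p padic cadlag measure)" if "0 \<in> U" "U \<in> sets borel" for U
    proof -
      have "emeasure P {\<omega>. \<forall>i\<le>0. sample_path \<omega> (real i * 1) \<in> U} = 1"
        using bm_grid[of 1 "\<lambda>_. U" 0] that by simp
      hence "{\<omega>. sample_path \<omega> 0 \<in> U} \<in> sets P" by (intro emeasure_neq_0_sets) simp
      thus ?thesis by (simp add: bm_sets)
    qed
    show ?thesis
    proof (cases "0 \<in> S")
      case True
      thus ?thesis using *[of S] S \<open>t = 0\<close> by (simp add: vimage_def)
    next
      case False
      have "space borel - {\<omega>. sample_path \<omega> 0 \<in> - S} \<in> sets (borel :: 'p padic cadlag measure)"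
        using *[of "- S"] False S by (intro sets.compl_sets) auto
      moreover have "space borel - {\<omega>. sample_path \<omega> 0 \<in> - S} = (\<lambda>\<omega>. sample_path \<omega> t) -` S \<inter> space borel"
        using \<open>t = 0\<close> by auto
      ultimately show ?thesis by simp
    qed
  next
    case False
    hence t: "t > 0" using assms by simp
    show ?thesis
    proof (cases "S = {}")
      case ne: False
      interpret padic_heat \<mu> b "\<sigma> * t" by unfold_locales (use b \<sigma> t in auto)
      let ?g = "\<lambda>x. ennreal (Re (padic_heat_kernel \<mu> b \<sigma> t x))"
      note [measurable] = heat_kernel_measurable[OF refl]
      have [measurable]: "S \<in> sets borel" using S by simp
      obtain a where a: "a \<in> S" using ne by blast
      then obtain e where e: "e > 0" "\<And>y. dist y a < e \<Longrightarrow> y \<in> S" using S unfolding open_dist by blast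
      obtain n where n: "(1 / real CARD('p)) ^ n < e"
        using real_arch_pow_inv[OF e(1), of "1 / real CARD('p)"] p_gt_1 by auto
      have sub: "pball a (- int n) \<subseteq> S"
      proof
        fix y assume "y \<in> pball a (- int n)"
        hence "dist y a \<le> (1 / real CARD('p)) ^ n"
          by (simp add: pball_def dist_padic_def power_int_minus power_divide inverse_eq_divide)
        thus "y \<in> S" using n e(2) by simp
      qed
      have "(\<integral>\<^sup>+y\<in>S. ?g y \<partial>\<mu>) \<noteq> 0"
      proof
        assume "(\<integral>\<^sup>+y\<in>S. ?g y \<partial>\<mu>) = 0"
        hence "AE y in \<mu>. ?g y * indicator S y = 0" by (subst (asm) nn_integral_0_iff_AE) measurable
        hence "AE y in \<mu>. y \<notin> pball a (- int n)"
        proof eventually_elim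
          case (elim y)
          thus ?case using heat_kernel_pos[OF refl, of y] sub by (auto simp: indicator_def split: if_splits)
        qed
        hence "emeasure \<mu> {y \<in> space \<mu>. y \<in> pball a (- int n)} = 0"
          by (subst (asm) AE_iff_measurable[OF _ refl]) auto
        thus False using p_pos by (simp add: emeasure_pball)
      qed
      moreover have "emeasure P {\<omega>. \<forall>i\<le>1. sample_path \<omega> (real i * t) \<in> (if i = 0 then UNIV else S)}
          = (\<integral>\<^sup>+y\<in>S. ?g y \<partial>\<mu>)"
        using bm_grid[OF t, of "\<lambda>i. if i = 0 then UNIV else S" 1] by simp
      ultimately have "{\<omega>. \<forall>i\<le>1. sample_path \<omega> (real i * t) \<in> (if i = 0 then UNIV else S)} \<in> sets P"
        by (intro emeasure_neq_0_sets) simp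
      moreover have "{\<omega>. \<forall>i\<le>1. sample_path \<omega> (real i * t) \<in> (if i = 0 then UNIV else S)}
          = (\<lambda>\<omega>. sample_path \<omega> t) -` S \<inter> space borel"
      proof -
        have "(\<forall>i\<le>(1::nat). Q i) \<longleftrightarrow> Q 0 \<and> Q 1" for Q
          by (metis One_nat_def le_Suc_eq le_zero_eq zero_le)
        thus ?thesis by (simp add: vimage_def)
      qed
      ultimately show ?thesis by (simp only: bm_sets)
    qed simp
  qed
qed

end

end

subsection \<open>Spectral analysis of the primitive walk\<close>

lemma padic_quot_cases:
  obtains x where "g = abs_padic_quot (x :: 'p::prime_card padic)"
  using Quotient_abs_rep[OF Quotient_padic_quot] by metis

lemma abs_padic_quot_diff: "abs_padic_quot x - abs_padic_quot y = abs_padic_quot (x - y :: 'p::prime_card padic)"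
  unfolding minus_padic_quot_def by (simp add: plus_padic_quot.abs_eq uminus_padic_quot.abs_eq)

lemma quot_ball_diff:
  assumes "g \<in> quot_ball i" "h \<in> quot_ball i" shows "g - h \<in> (quot_ball i :: 'p::prime_card padic_quot set)"
proof -
  obtain x where x: "g = abs_padic_quot x" by (rule padic_quot_cases)
  obtain y where y: "h = abs_padic_quot y" by (rule padic_quot_cases)
  show ?thesis using assms padic_abs_diff_le[of x y] by (simp add: x y abs_padic_quot_diff quot_ball_abs)
qed

lemma quot_ball_0 [simp]: "0 \<in> quot_ball i"
  by (simp add: zero_padic_quot_def quot_ball_abs)

lemma quot_ball_add:
  assumes "g \<in> quot_ball i" "h \<in> quot_ball i" shows "g + h \<in> quot_ball i"
  using quot_ball_diff[OF assms(1) quot_ball_diff[OF quot_ball_0 assms(2)]] by simp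

lemma quot_ball_minus_commute: "g - h \<in> quot_ball i \<longleftrightarrow> h - g \<in> quot_ball i"
  using quot_ball_diff[OF quot_ball_0, of "g - h" i] quot_ball_diff[OF quot_ball_0, of "h - g" i] by auto

lemma quot_ball_mono: "i \<le> j \<Longrightarrow> quot_ball i \<subseteq> (quot_ball j :: 'p::prime_card padic_quot set)"
proof -
  assume "i \<le> j"
  hence "real CARD('p) ^ i \<le> real CARD('p) ^ j" using card_gt_1[where 'p = 'p] by (intro power_increasing) auto
  thus ?thesis by (auto simp: quot_ball_def)
qed

lemma quot_ball_cover: "\<exists>i. g \<in> quot_ball i"
proof -
  obtain x where "g = abs_padic_quot x" by (rule padic_quot_cases)
  thus ?thesis using padic_abs_le_powi[of x] by (auto simp: quot_ball_abs)
qed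

lemma padic_quot_abs_eq:
  assumes "g \<in> quot_ball (Suc i)" "g \<notin> quot_ball i"
  shows "padic_quot_abs (g :: 'p::prime_card padic_quot) = real CARD('p) ^ Suc i"
proof -
  obtain x where x: "g = abs_padic_quot x" by (rule padic_quot_cases)
  have "padic_abs x \<le> real CARD('p) ^ Suc i" using assms(1) by (simp add: x quot_ball_abs)
  moreover have "\<not> padic_abs x < real CARD('p) powi (int (Suc i))"
    using assms(2) padic_abs_less_powi[of x "int (Suc i)"] by (simp add: x quot_ball_abs)
  ultimately have "padic_abs x = real CARD('p) ^ Suc i" unfolding power_int_of_nat by linarith
  moreover have "\<dots> > 1" using card_gt_1[where 'p = 'p] by (intro one_less_power) auto
  ultimately show ?thesis by (simp add: x padic_quot_abs.abs_eq)
qed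

text \<open>A countable union of finite subgroups. Countability makes products of discrete
  sigma-algebras discrete, which gives measurability of sums of steps.\<close>

instance padic_quot :: (prime_card) countable
proof
  have "UNIV = (\<Union>i. quot_ball i :: 'a padic_quot set)" using quot_ball_cover by auto
  moreover have "countable (\<Union>i. quot_ball i :: 'a padic_quot set)"
    by (rule countable_UN) (auto intro: countable_finite finite_quot_ball)
  ultimately have "countable (UNIV :: 'a padic_quot set)" by (rule ssubst)
  thus "\<exists>f :: 'a padic_quot \<Rightarrow> nat. inj f" unfolding countable_def .
qed

lemma measurable_sum_countable:
  fixes f :: "'i \<Rightarrow> 'b \<Rightarrow> 'a::{countable, comm_monoid_add}"
  assumes "finite J" "\<And>j. j \<in> J \<Longrightarrow> f j \<in> measurable N (count_space UNIV)"
  shows "(\<lambda>x. \<Sum>j\<in>J. f j x) \<in> measurable N (count_space UNIV)"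
  using assms
proof (induction J rule: finite_induct)
  case (insert j J)
  have [measurable]: "f j \<in> measurable N (count_space UNIV)" by (rule insert.prems) simp
  have [measurable]: "(\<lambda>x. \<Sum>j\<in>J. f j x) \<in> measurable N (count_space UNIV)"
    by (rule insert.IH) (rule insert.prems, simp)
  show ?case unfolding sum.insert[OF insert.hyps] by measurable
qed simp

text \<open>The mass function of the uniform law on the subgroup \<open>quot_ball i\<close>;
  convolution with it averages over cosets.\<close>

definition ball_kernel :: "nat \<Rightarrow> 'p::prime_card padic_quot \<Rightarrow> real" where
  "ball_kernel i g = (if g \<in> quot_ball i then (1 / real CARD('p)) ^ i else 0)"

text \<open>Convolution with it is the difference of two consecutive averaging operators, a
  projection onto an eigenspace common to all radial step laws.\<close>

definition shell_kernel :: "nat \<Rightarrow> 'p::prime_card padic_quot \<Rightarrow> real" where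
  "shell_kernel i g = ball_kernel i g - ball_kernel (Suc i) g"

lemma ball_kernel_bounds: "0 \<le> ball_kernel i g" "ball_kernel i (g :: 'p::prime_card padic_quot) \<le> (1 / real CARD('p)) ^ i"
  by (auto simp: ball_kernel_def)

section \<open>The step law, its eigenfunctions and the ball probabilities of partial sums\<close>

locale padic_walk = prob_space M for M :: "'s measure" +
  fixes b :: real and X :: "nat \<Rightarrow> 's \<Rightarrow> 'p::prime_card padic_quot"
  assumes b_pos: "b > 0" and walk: "is_primitive_walk b M X"
begin

text \<open>Origin of \<alpha>: when the step law is written as a signed mixture of the uniform laws
  on the subgroups, the weights of the subgroups larger than \<open>quot_ball i\<close> add up to
  \<alpha> / p^(ib).\<close>

definition eigenvalue :: "nat \<Rightarrow> real" where
  "eigenvalue i = 1 - scaling_alpha CARD('p) b / (real CARD('p) powr b) ^ i"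

lemma p_gt_1: "real CARD('p) > 1" by (rule card_gt_1)

lemma pb_gt_1: "real CARD('p) powr b > 1"
  using p_gt_1 b_pos by (simp add: gr_one_powr)

lemma indep: "indep_vars (\<lambda>_. count_space UNIV) X {1..}"
  using walk by (simp add: is_primitive_walk_def)

lemma X_measurable: "j \<ge> 1 \<Longrightarrow> X j \<in> measurable M (count_space UNIV)"
  using indep by (simp add: indep_vars_def)

lemma prob_eq:
  assumes "n \<ge> 1" "i \<ge> 1" "padic_quot_abs g = real CARD('p) ^ i"
  shows "prob {s \<in> space M. X n s = g} = (real CARD('p) powr b - 1) / (real CARD('p) powr b) ^ i
      * (1 / (real CARD('p) ^ i - real CARD('p) ^ (i - 1)))"
proof -
  have "real CARD('p) powr (real i * b) = (real CARD('p) powr b) ^ i"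
    using p_gt_1 by (simp add: mult.commute powr_power)
  thus ?thesis using walk assms unfolding is_primitive_walk_def by simp
qed

lemma prob_in_finite:
  assumes "n \<ge> 1" "finite A"
  shows "prob {s \<in> space M. X n s \<in> A} = (\<Sum>g\<in>A. prob {s \<in> space M. X n s = g})"
proof -
  note [measurable] = X_measurable[OF assms(1)]
  have "{s \<in> space M. X n s \<in> A} = (\<Union>g\<in>A. {s \<in> space M. X n s = g})" by auto
  also have "prob \<dots> = (\<Sum>g\<in>A. prob {s \<in> space M. X n s = g})"
    by (rule finite_measure_finite_Union[OF assms(2)]) (auto simp: disjoint_family_on_def)
  finally show ?thesis .
qed

text \<open>The number of points on a sphere cancels the denominator of the step law. With B = p^b
  the sphere of radius p^(i+1) has mass (B - 1) / B^(i+1), and these masses telescope.\<close>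

lemma prob_quot_ball:
  assumes "n \<ge> 1"
  shows "prob {s \<in> space M. X n s \<in> quot_ball i} = 1 - 1 / (real CARD('p) powr b) ^ i"
proof (induction i)
  case 0
  have "card (quot_ball 0 :: 'p padic_quot set) = 1" by (simp add: card_quot_ball)
  then obtain g :: "'p padic_quot" where "quot_ball 0 = {g}" by (auto simp: card_1_singleton_iff)
  hence "quot_ball 0 = {0 :: 'p padic_quot}" using quot_ball_0[of 0, where ?'a = 'p] by auto
  thus ?case using walk assms by (simp add: is_primitive_walk_def)
next
  case (Suc i)
  let ?p = "real CARD('p)" and ?B = "real CARD('p) powr b"
  let ?S = "quot_ball (Suc i) - quot_ball i :: 'p padic_quot set"
  have sub: "quot_ball i \<subseteq> (quot_ball (Suc i) :: 'p padic_quot set)" by (rule quot_ball_mono) simp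
  have "real (card ?S) = real (card (quot_ball (Suc i) :: 'p padic_quot set)) - real (card (quot_ball i :: 'p padic_quot set))"
    using card_Diff_subset[OF finite_quot_ball sub] card_mono[OF finite_quot_ball sub] by simp
  hence card: "real (card ?S) = ?p ^ Suc i - ?p ^ i" by (simp add: card_quot_ball)
  have "?p ^ i < ?p ^ Suc i" using p_gt_1 by (intro power_strict_increasing) auto
  hence ne: "?p ^ Suc i - ?p ^ i \<noteq> 0" by simp
  have "prob {s \<in> space M. X n s \<in> quot_ball (Suc i)} = (\<Sum>g\<in>quot_ball (Suc i). prob {s \<in> space M. X n s = g})"
    by (rule prob_in_finite[OF assms finite_quot_ball])
  also have "\<dots> = (\<Sum>g\<in>?S. prob {s \<in> space M. X n s = g}) + (\<Sum>g\<in>quot_ball i. prob {s \<in> space M. X n s = g})"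
    by (rule sum.subset_diff[OF sub finite_quot_ball])
  also have "(\<Sum>g\<in>quot_ball i. prob {s \<in> space M. X n s = g}) = 1 - 1 / ?B ^ i"
    using Suc prob_in_finite[OF assms finite_quot_ball] by simp
  also have "(\<Sum>g\<in>?S. prob {s \<in> space M. X n s = g}) = (\<Sum>g\<in>?S. (?B - 1) / ?B ^ Suc i * (1 / (?p ^ Suc i - ?p ^ i)))"
  proof (rule sum.cong[OF refl])
    fix g assume "g \<in> ?S"
    hence "padic_quot_abs g = ?p ^ Suc i" by (intro padic_quot_abs_eq) auto
    from prob_eq[OF assms _ this]
    show "prob {s \<in> space M. X n s = g} = (?B - 1) / ?B ^ Suc i * (1 / (?p ^ Suc i - ?p ^ i))" by simp
  qed
  also have "\<dots> = (?p ^ Suc i - ?p ^ i) * ((?B - 1) / ?B ^ Suc i * (1 / (?p ^ Suc i - ?p ^ i)))"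
    by (simp only: sum_constant card)
  also have "\<dots> = (?B - 1) / ?B ^ Suc i" 
  proof -
    have "d * (x * (1 / d)) = x" if "d \<noteq> 0" for d x :: real using that by simp
    thus ?thesis using ne by blast
  qed
  also have "\<dots> + (1 - 1 / ?B ^ i) = 1 - 1 / ?B ^ Suc i"
    using pb_gt_1 by (simp add: field_simps)
  finally show ?case .
qed

text \<open>The coset of \<open>g\<close> modulo \<open>quot_ball i\<close> lies entirely in the
  sphere of \<open>g\<close>, where the step law is constant; it has p^i points.\<close>

lemma prob_shifted_quot_ball:
  assumes n: "n \<ge> 1" and g: "g \<in> quot_ball (Suc j)" "g \<notin> quot_ball j" and ij: "i \<le> j"
  shows "prob {s \<in> space M. g - X n s \<in> quot_ball i} =
    real CARD('p) ^ i * ((real CARD('p) powr b - 1) / (real CARD('p) powr b) ^ Suc j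
      * (1 / (real CARD('p) ^ Suc j - real CARD('p) ^ j)))"
proof -
  let ?A = "(\<lambda>h. g - h) ` quot_ball i"
  have "{s \<in> space M. g - X n s \<in> quot_ball i} = {s \<in> space M. X n s \<in> ?A}"
    by (auto intro!: image_eqI[of _ _ "g - _"])
  also have "prob \<dots> = (\<Sum>z\<in>?A. prob {s \<in> space M. X n s = z})"
    by (rule prob_in_finite[OF n]) (simp add: finite_quot_ball)
  also have "\<dots> = (\<Sum>z\<in>?A. (real CARD('p) powr b - 1) / (real CARD('p) powr b) ^ Suc j
      * (1 / (real CARD('p) ^ Suc j - real CARD('p) ^ j)))"
  proof (rule sum.cong[OF refl])
    fix z assume "z \<in> ?A"
    then obtain h where h: "h \<in> quot_ball i" "z = g - h" by auto
    hence hj: "h \<in> quot_ball j" "h \<in> quot_ball (Suc j)" using quot_ball_mono[of i j] quot_ball_mono[of i "Suc j"] ij by auto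
    have "z \<in> quot_ball (Suc j)" unfolding h(2) by (rule quot_ball_diff[OF g(1) hj(2)])
    moreover have "z \<notin> quot_ball j"
    proof
      assume "z \<in> quot_ball j"
      from quot_ball_add[OF this hj(1)] show False using g(2) h(2) by simp
    qed
    ultimately have "padic_quot_abs z = real CARD('p) ^ Suc j" by (rule padic_quot_abs_eq)
    from prob_eq[OF n _ this]
    show "prob {s \<in> space M. X n s = z} = (real CARD('p) powr b - 1) / (real CARD('p) powr b) ^ Suc j
      * (1 / (real CARD('p) ^ Suc j - real CARD('p) ^ j))" by simp
  qed
  also have "card ?A = CARD('p) ^ i"
    by (subst card_image) (auto simp: card_quot_ball inj_on_def)
  hence "(\<Sum>z\<in>?A. (real CARD('p) powr b - 1) / (real CARD('p) powr b) ^ Suc j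
      * (1 / (real CARD('p) ^ Suc j - real CARD('p) ^ j))) =
    real CARD('p) ^ i * ((real CARD('p) powr b - 1) / (real CARD('p) powr b) ^ Suc j
      * (1 / (real CARD('p) ^ Suc j - real CARD('p) ^ j)))"
    by (simp only: sum_constant of_nat_power)
  finally show ?thesis .
qed


lemma expectation_ball_kernel:
  assumes "n \<ge> 1"
  shows "expectation (\<lambda>s. ball_kernel i (g - X n s)) = (1 / real CARD('p)) ^ i * prob {s \<in> space M. g - X n s \<in> quot_ball i}"
proof -
  note [measurable] = X_measurable[OF assms]
  have "expectation (\<lambda>s. ball_kernel i (g - X n s))
      = expectation (\<lambda>s. (1 / real CARD('p)) ^ i * indicator {s \<in> space M. g - X n s \<in> quot_ball i} s)"
    by (intro Bochner_Integration.integral_cong refl) (auto simp: ball_kernel_def)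
  also have "\<dots> = (1 / real CARD('p)) ^ i * prob {s \<in> space M. g - X n s \<in> quot_ball i}" by simp
  finally show ?thesis .
qed

lemma ball_kernel_integrable [simp, intro]:
  assumes "Y \<in> measurable M (count_space UNIV)"
  shows "integrable M (\<lambda>s. ball_kernel i (Y s :: 'p padic_quot))"
proof (rule integrable_const_bound[of _ 1])
  have "ball_kernel i g \<le> 1" for g :: "'p padic_quot"
    using ball_kernel_bounds(2)[of i g] p_gt_1 power_le_one[of "1 / real CARD('p)" i] by simp
  thus "AE s in M. norm (ball_kernel i (Y s)) \<le> 1" by (simp add: ball_kernel_bounds)
  show "(\<lambda>s. ball_kernel i (Y s)) \<in> borel_measurable M"
    by (rule measurable_compose[OF assms]) simp
qed

lemma alpha_eq: "scaling_alpha CARD('p) b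
    = (real CARD('p) powr b * real CARD('p) - 1) / (real CARD('p) powr b * (real CARD('p) - 1))"
  using p_gt_1 by (simp add: scaling_alpha_def powr_add algebra_simps)

text \<open>Averaging over a subgroup contained in \<open>quot_ball i\<close> fixes the shell
  kernel, averaging over a larger one kills it, and the step law is a signed mixture of such
  averages. The proof verifies the resulting eigenvalue equation on the three regions where the
  kernel is constant.\<close>

lemma expectation_shell_kernel:
  assumes n: "n \<ge> 1"
  shows "expectation (\<lambda>s. shell_kernel i (g - X n s)) = eigenvalue i * shell_kernel i g"
proof -
  let ?p = "real CARD('p)" and ?B = "real CARD('p) powr b"
  let ?Q = "\<lambda>i. prob {s \<in> space M. g - X n s \<in> quot_ball i}"
  note [measurable] = X_measurable[OF n]
  have "expectation (\<lambda>s. shell_kernel i (g - X n s))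
      = expectation (\<lambda>s. ball_kernel i (g - X n s)) - expectation (\<lambda>s. ball_kernel (Suc i) (g - X n s))"
    unfolding shell_kernel_def by (intro Bochner_Integration.integral_diff ball_kernel_integrable) measurable
  hence E: "expectation (\<lambda>s. shell_kernel i (g - X n s)) = (1 / ?p) ^ i * ?Q i - (1 / ?p) ^ Suc i * ?Q (Suc i)"
    by (simp only: expectation_ball_kernel[OF n])
  have inside: "?Q j = 1 - 1 / ?B ^ j" if "g \<in> quot_ball j" for j
  proof -
    have "g - x \<in> quot_ball j \<longleftrightarrow> x \<in> quot_ball j" for x
      using quot_ball_diff[OF that, of x] quot_ball_diff[OF that, of "g - x"] by auto
    thus ?thesis using prob_quot_ball[OF n, of j] by simp
  qed
  \<comment> \<open>With q = p^(-i) and \<beta> = B^(-i) these are the eigenvalue equations on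
    \<open>quot_ball i\<close>, where the kernel is q - q/p, and on the next sphere, where it is
    -q/p.\<close>
  have alg: "q * (1 - \<beta>) - q / p * (1 - \<beta> / B) = (1 - (B * p - 1) / (B * (p - 1)) * \<beta>) * (q - q / p)"
    "q * (B - 1) * \<beta> / (B * (p - 1)) - q / p * (1 - \<beta> / B) = (1 - (B * p - 1) / (B * (p - 1)) * \<beta>) * (0 - q / p)"
    if "p > 1" "B > 1" for p B q \<beta> :: real
    using that by (auto simp: divide_simps) (auto simp: algebra_simps)
  have p0: "?p > 0" and B0: "?B > 0" using p_gt_1 pb_gt_1 by linarith+
  consider (a) "g \<in> quot_ball i" | (b) "g \<notin> quot_ball i" "g \<in> quot_ball (Suc i)" | (c) "g \<notin> quot_ball (Suc i)" by blast
  thus ?thesis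
  proof cases
    case a
    have a': "g \<in> quot_ball (Suc i)" using a quot_ball_mono[of i "Suc i"] by auto
    show ?thesis unfolding E unfolding inside[OF a] inside[OF a'] eigenvalue_def alpha_eq shell_kernel_def ball_kernel_def
      using a a' alg(1)[OF p_gt_1 pb_gt_1, of "(1 / ?p) ^ i" "1 / ?B ^ i"] by (simp add: mult.commute)
  next
    case b
    have "?Q i = ?p ^ i * ((?B - 1) / ?B ^ Suc i * (1 / (?p ^ Suc i - ?p ^ i)))"
      by (rule prob_shifted_quot_ball[OF n b(2,1)]) simp
    also have "?p ^ Suc i - ?p ^ i = ?p ^ i * (?p - 1)" by (simp add: algebra_simps)
    also have "?p ^ i * ((?B - 1) / ?B ^ Suc i * (1 / (?p ^ i * (?p - 1)))) = (?B - 1) * (1 / ?B ^ i) / (?B * (?p - 1))"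
    proof -
      have "q * (x / (B * w) * (1 / (q * y))) = x * (1 / w) / (B * y)" if "q \<noteq> 0" for q x B w y :: real
        using that by simp
      from this[of "?p ^ i" "?B - 1" ?B "?B ^ i" "?p - 1"] show ?thesis using p0 by simp
    qed
    finally have Q: "?Q i = (?B - 1) * (1 / ?B ^ i) / (?B * (?p - 1))" .
    show ?thesis unfolding E unfolding Q inside[OF b(2)] eigenvalue_def alpha_eq shell_kernel_def ball_kernel_def
      using b alg(2)[OF p_gt_1 pb_gt_1, of "(1 / ?p) ^ i" "1 / ?B ^ i"] by (simp add: mult_ac)
  next
    case c
    obtain k where k: "g \<in> quot_ball k" using quot_ball_cover by blast
    \<comment> \<open>p^m is the absolute value of \<open>g\<close>. Both shifted subgroups stay in
      that sphere, where the step law is constant, so normalising by their sizes makes the two terms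
      cancel.\<close>
    define m where "m = (LEAST k. g \<in> quot_ball k)"
    have m: "g \<in> quot_ball m" unfolding m_def by (rule LeastI[of _ k]) (rule k)
    have "m > Suc i" using c m quot_ball_mono[of m "Suc i"] by (meson linorder_not_less subsetD)
    then obtain j where j: "m = Suc j" "Suc i \<le> j" by (cases m) auto
    have "g \<notin> quot_ball j" using not_less_Least[of j "\<lambda>k. g \<in> quot_ball k"] j(1) by (simp add: m_def)
    note Q = prob_shifted_quot_ball[OF n m[unfolded j(1)] this]
    have "g \<notin> quot_ball i" using c quot_ball_mono[of i "Suc i"] by auto
    moreover have "(1 / ?p) ^ k * (?p ^ k * w) = w" for k w
      using p0 by (simp add: power_divide)
    ultimately show ?thesis unfolding E using Q[of i] Q[of "Suc i"] j c
      by (simp only: shell_kernel_def ball_kernel_def if_False) simp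
  qed
qed

lemma sum_X_measurable:
  assumes "finite J" "J \<subseteq> {1..}"
  shows "(\<lambda>s. \<Sum>j\<in>J. X j s) \<in> measurable M (count_space UNIV)"
  using assms by (intro measurable_sum_countable X_measurable) auto

text \<open>By independence the expectation over \<open>X j\<close> can be taken first, with the sum
  \<open>y\<close> of the other steps fixed; the one-step identity at \<open>g - y\<close> then
  contributes one factor per step.\<close>

lemma expectation_shell_kernel_sum:
  assumes "finite J" "J \<subseteq> {1..}"
  shows "expectation (\<lambda>s. shell_kernel i (g - (\<Sum>j\<in>J. X j s))) = eigenvalue i ^ card J * shell_kernel i g"
  using assms
proof (induction J arbitrary: g rule: finite_induct)
  case (insert j J)
  let ?C = "count_space UNIV :: 'p padic_quot measure" and ?S = "\<lambda>s. \<Sum>j\<in>J. X j s"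
  have [measurable]: "X j \<in> measurable M ?C" using insert.prems by (intro X_measurable) auto
  have [measurable]: "?S \<in> measurable M ?C" using insert.hyps insert.prems by (intro sum_X_measurable) auto
  have "indep_var (PiM {j} (\<lambda>_. ?C)) (\<lambda>\<omega>. restrict (\<lambda>i. X i \<omega>) {j}) (PiM J (\<lambda>_. ?C)) (\<lambda>\<omega>. restrict (\<lambda>i. X i \<omega>) J)"
    by (rule indep_var_restrict[OF indep]) (use insert in auto)
  hence "indep_var ?C ((\<lambda>f. f j) \<circ> (\<lambda>\<omega>. restrict (\<lambda>i. X i \<omega>) {j})) ?C ((\<lambda>f. \<Sum>i\<in>J. f i) \<circ> (\<lambda>\<omega>. restrict (\<lambda>i. X i \<omega>) J))"
    by (rule indep_var_compose)
       (simp, intro measurable_sum_countable measurable_component_singleton insert.hyps)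
  moreover have "(\<lambda>f. f j) \<circ> (\<lambda>\<omega>. restrict (\<lambda>i. X i \<omega>) {j}) = X j" "(\<lambda>f. \<Sum>i\<in>J. f i) \<circ> (\<lambda>\<omega>. restrict (\<lambda>i. X i \<omega>) J) = ?S"
    by (auto simp: fun_eq_iff)
  ultimately have ind: "indep_var ?C (X j) ?C ?S" by simp
  hence dist: "distr M ?C (X j) \<Otimes>\<^sub>M distr M ?C ?S = distr M (?C \<Otimes>\<^sub>M ?C) (\<lambda>s. (X j s, ?S s))"
    by (simp add: indep_var_distribution_eq)
  interpret A: prob_space "distr M ?C (X j)" by (rule prob_space_distr) measurable
  interpret B: prob_space "distr M ?C ?S" by (rule prob_space_distr) measurable
  interpret AB: pair_prob_space "distr M ?C (X j)" "distr M ?C ?S" ..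
  let ?h = "\<lambda>(x, y). shell_kernel i (g - (x + y))"
  have CC: "?C \<Otimes>\<^sub>M ?C = count_space UNIV" by (simp add: pair_measure_countable)
  have h_meas: "?h \<in> borel_measurable (?C \<Otimes>\<^sub>M ?C)" unfolding CC by simp
  have bound: "norm (shell_kernel i x) \<le> 2" for x :: "'p padic_quot"
  proof -
    have "(1 / real CARD('p)) ^ k \<le> 1" for k using p_gt_1 by (intro power_le_one) auto
    hence "0 \<le> ball_kernel k x \<and> ball_kernel k x \<le> 1" for k using ball_kernel_bounds[of k x] order_trans by blast
    from this[of i] this[of "Suc i"] show ?thesis unfolding shell_kernel_def real_norm_def by linarith
  qed
  have "expectation (\<lambda>s. shell_kernel i (g - (\<Sum>j\<in>insert j J. X j s))) = expectation (\<lambda>s. ?h (X j s, ?S s))"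
    using insert.hyps by simp
  also have "\<dots> = (\<integral>z. ?h z \<partial>distr M (?C \<Otimes>\<^sub>M ?C) (\<lambda>s. (X j s, ?S s)))"
    by (rule integral_distr[symmetric, OF _ h_meas]) measurable
  also have "\<dots> = (\<integral>z. ?h z \<partial>(distr M ?C (X j) \<Otimes>\<^sub>M distr M ?C ?S))" by (simp add: dist)
  also have "\<dots> = (\<integral>y. (\<integral>x. shell_kernel i (g - (x + y)) \<partial>distr M ?C (X j)) \<partial>distr M ?C ?S)"
  proof (rule AB.integral_snd[symmetric])
    show "integrable (distr M ?C (X j) \<Otimes>\<^sub>M distr M ?C ?S) ?h"
      by (rule AB.integrable_const_bound[of _ 2]) (use bound h_meas in \<open>auto cong: measurable_cong_sets\<close>)
  qed
  also have "\<dots> = (\<integral>y. eigenvalue i * shell_kernel i (g - y) \<partial>distr M ?C ?S)"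
  proof (rule Bochner_Integration.integral_cong[OF refl])
    fix y
    have "(\<integral>x. shell_kernel i (g - (x + y)) \<partial>distr M ?C (X j)) = expectation (\<lambda>s. shell_kernel i ((g - y) - X j s))"
      by (subst integral_distr) (auto simp: algebra_simps)
    also have "\<dots> = eigenvalue i * shell_kernel i (g - y)"
      by (rule expectation_shell_kernel) (use insert in auto)
    finally show "(\<integral>x. shell_kernel i (g - (x + y)) \<partial>distr M ?C (X j)) = eigenvalue i * shell_kernel i (g - y)" .
  qed
  also have "\<dots> = eigenvalue i * expectation (\<lambda>s. shell_kernel i (g - ?S s))"
    by (subst integral_distr) auto
  also have "\<dots> = eigenvalue i ^ card (insert j J) * shell_kernel i g"
    using insert by simp
  finally show ?case .
qed (simp add: prob_space)

text \<open>Resolving the indicator of a ball into eigenfunctions of the one-step operator.\<close>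

lemma prob_sum_in_ball_sums:
  assumes J: "finite J" "J \<subseteq> {1..}"
  shows "(\<lambda>s. eigenvalue (r + s) ^ card J * (real CARD('p) ^ r * shell_kernel (r + s) g)) sums
    prob {s \<in> space M. g - (\<Sum>j\<in>J. X j s) \<in> quot_ball r}"
proof -
  let ?p = "real CARD('p)" and ?S = "\<lambda>s. \<Sum>j\<in>J. X j s"
  let ?E = "\<lambda>i. expectation (\<lambda>s. ball_kernel i (g - ?S s))"
  have p0: "?p > 0" using p_gt_1 by linarith
  have [measurable]: "?S \<in> measurable M (count_space UNIV)" by (rule sum_X_measurable[OF J])
  have gS: "(\<lambda>s. g - ?S s) \<in> measurable M (count_space UNIV)" by measurable
  have step: "?E i - ?E (Suc i) = eigenvalue i ^ card J * shell_kernel i g" for i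
  proof -
    have "?E i - ?E (Suc i) = expectation (\<lambda>s. shell_kernel i (g - ?S s))"
      unfolding shell_kernel_def by (intro Bochner_Integration.integral_diff[symmetric] ball_kernel_integrable gS)
    thus ?thesis by (simp add: expectation_shell_kernel_sum[OF J])
  qed
  have E0: "(\<lambda>s. ?E (r + s)) \<longlonglongrightarrow> 0"
  proof (rule tendsto_sandwich[OF always_eventually always_eventually tendsto_const])
    show "\<forall>s. 0 \<le> ?E (r + s)" by (intro allI Bochner_Integration.integral_nonneg ball_kernel_bounds)
    show "\<forall>s. ?E (r + s) \<le> (1 / ?p) ^ (r + s)"
    proof
      fix s
      have "?E (r + s) \<le> expectation (\<lambda>_. (1 / ?p) ^ (r + s))"
        by (intro integral_mono ball_kernel_integrable gS ball_kernel_bounds) simp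
      thus "?E (r + s) \<le> (1 / ?p) ^ (r + s)" by (simp add: prob_space)
    qed
    have "(\<lambda>s. (1 / ?p) ^ s) \<longlonglongrightarrow> 0" using p_gt_1 by (intro LIMSEQ_realpow_zero) auto
    from LIMSEQ_ignore_initial_segment[OF this, of r] show "(\<lambda>s. (1 / ?p) ^ (r + s)) \<longlonglongrightarrow> 0"
      by (simp add: add.commute)
  qed
  have "(\<lambda>s. ?E (r + s) - ?E (r + Suc s)) sums (?E (r + 0) - 0)"
    by (rule telescope_sums'[OF E0])
  hence "(\<lambda>s. ?p ^ r * (eigenvalue (r + s) ^ card J * shell_kernel (r + s) g)) sums (?p ^ r * ?E r)"
    using step by (intro sums_mult) simp
  moreover have "?p ^ r * ?E r = prob {s \<in> space M. g - ?S s \<in> quot_ball r}"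
  proof -
    have "?E r = expectation (\<lambda>s. (1 / ?p) ^ r * indicator {s \<in> space M. g - ?S s \<in> quot_ball r} s)"
      by (intro Bochner_Integration.integral_cong refl) (auto simp: ball_kernel_def)
    also have "\<dots> = (1 / ?p) ^ r * prob {s \<in> space M. g - ?S s \<in> quot_ball r}" by simp
    finally show ?thesis using p0 by (simp add: power_divide)
  qed
  ultimately show ?thesis by (simp add: mult_ac)
qed

end

subsection \<open>The scaled walk on a time grid\<close>

text \<open>Keeps the digits at positions below \<open>n\<close>. Using representatives of the
  cosets of p^n Z_p, and not the cosets themselves, makes a projected path again a path in Q_p that
  can be compared with the original.\<close>

definition padic_proj :: "int \<Rightarrow> 'p::prime_card padic \<Rightarrow> 'p padic" where
  "padic_proj n x = of_nat CARD('p) powi n * of_rat (padic_frac (of_nat CARD('p) powi (- n) * x))"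

lemma padic_proj_near: "padic_abs (x - padic_proj n x :: 'p::prime_card padic) \<le> real CARD('p) powi (- n)"
proof -
  let ?q = "of_nat CARD('p) :: 'p padic"
  have "x - padic_proj n x = ?q powi n * (?q powi (- n) * x - of_rat (padic_frac (?q powi (- n) * x)))"
    unfolding padic_proj_def by (simp add: right_diff_distrib flip: mult.assoc power_int_add)
  hence "padic_abs (x - padic_proj n x) = real CARD('p) powi (- n) * padic_abs (?q powi (- n) * x - of_rat (padic_frac (?q powi (- n) * x)))"
    by (simp only: padic_abs_mult padic_abs_p_powi)
  also have "\<dots> \<le> real CARD('p) powi (- n) * 1"
    by (intro mult_left_mono padic_frac_near) (simp add: zero_le_power_int)
  finally show ?thesis by simp
qed

lemma padic_proj_eq_iff: "padic_proj n x = padic_proj n y \<longleftrightarrow> y \<in> pball (x :: 'p::prime_card padic) (- n)"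
proof
  assume "padic_proj n x = padic_proj n y"
  thus "y \<in> pball x (- n)"
    using padic_abs_trans[of y "padic_proj n y" "real CARD('p) powi (- n)" x] padic_proj_near[of y n] padic_proj_near[of x n]
    by (simp add: pball_def padic_abs_commute)
next
  let ?q = "of_nat CARD('p) :: 'p padic"
  assume "y \<in> pball x (- n)"
  hence "padic_abs (x - y) \<le> real CARD('p) powi (- n)" by (simp add: pball_def padic_abs_commute)
  hence "real CARD('p) powi n * padic_abs (x - y) \<le> real CARD('p) powi n * real CARD('p) powi (- n)"
    by (intro mult_left_mono) (simp_all add: zero_le_power_int)
  also have "real CARD('p) powi n * real CARD('p) powi (- n) = 1" by (simp flip: power_int_add)
  finally have "padic_abs (?q powi (- n) * x - ?q powi (- n) * y) \<le> 1"
    by (simp add: padic_abs_mult padic_abs_p_powi flip: right_diff_distrib)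
  thus "padic_proj n x = padic_proj n y" unfolding padic_proj_def by (simp only: padic_frac_cong)
qed

lemma padic_proj_idem: "padic_proj n (padic_proj n x) = padic_proj n x"
  by (simp add: padic_proj_eq_iff pball_def padic_proj_near)

lemma countable_range_padic_proj: "countable (range (padic_proj n :: 'p::prime_card padic \<Rightarrow> _))"
proof -
  have "range (padic_proj n) \<subseteq> range (\<lambda>q. of_nat CARD('p) powi n * of_rat q :: 'p padic)"
    by (auto simp: padic_proj_def)
  thus ?thesis by (rule countable_subset) simp
qed

lemma compound_exp_limit:
  assumes L: "filterlim L at_top sequentially" and k: "(\<lambda>m. real (k m) / L m) \<longlonglongrightarrow> h"
  shows "(\<lambda>m. (1 - \<kappa> / L m) ^ k m) \<longlonglongrightarrow> exp (- \<kappa> * h)"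
proof -
  have "((\<lambda>x. x * ln (1 - \<kappa> / x)) \<longlongrightarrow> - \<kappa>) at_top" by real_asymp
  from filterlim_compose[OF this L] have "(\<lambda>m. (real (k m) / L m) * (L m * ln (1 - \<kappa> / L m))) \<longlonglongrightarrow> h * - \<kappa>"
    by (rule tendsto_mult[OF k])
  hence lim: "(\<lambda>m. exp ((real (k m) / L m) * (L m * ln (1 - \<kappa> / L m)))) \<longlonglongrightarrow> exp (- \<kappa> * h)"
    by (intro tendsto_exp) (simp add: mult.commute)
  \<comment> \<open>For small \<open>m\<close> the base of the power can be negative; the logarithm
    is used only where it is positive.\<close>
  have "eventually (\<lambda>x::real. x > 0 \<and> \<kappa> / x < 1) at_top" by (intro eventually_conj; real_asymp)
  from eventually_compose_filterlim[OF this L]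
  have "\<forall>\<^sub>F m in sequentially. exp ((real (k m) / L m) * (L m * ln (1 - \<kappa> / L m))) = (1 - \<kappa> / L m) ^ k m"
  proof eventually_elim
    case (elim m)
    hence "(1 - \<kappa> / L m) ^ k m = exp (real (k m) * ln (1 - \<kappa> / L m))" by (simp add: exp_of_nat_mult)
    also have "real (k m) * ln (1 - \<kappa> / L m) = (real (k m) / L m) * (L m * ln (1 - \<kappa> / L m))" using elim by simp
    finally show ?case by simp
  qed
  from Lim_transform_eventually[OF lim this] show ?thesis .
qed

lemma floor_scaling_limit:
  assumes L: "filterlim L at_top sequentially" and t: "t \<ge> 0"
  shows "(\<lambda>m. real (nat \<lfloor>t * L m\<rfloor>) / L m) \<longlonglongrightarrow> t"
proof -
  have "((\<lambda>x. real_of_int \<lfloor>t * x\<rfloor> / x) \<longlongrightarrow> t) at_top" by real_asymp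
  from filterlim_compose[OF this L] have lim: "(\<lambda>m. real_of_int \<lfloor>t * L m\<rfloor> / L m) \<longlonglongrightarrow> t" .
  have "eventually (\<lambda>m. L m \<ge> 0) sequentially" using L by (simp add: filterlim_at_top)
  hence "\<forall>\<^sub>F m in sequentially. real_of_int \<lfloor>t * L m\<rfloor> / L m = real (nat \<lfloor>t * L m\<rfloor>) / L m"
    by eventually_elim (use t in simp)
  from Lim_transform_eventually[OF lim this] show ?thesis .
qed

lemma quot_ball_add_iff: "h \<in> quot_ball i \<Longrightarrow> g + h \<in> quot_ball i \<longleftrightarrow> g \<in> quot_ball i"
  using quot_ball_add[of g i h] quot_ball_diff[of "g + h" i h] by auto

section \<open>Cells of the scaled walk and limits of their probabilities\<close>

context padic_walk
begin

lemma walk_0: "walk X 0 s = 0"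
  by (simp add: walk_def)

lemma walk_split: "k \<le> l \<Longrightarrow> walk X l s = walk X k s + (\<Sum>j\<in>{k<..l}. X j s)"
  unfolding walk_def
proof -
  assume "k \<le> l"
  hence eq: "{1..l} = {1..k} \<union> {k<..l}" by auto
  show "(\<Sum>j=1..l. X j s) = (\<Sum>j=1..k. X j s) + (\<Sum>j\<in>{k<..l}. X j s)"
    unfolding eq by (rule sum.union_disjoint) auto
qed

lemma walk_measurable: "walk X k \<in> measurable M (count_space UNIV)"
  unfolding walk_def by (rule sum_X_measurable) auto

text \<open>Multiplication by p^(-m) turns a ball of radius p^(-n) into one of radius p^(m-n), which
  is a union of cosets of Z_p if \<open>n <= m\<close>; so cells pull back to cosets of a finite
  subgroup.\<close>

lemma embed_in_pball:
  assumes "n \<le> int m"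
  shows "padic_quot_embed m (g :: 'p padic_quot) \<in> pball a (- n) \<longleftrightarrow>
    g - abs_padic_quot (of_nat CARD('p) powi (- int m) * a) \<in> quot_ball (nat (int m - n))"
proof -
  let ?q = "of_nat CARD('p) :: 'p padic" and ?p = "real CARD('p)"
  define f where "f = (of_rat (padic_frac (rep_padic_quot g)) :: 'p padic)"
  have "abs_padic_quot (rep_padic_quot g) = g" by (rule Quotient_abs_rep[OF Quotient_padic_quot])
  moreover have "abs_padic_quot (rep_padic_quot g) = abs_padic_quot f"
    unfolding padic_quot.abs_eq_iff f_def by (rule padic_frac_near)
  ultimately have g: "g = abs_padic_quot f" by simp
  have "padic_quot_embed m g - a = ?q powi (int m) * (f - ?q powi (- int m) * a)"
    unfolding padic_quot_embed_def f_def[symmetric] by (simp add: right_diff_distrib power_int_minus field_simps)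
  hence abs: "padic_abs (padic_quot_embed m g - a) = ?p powi (- int m) * padic_abs (f - ?q powi (- int m) * a)"
    by (simp only: padic_abs_mult padic_abs_p_powi)
  have pos: "?p powi (- int m) > 0" using p_gt_1 by (intro zero_less_power_int) linarith
  have "padic_quot_embed m g \<in> pball a (- n) \<longleftrightarrow> ?p powi (- int m) * padic_abs (f - ?q powi (- int m) * a) \<le> ?p powi (- int m) * ?p ^ nat (int m - n)"
  proof -
    have "?p powi (- int m) * ?p ^ nat (int m - n) = ?p powi (- int m) * ?p powi (int m - n)" using assms by (simp add: power_int_def)
    also have "\<dots> = ?p powi (- n)" using p_gt_1 by (simp flip: power_int_add)
    finally show ?thesis unfolding pball_def mem_Collect_eq abs by simp
  qed
  also have "\<dots> \<longleftrightarrow> g - abs_padic_quot (?q powi (- int m) * a) \<in> quot_ball (nat (int m - n))"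
    using pos by (simp add: g abs_padic_quot_diff quot_ball_abs)
  finally show ?thesis .
qed

lemma abs_embed: "abs_padic_quot (of_nat CARD('p) powi (- int m) * padic_quot_embed m g) = (g :: 'p padic_quot)"
proof -
  have "of_nat CARD('p) powi (- int m) * padic_quot_embed m g = (of_rat (padic_frac (rep_padic_quot g)) :: 'p padic)"
    unfolding padic_quot_embed_def by (simp add: power_int_minus)
  also have "abs_padic_quot \<dots> = abs_padic_quot (rep_padic_quot g)"
    unfolding padic_quot.abs_eq_iff by (subst padic_abs_commute) (rule padic_frac_near)
  also have "\<dots> = g" by (rule Quotient_abs_rep[OF Quotient_padic_quot])
  finally show ?thesis .
qed

text \<open>The representative chosen for the zero coset may be any p-adic integer, but its
  fractional part is 0; this gives the walk its start at 0.\<close>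

lemma rep_zero_frac: "padic_frac (rep_padic_quot (0 :: 'p padic_quot)) = 0"
proof -
  have "abs_padic_quot (rep_padic_quot (0 :: 'p padic_quot)) = abs_padic_quot 0"
    using Quotient_abs_rep[OF Quotient_padic_quot, of 0] by (simp add: zero_padic_quot_def)
  thus ?thesis unfolding padic_quot.abs_eq_iff by (intro padic_frac_eq_0) simp
qed

text \<open>After rescaling, the eigenfunctions do not depend on \<open>m\<close>: all dependence on
  \<open>m\<close> is left to the eigenvalues and the number of steps.\<close>

lemma shell_kernel_cell_weight:
  assumes "n \<le> int m"
  defines "r \<equiv> nat (int m - n)"
  shows "real CARD('p) ^ r * shell_kernel (r + s) (abs_padic_quot (of_nat CARD('p) powi (- int m) * (x :: 'p padic)))
    = cell_weight (real CARD('p)) n (padic_abs x) s - cell_weight (real CARD('p)) n (padic_abs x) (Suc s)"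
proof -
  let ?p = "real CARD('p)"
  have p0: "?p > 0" using p_gt_1 by linarith
  have "?p ^ r * ball_kernel (r + s) (abs_padic_quot (of_nat CARD('p) powi (- int m) * x)) = cell_weight ?p n (padic_abs x) s" for s
  proof -
    have "padic_abs (of_nat CARD('p) powi (- int m) * x) = ?p powi (int m) * padic_abs x"
      by (simp add: padic_abs_mult padic_abs_p_powi)
    moreover have "?p ^ (r + s) = ?p powi (int m) * ?p powi (int s - n)"
    proof -
      have "?p ^ (r + s) = ?p powi (int (r + s))" by (rule power_int_of_nat[symmetric])
      also have "int (r + s) = int m + (int s - n)" using assms by simp
      also have "?p powi (int m + (int s - n)) = ?p powi (int m) * ?p powi (int s - n)"
        by (rule power_int_add) (use p0 in simp)
      finally show ?thesis .
    qed
    moreover have "?p powi (int m) > 0" using p0 by simp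
    ultimately have "abs_padic_quot (of_nat CARD('p) powi (- int m) * x) \<in> quot_ball (r + s) \<longleftrightarrow> padic_abs x \<le> ?p powi (int s - n)"
      by (simp add: quot_ball_abs del: power_int_of_nat)
    thus ?thesis using p0 by (simp add: ball_kernel_def cell_weight_def power_add power_divide)
  qed
  thus ?thesis unfolding shell_kernel_def right_diff_distrib by (metis add_Suc_right)
qed

text \<open>\<alpha> is at most p / (p - 1), which is at most 2 because p >= 2. The bound dominates
  arbitrary powers of the eigenvalues when limit and series are exchanged.\<close>

lemma abs_eigenvalue_le_1: "\<bar>eigenvalue i\<bar> \<le> 1"
proof -
  let ?p = "real CARD('p)" and ?B = "real CARD('p) powr b"
  have "?p \<ge> 2" using prime_ge_2_nat[OF prime_card[where 'a = 'p]] by simp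
  have "?B * 2 \<le> ?B * ?p" using \<open>?p \<ge> 2\<close> pb_gt_1 by (intro mult_left_mono) auto
  moreover have "?B * (?p - 1) = ?B * ?p - ?B" by (simp add: algebra_simps)
  ultimately have "?B * ?p - 1 \<le> 2 * (?B * (?p - 1))" "?B * (?p - 1) > 0" "0 \<le> ?B * ?p - 1"
    using pb_gt_1 by linarith+
  hence "0 \<le> scaling_alpha CARD('p) b" "scaling_alpha CARD('p) b \<le> 2" unfolding alpha_eq
    by (simp_all add: divide_le_eq)
  moreover have "?B ^ i \<ge> 1" using pb_gt_1 by (intro one_le_power) auto
  ultimately have "0 \<le> scaling_alpha CARD('p) b / ?B ^ i" "scaling_alpha CARD('p) b / ?B ^ i \<le> 2 / 1"
    by (intro divide_nonneg_nonneg frac_le; linarith)+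
  thus ?thesis unfolding eigenvalue_def by linarith
qed

lemma alpha_pos: "scaling_alpha CARD('p) b > 0"
proof -
  have "real CARD('p) powr b * real CARD('p) > 1 * 1" using p_gt_1 pb_gt_1 by (intro mult_strict_mono) auto
  thus ?thesis unfolding alpha_eq using p_gt_1 pb_gt_1 by (intro divide_pos_pos mult_pos_pos) auto
qed

text \<open>Given that the walk is in the right coset at one grid time, being in the right coset at
  the next depends only on the steps in between, and disjoint blocks of steps are
  independent.\<close>

lemma prob_walk_grid:
  fixes k :: "nat \<Rightarrow> nat" and K :: nat
  assumes "mono k" "k 0 = 0"
  shows "prob {s \<in> space M. \<forall>i\<le>K. A i - walk X (k i) s \<in> quot_ball r} =
    (if A 0 \<in> quot_ball r then \<Prod>i=1..K. prob {s \<in> space M. (A i - A (i - 1)) - (\<Sum>j\<in>{k (i - 1)<..k i}. X j s) \<in> quot_ball r} else 0)"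
proof (induction K)
  case 0
  show ?case by (auto simp: assms(2) walk_0 prob_space)
next
  case (Suc K)
  let ?C = "count_space UNIV :: 'p padic_quot measure"
  let ?I1 = "{1..k K}" and ?I2 = "{k K<..k (Suc K)}"
  let ?P1 = "\<lambda>f. \<forall>i\<le>K. A i - (\<Sum>j=1..k i. f j) \<in> quot_ball r"
  let ?P2 = "\<lambda>f. (A (Suc K) - A K) - (\<Sum>j\<in>?I2. f j) \<in> quot_ball r"
  have kle: "k i \<le> k K" if "i \<le> K" for i using assms(1) that by (auto simp: mono_def)
  have comp: "(\<lambda>f. f j) \<in> measurable (PiM I (\<lambda>_. ?C)) ?C" if "j \<in> I" for j I
    using measurable_component_singleton[OF that, of "\<lambda>_. ?C"] .
  have sum1: "(\<lambda>f. \<Sum>j=1..k i. f j) \<in> measurable (PiM ?I1 (\<lambda>_. ?C)) ?C" if "i \<le> K" for i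
    by (intro measurable_sum_countable comp) (use kle[OF that] in auto)
  have sum2: "(\<lambda>f. \<Sum>j\<in>?I2. f j) \<in> measurable (PiM ?I2 (\<lambda>_. ?C)) ?C"
    by (intro measurable_sum_countable comp) auto
  have P1: "?P1 \<in> measurable (PiM ?I1 (\<lambda>_. ?C)) (count_space UNIV)"
  proof -
    have "(\<lambda>f. A i - (\<Sum>j=1..k i. f j) \<in> quot_ball r) \<in> measurable (PiM ?I1 (\<lambda>_. ?C)) (count_space UNIV)" if "i \<le> K" for i
      by (rule measurable_compose[OF sum1[OF that]]) simp
    hence "(\<lambda>f. \<forall>i\<in>{..K}. A i - (\<Sum>j=1..k i. f j) \<in> quot_ball r) \<in> measurable (PiM ?I1 (\<lambda>_. ?C)) (count_space UNIV)"
      by (intro pred_intros_finite) auto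
    thus ?thesis by (simp only: Ball_def atMost_iff)
  qed
  have P2: "?P2 \<in> measurable (PiM ?I2 (\<lambda>_. ?C)) (count_space UNIV)"
    by (rule measurable_compose[OF sum2]) simp
  have "indep_var (PiM ?I1 (\<lambda>_. ?C)) (\<lambda>\<omega>. restrict (\<lambda>i. X i \<omega>) ?I1) (PiM ?I2 (\<lambda>_. ?C)) (\<lambda>\<omega>. restrict (\<lambda>i. X i \<omega>) ?I2)"
    by (rule indep_var_restrict[OF indep]) auto
  hence "indep_var (count_space UNIV) (?P1 \<circ> (\<lambda>\<omega>. restrict (\<lambda>i. X i \<omega>) ?I1)) (count_space UNIV) (?P2 \<circ> (\<lambda>\<omega>. restrict (\<lambda>i. X i \<omega>) ?I2))"
    by (rule indep_var_compose[OF _ P1 P2])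
  moreover have "?P1 \<circ> (\<lambda>\<omega>. restrict (\<lambda>i. X i \<omega>) ?I1) = (\<lambda>s. \<forall>i\<le>K. A i - walk X (k i) s \<in> quot_ball r)"
  proof
    fix s
    have "(\<Sum>j=1..k i. restrict (\<lambda>i. X i s) ?I1 j) = walk X (k i) s" if "i \<le> K" for i
      unfolding walk_def by (intro sum.cong) (use kle[OF that] in auto)
    thus "(?P1 \<circ> (\<lambda>\<omega>. restrict (\<lambda>i. X i \<omega>) ?I1)) s = (\<forall>i\<le>K. A i - walk X (k i) s \<in> quot_ball r)" by simp
  qed
  moreover have "?P2 \<circ> (\<lambda>\<omega>. restrict (\<lambda>i. X i \<omega>) ?I2) = (\<lambda>s. (A (Suc K) - A K) - (\<Sum>j\<in>?I2. X j s) \<in> quot_ball r)"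
    by (simp add: fun_eq_iff)
  ultimately have "indep_var (count_space UNIV) (\<lambda>s. \<forall>i\<le>K. A i - walk X (k i) s \<in> quot_ball r)
      (count_space UNIV) (\<lambda>s. (A (Suc K) - A K) - (\<Sum>j\<in>?I2. X j s) \<in> quot_ball r)" by simp
  from indep_varD[OF this, of "{True}" "{True}"]
  have ind: "prob {s \<in> space M. (\<forall>i\<le>K. A i - walk X (k i) s \<in> quot_ball r) \<and> (A (Suc K) - A K) - (\<Sum>j\<in>?I2. X j s) \<in> quot_ball r}
    = prob {s \<in> space M. \<forall>i\<le>K. A i - walk X (k i) s \<in> quot_ball r}
      * prob {s \<in> space M. (A (Suc K) - A K) - (\<Sum>j\<in>?I2. X j s) \<in> quot_ball r}"
    by (simp add: vimage_def Int_def conj_commute)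
  have "A (Suc K) - walk X (k (Suc K)) s \<in> quot_ball r \<longleftrightarrow> (A (Suc K) - A K) - (\<Sum>j\<in>?I2. X j s) \<in> quot_ball r"
    if "A K - walk X (k K) s \<in> quot_ball r" for s
  proof -
    have eq: "A (Suc K) - walk X (k (Suc K)) s = ((A (Suc K) - A K) - (\<Sum>j\<in>?I2. X j s)) + (A K - walk X (k K) s)"
      using assms(1) walk_split[of "k K" "k (Suc K)" s] by (simp add: mono_def)
    show ?thesis unfolding eq by (rule quot_ball_add_iff[OF that])
  qed
  hence "{s \<in> space M. \<forall>i\<le>Suc K. A i - walk X (k i) s \<in> quot_ball r} =
    {s \<in> space M. (\<forall>i\<le>K. A i - walk X (k i) s \<in> quot_ball r) \<and> (A (Suc K) - A K) - (\<Sum>j\<in>?I2. X j s) \<in> quot_ball r}"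
    by (auto simp: le_Suc_eq)
  thus ?case by (simp only: ind Suc.IH) simp
qed


lemma scaling_lambda_eq:
  "scaling_lambda CARD('p) b \<sigma> m = \<sigma> / scaling_alpha CARD('p) b * (real CARD('p) powr b) ^ m"
proof -
  have "real CARD('p) powr (real m * b) = (real CARD('p) powr b) ^ m"
    using p_gt_1 by (simp add: mult.commute powr_power)
  thus ?thesis by (simp add: scaling_lambda_def)
qed

context
  fixes \<sigma> :: real
  assumes \<sigma>: "\<sigma> > 0"
begin

lemma lambda_pos: "scaling_lambda CARD('p) b \<sigma> m > 0"
  using \<sigma> alpha_pos pb_gt_1 by (simp add: scaling_lambda_eq)

lemma lambda_at_top: "filterlim (scaling_lambda CARD('p) b \<sigma>) at_top sequentially"
proof -
  have "filterlim (\<lambda>m. c * B ^ m) at_top sequentially" if "c > 0" "B > 1" for c B :: real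
    using that by real_asymp
  from this[of "\<sigma> / scaling_alpha CARD('p) b" "real CARD('p) powr b"] show ?thesis
    using \<sigma> alpha_pos pb_gt_1 by (simp add: scaling_lambda_eq[abs_def])
qed

text \<open>The scaling \<lambda>(m) is made for this: \<alpha> cancels, and what remains is a
  quantity independent of \<open>m\<close> divided by the number of steps per unit time.\<close>

lemma eigenvalue_scaled:
  assumes "n \<le> int m"
  shows "eigenvalue (nat (int m - n) + s)
    = 1 - \<sigma> * (real CARD('p) powr b) powi (n - int s) / scaling_lambda CARD('p) b \<sigma> m"
proof -
  let ?B = "real CARD('p) powr b"
  have B0: "?B > 0" using pb_gt_1 by linarith
  have "?B ^ (nat (int m - n) + s) = ?B powi (int (nat (int m - n) + s))" by (rule power_int_of_nat[symmetric])
  also have "int (nat (int m - n) + s) = int m - (n - int s)" using assms by simp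
  also have "?B powi (int m - (n - int s)) = ?B powi int m / ?B powi (n - int s)"
    by (rule power_int_diff) (use B0 in simp)
  finally have "?B ^ (nat (int m - n) + s) = ?B ^ m / ?B powi (n - int s)" by simp
  thus ?thesis using \<sigma> alpha_pos B0 unfolding eigenvalue_def scaling_lambda_eq by simp
qed

text \<open>In the eigenfunction series every term has a compound-interest limit, which is the
  corresponding term of \<open>heat_cell\<close>. Tannery's theorem exchanges limit and series, with
  the geometric decay of the cell weights as dominating sequence.\<close>

lemma increment_limit:
  assumes J: "\<And>m. finite (J m)" "\<And>m. J m \<subseteq> {1..}"
    and card: "(\<lambda>m. real (card (J m)) / scaling_lambda CARD('p) b \<sigma> m) \<longlonglongrightarrow> h"
  shows "(\<lambda>m. prob {s \<in> space M. abs_padic_quot (of_nat CARD('p) powi (- int m) * x) - (\<Sum>j\<in>J m. X j s) \<in> quot_ball (nat (int m - n))})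
    \<longlonglongrightarrow> heat_cell (real CARD('p)) b (\<sigma> * h) n (padic_abs x)"
proof -
  let ?w = "\<lambda>s. cell_weight (real CARD('p)) n (padic_abs x) s - cell_weight (real CARD('p)) n (padic_abs x) (Suc s)"
  let ?a = "\<lambda>s m. eigenvalue (nat (int m - n) + s) ^ card (J m) * ?w s"
  have "(\<lambda>m. \<Sum>s. ?a s m) \<longlonglongrightarrow> (\<Sum>s. stable_exp (real CARD('p)) b (\<sigma> * h) (n - int s) * ?w s)"
  proof (rule tannerys_theorem[where M = "\<lambda>s. (1 / real CARD('p)) ^ s", THEN conjunct2, THEN conjunct2])
    fix s
    have ev: "\<forall>\<^sub>F m in sequentially. n \<le> int m" by (rule eventually_sequentiallyI[of "nat n"]) linarith
    have "(\<lambda>m. (1 - \<sigma> * (real CARD('p) powr b) powi (n - int s) / scaling_lambda CARD('p) b \<sigma> m) ^ card (J m))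
        \<longlonglongrightarrow> exp (- (\<sigma> * (real CARD('p) powr b) powi (n - int s)) * h)"
      by (rule compound_exp_limit[OF lambda_at_top card])
    moreover have "exp (- (\<sigma> * (real CARD('p) powr b) powi (n - int s)) * h) = stable_exp (real CARD('p)) b (\<sigma> * h) (n - int s)"
      by (simp add: stable_exp_def mult_ac)
    ultimately have "(\<lambda>m. (1 - \<sigma> * (real CARD('p) powr b) powi (n - int s) / scaling_lambda CARD('p) b \<sigma> m) ^ card (J m))
        \<longlonglongrightarrow> stable_exp (real CARD('p)) b (\<sigma> * h) (n - int s)" by simp
    moreover have "\<forall>\<^sub>F m in sequentially. (1 - \<sigma> * (real CARD('p) powr b) powi (n - int s) / scaling_lambda CARD('p) b \<sigma> m) ^ card (J m)
        = eigenvalue (nat (int m - n) + s) ^ card (J m)"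
      using ev by eventually_elim (simp add: eigenvalue_scaled)
    ultimately have "(\<lambda>m. eigenvalue (nat (int m - n) + s) ^ card (J m)) \<longlonglongrightarrow> stable_exp (real CARD('p)) b (\<sigma> * h) (n - int s)"
      by (rule Lim_transform_eventually)
    thus "(\<lambda>m. ?a s m) \<longlonglongrightarrow> stable_exp (real CARD('p)) b (\<sigma> * h) (n - int s) * ?w s"
      by (intro tendsto_mult tendsto_const)
  next
    show "\<forall>\<^sub>F (s, m) in at_top \<times>\<^sub>F sequentially. norm (?a s m) \<le> (1 / real CARD('p)) ^ s"
    proof (rule always_eventually, clarify)
      fix s m
      have "\<bar>eigenvalue (nat (int m - n) + s) ^ card (J m)\<bar> \<le> 1"
        unfolding power_abs by (intro power_le_one abs_eigenvalue_le_1) simp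
      hence "norm (?a s m) \<le> 1 * (1 / real CARD('p)) ^ s"
        unfolding real_norm_def abs_mult using cell_weight_diff_bound[OF p_gt_1] by (intro mult_mono) auto
      thus "norm (?a s m) \<le> (1 / real CARD('p)) ^ s" by simp
    qed
    show "summable (\<lambda>s. (1 / real CARD('p)) ^ s)" by (rule summable_inverse_power[OF p_gt_1])
  qed simp
  moreover have "\<forall>\<^sub>F m in sequentially. (\<Sum>s. ?a s m) =
      prob {s \<in> space M. abs_padic_quot (of_nat CARD('p) powi (- int m) * x) - (\<Sum>j\<in>J m. X j s) \<in> quot_ball (nat (int m - n))}"
  proof (rule eventually_sequentiallyI[of "nat n"])
    fix m assume "nat n \<le> m"
    hence m: "n \<le> int m" by linarith
    show "(\<Sum>s. ?a s m) = prob {s \<in> space M. abs_padic_quot (of_nat CARD('p) powi (- int m) * x) - (\<Sum>j\<in>J m. X j s) \<in> quot_ball (nat (int m - n))}"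
      using prob_sum_in_ball_sums[OF J(1) J(2), of "nat (int m - n)" m "abs_padic_quot (of_nat CARD('p) powi (- int m) * x)"]
      unfolding shell_kernel_cell_weight[OF m] by (rule sums_unique[symmetric])
  qed
  ultimately show ?thesis unfolding heat_cell_def by (rule Lim_transform_eventually)
qed

text \<open>The number of steps in a mesh interval is a difference of floors that varies with
  \<open>i\<close> and \<open>m\<close>; only its ratio to \<lambda>(m), which tends to
  \<open>h\<close>, enters the limit.\<close>

lemma scaled_walk_grid_limit:
  assumes h: "h > 0"
  shows "(\<lambda>m. prob {s \<in> space M. \<forall>i\<le>K. scaled_walk b \<sigma> X m (real i * h) s \<in> pball (a i) (- n)}) \<longlonglongrightarrow>
    (if a 0 \<in> pball 0 (- n) then \<Prod>i=1..K. heat_cell (real CARD('p)) b (\<sigma> * h) n (padic_abs (a i - a (i - 1))) else 0)"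
proof -
  let ?L = "scaling_lambda CARD('p) b \<sigma>"
  define k where "k m i = nat \<lfloor>real i * h * ?L m\<rfloor>" for m i
  let ?A = "\<lambda>m x. abs_padic_quot (of_nat CARD('p) powi (- int m) * x) :: 'p padic_quot"
  let ?J = "\<lambda>m i. {k m (i - 1)<..k m i}"
  let ?F = "\<lambda>i m. prob {s \<in> space M. ?A m (a i - a (i - 1)) - (\<Sum>j\<in>?J m i. X j s) \<in> quot_ball (nat (int m - n))}"
  have mono: "mono (k m)" for m
    unfolding k_def using h lambda_pos[of m] by (auto intro!: monoI nat_mono floor_mono mult_right_mono)
  have lim: "?F i \<longlonglongrightarrow> heat_cell (real CARD('p)) b (\<sigma> * h) n (padic_abs (a i - a (i - 1)))" if i: "i \<ge> 1" for i
  proof (rule increment_limit)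
    have "(\<lambda>m. real (k m i) / ?L m - real (k m (i - 1)) / ?L m) \<longlonglongrightarrow> real i * h - real (i - 1) * h"
      unfolding k_def using h by (intro tendsto_diff floor_scaling_limit lambda_at_top) auto
    moreover have "real i * h - real (i - 1) * h = h" using i by (simp add: of_nat_diff algebra_simps)
    moreover have "real (k m i) / ?L m - real (k m (i - 1)) / ?L m = real (card (?J m i)) / ?L m" for m
      using monoD[OF mono, of "i - 1" i m] by (simp add: of_nat_diff diff_divide_distrib)
    ultimately show "(\<lambda>m. real (card (?J m i)) / ?L m) \<longlonglongrightarrow> h" by simp
  qed auto
  have "(\<lambda>m. if a 0 \<in> pball 0 (- n) then \<Prod>i=1..K. ?F i m else 0) \<longlonglongrightarrow>
    (if a 0 \<in> pball 0 (- n) then \<Prod>i=1..K. heat_cell (real CARD('p)) b (\<sigma> * h) n (padic_abs (a i - a (i - 1))) else 0)"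
    using lim by (auto intro!: tendsto_prod)
  moreover have "\<forall>\<^sub>F m in sequentially. (if a 0 \<in> pball 0 (- n) then \<Prod>i=1..K. ?F i m else 0) =
    prob {s \<in> space M. \<forall>i\<le>K. scaled_walk b \<sigma> X m (real i * h) s \<in> pball (a i) (- n)}"
  proof (rule eventually_sequentiallyI[of "nat n"])
    fix m assume "nat n \<le> m"
    hence m: "n \<le> int m" by linarith
    have "scaled_walk b \<sigma> X m (real i * h) s \<in> pball (a i) (- n) \<longleftrightarrow> ?A m (a i) - walk X (k m i) s \<in> quot_ball (nat (int m - n))" for i s
      unfolding scaled_walk_def k_def by (subst embed_in_pball[OF m]) (rule quot_ball_minus_commute)
    hence "prob {s \<in> space M. \<forall>i\<le>K. scaled_walk b \<sigma> X m (real i * h) s \<in> pball (a i) (- n)}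
        = prob {s \<in> space M. \<forall>i\<le>K. ?A m (a i) - walk X (k m i) s \<in> quot_ball (nat (int m - n))}" by simp
    also have "\<dots> = (if ?A m (a 0) \<in> quot_ball (nat (int m - n)) then \<Prod>i=1..K. prob {s \<in> space M. (?A m (a i) - ?A m (a (i - 1))) - (\<Sum>j\<in>?J m i. X j s) \<in> quot_ball (nat (int m - n))} else 0)"
      by (rule prob_walk_grid[OF mono]) (simp add: k_def)
    finally have prob_eq: "prob {s \<in> space M. \<forall>i\<le>K. scaled_walk b \<sigma> X m (real i * h) s \<in> pball (a i) (- n)} = \<dots>" .
    have A_diff: "?A m (a i) - ?A m (a (i - 1)) = ?A m (a i - a (i - 1))" for i
      by (simp add: abs_padic_quot_diff right_diff_distrib)
    have A_0: "?A m (a 0) \<in> quot_ball (nat (int m - n)) \<longleftrightarrow> a 0 \<in> pball 0 (- n)"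
    proof -
      have "padic_quot_embed m (0 :: 'p padic_quot) = 0"
        by (simp add: padic_quot_embed_def rep_zero_frac)
      thus ?thesis using embed_in_pball[OF m, of 0 "a 0"] quot_ball_minus_commute[of 0 "?A m (a 0)"]
        by (simp add: pball_def)
    qed
    show "(if a 0 \<in> pball 0 (- n) then \<Prod>i=1..K. ?F i m else 0) =
      prob {s \<in> space M. \<forall>i\<le>K. scaled_walk b \<sigma> X m (real i * h) s \<in> pball (a i) (- n)}"
      unfolding prob_eq by (simp only: A_diff A_0)
  qed
  ultimately show ?thesis by (rule Lim_transform_eventually)
qed

end

end

subsection \<open>Skorohod distance to a grid path\<close>

text \<open>
  Seen on the grid of mesh \<open>h\<close>, the path jumps twice within time \<open>\<delta>\<close>, or once before time \<open>\<delta>\<close>. The grid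
  points need not be adjacent, which makes the property stable under refinement.
\<close>

definition irregular :: "real \<Rightarrow> real \<Rightarrow> nat \<Rightarrow> (nat \<Rightarrow> 'a) \<Rightarrow> bool" where
  "irregular h \<delta> K x \<longleftrightarrow>
     (\<exists>i0 i1 i2 i3. i0 < i1 \<and> i1 \<le> i2 \<and> i2 < i3 \<and> i3 \<le> K \<and> real (i3 - i0) * h < \<delta> \<and> x i0 \<noteq> x i1 \<and> x i2 \<noteq> x i3) \<or>
     (\<exists>i\<le>K. real i * h < \<delta> \<and> x 0 \<noteq> x i)"

text \<open>A coarse grid time is the fine grid time of twice the index. This makes the dyadic
  exceptional events increasing.\<close>

lemma irregular_refine:
  assumes "irregular h \<delta> K (\<lambda>i. x (real i * h))"
  shows "irregular (h / 2) \<delta> (2 * K) (\<lambda>i. x (real i * (h / 2)))"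
proof -
  have eq: "real (2 * i) * (h / 2) = real i * h" for i by simp
  from assms consider (a) i0 i1 i2 i3 where "i0 < i1" "i1 \<le> i2" "i2 < i3" "i3 \<le> K" "real (i3 - i0) * h < \<delta>"
        "x (real i0 * h) \<noteq> x (real i1 * h)" "x (real i2 * h) \<noteq> x (real i3 * h)"
      | (b) i where "i \<le> K" "real i * h < \<delta>" "x (real 0 * h) \<noteq> x (real i * h)"
    unfolding irregular_def by blast
  thus ?thesis
  proof cases
    case a
    have diff: "real (2 * i3 - 2 * i0) * (h / 2) = real (i3 - i0) * h" using eq[of "i3 - i0"] by (simp only: diff_mult_distrib2)
    have "2 * i0 < 2 * i1" "2 * i1 \<le> 2 * i2" "2 * i2 < 2 * i3" "2 * i3 \<le> 2 * K" using a by linarith+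
    moreover have "x (real (2 * i0) * (h / 2)) \<noteq> x (real (2 * i1) * (h / 2))"
      "x (real (2 * i2) * (h / 2)) \<noteq> x (real (2 * i3) * (h / 2))" "real (2 * i3 - 2 * i0) * (h / 2) < \<delta>"
      unfolding eq diff by (rule a)+
    ultimately show ?thesis unfolding irregular_def by blast
  next
    case b
    have "x (real 0 * (h / 2)) \<noteq> x (real (2 * i) * (h / 2))" "real (2 * i) * (h / 2) < \<delta>" "2 * i \<le> 2 * K"
      unfolding eq using b by simp_all
    thus ?thesis unfolding irregular_def by blast
  qed
qed

text \<open>For negative \<open>t\<close>, \<^const>\<open>nat\<close> truncates the index to \<open>0\<close>, as the encoding of paths demands.\<close>

definition grid_path :: "real \<Rightarrow> nat \<Rightarrow> (nat \<Rightarrow> 'a::metric_space) \<Rightarrow> 'a cadlag" where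
  "grid_path h K w = Abs_cadlag (\<lambda>t. w (min K (nat \<lfloor>t / h\<rfloor>)))"

lemma sample_path_grid_path:
  assumes h: "h > 0"
  shows "sample_path (grid_path h K w) = (\<lambda>t. w (min K (nat \<lfloor>t / h\<rfloor>)))"
  unfolding grid_path_def
proof (rule Abs_cadlag_inverse, intro CollectI conjI allI impI)
  let ?y = "\<lambda>t. w (min K (nat \<lfloor>t / h\<rfloor>))"
  fix t :: real
  show "(?y \<longlongrightarrow> ?y t) (at_right t)"
  proof (rule tendsto_eventually)
    have "\<lfloor>s / h\<rfloor> = \<lfloor>t / h\<rfloor>" if "t < s" "s < (of_int \<lfloor>t / h\<rfloor> + 1) * h" for s
    proof (rule floor_unique)
      have "of_int \<lfloor>t / h\<rfloor> \<le> t / h" by simp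
      also have "t / h \<le> s / h" using that h by (simp add: divide_right_mono)
      finally show "of_int \<lfloor>t / h\<rfloor> \<le> s / h" .
      show "s / h < of_int \<lfloor>t / h\<rfloor> + 1" using that h by (simp add: field_simps)
    qed
    moreover have "t / h < of_int \<lfloor>t / h\<rfloor> + 1" by linarith
    hence "t < (of_int \<lfloor>t / h\<rfloor> + 1) * h" using h by (simp only: pos_divide_less_eq)
    ultimately show "\<forall>\<^sub>F s in at_right t. ?y s = ?y t"
      unfolding eventually_at_right_field by (intro exI[of _ "(of_int \<lfloor>t / h\<rfloor> + 1) * h"]) auto
  qed
next
  let ?y = "\<lambda>t. w (min K (nat \<lfloor>t / h\<rfloor>))"
  fix t :: real
  have A: "\<lfloor>s / h\<rfloor> = \<lceil>t / h\<rceil> - 1" if "s < t" "(of_int \<lceil>t / h\<rceil> - 1) * h < s" for s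
  proof (rule floor_unique)
    show "of_int (\<lceil>t / h\<rceil> - 1) \<le> s / h" using that h by (simp add: field_simps)
    have "s / h < t / h" using that h by (simp add: divide_strict_right_mono)
    thus "s / h < of_int (\<lceil>t / h\<rceil> - 1) + 1" by (simp add: le_of_int_ceiling order_less_le_trans)
  qed
  have "of_int \<lceil>t / h\<rceil> - 1 < t / h" by linarith
  hence B: "(of_int \<lceil>t / h\<rceil> - 1) * h < t" using h by (simp only: pos_less_divide_eq)
  have "\<forall>\<^sub>F s in at_left t. w (min K (nat (\<lceil>t / h\<rceil> - 1))) = ?y s"
    unfolding eventually_at_left_field
  proof (intro exI[of _ "(of_int \<lceil>t / h\<rceil> - 1) * h"] conjI allI impI B)
    fix s assume "(of_int \<lceil>t / h\<rceil> - 1) * h < s" "s < t"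
    thus "w (min K (nat (\<lceil>t / h\<rceil> - 1))) = ?y s" by (subst A) simp_all
  qed
  from Lim_transform_eventually[OF tendsto_const this] show "\<exists>l. (?y \<longlongrightarrow> l) (at_left t)" by (rule exI)
next
  fix t :: real assume "t < 0"
  hence "\<lfloor>t / h\<rfloor> \<le> 0" using h by (simp add: divide_less_0_iff)
  thus "w (min K (nat \<lfloor>t / h\<rfloor>)) = w (min K (nat \<lfloor>0 / h\<rfloor>))" by simp
qed

section \<open>Time changes by tents, and the stopped distance integral\<close>

lemma ln_ratio_bound:
  fixes \<kappa> r :: real
  assumes "0 \<le> \<kappa>" "\<kappa> \<le> 1 / 2" "1 - \<kappa> \<le> r" "r \<le> 1 + \<kappa>"
  shows "\<bar>ln r\<bar> \<le> 2 * \<kappa>"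
proof -
  have r: "r > 0" using assms by linarith
  have "ln r \<le> ln (1 + \<kappa>)" using assms r by simp
  also have "\<dots> \<le> \<kappa>" using assms by (intro ln_add_one_self_le_self) auto
  finally have 1: "ln r \<le> 2 * \<kappa>" using assms by linarith
  \<comment> \<open>The restriction to \<kappa> <= 1/2 absorbs the quadratic error of the logarithm
    into the factor 2.\<close>
  have "2 * \<kappa>\<^sup>2 \<le> \<kappa>" using assms mult_left_mono[of "\<kappa>" "1/2" "2 * \<kappa>"] by (simp add: power2_eq_square)
  moreover have "- \<kappa> - 2 * \<kappa>\<^sup>2 \<le> ln (1 - \<kappa>)" using assms by (intro ln_one_minus_pos_lower_bound) auto
  moreover have "ln (1 - \<kappa>) \<le> ln r" using assms by simp
  ultimately show ?thesis using 1 by linarith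
qed

text \<open>
  A time change that moves the jump times \<open>J\<close> of a path to the next grid times \<open>g\<close>: add the upper
  envelope of tents of slope \<open>\<kappa>\<close> centred at the jump times. Separation of the jumps keeps each tent
  from disturbing the tips of the others.
\<close>

locale tent_time_change =
  fixes J :: "real set" and g :: "real \<Rightarrow> real" and h \<kappa> :: real
  assumes h: "h > 0" and \<kappa>: "0 < \<kappa>" "\<kappa> \<le> 1 / 2"
    and g: "\<And>s. s \<in> J \<Longrightarrow> s \<le> g s" "\<And>s. s \<in> J \<Longrightarrow> g s \<le> s + h"
    and sep: "\<And>s s'. s \<in> J \<Longrightarrow> s' \<in> J \<Longrightarrow> s < s' \<Longrightarrow> h \<le> \<kappa> * (s' - s)"
    and start: "\<And>s. s \<in> J \<Longrightarrow> h \<le> \<kappa> * s"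
begin

text \<open>The inserted 0 keeps the envelope nonnegative, so time is never moved backwards, and
  covers a path without jumps.\<close>

definition tent :: "real \<Rightarrow> real" where
  "tent t = Sup (insert 0 ((\<lambda>s. g s - s - \<kappa> * \<bar>t - s\<bar>) ` J))"

definition change :: "real \<Rightarrow> real" where "change t = t + tent t"

lemma tent_bdd: "bdd_above (insert 0 ((\<lambda>s. g s - s - \<kappa> * \<bar>t - s\<bar>) ` J))"
proof (rule bdd_aboveI[of _ h])
  fix x assume "x \<in> insert 0 ((\<lambda>s. g s - s - \<kappa> * \<bar>t - s\<bar>) ` J)"
  moreover have "g s - s - \<kappa> * \<bar>t - s\<bar> \<le> h" if "s \<in> J" for s
  proof -
    have "0 \<le> \<kappa> * \<bar>t - s\<bar>" using \<kappa>(1) by simp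
    thus ?thesis using g(2)[OF that] by linarith
  qed
  ultimately show "x \<le> h" using h by auto
qed

lemma tent_ge: "s \<in> J \<Longrightarrow> g s - s - \<kappa> * \<bar>t - s\<bar> \<le> tent t" and tent_nonneg: "0 \<le> tent t"
  unfolding tent_def by (intro cSup_upper tent_bdd; simp)+

lemma tent_le:
  assumes "0 \<le> c" "\<And>s. s \<in> J \<Longrightarrow> g s - s - \<kappa> * \<bar>t - s\<bar> \<le> c" shows "tent t \<le> c"
  unfolding tent_def using assms by (intro cSup_least) auto

lemma tent_lipschitz_le: "tent t \<le> tent t' + \<kappa> * \<bar>t - t'\<bar>"
proof (rule tent_le)
  show "0 \<le> tent t' + \<kappa> * \<bar>t - t'\<bar>" using tent_nonneg[of t'] \<kappa>(1) by simp
  fix s assume s: "s \<in> J"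
  have "\<kappa> * \<bar>t' - s\<bar> \<le> \<kappa> * (\<bar>t - s\<bar> + \<bar>t - t'\<bar>)" using \<kappa>(1) by (intro mult_left_mono) auto
  thus "g s - s - \<kappa> * \<bar>t - s\<bar> \<le> tent t' + \<kappa> * \<bar>t - t'\<bar>" using tent_ge[OF s, of t'] by (simp add: algebra_simps)
qed

lemma tent_lipschitz: "\<bar>tent t - tent t'\<bar> \<le> \<kappa> * \<bar>t - t'\<bar>"
  using tent_lipschitz_le[of t t'] tent_lipschitz_le[of t' t] by (simp add: abs_minus_commute abs_le_iff)

text \<open>A tent has height at most \<open>h\<close>, hence fades out within h / \<kappa>, and by
  \<open>start\<close> every jump is at least that far from 0.\<close>

lemma tent_0: "tent 0 = 0"
proof (rule antisym[OF tent_le tent_nonneg])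
  fix s assume s: "s \<in> J"
  hence "s > 0" using start[OF s] h \<kappa>(1) by (metis less_le_trans zero_less_mult_pos)
  thus "g s - s - \<kappa> * \<bar>0 - s\<bar> \<le> 0" using start[OF s] g(2)[OF s] by simp
qed simp

text \<open>By \<open>sep\<close> every other tent has faded out at the jump \<open>s\<close>, so
  the tip of the tent of \<open>s\<close> is the envelope there.\<close>

lemma change_jump:
  assumes s: "s \<in> J" shows "change s = g s"
proof -
  have "tent s \<le> g s - s"
  proof (rule tent_le)
    fix s' assume s': "s' \<in> J"
    show "g s' - s' - \<kappa> * \<bar>s - s'\<bar> \<le> g s - s"
    proof (cases "s' = s")
      case False
      have "h \<le> \<kappa> * \<bar>s - s'\<bar>"
      proof (cases "s < s'")
        case True
        thus ?thesis using sep[OF s s' True] by simp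
      next
        case ge: False
        hence less: "s' < s" using False by simp
        thus ?thesis using sep[OF s' s less] by simp
      qed
      thus ?thesis using g(2)[OF s'] g(1)[OF s] by linarith
    qed simp
  qed (use g(1)[OF s] in simp)
  thus ?thesis using tent_ge[OF s, of s] by (simp add: change_def)
qed

lemma change_ge: "t \<le> change t"
  using tent_nonneg by (simp add: change_def)

lemma change_increment:
  assumes "s < t"
  shows "(1 - \<kappa>) * (t - s) \<le> change t - change s" "change t - change s \<le> (1 + \<kappa>) * (t - s)"
  using tent_lipschitz[of t s] assms by (auto simp: change_def algebra_simps abs_le_iff)

lemma change_strict_mono: "s < t \<Longrightarrow> change s < change t"
proof -
  assume "s < t"
  hence "0 < (1 - \<kappa>) * (t - s)" using \<kappa> by (intro mult_pos_pos) auto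
  thus ?thesis using change_increment(1)[OF \<open>s < t\<close>] by linarith
qed

lemma change_surj: "y \<ge> 0 \<Longrightarrow> \<exists>t\<ge>0. t \<le> y \<and> change t = y"
proof -
  assume y: "y \<ge> 0"
  have "continuous_on UNIV tent"
    by (rule lipschitz_on_continuous_on[of \<kappa>]) (rule lipschitz_onI, use tent_lipschitz \<kappa> in \<open>auto simp: dist_real_def\<close>)
  hence "continuous_on {0..y} change"
    unfolding change_def by (intro continuous_intros) (auto intro: continuous_on_subset)
  moreover have "change 0 \<le> y" "y \<le> change y" using y change_ge by (auto simp: change_def tent_0)
  ultimately obtain t where "0 \<le> t" "t \<le> y" "change t = y" using IVT'[of change 0 y y] y by blast
  thus ?thesis by blast
qed

lemma change_ratio_bound: "s < t \<Longrightarrow> \<bar>ln ((change t - change s) / (t - s))\<bar> \<le> 2 * \<kappa>"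
  using change_increment[of s t] \<kappa> by (intro ln_ratio_bound) (auto simp: field_simps)

lemma change_in_time_changes: "change \<in> time_changes"
  unfolding time_changes_def
proof (intro CollectI conjI)
  show "strict_mono_on {0..} change" by (auto simp: strict_mono_on_def change_strict_mono)
  show "change ` {0..} = {0..}"
  proof (intro equalityI subsetI)
    fix y assume "y \<in> change ` {0..}"
    then obtain t where "t \<ge> 0" "y = change t" by auto
    thus "y \<in> {0..}" using change_ge[of t] by simp
  next
    fix y :: real assume "y \<in> {0..}"
    thus "y \<in> change ` {0..}" using change_surj[of y] by (auto simp: image_iff)
  qed
  show "bdd_above ((\<lambda>(s, t). \<bar>ln ((change t - change s) / (t - s))\<bar>) ` {(s, t). 0 \<le> s \<and> s < t})"
    by (intro bdd_aboveI2[where M = "2 * \<kappa>"]) (auto simp: change_ratio_bound)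
qed

lemma change_size: "time_change_size change \<le> 2 * \<kappa>"
  unfolding time_change_size_def
proof (rule cSUP_least)
  have "(0, 1) \<in> {(s::real, t). 0 \<le> s \<and> s < t}" by simp
  thus "{(s::real, t). 0 \<le> s \<and> s < t} \<noteq> {}" by blast
qed (auto simp: change_ratio_bound)

end

lemma exp_tail_integral: "(LINT u:{T..}|lborel. exp (- u)) = exp (- T)" if "T \<ge> 0" for T :: real
proof -
  have "set_integrable lborel {T..} (\<lambda>u. exp (- u) :: real)"
    by (rule set_integrable_subset[OF exp_integrable]) (use that in auto)
  from set_borel_integral_eq_integral(2)[OF this]
  have "(LINT u:{T..}|lborel. exp (- u)) = integral {T..} (\<lambda>u. exp (- u))" .
  also have "\<dots> = exp (- T)"
    using has_integral_exp_minus_to_infinity[of 1 T] by (intro integral_unique) simp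
  finally show ?thesis .
qed

text \<open>The weighted integrand is at most 1 on \<open>B\<close> and at most exp(-u) beyond
  \<open>T\<close>; elsewhere \<open>\<eta>\<close> bounds it against a density of total mass
  1.\<close>

lemma stopped_path_integral_le:
  assumes l: "l \<in> time_changes" and T: "T \<ge> 0" and \<eta>: "\<eta> \<ge> 0"
    and B: "B \<in> sets borel" "emeasure lborel B < \<infinity>"
    and le: "\<And>u. 0 \<le> u \<Longrightarrow> u < T \<Longrightarrow> u \<notin> B \<Longrightarrow> stopped_path_dist x y l u \<le> \<eta>"
  shows "stopped_path_integral x y l \<le> \<eta> + measure lborel B + exp (- T)"
proof -
  have int1: "set_integrable lborel {0..} (\<lambda>u. \<eta> * exp (- u))"
    by (rule set_integrable_mult_right) (rule exp_integrable)
  have int2: "set_integrable lborel {0..} (\<lambda>u. indicator B u :: real)"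
  proof -
    have "integrable lborel (\<lambda>u. indicator ({0..} \<inter> B) u :: real)"
      using B by (intro integrable_real_indicator) (auto intro: le_less_trans[OF emeasure_mono])
    thus ?thesis by (simp add: set_integrable_def indicator_inter_arith)
  qed
  have int3: "set_integrable lborel {0..} (\<lambda>u. indicator {T..} u * exp (- u) :: real)"
  proof -
    have "set_integrable lborel {T..} (\<lambda>u. exp (- u) :: real)"
      by (rule set_integrable_subset[OF exp_integrable]) (use T in auto)
    moreover have "indicator {0..} u *\<^sub>R (indicator {T..} u * exp (- u)) = indicator {T..} u *\<^sub>R exp (- u :: real)" for u
      using T by (auto simp: indicator_def)
    ultimately show ?thesis unfolding set_integrable_def by (simp only:)
  qed
  have "stopped_path_integral x y l \<le> (LINT u:{0..}|lborel. \<eta> * exp (- u) + indicator B u + indicator {T..} u * exp (- u))"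
  proof (rule set_integral_mono)
    show "set_integrable lborel {0..} (\<lambda>u. exp (- u) * stopped_path_dist x y l u)"
      by (rule stopped_path_dist_integrable[OF l])
    show "set_integrable lborel {0..} (\<lambda>u. \<eta> * exp (- u) + indicator B u + indicator {T..} u * exp (- u))"
      by (intro set_integral_add int1 int2 int3)
    fix u :: real assume u: "u \<in> {0..}"
    have e1: "exp (- u) * stopped_path_dist x y l u \<le> exp (- u)" by (simp add: stopped_path_dist_le_1 mult_left_le)
    have e2: "exp (- u) \<le> 1" using u by simp
    have e0: "0 \<le> \<eta> * exp (- u)" using \<eta> by simp
    consider "u \<in> B" | "u \<ge> T" | "u \<notin> B" "u < T" by linarith
    thus "exp (- u) * stopped_path_dist x y l u \<le> \<eta> * exp (- u) + indicator B u + indicator {T..} u * exp (- u)"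
    proof cases
      case 1
      have "0 \<le> indicator {T..} u * exp (- u)" by simp
      moreover have "indicator B u = (1 :: real)" using 1 by simp
      ultimately show ?thesis using e0 e1 e2 by linarith
    next
      case 2
      have "0 \<le> (indicator B u :: real)" by simp
      moreover have "indicator {T..} u * exp (- u) = exp (- u)" using 2 by simp
      ultimately show ?thesis using e0 e1 by linarith
    next
      case 3
      have "exp (- u) * stopped_path_dist x y l u \<le> exp (- u) * \<eta>"
        using le[of u] 3 u by (intro mult_left_mono) auto
      thus ?thesis using 3 by (simp add: mult.commute)
    qed
  qed
  also have "\<dots> = (LINT u:{0..}|lborel. \<eta> * exp (- u)) + (LINT u:{0..}|lborel. indicator B u) + (LINT u:{0..}|lborel. indicator {T..} u * exp (- u))"
    using int1 int2 int3 by (simp add: set_integral_add)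
  also have "(LINT u:{0..}|lborel. \<eta> * exp (- u)) = \<eta>"
    using exp_tail_integral[of 0] by simp
  also have "(LINT u:{0..}|lborel. indicator {T..} u * exp (- u)) = exp (- T)"
  proof -
    have "(LINT u:{0..}|lborel. indicator {T..} u * exp (- u)) = (LINT u:{T..}|lborel. exp (- u))"
      unfolding set_lebesgue_integral_def using T by (intro Bochner_Integration.integral_cong) (auto simp: indicator_def)
    thus ?thesis using exp_tail_integral[OF T] by simp
  qed
  also have "(LINT u:{0..}|lborel. indicator B u) \<le> measure lborel B"
  proof -
    have "(LINT u:{0..}|lborel. (indicator B u :: real)) = (LINT u|lborel. indicator ({0..} \<inter> B) u)"
      unfolding set_lebesgue_integral_def by (simp add: indicator_inter_arith)
    also have "\<dots> = measure lborel ({0..} \<inter> B)" by simp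
    also have "\<dots> \<le> measure lborel B" using B by (intro measure_mono_fmeasurable) (auto simp: fmeasurable_def)
    finally show ?thesis .
  qed
  finally show ?thesis by simp
qed

section \<open>Jumps of paths that are constant to the right of every time\<close>

definition jumps :: "(real \<Rightarrow> 'b) \<Rightarrow> real \<Rightarrow> real set" where
  "jumps x T = {s. 0 < s \<and> s \<le> T \<and> \<not> (\<forall>\<^sub>F r in at_left s. x r = x s)}"

context
  fixes x :: "real \<Rightarrow> 'b"
  assumes rc: "\<And>t. \<forall>\<^sub>F s in at_right t. x s = x t"
begin

lemma right_constant: "\<exists>e>t. \<forall>s. t < s \<and> s < e \<longrightarrow> x s = x t"
  using rc[of t] unfolding eventually_at_right_field by blast

text \<open>A supremum argument: the absence of a jump carries constancy up to the supremum
  \<open>w\<close> of the good times, and right constancy carries it beyond, so \<open>w\<close> is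
  \<open>v\<close>.\<close>

lemma constant_between_jumps:
  assumes "0 \<le> u" "u \<le> v" "v \<le> T" "jumps x T \<inter> {u<..v} = {}"
  shows "x u = x v"
proof -
  define S where "S = {w. u \<le> w \<and> w \<le> v \<and> (\<forall>z. u \<le> z \<and> z \<le> w \<longrightarrow> x z = x u)}"
  have "x z = x u" if "u \<le> z" "z \<le> u" for z using antisym[OF that] by simp
  hence uS: "u \<in> S" using assms(2) by (auto simp: S_def)
  have bdd: "bdd_above S" by (rule bdd_aboveI[of _ v]) (simp add: S_def)
  define w where "w = Sup S"
  have uw: "u \<le> w" unfolding w_def by (rule cSup_upper[OF uS bdd])
  have wv: "w \<le> v" unfolding w_def
  proof (rule cSup_least)
    show "S \<noteq> {}" using uS by blast
    show "y \<le> v" if "y \<in> S" for y using that unfolding S_def by blast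
  qed
  have below: "x z = x u" if z: "u \<le> z" "z < w" for z
  proof -
    obtain y where "y \<in> S" "z < y" using less_cSupD[of S z] uS z(2) unfolding w_def by blast
    hence "\<forall>z. u \<le> z \<and> z \<le> y \<longrightarrow> x z = x u" unfolding S_def by blast
    moreover have "z \<le> y" using \<open>z < y\<close> by simp
    ultimately show ?thesis using z(1) by blast
  qed
  have xw: "x w = x u"
  proof (cases "u = w")
    case False
    hence "u < w" using uw by simp
    hence "w \<notin> jumps x T" "0 < w" "w \<le> T" using assms wv by auto
    hence "\<forall>\<^sub>F r in at_left w. x r = x w" by (simp add: jumps_def)
    then obtain c where c: "c < w" "\<And>r. c < r \<Longrightarrow> r < w \<Longrightarrow> x r = x w" unfolding eventually_at_left_field by blast
    define r where "r = (max c u + w) / 2"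
    have "c < r" "u < r" "r < w" using c(1) \<open>u < w\<close> by (auto simp: r_def)
    thus ?thesis using c(2)[of r] below[of r] by simp
  qed simp
  show ?thesis
  proof (cases "w = v")
    case False
    obtain e where e: "e > w" "\<And>s. w < s \<Longrightarrow> s < e \<Longrightarrow> x s = x w" using right_constant[of w] by blast
    define y where "y = min v ((w + e) / 2)"
    have y: "w < y" "y < e" "y \<le> v" using False wv e(1) by (auto simp: y_def min_def)
    have "x z = x u" if z: "u \<le> z" "z \<le> y" for z
      using below[of z] e(2)[of z] xw z y(2) by (cases "z < w"; cases "z = w") auto
    moreover have "u \<le> y" using y(1) uw by simp
    ultimately have "y \<in> S" using y(3) unfolding S_def by blast
    hence "y \<le> w" unfolding w_def by (rule cSup_upper[OF _ bdd])
    thus ?thesis using y by simp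
  qed (use xw in simp)
qed

lemma dyadic_between:
  assumes "0 \<le> a" "a + 1 / 2 ^ j < b"
  shows "\<exists>i. a < real i * (1 / 2 ^ j) \<and> real i * (1 / 2 ^ j) < b"
proof -
  define i where "i = nat \<lfloor>a * 2 ^ j\<rfloor> + 1"
  have "a * 2 ^ j \<ge> 0" using assms by simp
  hence i: "a * 2 ^ j < real i" "real i \<le> a * 2 ^ j + 1" unfolding i_def by linarith+
  have "(a + 1 / 2 ^ j) * 2 ^ j < b * 2 ^ j" using assms(2) by (intro mult_strict_right_mono) auto
  hence "real i < b * 2 ^ j" using i(2) by (simp add: distrib_right)
  thus ?thesis using i(1) by (intro exI[of _ i]) (simp add: pos_less_divide_eq pos_divide_less_eq)
qed

text \<open>Two jumps closer than \<open>\<delta>\<close> show four values, before and at each jump.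
  By right constancy each value persists on a short interval, and a fine enough dyadic grid has a
  point in all four intervals, which makes it irregular.\<close>

lemma jumps_separated:
  fixes T :: nat
  assumes \<delta>: "\<delta> > 0"
    and reg: "\<And>j. \<not> irregular (1 / 2 ^ j) \<delta> ((T + 1) * 2 ^ j) (\<lambda>i. x (real i * (1 / 2 ^ j)))"
  shows "s \<in> jumps x T \<Longrightarrow> s' \<in> jumps x T \<Longrightarrow> s < s' \<Longrightarrow> \<delta> \<le> s' - s"
    and "s \<in> jumps x T \<Longrightarrow> \<delta> \<le> s"
proof -
  have small: "\<exists>j. 1 / 2 ^ j < e" if "e > 0" for e :: real
    using real_arch_pow_inv[OF that, of "1 / 2"] by (auto simp: power_divide)
  have le_K: "i \<le> (T + 1) * 2 ^ j" if "real i * (1 / 2 ^ j) < real T + 1" for i j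
  proof -
    have "real i < (real T + 1) * 2 ^ j" using that by (simp add: pos_divide_less_eq)
    also have "\<dots> = real ((T + 1) * 2 ^ j)" by (simp add: distrib_right)
    finally show ?thesis by (simp only: of_nat_less_iff less_imp_le)
  qed
  have mono: "i < k" if "real i * (1 / 2 ^ j) < real k * (1 / 2 ^ j)" for i k j
  proof (rule ccontr)
    assume "\<not> i < k"
    hence "real k * (1 / 2 ^ j) \<le> real i * (1 / 2 ^ j)" by (intro mult_right_mono) auto
    thus False using that by simp
  qed
  have before: "\<exists>r. max a 0 \<le> r \<and> r < s \<and> x r \<noteq> x s" if "s \<in> jumps x T" "a < s" for s a
  proof (rule ccontr)
    assume n: "\<nexists>r. max a 0 \<le> r \<and> r < s \<and> x r \<noteq> x s"
    have "\<forall>\<^sub>F r in at_left s. x r = x s" unfolding eventually_at_left_field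
      by (rule exI[of _ "max a 0"]) (use that n in \<open>auto simp: jumps_def less_imp_le\<close>)
    thus False using that(1) by (simp add: jumps_def)
  qed
  show "\<delta> \<le> s' - s" if s: "s \<in> jumps x T" and s': "s' \<in> jumps x T" and less: "s < s'"
  proof (rule ccontr)
    assume "\<not> \<delta> \<le> s' - s"
    hence "s' - \<delta> < s" by simp
    have sT: "0 < s" "s' \<le> T" using s s' by (auto simp: jumps_def)
    obtain r0 where r0: "max ((s' - \<delta> + s) / 2) 0 \<le> r0" "r0 < s" "x r0 \<noteq> x s"
      using before[OF s, of "(s' - \<delta> + s) / 2"] \<open>s' - \<delta> < s\<close> by auto
    have r0': "0 \<le> r0" "s' - \<delta> < r0" using r0 \<open>s' - \<delta> < s\<close> by auto
    obtain r1 where r1: "max ((s + s') / 2) 0 \<le> r1" "r1 < s'" "x r1 \<noteq> x s'"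
      using before[OF s', of "(s + s') / 2"] less by auto
    have r1': "s < r1" using r1 less by auto
    obtain e0 where e0: "e0 > r0" "\<And>z. r0 < z \<Longrightarrow> z < e0 \<Longrightarrow> x z = x r0" using right_constant by blast
    obtain e1 where e1: "e1 > s" "\<And>z. s < z \<Longrightarrow> z < e1 \<Longrightarrow> x z = x s" using right_constant by blast
    obtain e2 where e2: "e2 > r1" "\<And>z. r1 < z \<Longrightarrow> z < e2 \<Longrightarrow> x z = x r1" using right_constant by blast
    obtain e3 where e3: "e3 > s'" "\<And>z. s' < z \<Longrightarrow> z < e3 \<Longrightarrow> x z = x s'" using right_constant by blast
    \<comment> \<open>Right ends of the four intervals, which start at \<open>r0\<close>,
      \<open>s\<close>, \<open>r1\<close> and \<open>s'\<close>: they keep the grid points in order,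
      their total span below \<open>\<delta>\<close>, and the last one below T + 1. The extra unit
      of time leaves room to the right of a jump at \<open>T\<close>.\<close>
    define b0 b1 b2 b3 where b: "b0 = min e0 s" "b1 = min e1 r1" "b2 = min e2 s'" "b3 = min (min e3 (r0 + \<delta>)) (real T + 1)"
    define e where "e = min (min (b0 - r0) (b1 - s)) (min (b2 - r1) (b3 - s'))"
    have "e > 0" using e0 e1 e2 e3 r0 r0' r1 r1' sT by (auto simp: e_def b)
    then obtain j where j: "1 / 2 ^ j < e" using small by blast
    let ?q = "\<lambda>i. real i * (1 / 2 ^ j)"
    obtain i0 where i0: "r0 < ?q i0" "?q i0 < b0" using dyadic_between[of r0 j b0] j r0' by (auto simp: e_def)
    obtain i1 where i1: "s < ?q i1" "?q i1 < b1" using dyadic_between[of s j b1] j sT by (auto simp: e_def)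
    obtain i2 where i2: "r1 < ?q i2" "?q i2 < b2" using dyadic_between[of r1 j b2] j sT r1' by (auto simp: e_def)
    obtain i3 where i3: "s' < ?q i3" "?q i3 < b3" using dyadic_between[of s' j b3] j sT less by (auto simp: e_def)
    have o1: "i0 < i1" by (rule mono[where j = j]) (use i0 i1 in \<open>simp add: b\<close>)
    have o2: "i1 < i2" by (rule mono[where j = j]) (use i1 i2 in \<open>simp add: b\<close>)
    have o3: "i2 < i3" by (rule mono[where j = j]) (use i2 i3 in \<open>simp add: b\<close>)
    have o4: "i3 \<le> (T + 1) * 2 ^ j" by (rule le_K) (use i3 in \<open>simp add: b\<close>)
    have "real (i3 - i0) * (1 / 2 ^ j) = ?q i3 - ?q i0"
      using o1 o2 o3 by (simp add: of_nat_diff left_diff_distrib diff_divide_distrib)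
    also have "\<dots> < \<delta>" using i0 i3 by (simp add: b)
    finally have o5: "real (i3 - i0) * (1 / 2 ^ j) < \<delta>" .
    have "x (?q i0) = x r0" using e0(2) i0 by (simp add: b)
    moreover have "x (?q i1) = x s" using e1(2) i1 by (simp add: b)
    moreover have "x (?q i2) = x r1" using e2(2) i2 by (simp add: b)
    moreover have "x (?q i3) = x s'" using e3(2) i3 by (simp add: b)
    ultimately have "x (?q i0) \<noteq> x (?q i1)" "x (?q i2) \<noteq> x (?q i3)" using r0(3) r1(3) by simp_all
    hence "irregular (1 / 2 ^ j) \<delta> ((T + 1) * 2 ^ j) (\<lambda>i. x (?q i))"
      unfolding irregular_def using o1 less_imp_le[OF o2] o3 o4 o5 by blast
    thus False using reg by blast
  qed
  show "\<delta> \<le> s" if s: "s \<in> jumps x T"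
  proof (rule ccontr)
    assume n: "\<not> \<delta> \<le> s"
    have sT: "0 < s" "s \<le> T" using s by (auto simp: jumps_def)
    obtain r where r: "0 \<le> r" "r < s" "x r \<noteq> x s" using before[OF s, of 0] sT by auto
    \<comment> \<open>Irregularity near 0 compares with time 0, whereas a jump compares with earlier
      times: if the value at \<open>s\<close> is again that at 0, the time \<open>r\<close> before
      it differs from both.\<close>
    obtain z where z: "0 \<le> z" "z \<le> s" "x z \<noteq> x 0"
    proof (cases "x s = x 0")
      case True
      thus ?thesis using that[of r] r by simp
    next
      case False
      thus ?thesis using that[of s] sT by simp
    qed
    obtain e0 where e0: "e0 > z" "\<And>y. z < y \<Longrightarrow> y < e0 \<Longrightarrow> x y = x z" using right_constant by blast
    define b where "b = min (min e0 \<delta>) (real T + 1)"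
    have "b - z > 0" using e0 z n sT by (auto simp: b_def)
    then obtain j where j: "1 / 2 ^ j < b - z" using small by blast
    let ?q = "\<lambda>i. real i * (1 / 2 ^ j)"
    obtain i where i: "z < ?q i" "?q i < b" using dyadic_between[of z j b] j z by auto
    have "x (?q i) = x z" using e0(2) i by (simp add: b_def)
    hence "x (?q 0) \<noteq> x (?q i)" using z by simp
    moreover have "i \<le> (T + 1) * 2 ^ j" by (rule le_K) (use i in \<open>simp add: b_def\<close>)
    moreover have "?q i < \<delta>" using i by (simp add: b_def)
    ultimately have "irregular (1 / 2 ^ j) \<delta> ((T + 1) * 2 ^ j) (\<lambda>i. x (?q i))"
      unfolding irregular_def by blast
    thus False using reg by blast
  qed
qed

end

text \<open>After the time change the projected path and the grid path jump together, so they differ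
  from the original by at most \<open>\<eta>\<close>. An error remains only if the stopping level
  \<open>u\<close> lies between a jump and the grid time it is moved to; there are at most T /
  \<delta> + 1 such intervals, of length at most \<open>h\<close>.\<close>

lemma skorohod_dist_grid_path:
  fixes \<omega> :: "'a::metric_space cadlag" and T K :: nat
  assumes near: "\<And>y. dist y (f y) \<le> \<eta>" and loc: "r > 0" "\<And>y z. dist y z < r \<Longrightarrow> f y = f z"
    and \<delta>: "\<delta> > 0" and h: "h > 0" "2 * h \<le> \<delta>" and K: "real K * h = T"
    and reg: "\<And>j. \<not> irregular (1 / 2 ^ j) \<delta> ((T + 1) * 2 ^ j) (\<lambda>i. f (sample_path \<omega> (real i * (1 / 2 ^ j))))"
  shows "skorohod_dist \<omega> (grid_path h K (\<lambda>i. f (sample_path \<omega> (real i * h))))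
    \<le> max (2 * (h / \<delta>)) (\<eta> + h * (T / \<delta> + 1) + exp (- real T))"
proof -
  define x where "x t = f (sample_path \<omega> t)" for t
  have rc: "\<forall>\<^sub>F s in at_right t. x s = x t" for t
    using tendstoD[OF path_right_continuous loc(1), of \<omega> t] by eventually_elim (simp add: x_def loc(2))
  let ?J = "jumps x T"
  define g where "g s = h * of_int \<lceil>s / h\<rceil>" for s
  \<comment> \<open>The slope at which a tent of height \<open>h\<close> fades out within
    \<open>\<delta>\<close>, the guaranteed distance between jumps.\<close>
  define \<kappa> where "\<kappa> = h / \<delta>"
  note apart = jumps_separated[OF rc \<delta> reg[folded x_def]]
  have \<eta>: "\<eta> \<ge> 0" using near[of undefined] zero_le_dist order_trans by blast
  have J: "0 < s" "s \<le> T" if "s \<in> ?J" for s using that by (auto simp: jumps_def)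
  have g_ge: "s \<le> g s" for s
  proof -
    have "s / h \<le> of_int \<lceil>s / h\<rceil>" by simp
    hence "s \<le> of_int \<lceil>s / h\<rceil> * h" using h(1) by (simp only: pos_divide_le_eq)
    thus ?thesis by (simp add: g_def mult.commute)
  qed
  have g_le: "g s \<le> s + h" for s
  proof -
    have "of_int \<lceil>s / h\<rceil> \<le> s / h + 1" by linarith
    hence "h * of_int \<lceil>s / h\<rceil> \<le> h * (s / h + 1)" using h(1) by (intro mult_left_mono) auto
    thus ?thesis using h(1) by (simp add: g_def distrib_left)
  qed
  have h_le: "h \<le> \<kappa> * d" if "\<delta> \<le> d" for d
    using that h(1) \<delta> by (simp add: \<kappa>_def pos_le_divide_eq)
  interpret tent_time_change ?J g h \<kappa>
  proof
    show "0 < \<kappa>" "\<kappa> \<le> 1 / 2" using h \<delta> by (simp_all add: \<kappa>_def field_simps)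
  qed (use h g_ge g_le h_le apart in auto)
  let ?w = "\<lambda>i. x (real i * h)"
  let ?y = "grid_path h K ?w"
  note path = sample_path_grid_path[OF h(1), of K ?w]
  \<comment> \<open>The last grid time before \<open>change t\<close> and \<open>t\<close> itself
    have no jump between them, because jumps are sent exactly to the grid times obtained by rounding
    up.\<close>
  have key: "sample_path ?y (change t) = x t" if t: "t \<ge> 0" "change t \<le> T" for t
  proof -
    define i where "i = nat \<lfloor>change t / h\<rfloor>"
    have c0: "change t \<ge> 0" using change_ge[of t] t by linarith
    have "change t / h \<ge> 0" using c0 h(1) by simp
    hence i: "real i \<le> change t / h" "change t / h < real i + 1" unfolding i_def by linarith+
    have ih: "real i * h \<le> change t" "change t < real i * h + h"
      using i h(1) by (simp_all add: pos_le_divide_eq pos_divide_less_eq distrib_right)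
    have "real i * h \<le> real K * h" using ih t K by linarith
    hence "i \<le> K" using h(1) by simp
    hence y: "sample_path ?y (change t) = x (real i * h)" by (simp add: path i_def)
    have grid_g: "g s \<le> real i * h" if "s \<le> real i * h" for s
    proof -
      have "s / h \<le> real_of_int (int i)" using that h(1) by (simp add: pos_divide_le_eq)
      hence "\<lceil>s / h\<rceil> \<le> int i" by (rule ceiling_le)
      hence "of_int \<lceil>s / h\<rceil> \<le> real i" by linarith
      thus ?thesis using h(1) by (simp add: g_def mult.commute)
    qed
    have "x (real i * h) = x t"
    proof (cases "t \<le> real i * h")
      case True
      have "?J \<inter> {t<..real i * h} = {}"
      proof (rule ccontr)
        assume "?J \<inter> {t<..real i * h} \<noteq> {}"
        then obtain s where s: "s \<in> ?J" "t < s" "s \<le> real i * h" by auto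
        have "change t < g s" using change_strict_mono[OF s(2)] change_jump[OF s(1)] by simp
        thus False using grid_g[OF s(3)] h ih by linarith
      qed
      moreover have "real i * h \<le> T" using ih t by linarith
      ultimately show ?thesis using constant_between_jumps[OF rc t(1) True, of T] by simp
    next
      case False
      have "?J \<inter> {real i * h<..t} = {}"
      proof (rule ccontr)
        assume "?J \<inter> {real i * h<..t} \<noteq> {}"
        then obtain s where s: "s \<in> ?J" "real i * h < s" "s \<le> t" by auto
        have "g s \<le> change t"
          using change_strict_mono[of s t] change_jump[OF s(1)] s(3) by (cases "s = t") auto
        hence "h * of_int \<lceil>s / h\<rceil> < h * (real i + 1)" using ih by (simp add: g_def algebra_simps)
        hence "of_int \<lceil>s / h\<rceil> < real i + 1" using h(1) by simp
        hence "\<lceil>s / h\<rceil> \<le> int i" by linarith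
        hence "s / h \<le> real i" by (simp add: ceiling_le_iff)
        thus False using s(2) h(1) by (simp add: pos_divide_le_eq)
      qed
      moreover have "t \<le> T" using change_ge[of t] t by linarith
      ultimately show ?thesis using constant_between_jumps[OF rc, of "real i * h" t T] False h(1) by simp
    qed
    thus ?thesis using y by simp
  qed
  \<comment> \<open>Stopping at such a level \<open>u\<close> lets the original path jump but cuts
    off the delayed jump of the grid path.\<close>
  define B where "B = (\<Union>s\<in>?J. {s..g s})"
  \<comment> \<open>Each window of length \<open>\<delta>\<close> holds at most one jump, which
    counts the jumps up to \<open>T\<close>.\<close>
  have inj: "inj_on (\<lambda>s. nat \<lfloor>s / \<delta>\<rfloor>) ?J"
  proof
    fix s s' assume s: "s \<in> ?J" "s' \<in> ?J" "nat \<lfloor>s / \<delta>\<rfloor> = nat \<lfloor>s' / \<delta>\<rfloor>"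
    have *: False if "u \<in> ?J" "v \<in> ?J" "nat \<lfloor>u / \<delta>\<rfloor> = nat \<lfloor>v / \<delta>\<rfloor>" "u < v" for u v
    proof -
      have "u / \<delta> \<ge> 0" "v / \<delta> \<ge> 0" using J[OF that(1)] J[OF that(2)] \<delta> by simp_all
      hence "\<lfloor>u / \<delta>\<rfloor> = \<lfloor>v / \<delta>\<rfloor>" using that(3) by linarith
      hence "v / \<delta> - u / \<delta> < 1" by linarith
      hence "v - u < \<delta>" using \<delta> by (simp add: pos_divide_less_eq flip: diff_divide_distrib)
      thus False using apart(1)[OF that(1,2,4)] by simp
    qed
    show "s = s'" using *[of s s'] *[of s' s] s by (cases s s' rule: linorder_cases) auto
  qed
  have img: "(\<lambda>s. nat \<lfloor>s / \<delta>\<rfloor>) ` ?J \<subseteq> {..nat \<lfloor>T / \<delta>\<rfloor>}"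
    using J \<delta> by (auto intro!: nat_mono floor_mono divide_right_mono)
  have fin: "finite ?J" using inj_on_finite[OF inj img] by simp
  have "card ?J \<le> card {..nat \<lfloor>T / \<delta>\<rfloor>}" by (rule card_inj_on_le[OF inj img]) simp
  hence "real (card ?J) \<le> real (nat \<lfloor>T / \<delta>\<rfloor>) + 1" by simp
  also have "\<dots> \<le> T / \<delta> + 1" using \<delta> by simp
  finally have card: "real (card ?J) \<le> T / \<delta> + 1" .
  have B_borel: "B \<in> sets borel" unfolding B_def using fin by (intro sets.finite_UN) auto
  have B_finite: "emeasure lborel B < \<infinity>"
  proof -
    have "emeasure lborel B \<le> (\<Sum>s\<in>?J. emeasure lborel {s..g s})"
      unfolding B_def using fin by (intro emeasure_subadditive_finite) auto
    also have "\<dots> < \<infinity>" using g_ge by (simp add: ennreal_sum_less_top fin)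
    finally show ?thesis .
  qed
  have "measure lborel B \<le> (\<Sum>s\<in>?J. measure lborel {s..g s})"
    unfolding B_def using fin by (intro measure_UNION_le) auto
  also have "\<dots> \<le> (\<Sum>s\<in>?J. h)" using g_le g_ge by (intro sum_mono) (simp add: diff_le_eq add.commute)
  also have "\<dots> \<le> h * (T / \<delta> + 1)" using card h(1) by (simp add: mult.commute)
  finally have B_measure: "measure lborel B \<le> h * (T / \<delta> + 1)" .
  have "stopped_path_dist \<omega> ?y change u \<le> \<eta>" if u: "0 \<le> u" "u < T" "u \<notin> B" for u :: real
  proof (rule stopped_path_dist_le)
    fix t :: real assume t: "t \<ge> 0"
    have "dist (sample_path \<omega> (min t u)) (sample_path ?y (min (change t) u)) \<le> \<eta>"
    proof (cases "change t < u")
      case True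
      hence "min t u = t" "min (change t) u = change t" using change_ge[of t] by auto
      thus ?thesis using key[OF t] True u near[of "sample_path \<omega> t"] by (simp add: x_def)
    next
      case False
      \<comment> \<open>\<open>u'\<close> is the time that \<open>change\<close> sends to
        \<open>u\<close>. The grid path stopped at \<open>u\<close> shows the value of the projected
        path at \<open>u'\<close>, and since \<open>u\<close> is not in \<open>B\<close> no jump
        separates \<open>u'\<close> from the time at which the original path is read.\<close>
      obtain u' where u': "u' \<ge> 0" "u' \<le> u" "change u' = u" using change_surj[OF u(1)] by blast
      have "u' \<le> t" using change_strict_mono[of t u'] u'(3) False by (cases "t < u'") auto
      hence le: "u' \<le> min t u" using u'(2) by simp
      have "?J \<inter> {u'<..min t u} = {}"
      proof (rule ccontr)
        assume "?J \<inter> {u'<..min t u} \<noteq> {}"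
        then obtain s where s: "s \<in> ?J" "u' < s" "s \<le> u" by auto
        have "u < g s" using change_strict_mono[OF s(2)] change_jump[OF s(1)] u'(3) by simp
        thus False using u(3) s by (auto simp: B_def)
      qed
      hence "x u' = x (min t u)" using u by (intro constant_between_jumps[OF rc u'(1) le]) auto
      moreover have "sample_path ?y u = x u'" using key[OF u'(1)] u'(3) u(2) by simp
      moreover have "min (change t) u = u" using False by simp
      ultimately show ?thesis using near[of "sample_path \<omega> (min t u)"] by (simp add: x_def)
    qed
    thus "min 1 (dist (sample_path \<omega> (min t u)) (sample_path ?y (min (change t) u))) \<le> \<eta>" by simp
  qed
  hence "stopped_path_integral \<omega> ?y change \<le> \<eta> + measure lborel B + exp (- real T)"
    by (intro stopped_path_integral_le change_in_time_changes \<eta> B_borel B_finite) auto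
  hence "stopped_path_integral \<omega> ?y change \<le> \<eta> + h * (T / \<delta> + 1) + exp (- real T)" using B_measure by linarith
  hence "max (time_change_size change) (stopped_path_integral \<omega> ?y change) \<le> max (2 * (h / \<delta>)) (\<eta> + h * (T / \<delta> + 1) + exp (- real T))"
    using change_size unfolding \<kappa>_def by (intro max.mono)
  from order_trans[OF skorohod_dist_le[OF change_in_time_changes, of \<omega> ?y] this]
  show ?thesis unfolding x_def .
qed

subsection \<open>Close jumps of the walk are rare\<close>

lemma quot_ball_sum: "(\<And>j. j \<in> J \<Longrightarrow> f j \<in> quot_ball i) \<Longrightarrow> (\<Sum>j\<in>J. f j) \<in> quot_ball i"
  by (induction J rule: infinite_finite_induct) (auto intro: quot_ball_add)

context padic_walk
begin

lemma prob_outside_quot_ball: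
  assumes "j \<ge> 1" shows "prob {s \<in> space M. X j s \<notin> quot_ball r} = 1 / (real CARD('p) powr b) ^ r"
proof -
  note [measurable] = X_measurable[OF assms]
  have "{s \<in> space M. X j s \<notin> quot_ball r} = space M - {s \<in> space M. X j s \<in> quot_ball r}" by auto
  moreover have "{s \<in> space M. X j s \<in> quot_ball r} \<in> events" by measurable
  ultimately show ?thesis using prob_quot_ball[OF assms, of r] by (simp add: prob_compl)
qed

lemma prob_two_outside:
  assumes "i \<ge> 1" "j \<ge> 1" "i \<noteq> j"
  shows "prob {s \<in> space M. X i s \<notin> quot_ball r \<and> X j s \<notin> quot_ball r} = (1 / (real CARD('p) powr b) ^ r)\<^sup>2"
proof -
  have "prob (\<Inter>k\<in>{i, j}. X k -` (- quot_ball r) \<inter> space M) = (\<Prod>k\<in>{i, j}. prob (X k -` (- quot_ball r) \<inter> space M))"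
    by (rule indep_varsD[OF indep]) (use assms in auto)
  moreover have "X k -` (- quot_ball r) \<inter> space M = {s \<in> space M. X k s \<notin> quot_ball r}" for k by auto
  moreover have "(\<Inter>k\<in>{i, j}. {s \<in> space M. X k s \<notin> quot_ball r}) = {s \<in> space M. X i s \<notin> quot_ball r \<and> X j s \<notin> quot_ball r}"
    by auto
  ultimately show ?thesis using assms by (simp add: prob_outside_quot_ball power2_eq_square)
qed

lemma embed_proj_eq:
  assumes "n \<le> int m"
  shows "padic_proj n (padic_quot_embed m g) = padic_proj n (padic_quot_embed m (h :: 'p padic_quot)) \<longleftrightarrow> h - g \<in> quot_ball (nat (int m - n))"
  unfolding padic_proj_eq_iff embed_in_pball[OF assms] abs_embed ..

text \<open>Steps inside the subgroup add up to an element of it and leave the projection unchanged,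
  so a visible change needs at least one large step.\<close>

lemma walk_jump:
  assumes "n \<le> int m" "k \<le> l"
    and "padic_proj n (padic_quot_embed m (walk X k s)) \<noteq> padic_proj n (padic_quot_embed m (walk X l s))"
  shows "\<exists>j\<in>{k<..l}. X j s \<notin> quot_ball (nat (int m - n))"
proof (rule ccontr)
  assume "\<not> ?thesis"
  hence "(\<Sum>j\<in>{k<..l}. X j s) \<in> quot_ball (nat (int m - n))" by (intro quot_ball_sum) auto
  hence "walk X l s - walk X k s \<in> quot_ball (nat (int m - n))" using walk_split[OF assms(2), of s] by simp
  thus False using assms(3) embed_proj_eq[OF assms(1)] by blast
qed

text \<open>Union bounds over pairs of large steps at most \<open>w\<close> apart, and over single
  large steps among the first \<open>w\<close>.\<close>

lemma prob_jumps_le: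
  "prob {s \<in> space M. (\<exists>i j. 1 \<le> i \<and> i \<le> T \<and> i < j \<and> j \<le> i + w \<and> X i s \<notin> quot_ball r \<and> X j s \<notin> quot_ball r) \<or>
     (\<exists>i. 1 \<le> i \<and> i \<le> w \<and> X i s \<notin> quot_ball r)}
   \<le> (real T * (1 / (real CARD('p) powr b) ^ r)) * (real w * (1 / (real CARD('p) powr b) ^ r)) + real w * (1 / (real CARD('p) powr b) ^ r)"
  (is "prob ?E \<le> _")
proof -
  let ?q = "1 / (real CARD('p) powr b) ^ r"
  let ?A = "\<lambda>i j. {s \<in> space M. X i s \<notin> quot_ball r \<and> X j s \<notin> quot_ball r}"
  let ?B = "\<lambda>i. {s \<in> space M. X i s \<notin> quot_ball r}"
  have B: "?B i \<in> events" if "i \<ge> 1" for i using X_measurable[OF that] by measurable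
  have A: "?A i j \<in> events" if "i \<ge> 1" "j \<ge> 1" for i j
    using X_measurable[OF that(1)] X_measurable[OF that(2)] by measurable
  have UA: "(\<Union>j\<in>{i<..i + w}. ?A i j) \<in> events" if "i \<ge> 1" for i using that by (intro sets.finite_UN A) auto
  have "?E \<subseteq> (\<Union>i\<in>{1..T}. \<Union>j\<in>{i<..i + w}. ?A i j) \<union> (\<Union>i\<in>{1..w}. ?B i)" by fastforce
  hence "prob ?E \<le> prob ((\<Union>i\<in>{1..T}. \<Union>j\<in>{i<..i + w}. ?A i j) \<union> (\<Union>i\<in>{1..w}. ?B i))"
    by (rule finite_measure_mono) (intro sets.Un sets.finite_UN UA B; auto)
  also have "\<dots> \<le> prob (\<Union>i\<in>{1..T}. \<Union>j\<in>{i<..i + w}. ?A i j) + prob (\<Union>i\<in>{1..w}. ?B i)"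
    by (rule measure_Un_le) (intro sets.finite_UN UA B; auto)+
  also have "prob (\<Union>i\<in>{1..w}. ?B i) \<le> (\<Sum>i\<in>{1..w}. prob (?B i))"
    by (rule finite_measure_subadditive_finite) (auto intro!: B)
  also have "(\<Sum>i\<in>{1..w}. prob (?B i)) = real w * ?q"
    by (simp add: prob_outside_quot_ball)
  also have "prob (\<Union>i\<in>{1..T}. \<Union>j\<in>{i<..i + w}. ?A i j) \<le> (\<Sum>i\<in>{1..T}. prob (\<Union>j\<in>{i<..i + w}. ?A i j))"
    by (rule finite_measure_subadditive_finite) (auto intro!: UA)
  also have "\<dots> \<le> (\<Sum>i\<in>{1..T}. \<Sum>j\<in>{i<..i + w}. prob (?A i j))"
    by (intro sum_mono finite_measure_subadditive_finite) (auto intro!: A)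
  also have "\<dots> = (\<Sum>i\<in>{1..T}. \<Sum>j\<in>{i<..i + w}. ?q\<^sup>2)"
    by (intro sum.cong refl prob_two_outside) auto
  also have "\<dots> = (real T * ?q) * (real w * ?q)" by (simp add: power2_eq_square)
  finally show ?thesis by simp
qed

context
  fixes \<sigma> :: real
  assumes \<sigma>: "\<sigma> > 0"
begin

text \<open>The expected number of visible steps per unit time: it does not depend on
  \<open>m\<close>, although the number of steps and the probability of each being visible
  do.\<close>

lemma lambda_scaled:
  assumes "n \<le> int m"
  shows "scaling_lambda CARD('p) b \<sigma> m * (1 / (real CARD('p) powr b) ^ nat (int m - n))
    = \<sigma> / scaling_alpha CARD('p) b * (real CARD('p) powr b) powi n"
proof -
  let ?B = "real CARD('p) powr b"
  have B0: "?B > 0" using pb_gt_1 by linarith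
  have "?B ^ nat (int m - n) = ?B powi (int (nat (int m - n)))" by (rule power_int_of_nat[symmetric])
  also have "int (nat (int m - n)) = int m - n" using assms by simp
  also have "?B powi (int m - n) = ?B powi int m / ?B powi n" by (rule power_int_diff) (use B0 in simp)
  finally have "?B ^ nat (int m - n) = ?B ^ m / ?B powi n" by simp
  thus ?thesis using B0 by (simp add: scaling_lambda_eq)
qed

text \<open>The two changes seen on the grid come from disjoint blocks of steps, because
  \<open>i1 <= i2\<close>, and so from two different large steps within a window of
  \<open>w\<close>. \<open>C\<close> is the rate of large steps per unit time, and \<open>q\<close>
  is the price of rounding the window up.\<close>

lemma prob_irregular_le:
  assumes m: "n \<le> int m" and h: "h > 0" and \<delta>: "\<delta> > 0"
  defines "C \<equiv> \<sigma> / scaling_alpha CARD('p) b * (real CARD('p) powr b) powi n"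
    and "q \<equiv> 1 / (real CARD('p) powr b) ^ nat (int m - n)"
  shows "prob {s \<in> space M. irregular h \<delta> K (\<lambda>i. padic_proj n (scaled_walk b \<sigma> X m (real i * h) s))}
    \<le> real K * h * C * (\<delta> * C + q) + (\<delta> * C + q)"
proof -
  let ?L = "scaling_lambda CARD('p) b \<sigma> m" and ?r = "nat (int m - n)"
  define k where "k i = nat \<lfloor>real i * h * ?L\<rfloor>" for i
  \<comment> \<open>Two steps seen within time \<open>\<delta>\<close> have numbers differing by at
    most \<delta> \<lambda>(m) + 1; the 1 comes from rounding grid times down to step
    numbers.\<close>
  define w where "w = nat \<lfloor>\<delta> * ?L + 1\<rfloor>"
  have L: "?L > 0" by (rule lambda_pos[OF \<sigma>])
  have B0: "real CARD('p) powr b > 0" using pb_gt_1 by linarith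
  have q: "q > 0" using B0 by (simp add: q_def)
  have kmono: "k i \<le> k j" if "i \<le> j" for i j
    unfolding k_def using that h L by (intro nat_mono floor_mono mult_right_mono) auto
  have k_le: "real (k i) \<le> real i * h * ?L" and k_ge: "real (k i) > real i * h * ?L - 1" for i
  proof -
    have "real i * h * ?L \<ge> 0" using h L by simp
    thus "real (k i) \<le> real i * h * ?L" "real (k i) > real i * h * ?L - 1" unfolding k_def by linarith+
  qed
  have w_le: "real w \<le> \<delta> * ?L + 1" using \<delta> L by (simp add: w_def)
  have le_w: "x \<le> w" if "real x \<le> \<delta> * ?L + 1" for x using that unfolding w_def by (rule le_nat_floor)
  let ?x = "\<lambda>s i. padic_proj n (scaled_walk b \<sigma> X m (real i * h) s)"
  have jump: "\<exists>j\<in>{k i<..k i'}. X j s \<notin> quot_ball ?r" if "i < i'" "?x s i \<noteq> ?x s i'" for i i' s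
    using walk_jump[OF m kmono, of i i' s] that by (simp add: scaled_walk_def k_def)
  have "{s \<in> space M. irregular h \<delta> K (?x s)} \<subseteq>
    {s \<in> space M. (\<exists>i j. 1 \<le> i \<and> i \<le> k K \<and> i < j \<and> j \<le> i + w \<and> X i s \<notin> quot_ball ?r \<and> X j s \<notin> quot_ball ?r) \<or>
       (\<exists>i. 1 \<le> i \<and> i \<le> w \<and> X i s \<notin> quot_ball ?r)}"
  proof (intro subsetI CollectI conjI)
    fix s assume s: "s \<in> {s \<in> space M. irregular h \<delta> K (?x s)}"
    thus "s \<in> space M" by simp
    from s consider (a) i0 i1 i2 i3 where "i0 < i1" "i1 \<le> i2" "i2 < i3" "i3 \<le> K" "real (i3 - i0) * h < \<delta>"
        "?x s i0 \<noteq> ?x s i1" "?x s i2 \<noteq> ?x s i3"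
      | (b) i where "i \<le> K" "real i * h < \<delta>" "?x s 0 \<noteq> ?x s i"
      unfolding irregular_def by blast
    thus "(\<exists>i j. 1 \<le> i \<and> i \<le> k K \<and> i < j \<and> j \<le> i + w \<and> X i s \<notin> quot_ball ?r \<and> X j s \<notin> quot_ball ?r) \<or>
       (\<exists>i. 1 \<le> i \<and> i \<le> w \<and> X i s \<notin> quot_ball ?r)"
    proof cases
      case a
      obtain i where i: "k i0 < i" "i \<le> k i1" "X i s \<notin> quot_ball ?r" using jump[OF a(1,6)] by auto
      obtain j where j: "k i2 < j" "j \<le> k i3" "X j s \<notin> quot_ball ?r" using jump[OF a(3,7)] by auto
      have "k i1 \<le> k i2" "k i1 \<le> k K" using kmono a by auto
      hence ij: "i < j" "i \<le> k K" using i j by linarith+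
      have "real j - real i \<le> real (k i3) - real (k i0)" using i j by linarith
      also have "\<dots> \<le> real i3 * h * ?L - (real i0 * h * ?L - 1)" using k_le[of i3] k_ge[of i0] by linarith
      also have "\<dots> = (real (i3 - i0) * h) * ?L + 1" using a by (simp add: of_nat_diff algebra_simps)
      also have "\<dots> \<le> \<delta> * ?L + 1" using a L by (intro add_right_mono mult_right_mono) auto
      finally have "j - i \<le> w" using ij by (intro le_w) (simp add: of_nat_diff)
      thus ?thesis using i j ij by (intro disjI1 exI[of _ i] exI[of _ j]) auto
    next
      case b
      hence "0 < i" by (cases i) auto
      then obtain j where j: "k 0 < j" "j \<le> k i" "X j s \<notin> quot_ball ?r" using jump[OF _ b(3)] by auto
      have "real j \<le> real i * h * ?L" using j k_le[of i] by linarith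
      also have "\<dots> \<le> \<delta> * ?L" using b L by (intro mult_right_mono) auto
      finally have "j \<le> w" by (intro le_w) simp
      thus ?thesis using j by (intro disjI2 exI[of _ j]) auto
    qed
  qed
  hence "prob {s \<in> space M. irregular h \<delta> K (?x s)} \<le>
    prob {s \<in> space M. (\<exists>i j. 1 \<le> i \<and> i \<le> k K \<and> i < j \<and> j \<le> i + w \<and> X i s \<notin> quot_ball ?r \<and> X j s \<notin> quot_ball ?r) \<or>
       (\<exists>i. 1 \<le> i \<and> i \<le> w \<and> X i s \<notin> quot_ball ?r)}"
  proof (rule finite_measure_mono)
    have "Measurable.pred M (\<lambda>s. (\<exists>i\<in>{1..k K}. \<exists>j\<in>{i<..i + w}. X i s \<notin> quot_ball ?r \<and> X j s \<notin> quot_ball ?r) \<or>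
       (\<exists>i\<in>{1..w}. X i s \<notin> quot_ball ?r))"
    proof (intro pred_intros_logic pred_intros_finite)
      have [simp]: "Measurable.pred M (\<lambda>s. X i s \<in> quot_ball ?r)" if "i \<ge> 1" for i
        using X_measurable[OF that] by measurable
      show "Measurable.pred M (\<lambda>s. X i s \<in> quot_ball ?r)" if "i \<in> {1..k K}" for i using that by simp
      show "Measurable.pred M (\<lambda>s. X j s \<in> quot_ball ?r)" if "i \<in> {1..k K}" "j \<in> {i<..i + w}" for i j using that by simp
      show "Measurable.pred M (\<lambda>s. X i s \<in> quot_ball ?r)" if "i \<in> {1..w}" for i using that by simp
    qed auto
    hence "{s \<in> space M. (\<exists>i\<in>{1..k K}. \<exists>j\<in>{i<..i + w}. X i s \<notin> quot_ball ?r \<and> X j s \<notin> quot_ball ?r) \<or>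
       (\<exists>i\<in>{1..w}. X i s \<notin> quot_ball ?r)} \<in> events" by simp
    also have "{s \<in> space M. (\<exists>i\<in>{1..k K}. \<exists>j\<in>{i<..i + w}. X i s \<notin> quot_ball ?r \<and> X j s \<notin> quot_ball ?r) \<or>
       (\<exists>i\<in>{1..w}. X i s \<notin> quot_ball ?r)} =
      {s \<in> space M. (\<exists>i j. 1 \<le> i \<and> i \<le> k K \<and> i < j \<and> j \<le> i + w \<and> X i s \<notin> quot_ball ?r \<and> X j s \<notin> quot_ball ?r) \<or>
       (\<exists>i. 1 \<le> i \<and> i \<le> w \<and> X i s \<notin> quot_ball ?r)}" by fastforce
    finally show "{s \<in> space M. (\<exists>i j. 1 \<le> i \<and> i \<le> k K \<and> i < j \<and> j \<le> i + w \<and> X i s \<notin> quot_ball ?r \<and> X j s \<notin> quot_ball ?r) \<or>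
       (\<exists>i. 1 \<le> i \<and> i \<le> w \<and> X i s \<notin> quot_ball ?r)} \<in> events" .
  qed
  also have "\<dots> \<le> (real (k K) * q) * (real w * q) + real w * q"
    unfolding q_def by (rule prob_jumps_le)
  also have "\<dots> \<le> (real K * h * C) * (\<delta> * C + q) + (\<delta> * C + q)"
  proof -
    have LC: "?L * q = C" using lambda_scaled[OF m] by (simp add: C_def q_def)
    have "real (k K) * q \<le> real K * h * ?L * q" using k_le[of K] q by (intro mult_right_mono) auto
    also have "\<dots> = real K * h * C" using LC by (simp add: mult.assoc)
    finally have 1: "real (k K) * q \<le> real K * h * C" .
    have "real w * q \<le> (\<delta> * ?L + 1) * q" using w_le q by (intro mult_right_mono) auto
    also have "\<dots> = \<delta> * C + q" using LC by (simp add: algebra_simps)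
    finally have 2: "real w * q \<le> \<delta> * C + q" .
    have "real (k K) * q * (real w * q) \<le> real K * h * C * (\<delta> * C + q)"
    proof (rule mult_mono[OF 1 2])
      show "0 \<le> real K * h * C" using h q L by (simp flip: LC)
      show "0 \<le> real w * q" using q by simp
    qed
    with 2 show ?thesis by (rule add_mono[rotated])
  qed
  finally show ?thesis by simp
qed

text \<open>The bound involves \<open>K\<close> and \<open>h\<close> only through their product,
  hence is uniform in the mesh; this is what allows the mesh to tend to 0 afterwards.\<close>

lemma irregular_uniformly_small:
  assumes \<epsilon>: "\<epsilon> > 0" and T: "T \<ge> 0"
  shows "\<exists>\<delta>>0. \<exists>m0. \<forall>m\<ge>m0. \<forall>h>0. \<forall>K. real K * h \<le> T \<longrightarrow>
    prob {s \<in> space M. irregular h \<delta> K (\<lambda>i. padic_proj n (scaled_walk b \<sigma> X m (real i * h) s))} \<le> \<epsilon>"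
proof -
  let ?B = "real CARD('p) powr b"
  define C where "C = \<sigma> / scaling_alpha CARD('p) b * ?B powi n"
  have B0: "?B > 0" using pb_gt_1 by linarith
  have C: "C > 0" using \<sigma> alpha_pos B0 by (simp add: C_def)
  \<comment> \<open>Makes the limit (T C + 1) \<delta> C of the bound equal to \<epsilon> / 2; the
    summand 1 accounts for jumps near time 0.\<close>
  define \<delta> where "\<delta> = \<epsilon> / (2 * (T * C + 1) * C)"
  have TC: "T * C + 1 > 0" using T C by (simp add: add_nonneg_pos)
  have \<delta>: "\<delta> > 0" using \<epsilon> TC C by (simp add: \<delta>_def)
  have "t * (\<epsilon> / (2 * t * c) * c) = \<epsilon> / 2" if "t > 0" "c > 0" for t c :: real using that by simp
  from this[OF TC C] have "(T * C + 1) * (\<delta> * C) = \<epsilon> / 2" by (simp add: \<delta>_def)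
  define q where "q m = 1 / ?B ^ nat (int m - n)" for m
  have "(\<lambda>k. inverse (?B ^ k)) \<longlonglongrightarrow> 0" by (rule LIMSEQ_inverse_realpow_zero[OF pb_gt_1])
  moreover have "filterlim (\<lambda>m. nat (int m - n)) sequentially sequentially"
    unfolding filterlim_at_top
  proof
    fix Z show "\<forall>\<^sub>F m in sequentially. Z \<le> nat (int m - n)"
      by (rule eventually_sequentiallyI[of "nat (int Z + \<bar>n\<bar>)"]) linarith
  qed
  ultimately have "q \<longlonglongrightarrow> 0" unfolding q_def inverse_eq_divide by (rule filterlim_compose)
  hence lim: "(\<lambda>m. (T * C + 1) * (\<delta> * C + q m)) \<longlonglongrightarrow> (T * C + 1) * (\<delta> * C + 0)"
    by (intro tendsto_intros)
  have "(T * C + 1) * (\<delta> * C + 0) < \<epsilon>"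
    using \<open>(T * C + 1) * (\<delta> * C) = \<epsilon> / 2\<close> \<epsilon> by simp
  from order_tendstoD(2)[OF lim this]
  have "\<forall>\<^sub>F m in sequentially. (T * C + 1) * (\<delta> * C + q m) < \<epsilon>" .
  moreover have "\<forall>\<^sub>F m in sequentially. n \<le> int m" by (rule eventually_sequentiallyI[of "nat n"]) linarith
  ultimately have "\<forall>\<^sub>F m in sequentially. (T * C + 1) * (\<delta> * C + q m) < \<epsilon> \<and> n \<le> int m" by (rule eventually_conj)
  then obtain m0 where m0: "\<And>m. m \<ge> m0 \<Longrightarrow> (T * C + 1) * (\<delta> * C + q m) < \<epsilon> \<and> n \<le> int m"
    unfolding eventually_sequentially by blast
  have "prob {s \<in> space M. irregular h \<delta> K (\<lambda>i. padic_proj n (scaled_walk b \<sigma> X m (real i * h) s))} \<le> \<epsilon>"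
    if "m \<ge> m0" "h > 0" "real K * h \<le> T" for m h K
  proof -
    have "prob {s \<in> space M. irregular h \<delta> K (\<lambda>i. padic_proj n (scaled_walk b \<sigma> X m (real i * h) s))}
      \<le> real K * h * C * (\<delta> * C + q m) + (\<delta> * C + q m)"
      unfolding C_def q_def by (rule prob_irregular_le) (use m0[OF that(1)] that \<delta> in auto)
    also have "\<dots> \<le> T * C * (\<delta> * C + q m) + (\<delta> * C + q m)"
      using that(3) C \<delta> B0 by (intro add_right_mono mult_right_mono) (auto simp: q_def)
    also have "\<dots> = (T * C + 1) * (\<delta> * C + q m)" by (simp add: algebra_simps)
    also have "\<dots> \<le> \<epsilon>" using m0[OF that(1)] by simp
    finally show ?thesis .
  qed
  thus ?thesis using \<delta> by blast
qed

end

end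

subsection \<open>Reduction of weak convergence to Lipschitz functions\<close>

text \<open>The second hypothesis is the lower bound for the complementary function, as one-sided
  arguments such as Fatou's lemma or Lipschitz minorants provide it.\<close>

lemma tendsto_from_lower_bounds:
  fixes a :: "nat \<Rightarrow> real"
  assumes "\<And>e. e > 0 \<Longrightarrow> \<forall>\<^sub>F m in sequentially. l - e < a m"
    and "\<And>e. e > 0 \<Longrightarrow> \<forall>\<^sub>F m in sequentially. (1 - l) - e < 1 - a m"
  shows "a \<longlonglongrightarrow> l"
proof (rule tendstoI)
  fix e :: real assume "e > 0"
  from assms(1)[OF this] assms(2)[OF this] show "\<forall>\<^sub>F m in sequentially. dist (a m) l < e"
    by eventually_elim (simp add: dist_real_def abs_less_iff)
qed

text \<open>Fatou's lemma for the counting measure. Since the pointwise limit is itself a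
  probability mass function, applying this to \<open>F\<close> and to \<open>1 - F\<close> shows
  that no mass is lost.\<close>

lemma pmf_expectation_lower_bound:
  fixes F :: "'c \<Rightarrow> real"
  assumes conv: "\<And>w. (\<lambda>m. pmf (q m) w) \<longlonglongrightarrow> pmf p w" and F: "\<And>w. 0 \<le> F w" "\<And>w. F w \<le> 1" and e: "e > 0"
  shows "\<forall>\<^sub>F m in sequentially. measure_pmf.expectation p F - e < measure_pmf.expectation (q m) F"
proof (cases "measure_pmf.expectation p F - e < 0")
  case True
  have "0 \<le> measure_pmf.expectation (q m) F" for m using F(1) by simp
  thus ?thesis using True by (intro always_eventually allI) (rule less_le_trans)
next
  case False
  have nn: "(\<integral>\<^sup>+w. ennreal (pmf r w) * ennreal (F w) \<partial>count_space UNIV) = ennreal (measure_pmf.expectation r F)" for r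
  proof -
    have "integrable (measure_pmf r) F"
      by (rule measure_pmf.integrable_const_bound[of _ 1]) (use F in auto)
    thus ?thesis using F(1) by (simp add: nn_integral_measure_pmf[symmetric] nn_integral_eq_integral)
  qed
  have "ennreal (measure_pmf.expectation p F) = (\<integral>\<^sup>+w. liminf (\<lambda>m. ennreal (pmf (q m) w) * ennreal (F w)) \<partial>count_space UNIV)"
  proof -
    have "(\<lambda>m. ennreal (pmf (q m) w) * ennreal (F w)) \<longlonglongrightarrow> ennreal (pmf p w) * ennreal (F w)" for w
      using tendsto_ennrealI[OF tendsto_mult[OF conv tendsto_const], of w "F w"] F(1) by (simp add: ennreal_mult)
    hence "liminf (\<lambda>m. ennreal (pmf (q m) w) * ennreal (F w)) = ennreal (pmf p w) * ennreal (F w)" for w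
      by (intro lim_imp_Liminf) auto
    thus ?thesis by (simp only: nn)
  qed
  also have "\<dots> \<le> liminf (\<lambda>m. \<integral>\<^sup>+w. ennreal (pmf (q m) w) * ennreal (F w) \<partial>count_space UNIV)"
    by (rule nn_integral_liminf) simp
  also have "\<dots> = liminf (\<lambda>m. ennreal (measure_pmf.expectation (q m) F))" by (simp only: nn)
  finally have le: "ennreal (measure_pmf.expectation p F) \<le> liminf (\<lambda>m. ennreal (measure_pmf.expectation (q m) F))" .
  \<comment> \<open>The case assumption makes the threshold nonnegative, where
    \<open>ennreal\<close> does not truncate.\<close>
  have "ennreal (measure_pmf.expectation p F - e) < ennreal (measure_pmf.expectation p F)"
    using False e by (intro ennreal_lessI) auto
  hence "ennreal (measure_pmf.expectation p F - e) < liminf (\<lambda>m. ennreal (measure_pmf.expectation (q m) F))"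
    using le by (rule less_le_trans)
  from less_LiminfD[OF this] show ?thesis
    by eventually_elim (use False in \<open>simp add: ennreal_less_iff\<close>)
qed

lemma pmf_expectation_tendsto:
  fixes F :: "'c \<Rightarrow> real"
  assumes conv: "\<And>w. (\<lambda>m. pmf (q m) w) \<longlonglongrightarrow> pmf p w" and F: "\<And>w. 0 \<le> F w" "\<And>w. F w \<le> 1"
  shows "(\<lambda>m. measure_pmf.expectation (q m) F) \<longlonglongrightarrow> measure_pmf.expectation p F"
proof (rule tendsto_from_lower_bounds)
  fix e :: real assume e: "e > 0"
  show "\<forall>\<^sub>F m in sequentially. measure_pmf.expectation p F - e < measure_pmf.expectation (q m) F"
    by (rule pmf_expectation_lower_bound[OF conv F e])
  have int: "integrable (measure_pmf r) F" for r
    by (rule measure_pmf.integrable_const_bound[of _ 1]) (use F in auto)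
  have "measure_pmf.expectation r (\<lambda>w. 1 - F w) = 1 - measure_pmf.expectation r F" for r
    using int[of r] by simp
  moreover have "\<forall>\<^sub>F m in sequentially. measure_pmf.expectation p (\<lambda>w. 1 - F w) - e < measure_pmf.expectation (q m) (\<lambda>w. 1 - F w)"
    by (rule pmf_expectation_lower_bound[OF conv _ _ e]) (use F in auto)
  ultimately show "\<forall>\<^sub>F m in sequentially. 1 - measure_pmf.expectation p F - e < 1 - measure_pmf.expectation (q m) F"
    by (simp only:)
qed

lemma measurable_countable_range:
  fixes G :: "'a \<Rightarrow> 'b"
  assumes C: "countable C" "\<And>\<omega>. \<omega> \<in> space Q \<Longrightarrow> G \<omega> \<in> C"
    and G: "\<And>w. w \<in> C \<Longrightarrow> {\<omega> \<in> space Q. G \<omega> = w} \<in> sets Q"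
  shows "G \<in> measurable Q (count_space UNIV)"
proof (rule measurableI)
  fix A :: "'b set"
  have "G -` A \<inter> space Q = (\<Union>w\<in>C \<inter> A. {\<omega> \<in> space Q. G \<omega> = w})" using C(2) by auto
  also have "\<dots> \<in> sets Q" using C(1) G by (intro sets.countable_UN') auto
  finally show "G -` A \<inter> space Q \<in> sets Q" .
qed simp

text \<open>The law is carried by a countable set, so almost every point is an atom, which is the
  condition for being a \<open>pmf\<close>.\<close>

lemma discrete_law:
  assumes "prob_space Q" and C: "countable C" "\<And>\<omega>. \<omega> \<in> space Q \<Longrightarrow> G \<omega> \<in> C"
    and G: "\<And>w. w \<in> C \<Longrightarrow> {\<omega> \<in> space Q. G \<omega> = w} \<in> sets Q"
  obtains p where "distr Q (count_space UNIV) G = measure_pmf p" "\<And>w. pmf p w = measure Q {\<omega> \<in> space Q. G \<omega> = w}"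
proof -
  interpret Q: prob_space Q by fact
  have meas: "G \<in> measurable Q (count_space UNIV)" by (rule measurable_countable_range[OF C G])
  let ?D = "distr Q (count_space UNIV) G"
  interpret D: prob_space ?D by (rule Q.prob_space_distr[OF meas])
  have sing: "measure ?D {w} = measure Q {\<omega> \<in> space Q. G \<omega> = w}" for w
    by (subst measure_distr[OF meas]) (auto intro!: arg_cong[where f = "measure Q"])
  have "AE x in ?D. \<forall>w\<in>C. measure ?D {w} = 0 \<longrightarrow> x \<noteq> w"
  proof (subst AE_ball_countable[OF C(1)], intro ballI)
    fix w assume "w \<in> C"
    show "AE x in ?D. measure ?D {w} = 0 \<longrightarrow> x \<noteq> w"
    proof (cases "measure ?D {w} = 0")
      case True
      hence "{w} \<in> null_sets ?D" by (auto simp: null_sets_def D.emeasure_eq_measure)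
      from AE_not_in[OF this] show ?thesis by simp
    qed simp
  qed
  moreover have "AE x in ?D. x \<in> C" using C(2) meas by (subst AE_distr_iff) auto
  ultimately have "AE x in ?D. measure ?D {x} \<noteq> 0" by eventually_elim blast
  hence "measure_pmf (Abs_pmf ?D) = ?D" by (intro Abs_pmf_inverse) (simp add: D.prob_space_axioms)
  thus ?thesis using that[of "Abs_pmf ?D"] sing by (simp add: pmf.rep_eq)
qed

text \<open>The Pasch-Hausdorff envelope, the largest \<open>k\<close>-Lipschitz minorant of
  \<open>f\<close>.\<close>

definition lip_reg :: "('a::metric_space \<Rightarrow> real) \<Rightarrow> real \<Rightarrow> 'a \<Rightarrow> real" where
  "lip_reg f k x = (INF y. f y + k * dist x y)"

context
  fixes f :: "'a::metric_space \<Rightarrow> real"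
  assumes f: "\<And>x. 0 \<le> f x" "\<And>x. f x \<le> 1"
begin

lemma lip_reg_lower: "k \<ge> 0 \<Longrightarrow> lip_reg f k x \<le> f y + k * dist x y"
  unfolding lip_reg_def using f(1) by (intro cINF_lower bdd_belowI2[where m = 0]) auto

lemma lip_reg_greatest: "(\<And>y. c \<le> f y + k * dist x y) \<Longrightarrow> c \<le> lip_reg f k x"
  unfolding lip_reg_def by (intro cINF_greatest) auto

lemma lip_reg_nonneg: "k \<ge> 0 \<Longrightarrow> 0 \<le> lip_reg f k x"
  using f(1) by (intro lip_reg_greatest) (simp add: add_nonneg_nonneg)

lemma lip_reg_le: "k \<ge> 0 \<Longrightarrow> lip_reg f k x \<le> f x"
  using lip_reg_lower[of k x x] by simp

lemma lip_reg_lipschitz: "k \<ge> 0 \<Longrightarrow> \<bar>lip_reg f k x - lip_reg f k z\<bar> \<le> k * dist x z"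
proof -
  have "lip_reg f k x - k * dist x z \<le> lip_reg f k z" if "k \<ge> 0" for x z
  proof (rule lip_reg_greatest)
    fix y
    have "k * dist x y \<le> k * (dist x z + dist z y)" using that by (intro mult_left_mono dist_triangle)
    thus "lip_reg f k x - k * dist x z \<le> f y + k * dist z y"
      using lip_reg_lower[OF that, of x y] by (simp add: distrib_left)
  qed
  moreover assume "k \<ge> 0"
  ultimately show ?thesis by (smt (verit) dist_commute)
qed

lemma lip_reg_tendsto:
  assumes "continuous_on UNIV f"
  shows "(\<lambda>k. lip_reg f (real k) x) \<longlonglongrightarrow> f x"
proof (rule tendstoI)
  fix e :: real assume e: "e > 0"
  obtain d where d: "d > 0" "\<And>y. dist y x < d \<Longrightarrow> dist (f y) (f x) < e / 2"
    using assms e unfolding continuous_on_iff by (metis UNIV_I half_gt_zero)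
  show "\<forall>\<^sub>F k in sequentially. dist (lip_reg f (real k) x) (f x) < e"
  proof (rule eventually_sequentiallyI)
    \<comment> \<open>From this \<open>k\<close> on, points outside the \<open>d\<close>-ball pay a
      penalty of at least 1, an upper bound of \<open>f\<close>, so only nearby points can lower the
      infimum.\<close>
    fix k assume k: "k \<ge> nat \<lceil>1 / d\<rceil>"
    hence "real k \<ge> 1 / d" by linarith
    hence kd: "real k * d \<ge> 1" using d(1) by (simp add: pos_divide_le_eq)
    have "f x - e / 2 \<le> lip_reg f (real k) x"
    proof (rule lip_reg_greatest)
      fix y
      show "f x - e / 2 \<le> f y + real k * dist x y"
      proof (cases "dist y x < d")
        case True
        have "0 \<le> real k * dist x y" by simp
        thus ?thesis using d(2)[OF True] unfolding dist_real_def by linarith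
      next
        case False
        hence "real k * d \<le> real k * dist x y" by (intro mult_left_mono) (auto simp: dist_commute)
        thus ?thesis using kd f(1)[of y] f(2)[of x] e by linarith
      qed
    qed
    thus "dist (lip_reg f (real k) x) (f x) < e" using lip_reg_le[of "real k" x] e by (simp add: dist_real_def)
  qed
qed

end

lemma lipschitz_continuous_on_UNIV:
  fixes f :: "'a::metric_space \<Rightarrow> real"
  assumes "L \<ge> 0" "\<And>x y. \<bar>f x - f y\<bar> \<le> L * dist x y"
  shows "continuous_on UNIV f"
  by (rule lipschitz_on_continuous_on[of L]) (rule lipschitz_onI, use assms in \<open>auto simp: dist_real_def\<close>)

text \<open>A Lipschitz minorant of nearly the same \<open>P\<close>-integral gives the lower bound,
  the same argument for \<open>1 - f\<close> the upper one; an affine map brings a bounded function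
  into [0,1].\<close>

lemma weakly_converges_lipschitz:
  fixes Q :: "nat \<Rightarrow> 'a::metric_space measure" and P :: "'a measure"
  assumes Q: "\<And>m. prob_space (Q m)" "\<And>m. sets (Q m) = sets borel"
    and P: "prob_space P" "sets P = sets borel"
    and lip: "\<And>f L. L \<ge> 0 \<Longrightarrow> (\<And>x. 0 \<le> f x) \<Longrightarrow> (\<And>x. f x \<le> 1) \<Longrightarrow> (\<And>x y. \<bar>f x - f y\<bar> \<le> L * dist x y) \<Longrightarrow>
       (\<lambda>m. \<integral>\<omega>. f \<omega> \<partial>Q m) \<longlonglongrightarrow> (\<integral>\<omega>. (f \<omega> :: real) \<partial>P)"
  shows "weakly_converges Q P"
proof -
  have integrable: "integrable R f" if R: "prob_space R" "sets R = sets borel" and f: "continuous_on UNIV f" "\<And>x. 0 \<le> f x" "\<And>x. f x \<le> 1"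
    for f :: "'a \<Rightarrow> real" and R :: "'a measure"
  proof -
    interpret prob_space R by fact
    have "f \<in> borel_measurable R" using borel_measurable_continuous_onI[OF f(1)] measurable_cong_sets[OF R(2) refl] by blast
    thus ?thesis by (intro integrable_const_bound[of _ 1]) (use f in auto)
  qed
  have lower: "\<forall>\<^sub>F m in sequentially. (\<integral>\<omega>. f \<omega> \<partial>P) - e < (\<integral>\<omega>. f \<omega> \<partial>Q m)"
    if f: "continuous_on UNIV f" "\<And>x. 0 \<le> f x" "\<And>x. f x \<le> 1" and e: "e > 0" for f :: "'a \<Rightarrow> real" and e
  proof -
    have cont: "continuous_on UNIV (lip_reg f (real k))" for k
      by (rule lipschitz_continuous_on_UNIV[of "real k"]) (use lip_reg_lipschitz[of f "real k"] f in auto)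
    have le1: "lip_reg f (real k) x \<le> 1" for k x
      by (rule order_trans[OF lip_reg_le[of f "real k" x] f(3)]) (use f in auto)
    have ge0: "0 \<le> lip_reg f (real k) x" for k x using lip_reg_nonneg[of f "real k" x] f by auto
    have "(\<lambda>k. \<integral>\<omega>. lip_reg f (real k) \<omega> \<partial>P) \<longlonglongrightarrow> (\<integral>\<omega>. f \<omega> \<partial>P)"
    proof (rule integral_dominated_convergence[where w = "\<lambda>_. 1"])
      show "f \<in> borel_measurable P" using integrable[OF P f] by auto
      show "lip_reg f (real k) \<in> borel_measurable P" for k
        using integrable[OF P cont ge0 le1] by auto
      show "integrable P (\<lambda>_. 1 :: real)" by (rule finite_measure.integrable_const[OF prob_space.finite_measure[OF P(1)]])
      show "AE x in P. (\<lambda>k. lip_reg f (real k) x) \<longlonglongrightarrow> f x"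
        using lip_reg_tendsto[OF f(2,3,1)] by simp
      show "AE x in P. norm (lip_reg f (real k) x) \<le> 1" for k using ge0 le1 by simp
    qed
    from order_tendstoD(1)[OF this, of "(\<integral>\<omega>. f \<omega> \<partial>P) - e"] e
    obtain k where k: "(\<integral>\<omega>. f \<omega> \<partial>P) - e < (\<integral>\<omega>. lip_reg f (real k) \<omega> \<partial>P)"
      by (auto simp: eventually_sequentially)
    have "(\<lambda>m. \<integral>\<omega>. lip_reg f (real k) \<omega> \<partial>Q m) \<longlonglongrightarrow> (\<integral>\<omega>. lip_reg f (real k) \<omega> \<partial>P)"
      by (rule lip[of "real k"]) (use ge0 le1 lip_reg_lipschitz[of f "real k"] f in auto)
    from order_tendstoD(1)[OF this k] show ?thesis
    proof eventually_elim
      case (elim m)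
      have "(\<integral>\<omega>. lip_reg f (real k) \<omega> \<partial>Q m) \<le> (\<integral>\<omega>. f \<omega> \<partial>Q m)"
        by (intro integral_mono integrable Q cont ge0 le1 f lip_reg_le) auto
      thus ?case using elim by linarith
    qed
  qed
  have unit: "(\<lambda>m. \<integral>\<omega>. f \<omega> \<partial>Q m) \<longlonglongrightarrow> (\<integral>\<omega>. f \<omega> \<partial>P)"
    if f: "continuous_on UNIV f" "\<And>x. 0 \<le> f x" "\<And>x. f x \<le> 1" for f :: "'a \<Rightarrow> real"
  proof (rule tendsto_from_lower_bounds)
    fix e :: real assume e: "e > 0"
    show "\<forall>\<^sub>F m in sequentially. (\<integral>\<omega>. f \<omega> \<partial>P) - e < (\<integral>\<omega>. f \<omega> \<partial>Q m)" by (rule lower[OF f e])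
    have compl: "(\<integral>\<omega>. 1 - f \<omega> \<partial>R) = 1 - (\<integral>\<omega>. f \<omega> \<partial>R)" if R: "prob_space R" "sets R = sets borel" for R :: "'a measure"
    proof -
      interpret prob_space R by fact
      show ?thesis using integrable[OF R f] by (simp add: prob_space)
    qed
    have "\<forall>\<^sub>F m in sequentially. (\<integral>\<omega>. 1 - f \<omega> \<partial>P) - e < (\<integral>\<omega>. 1 - f \<omega> \<partial>Q m)"
      by (rule lower[OF _ _ _ e]) (use f in \<open>auto intro!: continuous_intros\<close>)
    thus "\<forall>\<^sub>F m in sequentially. 1 - (\<integral>\<omega>. f \<omega> \<partial>P) - e < 1 - (\<integral>\<omega>. f \<omega> \<partial>Q m)"
      by (simp only: compl[OF P] compl[OF Q])
  qed
  show ?thesis unfolding weakly_converges_def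
  proof (intro allI impI, elim conjE)
    fix f :: "'a \<Rightarrow> real" assume f: "continuous_on UNIV f" "bounded (range f)"
    then obtain B where B: "B > 0" "\<And>x. \<bar>f x\<bar> \<le> B" by (auto simp: bounded_pos)
    define g where "g x = (f x + B) / (2 * B)" for x
    have gc: "continuous_on UNIV g" unfolding g_def using B f by (intro continuous_intros) auto
    have g0: "0 \<le> g x" and g1: "g x \<le> 1" for x
      using B(1) B(2)[of x] by (auto simp: g_def abs_le_iff field_simps)
    have fg: "f x = 2 * B * g x - B" for x using B(1) by (simp add: g_def)
    have eq: "(\<integral>\<omega>. f \<omega> \<partial>R) = 2 * B * (\<integral>\<omega>. g \<omega> \<partial>R) - B" if R: "prob_space R" "sets R = sets borel" for R :: "'a measure"
    proof -
      interpret prob_space R by fact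
      show ?thesis unfolding fg using integrable[OF R gc g0 g1] by (simp add: prob_space)
    qed
    have "(\<lambda>m. 2 * B * (\<integral>\<omega>. g \<omega> \<partial>Q m) - B) \<longlonglongrightarrow> 2 * B * (\<integral>\<omega>. g \<omega> \<partial>P) - B"
      by (intro tendsto_intros unit gc g0 g1)
    thus "(\<lambda>m. \<integral>\<omega>. f \<omega> \<partial>Q m) \<longlonglongrightarrow> (\<integral>\<omega>. f \<omega> \<partial>P)" by (simp only: eq[OF P] eq[OF Q])
  qed
qed

subsection \<open>Weak convergence\<close>

lemma irregular_cong:
  assumes "\<And>i. i \<le> K \<Longrightarrow> x i = y i"
  shows "irregular h \<delta> K x \<longleftrightarrow> irregular h \<delta> K y"
proof -
  have "irregular h \<delta> K y" if "irregular h \<delta> K x" "\<And>i. i \<le> K \<Longrightarrow> x i = y i" for x y :: "nat \<Rightarrow> 'a"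
  proof -
    from that(1) consider (a) i0 i1 i2 i3 where "i0 < i1" "i1 \<le> i2" "i2 < i3" "i3 \<le> K" "real (i3 - i0) * h < \<delta>"
        "x i0 \<noteq> x i1" "x i2 \<noteq> x i3"
      | (b) i where "i \<le> K" "real i * h < \<delta>" "x 0 \<noteq> x i"
      unfolding irregular_def by blast
    thus ?thesis
    proof cases
      case a
      hence "y i0 \<noteq> y i1" "y i2 \<noteq> y i3" using that(2)[of i0] that(2)[of i1] that(2)[of i2] that(2)[of i3] by auto
      thus ?thesis unfolding irregular_def using a by blast
    next
      case b
      hence "y 0 \<noteq> y i" using that(2)[of 0] that(2)[of i] by auto
      thus ?thesis unfolding irregular_def using b by blast
    qed
  qed
  thus ?thesis using assms by metis
qed

section \<open>Grid skeletons and their laws\<close>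

locale padic_walk_limit = padic_walk M b X + padic_haar \<mu>
  for M :: "'s measure" and b :: real and X :: "nat \<Rightarrow> 's \<Rightarrow> 'p::prime_card padic_quot" and \<mu> :: "'p padic measure" +
  fixes \<sigma> :: real and Pm :: "nat \<Rightarrow> 'p padic cadlag measure" and P :: "'p padic cadlag measure"
  assumes \<sigma>_pos: "\<sigma> > 0"
    and walk_law: "\<And>m. is_scaled_walk_law b \<sigma> M X m (Pm m)"
    and bm: "is_padic_brownian_motion \<mu> b \<sigma> P"
begin

text \<open>Freezing the sequence after index \<open>K\<close> leaves only countably many possible
  skeletons while keeping them total functions.\<close>

definition skeleton :: "int \<Rightarrow> real \<Rightarrow> nat \<Rightarrow> (real \<Rightarrow> 'p padic) \<Rightarrow> nat \<Rightarrow> 'p padic" where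
  "skeleton n h K z i = padic_proj n (z (real (min i K) * h))"

definition skeletons :: "int \<Rightarrow> nat \<Rightarrow> (nat \<Rightarrow> 'p padic) set" where
  "skeletons n K = {w. (\<forall>i. w i \<in> range (padic_proj n)) \<and> (\<forall>i. w i = w (min i K))}"

lemma countable_skeletons: "countable (skeletons n K)"
proof -
  have "skeletons n K \<subseteq> (\<lambda>xs i. xs ! min i K) ` lists (range (padic_proj n))"
  proof
    fix w assume w: "w \<in> skeletons n K"
    have "w = (\<lambda>i. map w [0..<Suc K] ! min i K)"
    proof
      fix i
      have "map w [0..<Suc K] ! min i K = w (min i K)" by (subst nth_map) (simp_all del: upt_Suc)
      also have "\<dots> = w i" using w unfolding skeletons_def by (auto dest: spec[of _ i])
      finally show "w i = map w [0..<Suc K] ! min i K" ..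
    qed
    moreover have "map w [0..<Suc K] \<in> lists (range (padic_proj n))"
      using w by (auto simp: skeletons_def)
    ultimately show "w \<in> (\<lambda>xs i. xs ! min i K) ` lists (range (padic_proj n))" by (rule image_eqI)
  qed
  thus ?thesis by (rule countable_subset) (intro countable_image countable_lists countable_range_padic_proj)
qed

lemma skeleton_in: "skeleton n h K z \<in> skeletons n K"
  by (auto simp: skeletons_def skeleton_def)

lemma skeleton_eq_iff:
  assumes w: "w \<in> skeletons n K"
  shows "skeleton n h K z = w \<longleftrightarrow> (\<forall>i\<le>K. z (real i * h) \<in> pball (w i) (- n))"
proof -
  have wi: "w i = w (min i K)" "padic_proj n (w i) = w i" for i
    using w by (auto simp: skeletons_def padic_proj_idem intro: range_eqI) (metis padic_proj_idem rangeE)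
  have iff: "padic_proj n x = w i \<longleftrightarrow> x \<in> pball (w i) (- n)" for x i
    using padic_proj_eq_iff[of n "w i" x] wi(2)[of i] by metis
  show ?thesis
  proof
    assume e: "skeleton n h K z = w"
    show "\<forall>i\<le>K. z (real i * h) \<in> pball (w i) (- n)"
    proof (intro allI impI)
      fix i assume "i \<le> K"
      hence "padic_proj n (z (real i * h)) = w i" using fun_cong[OF e, of i] by (simp add: skeleton_def)
      thus "z (real i * h) \<in> pball (w i) (- n)" by (simp only: iff)
    qed
  next
    assume a: "\<forall>i\<le>K. z (real i * h) \<in> pball (w i) (- n)"
    show "skeleton n h K z = w"
    proof
      fix i
      have "padic_proj n (z (real (min i K) * h)) = w (min i K)" using a by (simp only: iff min.cobounded2)
      thus "skeleton n h K z i = w i" using wi(1)[of i] by (simp only: skeleton_def)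
    qed
  qed
qed

lemmas path_measurable = sample_path_measurable[OF b_pos \<sigma>_pos bm]

lemma Pm_prob: "prob_space (Pm m)" and Pm_sets: "sets (Pm m) = sets borel"
  using walk_law[of m] by (simp_all add: is_scaled_walk_law_def)

lemma P_prob: "prob_space P" and P_sets: "sets P = sets borel"
  using bm by (simp_all add: is_padic_brownian_motion_def)

lemma space_eq_UNIV: "sets R = sets borel \<Longrightarrow> space R = UNIV"
  using sets_eq_imp_space_eq[of R borel] by simp

lemma grid_event_sets:
  fixes R :: "'p padic cadlag measure"
  assumes "sets R = sets borel" "h > 0"
  shows "{\<omega>. \<forall>i\<le>K. sample_path \<omega> (real i * h) \<in> pball (w i) (- n)} \<in> sets R"
proof -
  have "{\<omega>. \<forall>i\<le>K. sample_path \<omega> (real i * h) \<in> pball (w i) (- n)}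
      = (\<Inter>i\<in>{..K}. (\<lambda>\<omega>. sample_path \<omega> (real i * h)) -` pball (w i) (- n) \<inter> space borel)" by auto
  also have "\<dots> \<in> sets borel"
  proof (rule sets.finite_INT)
    fix i
    have "0 \<le> real i * h" using assms(2) by simp
    from measurable_sets[OF path_measurable[OF this] pball_measurable]
    show "(\<lambda>\<omega>. sample_path \<omega> (real i * h)) -` pball (w i) (- n) \<inter> space borel \<in> sets borel" .
  qed simp_all
  finally show ?thesis unfolding assms(1) .
qed

lemma scaled_walk_measurable: "scaled_walk b \<sigma> X m t \<in> measurable M (count_space UNIV)"
  unfolding scaled_walk_def by (rule measurable_compose[OF walk_measurable]) simp

lemma walk_grid_event_sets: "{s \<in> space M. \<forall>i\<le>K. scaled_walk b \<sigma> X m (real i * h) s \<in> pball (w i) (- n)} \<in> sets M"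
proof -
  have "{s \<in> space M. \<forall>i\<le>K. scaled_walk b \<sigma> X m (real i * h) s \<in> pball (w i) (- n)}
      = (\<Inter>i\<in>{..K}. scaled_walk b \<sigma> X m (real i * h) -` pball (w i) (- n) \<inter> space M)" by auto
  also have "\<dots> \<in> sets M" by (intro sets.finite_INT measurable_sets[OF scaled_walk_measurable]) auto
  finally show ?thesis .
qed

lemma Pm_grid:
  assumes h: "h > 0"
  shows "measure (Pm m) {\<omega>. \<forall>i\<le>K. sample_path \<omega> (real i * h) \<in> pball (w i) (- n)}
    = prob {s \<in> space M. \<forall>i\<le>K. scaled_walk b \<sigma> X m (real i * h) s \<in> pball (w i) (- n)}"
proof -
  define J where "J = (\<lambda>i. real i * h) ` {..K}"
  let ?S = "\<Pi>\<^sub>M t\<in>J. (borel :: 'p padic measure)"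
  let ?A = "{f \<in> space ?S. \<forall>i\<in>{..K}. f (real i * h) \<in> pball (w i) (- n)}"
  have J: "finite J" "J \<subseteq> {0..}" using h by (auto simp: J_def)
  have eq: "distr (Pm m) ?S (\<lambda>\<omega>. \<lambda>t\<in>J. sample_path \<omega> t) = distr M ?S (\<lambda>s. \<lambda>t\<in>J. scaled_walk b \<sigma> X m t s)"
    using walk_law[of m] J unfolding is_scaled_walk_law_def by blast
  have A: "?A \<in> sets ?S"
  proof -
    have "(\<lambda>f. f (real i * h)) \<in> measurable ?S borel" if "i \<in> {..K}" for i
      by (rule measurable_component_singleton) (use that in \<open>auto simp: J_def\<close>)
    from measurable_sets[OF this pball_measurable]
    have "{f \<in> space ?S. f (real i * h) \<in> pball (w i) (- n)} \<in> sets ?S" if "i \<in> {..K}" for i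
      using that by (simp add: vimage_def Int_def conj_commute)
    thus ?thesis by (intro sets.sets_Collect_finite_All) auto
  qed
  have m1: "(\<lambda>\<omega>. \<lambda>t\<in>J. sample_path \<omega> t) \<in> measurable (Pm m) ?S"
  proof (rule measurable_restrict)
    fix t assume "t \<in> J"
    hence "t \<ge> 0" using J by auto
    thus "(\<lambda>\<omega>. sample_path \<omega> t) \<in> borel_measurable (Pm m)"
      using path_measurable measurable_cong_sets[OF Pm_sets refl] by blast
  qed
  have m2: "(\<lambda>s. \<lambda>t\<in>J. scaled_walk b \<sigma> X m t s) \<in> measurable M ?S"
    by (rule measurable_restrict) (rule measurable_compose[OF scaled_walk_measurable], simp)
  have "measure (Pm m) {\<omega>. \<forall>i\<le>K. sample_path \<omega> (real i * h) \<in> pball (w i) (- n)}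
      = measure (distr (Pm m) ?S (\<lambda>\<omega>. \<lambda>t\<in>J. sample_path \<omega> t)) ?A"
    unfolding measure_distr[OF m1 A]
    by (rule arg_cong[where f = "measure (Pm m)"])
       (auto simp: space_eq_UNIV[OF Pm_sets] J_def space_PiM)
  also have "\<dots> = measure (distr M ?S (\<lambda>s. \<lambda>t\<in>J. scaled_walk b \<sigma> X m t s)) ?A" by (simp only: eq)
  also have "\<dots> = prob {s \<in> space M. \<forall>i\<le>K. scaled_walk b \<sigma> X m (real i * h) s \<in> pball (w i) (- n)}"
    unfolding measure_distr[OF m2 A]
    by (rule arg_cong[where f = "prob"]) (auto simp: J_def space_PiM)
  finally show ?thesis .
qed

lemma skeleton_law:
  fixes R :: "'p padic cadlag measure"
  assumes R: "prob_space R" "sets R = sets borel" and h: "h > 0"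
  obtains p where "distr R (count_space UNIV) (\<lambda>\<omega>. skeleton n h K (sample_path \<omega>)) = measure_pmf p"
    "(\<lambda>\<omega>. skeleton n h K (sample_path \<omega>)) \<in> measurable R (count_space UNIV)"
    "\<And>w. w \<in> skeletons n K \<Longrightarrow> pmf p w = measure R {\<omega>. \<forall>i\<le>K. sample_path \<omega> (real i * h) \<in> pball (w i) (- n)}"
    "\<And>w. w \<notin> skeletons n K \<Longrightarrow> pmf p w = 0"
proof -
  have sp: "space R = UNIV" by (rule space_eq_UNIV[OF R(2)])
  have ev: "{\<omega> \<in> space R. skeleton n h K (sample_path \<omega>) = w} = {\<omega>. \<forall>i\<le>K. sample_path \<omega> (real i * h) \<in> pball (w i) (- n)}"
    if "w \<in> skeletons n K" for w
    by (simp add: skeleton_eq_iff[OF that] sp)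
  have sets: "{\<omega> \<in> space R. skeleton n h K (sample_path \<omega>) = w} \<in> sets R" if "w \<in> skeletons n K" for w
    unfolding ev[OF that] by (rule grid_event_sets[OF R(2) h])
  obtain p where p: "distr R (count_space UNIV) (\<lambda>\<omega>. skeleton n h K (sample_path \<omega>)) = measure_pmf p"
    "\<And>w. pmf p w = measure R {\<omega> \<in> space R. skeleton n h K (sample_path \<omega>) = w}"
    by (rule discrete_law[OF R(1) countable_skeletons skeleton_in sets]) blast+
  show ?thesis
  proof (rule that[OF p(1)])
    show "(\<lambda>\<omega>. skeleton n h K (sample_path \<omega>)) \<in> measurable R (count_space UNIV)"
      by (rule measurable_countable_range[OF countable_skeletons skeleton_in sets])
    show "pmf p w = measure R {\<omega>. \<forall>i\<le>K. sample_path \<omega> (real i * h) \<in> pball (w i) (- n)}" if "w \<in> skeletons n K" for w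
      unfolding p(2) ev[OF that] ..
    show "pmf p w = 0" if "w \<notin> skeletons n K" for w
    proof -
      have "{\<omega> \<in> space R. skeleton n h K (sample_path \<omega>) = w} = {}" using skeleton_in that by blast
      thus ?thesis unfolding p(2) by (simp only: measure_empty)
    qed
  qed
qed

text \<open>Both laws are discrete with the same atoms, by the agreement of finite-dimensional
  distributions, so they agree on every set of skeletons, in particular on the irregular
  ones.\<close>

lemma walk_skeleton_law:
  assumes h: "h > 0"
  shows "measure (Pm m) {\<omega>. skeleton n h K (sample_path \<omega>) \<in> A}
    = prob {s \<in> space M. skeleton n h K (\<lambda>t. scaled_walk b \<sigma> X m t s) \<in> A}"
proof -
  let ?G = "\<lambda>\<omega>. skeleton n h K (sample_path \<omega>)" and ?H = "\<lambda>s. skeleton n h K (\<lambda>t. scaled_walk b \<sigma> X m t s)"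
  obtain p where p: "distr (Pm m) (count_space UNIV) ?G = measure_pmf p" "?G \<in> measurable (Pm m) (count_space UNIV)"
    "\<And>w. w \<in> skeletons n K \<Longrightarrow> pmf p w = measure (Pm m) {\<omega>. \<forall>i\<le>K. sample_path \<omega> (real i * h) \<in> pball (w i) (- n)}"
    "\<And>w. w \<notin> skeletons n K \<Longrightarrow> pmf p w = 0"
    by (rule skeleton_law[OF Pm_prob[of m] Pm_sets[of m] h, where n = n and K = K]) blast+
  have ev: "{s \<in> space M. ?H s = w} = {s \<in> space M. \<forall>i\<le>K. scaled_walk b \<sigma> X m (real i * h) s \<in> pball (w i) (- n)}"
    if "w \<in> skeletons n K" for w by (simp only: skeleton_eq_iff[OF that])
  have sets: "{s \<in> space M. ?H s = w} \<in> sets M" if "w \<in> skeletons n K" for w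
    unfolding ev[OF that] by (rule walk_grid_event_sets)
  obtain q where q: "distr M (count_space UNIV) ?H = measure_pmf q" "\<And>w. pmf q w = prob {s \<in> space M. ?H s = w}"
    by (rule discrete_law[OF prob_space_axioms countable_skeletons skeleton_in sets]) blast+
  have Hm: "?H \<in> measurable M (count_space UNIV)"
    by (rule measurable_countable_range[OF countable_skeletons skeleton_in sets])
  have "p = q"
  proof (rule pmf_eqI)
    fix w
    show "pmf p w = pmf q w"
    proof (cases "w \<in> skeletons n K")
      case True
      show ?thesis unfolding p(3)[OF True] q(2) ev[OF True] by (rule Pm_grid[OF h])
    next
      case False
      have "{s \<in> space M. ?H s = w} = {}" using skeleton_in False by blast
      thus ?thesis unfolding p(4)[OF False] q(2) by (simp only: measure_empty)
    qed
  qed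
  have "measure (Pm m) {\<omega>. ?G \<omega> \<in> A} = measure (measure_pmf p) A"
    unfolding p(1)[symmetric] by (subst measure_distr[OF p(2)]) (auto simp: space_eq_UNIV[OF Pm_sets] vimage_def)
  also have "\<dots> = prob {s \<in> space M. ?H s \<in> A}"
    unfolding \<open>p = q\<close> q(1)[symmetric] by (subst measure_distr[OF Hm]) (auto simp: vimage_def Int_def conj_commute)
  finally show ?thesis .
qed

text \<open>The atoms of both skeleton laws are masses of ball events, and those of the walk
  converge to those of Brownian motion. On a discrete countable set this suffices for arbitrary
  \<open>F\<close> with values in [0,1].\<close>

lemma skeleton_expectation_tendsto:
  fixes F :: "(nat \<Rightarrow> 'p padic) \<Rightarrow> real"
  assumes h: "h > 0" and F: "\<And>w. 0 \<le> F w" "\<And>w. F w \<le> 1"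
  shows "(\<lambda>m. \<integral>\<omega>. F (skeleton n h K (sample_path \<omega>)) \<partial>Pm m) \<longlonglongrightarrow> (\<integral>\<omega>. F (skeleton n h K (sample_path \<omega>)) \<partial>P)"
proof -
  let ?G = "\<lambda>\<omega>. skeleton n h K (sample_path \<omega>)"
  let ?E = "\<lambda>w. {\<omega>. \<forall>i\<le>K. sample_path \<omega> (real i * h) \<in> pball (w i) (- n)}"
  let ?\<Phi> = "\<lambda>m q. distr (Pm m) (count_space UNIV) ?G = measure_pmf q \<and> ?G \<in> measurable (Pm m) (count_space UNIV) \<and>
    (\<forall>w. w \<in> skeletons n K \<longrightarrow> pmf q w = measure (Pm m) (?E w)) \<and> (\<forall>w. w \<notin> skeletons n K \<longrightarrow> pmf q w = 0)"
  have "\<exists>q. ?\<Phi> m q" for m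
    by (rule skeleton_law[OF Pm_prob[of m] Pm_sets[of m] h, where n = n and K = K]) blast
  hence "\<exists>q. \<forall>m. ?\<Phi> m (q m)" by (intro choice allI)
  then obtain q where "\<And>m. ?\<Phi> m (q m)" by (elim exE) (rule that, erule spec)
  hence q: "\<And>m. distr (Pm m) (count_space UNIV) ?G = measure_pmf (q m)" "\<And>m. ?G \<in> measurable (Pm m) (count_space UNIV)"
    "\<And>m w. w \<in> skeletons n K \<Longrightarrow> pmf (q m) w = measure (Pm m) (?E w)" "\<And>m w. w \<notin> skeletons n K \<Longrightarrow> pmf (q m) w = 0"
    by blast+
  obtain p where p: "distr P (count_space UNIV) ?G = measure_pmf p" "?G \<in> measurable P (count_space UNIV)"
    "\<And>w. w \<in> skeletons n K \<Longrightarrow> pmf p w = measure P (?E w)" "\<And>w. w \<notin> skeletons n K \<Longrightarrow> pmf p w = 0"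
    by (rule skeleton_law[OF P_prob P_sets h, where n = n and K = K]) blast+
  have conv: "(\<lambda>m. pmf (q m) w) \<longlonglongrightarrow> pmf p w" for w
  proof (cases "w \<in> skeletons n K")
    case True
    let ?h = "\<lambda>i. heat_cell (real CARD('p)) b (\<sigma> * h) n (padic_abs (w i - w (i - 1)))"
    let ?lim = "if w 0 \<in> pball 0 (- n) then \<Prod>i=1..K. ?h i else 0"
    have lim: "(\<lambda>m. pmf (q m) w) \<longlonglongrightarrow> ?lim"
      unfolding q(3)[OF True] Pm_grid[OF h] by (rule scaled_walk_grid_limit[OF \<sigma>_pos h])
    \<comment> \<open>The series defining \<open>heat_cell\<close> has terms of both signs; its sign
      is read off from its being a limit of probabilities. It is needed to leave
      \<open>ennreal\<close>.\<close>
    have nonneg: "0 \<le> ?h i" if "i \<ge> 1" for i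
    proof (rule LIMSEQ_le_const)
      let ?L = "scaling_lambda CARD('p) b \<sigma>"
      show "(\<lambda>m. prob {s \<in> space M. abs_padic_quot (of_nat CARD('p) powi (- int m) * (w i - w (i - 1))) - (\<Sum>j\<in>{0<..nat \<lfloor>h * ?L m\<rfloor>}. X j s) \<in> quot_ball (nat (int m - n))}) \<longlonglongrightarrow> ?h i"
        by (rule increment_limit[OF \<sigma>_pos]) (use floor_scaling_limit[OF lambda_at_top[OF \<sigma>_pos], of h] h in auto)
    qed auto
    have "ennreal (pmf p w) = emeasure P (?E w)"
      unfolding p(3)[OF True] using prob_space.finite_measure[OF P_prob] by (simp add: finite_measure.emeasure_eq_measure)
    also have "\<dots> = (if w 0 \<in> pball 0 (- n) then \<Prod>i=1..K. ennreal (?h i) else 0)"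
      by (rule bm_grid_pball[OF b_pos \<sigma>_pos bm h])
    also have "(\<Prod>i=1..K. ennreal (?h i)) = ennreal (\<Prod>i=1..K. ?h i)"
      by (rule prod_ennreal) (use nonneg in auto)
    also have "(if w 0 \<in> pball 0 (- n) then ennreal (\<Prod>i=1..K. ?h i) else 0) = ennreal ?lim" by simp
    finally have "pmf p w = ?lim"
      using nonneg by (subst (asm) ennreal_inj) (auto intro!: prod_nonneg)
    thus ?thesis using lim by simp
  qed (simp add: q(4) p(4))
  have "(\<integral>\<omega>. F (?G \<omega>) \<partial>R) = measure_pmf.expectation r F"
    if "distr R (count_space UNIV) ?G = measure_pmf r" "?G \<in> measurable R (count_space UNIV)" for R r
    unfolding that(1)[symmetric] by (rule integral_distr[OF that(2), symmetric]) simp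
  thus ?thesis using pmf_expectation_tendsto[OF conv F] q p by simp
qed

section \<open>Exceptional paths and the final approximation\<close>

lemma scaled_irregular_eq:
  "irregular h \<delta> K (\<lambda>i. padic_proj n (z (real i * h))) \<longleftrightarrow> skeleton n h K z \<in> {w. irregular h \<delta> K w}"
  unfolding mem_Collect_eq by (rule irregular_cong) (simp add: skeleton_def min_absorb1)

lemma irregular_sets:
  fixes R :: "'p padic cadlag measure"
  assumes R: "prob_space R" "sets R = sets borel" and h: "h > 0"
  shows "{\<omega>. irregular h \<delta> K (\<lambda>i. padic_proj n (sample_path \<omega> (real i * h)))} \<in> sets R"
proof -
  have "(\<lambda>\<omega>. skeleton n h K (sample_path \<omega>)) \<in> measurable R (count_space UNIV)"
    by (rule skeleton_law[OF R h, where n = n and K = K]) blast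
  from measurable_sets[OF this, of "{w. irregular h \<delta> K w}"]
  have "(\<lambda>\<omega>. skeleton n h K (sample_path \<omega>)) -` {w. irregular h \<delta> K w} \<inter> space R \<in> sets R" by simp
  thus ?thesis unfolding scaled_irregular_eq by (simp add: vimage_def space_eq_UNIV[OF R(2)])
qed

lemma irregular_limit:
  assumes h: "h > 0"
  shows "(\<lambda>m. measure (Pm m) {\<omega>. irregular h \<delta> K (\<lambda>i. padic_proj n (sample_path \<omega> (real i * h)))})
    \<longlonglongrightarrow> measure P {\<omega>. irregular h \<delta> K (\<lambda>i. padic_proj n (sample_path \<omega> (real i * h)))}"
proof -
  have eq: "(\<integral>\<omega>. indicator {w. irregular h \<delta> K w} (skeleton n h K (sample_path \<omega>)) \<partial>R)
      = measure R {\<omega>. irregular h \<delta> K (\<lambda>i. padic_proj n (sample_path \<omega> (real i * h)))}"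
    if R: "prob_space R" "sets R = sets borel" for R :: "'p padic cadlag measure"
  proof -
    have "(\<integral>\<omega>. indicator {w. irregular h \<delta> K w} (skeleton n h K (sample_path \<omega>)) \<partial>R)
        = (\<integral>\<omega>. (indicator {\<omega>. irregular h \<delta> K (\<lambda>i. padic_proj n (sample_path \<omega> (real i * h)))} \<omega> :: real) \<partial>R)"
      unfolding scaled_irregular_eq by (intro Bochner_Integration.integral_cong) (auto simp: indicator_def)
    also have "\<dots> = measure R {\<omega>. irregular h \<delta> K (\<lambda>i. padic_proj n (sample_path \<omega> (real i * h)))}"
      by (simp add: space_eq_UNIV[OF R(2)])
    finally show ?thesis .
  qed
  have "(\<lambda>m. \<integral>\<omega>. indicator {w. irregular h \<delta> K w} (skeleton n h K (sample_path \<omega>)) \<partial>Pm m)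
    \<longlonglongrightarrow> (\<integral>\<omega>. (indicator {w. irregular h \<delta> K w} (skeleton n h K (sample_path \<omega>)) :: real) \<partial>P)"
    by (rule skeleton_expectation_tendsto[OF h]) auto
  thus ?thesis by (simp only: eq[OF Pm_prob Pm_sets] eq[OF P_prob P_sets])
qed

text \<open>Dyadic meshes make the sets increase with \<open>j\<close>; the horizon T + 1 leaves
  room to observe a path just after a jump at time \<open>T\<close>.\<close>

definition bad_paths :: "int \<Rightarrow> nat \<Rightarrow> real \<Rightarrow> nat \<Rightarrow> 'p padic cadlag set" where
  "bad_paths n T \<delta> j = {\<omega>. irregular (1 / 2 ^ j) \<delta> ((T + 1) * 2 ^ j) (\<lambda>i. padic_proj n (sample_path \<omega> (real i * (1 / 2 ^ j))))}"

lemma incseq_bad_paths: "incseq (bad_paths n T \<delta>)"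
proof (rule incseq_SucI)
  fix j
  have "irregular (1 / 2 ^ Suc j) \<delta> ((T + 1) * 2 ^ Suc j) (\<lambda>i. x (real i * (1 / 2 ^ Suc j)))"
    if "irregular (1 / 2 ^ j) \<delta> ((T + 1) * 2 ^ j) (\<lambda>i. x (real i * (1 / 2 ^ j)))" for x :: "real \<Rightarrow> 'p padic"
  proof -
    have "1 / 2 ^ j / 2 = (1 / 2 ^ Suc j :: real)" "2 * ((T + 1) * 2 ^ j) = (T + 1) * 2 ^ Suc j" by simp_all
    with irregular_refine[OF that] show ?thesis by (simp only:)
  qed
  from this[of "\<lambda>t. padic_proj n (sample_path \<omega> t)" for \<omega>] show "bad_paths n T \<delta> j \<subseteq> bad_paths n T \<delta> (Suc j)"
    unfolding bad_paths_def by blast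
qed

text \<open>The order of limits matters: at a fixed mesh the bound passes from the walks to
  \<open>P\<close>, and only then the mesh tends to 0 by continuity from below, with the same
  \<open>\<delta>\<close> throughout.\<close>

lemma bad_paths_small:
  assumes e: "e > 0"
  shows "\<exists>\<delta>>0. (\<forall>\<^sub>F m in sequentially. measure (Pm m) (\<Union>j. bad_paths n T \<delta> j) \<le> e) \<and> measure P (\<Union>j. bad_paths n T \<delta> j) \<le> e"
proof -
  have "0 \<le> real T + 1" by simp
  from irregular_uniformly_small[OF \<sigma>_pos e this, of n]
  obtain \<delta> m0 where \<delta>: "\<delta> > 0" and "\<forall>m\<ge>m0. \<forall>h>0. \<forall>K. real K * h \<le> real T + 1 \<longrightarrow>
    prob {s \<in> space M. irregular h \<delta> K (\<lambda>i. padic_proj n (scaled_walk b \<sigma> X m (real i * h) s))} \<le> e"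
    by blast
  hence m0: "\<And>m h K. m \<ge> m0 \<Longrightarrow> h > 0 \<Longrightarrow> real K * h \<le> real T + 1 \<Longrightarrow>
    prob {s \<in> space M. irregular h \<delta> K (\<lambda>i. padic_proj n (scaled_walk b \<sigma> X m (real i * h) s))} \<le> e"
    by blast
  have sets: "bad_paths n T \<delta> j \<in> sets R" if "prob_space R" "sets R = sets borel" for R :: "'p padic cadlag measure" and j
    unfolding bad_paths_def by (rule irregular_sets[OF that]) simp
  have Pm_j: "measure (Pm m) (bad_paths n T \<delta> j) \<le> e" if "m \<ge> m0" for m j
  proof -
    have "measure (Pm m) (bad_paths n T \<delta> j) = prob {s \<in> space M. irregular (1 / 2 ^ j) \<delta> ((T + 1) * 2 ^ j)
        (\<lambda>i. padic_proj n (scaled_walk b \<sigma> X m (real i * (1 / 2 ^ j)) s))}"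
      unfolding bad_paths_def scaled_irregular_eq scaled_irregular_eq[where z = "\<lambda>t. scaled_walk b \<sigma> X m t s" for s]
      by (rule walk_skeleton_law) simp
    also have "\<dots> \<le> e" by (rule m0[OF that]) (simp_all add: add_divide_distrib)
    finally show ?thesis .
  qed
  have P_j: "measure P (bad_paths n T \<delta> j) \<le> e" for j
  proof (rule LIMSEQ_le_const2)
    show "(\<lambda>m. measure (Pm m) (bad_paths n T \<delta> j)) \<longlonglongrightarrow> measure P (bad_paths n T \<delta> j)"
      unfolding bad_paths_def by (rule irregular_limit) simp
    show "\<exists>N. \<forall>m\<ge>N. measure (Pm m) (bad_paths n T \<delta> j) \<le> e" using Pm_j by blast
  qed
  have union: "measure R (\<Union>j. bad_paths n T \<delta> j) \<le> e"
    if R: "prob_space R" "sets R = sets borel" and le: "\<And>j. measure R (bad_paths n T \<delta> j) \<le> e" for R :: "'p padic cadlag measure"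
  proof -
    interpret R: prob_space R by fact
    have "(\<lambda>j. measure R (bad_paths n T \<delta> j)) \<longlonglongrightarrow> measure R (\<Union>j. bad_paths n T \<delta> j)"
      by (rule R.finite_Lim_measure_incseq[OF _ incseq_bad_paths]) (use sets[OF R] in auto)
    thus ?thesis by (rule LIMSEQ_le_const2) (use le in blast)
  qed
  have "\<forall>\<^sub>F m in sequentially. measure (Pm m) (\<Union>j. bad_paths n T \<delta> j) \<le> e"
    by (rule eventually_sequentiallyI[of m0]) (intro union Pm_prob Pm_sets Pm_j)
  thus ?thesis using \<delta> union[OF P_prob P_sets P_j] by blast
qed

lemma grid_approximation:
  assumes T: "exp (- real T) < d / 3" and n: "real CARD('p) powi (- n) < d / 3" and \<delta>: "\<delta> > 0" and d: "d > 0"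
  obtains j where "\<And>\<omega>. \<omega> \<notin> (\<Union>j. bad_paths n T \<delta> j) \<Longrightarrow>
    dist \<omega> (grid_path (1 / 2 ^ j) (T * 2 ^ j) (skeleton n (1 / 2 ^ j) (T * 2 ^ j) (sample_path \<omega>))) \<le> d"
proof -
  have TD: "real T / \<delta> + 1 > 0" using \<delta> by (simp add: add_nonneg_pos)
  \<comment> \<open>The three bounds on the mesh ensure, in this order, tents of slope at most 1/2,
    a time change of size at most \<open>d\<close>, and exceptional stopping levels of total length
    at most d / 3.\<close>
  define c where "c = min (min (\<delta> / 2) (d * \<delta> / 2)) (d / (3 * (real T / \<delta> + 1)))"
  have "c > 0" using \<delta> d TD by (simp add: c_def)
  then obtain j where "(1 / 2) ^ j < c" using real_arch_pow_inv[of c "1 / 2"] by auto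
  hence hc: "1 / 2 ^ j < c" by (simp add: power_divide)
  let ?h = "1 / 2 ^ j :: real" and ?K = "T * 2 ^ j"
  have h: "?h > 0" by simp
  have h1: "2 * ?h \<le> \<delta>" and h2: "2 * (?h / \<delta>) \<le> d" and h3: "?h * (real T / \<delta> + 1) \<le> d / 3"
  proof -
    have "?h < \<delta> / 2" "?h < d * \<delta> / 2" "?h < d / (3 * (real T / \<delta> + 1))" using hc by (simp_all add: c_def)
    thus "2 * ?h \<le> \<delta>" "2 * (?h / \<delta>) \<le> d" using \<delta> by (simp_all add: field_simps)
    have "?h * (real T / \<delta> + 1) \<le> d / (3 * (real T / \<delta> + 1)) * (real T / \<delta> + 1)"
      using \<open>?h < d / (3 * (real T / \<delta> + 1))\<close> TD by (intro mult_right_mono) auto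
    also have "\<dots> = d / 3"
    proof -
      have "d / (3 * t) * t = d / 3" if "t > 0" for t :: real using that by simp
      thus ?thesis using TD by blast
    qed
    finally show "?h * (real T / \<delta> + 1) \<le> d / 3" .
  qed
  show ?thesis
  proof (rule that[of j])
    fix \<omega> assume good: "\<omega> \<notin> (\<Union>j. bad_paths n T \<delta> j)"
    let ?x = "\<lambda>i. padic_proj n (sample_path \<omega> (real i * ?h))"
    have path: "grid_path ?h ?K (skeleton n ?h ?K (sample_path \<omega>)) = grid_path ?h ?K ?x"
      unfolding grid_path_def skeleton_def by (simp add: min.assoc[symmetric] min.commute)
    have "skorohod_dist \<omega> (grid_path ?h ?K ?x)
      \<le> max (2 * (?h / \<delta>)) (real CARD('p) powi (- n) + ?h * (real T / \<delta> + 1) + exp (- real T))"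
    proof (rule skorohod_dist_grid_path[where r = "real CARD('p) powi (- n)"])
      show "dist y (padic_proj n y) \<le> real CARD('p) powi (- n)" for y :: "'p padic"
        unfolding dist_padic_def by (rule padic_proj_near)
      show "real CARD('p) powi (- n) > 0" using padic_haar.p_pos[OF padic_haar_axioms] by simp
      show "padic_proj n y = padic_proj n z" if "dist y z < real CARD('p) powi (- n)" for y z :: "'p padic"
        using that unfolding padic_proj_eq_iff pball_def dist_padic_def by (simp add: padic_abs_commute)
      show "\<not> irregular (1 / 2 ^ j) \<delta> ((T + 1) * 2 ^ j) (\<lambda>i. padic_proj n (sample_path \<omega> (real i * (1 / 2 ^ j))))" for j
        using good by (auto simp: bad_paths_def)
    qed (use \<delta> h1 in auto)
    also have "\<dots> \<le> d" by (rule max.boundedI[OF h2]) (use h3 T n in linarith)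
    finally show "dist \<omega> (grid_path ?h ?K (skeleton n ?h ?K (sample_path \<omega>))) \<le> d"
      unfolding path dist_cadlag_def .
  qed
qed

text \<open>The values on good paths and on their grid paths differ by at most \<open>L * d\<close>,
  on bad paths by at most 1. Of the error \<open>e\<close>, two fifths go to this replacement under
  \<open>Pm m\<close>, two fifths under \<open>P\<close>, and one fifth to the skeletons.\<close>

lemma lipschitz_limit:
  fixes f :: "'p padic cadlag \<Rightarrow> real"
  assumes L: "L \<ge> 0" and f: "\<And>x. 0 \<le> f x" "\<And>x. f x \<le> 1" and lip: "\<And>x y. \<bar>f x - f y\<bar> \<le> L * dist x y"
  shows "(\<lambda>m. \<integral>\<omega>. f \<omega> \<partial>Pm m) \<longlonglongrightarrow> (\<integral>\<omega>. f \<omega> \<partial>P)"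
proof (rule tendstoI)
  fix e :: real assume e: "e > 0"
  \<comment> \<open>Chosen so that \<open>L * d\<close> is at most e / 5; the denominator uses
    \<open>L + 1\<close> to allow L = 0.\<close>
  define d where "d = e / (5 * (L + 1))"
  have d: "d > 0" using e L by (simp add: d_def)
  have "L * d \<le> (L + 1) * d" using d by (intro mult_right_mono) auto
  also have "\<dots> = e / 5" using L by (simp add: d_def field_simps)
  finally have Ld: "L * d \<le> e / 5" .
  have "(\<lambda>T. exp (- real T)) \<longlonglongrightarrow> 0" by real_asymp
  from order_tendstoD(2)[OF this, of "d / 3"] d
  obtain T :: nat where T: "exp (- real T) < d / 3" by (auto simp: eventually_sequentially)
  obtain n0 where "(1 / real CARD('p)) ^ n0 < d / 3"
    using real_arch_pow_inv[of "d / 3" "1 / real CARD('p)"] d card_gt_1[where 'p = 'p] by auto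
  hence n: "real CARD('p) powi (- int n0) < d / 3" by (simp add: power_int_minus power_divide inverse_eq_divide)
  obtain \<delta> where \<delta>: "\<delta> > 0" and bad_Pm: "\<forall>\<^sub>F m in sequentially. measure (Pm m) (\<Union>j. bad_paths (int n0) T \<delta> j) \<le> e / 5"
    and bad_P: "measure P (\<Union>j. bad_paths (int n0) T \<delta> j) \<le> e / 5"
    using bad_paths_small[of "e / 5" "int n0" T] e by auto
  obtain j where j: "\<And>\<omega>. \<omega> \<notin> (\<Union>j. bad_paths (int n0) T \<delta> j) \<Longrightarrow>
    dist \<omega> (grid_path (1 / 2 ^ j) (T * 2 ^ j) (skeleton (int n0) (1 / 2 ^ j) (T * 2 ^ j) (sample_path \<omega>))) \<le> d"
    using grid_approximation[OF T n \<delta> d] by blast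
  let ?h = "1 / 2 ^ j :: real" and ?K = "T * 2 ^ j" and ?Bad = "\<Union>j. bad_paths (int n0) T \<delta> j"
  define F where "F w = f (grid_path ?h ?K w)" for w
  let ?G = "\<lambda>\<omega>. skeleton (int n0) ?h ?K (sample_path \<omega>)"
  have approx: "\<bar>(\<integral>\<omega>. f \<omega> \<partial>R) - (\<integral>\<omega>. F (?G \<omega>) \<partial>R)\<bar> \<le> 2 * e / 5"
    if R: "prob_space R" "sets R = sets borel" and bad: "measure R ?Bad \<le> e / 5" for R :: "'p padic cadlag measure"
  proof -
    interpret R: prob_space R by fact
    have "bad_paths (int n0) T \<delta> j \<in> sets R" for j
      unfolding bad_paths_def by (rule irregular_sets[OF R]) simp
    hence Bad: "?Bad \<in> sets R" by (intro sets.countable_UN) auto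
    have "f \<in> borel_measurable R"
      using borel_measurable_continuous_onI[OF lipschitz_continuous_on_UNIV[OF L lip]] measurable_cong_sets[OF R(2) refl] by blast
    hence fi: "integrable R f" by (intro R.integrable_const_bound[of _ 1]) (use f in auto)
    have "?G \<in> measurable R (count_space UNIV)"
      by (rule skeleton_law[OF R, where n = "int n0" and K = ?K and h = ?h]) (simp, blast)
    hence "(\<lambda>\<omega>. F (?G \<omega>)) \<in> borel_measurable R" by (rule measurable_compose) simp
    hence Fi: "integrable R (\<lambda>\<omega>. F (?G \<omega>))" by (intro R.integrable_const_bound[of _ 1]) (use f in \<open>auto simp: F_def\<close>)
    have pointwise: "\<bar>f \<omega> - F (?G \<omega>)\<bar> \<le> L * d + indicator ?Bad \<omega>" for \<omega>
    proof (cases "\<omega> \<in> ?Bad")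
      case True
      have "\<bar>f \<omega> - F (?G \<omega>)\<bar> \<le> 1" using f[of \<omega>] f[of "grid_path ?h ?K (?G \<omega>)"] by (simp add: F_def)
      moreover have "0 \<le> L * d" using L d by simp
      moreover have "indicator ?Bad \<omega> = (1 :: real)" using True by (rule indicator_simps(1))
      ultimately show ?thesis by linarith
    next
      case False
      have "\<bar>f \<omega> - F (?G \<omega>)\<bar> \<le> L * dist \<omega> (grid_path ?h ?K (?G \<omega>))" unfolding F_def by (rule lip)
      also have "\<dots> \<le> L * d" by (rule mult_left_mono[OF j[OF False] L])
      also have "\<dots> \<le> L * d + indicator ?Bad \<omega>" by simp
      finally show ?thesis .
    qed
    have "\<bar>(\<integral>\<omega>. f \<omega> \<partial>R) - (\<integral>\<omega>. F (?G \<omega>) \<partial>R)\<bar> = \<bar>\<integral>\<omega>. f \<omega> - F (?G \<omega>) \<partial>R\<bar>"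
      using fi Fi by simp
    also have "\<dots> \<le> (\<integral>\<omega>. \<bar>f \<omega> - F (?G \<omega>)\<bar> \<partial>R)"
      using integral_norm_bound[of R "\<lambda>\<omega>. f \<omega> - F (?G \<omega>)"] by simp
    also have "\<dots> \<le> (\<integral>\<omega>. L * d + indicator ?Bad \<omega> \<partial>R)"
    proof (rule integral_mono[OF _ _ pointwise])
      show "integrable R (\<lambda>\<omega>. \<bar>f \<omega> - F (?G \<omega>)\<bar>)" using fi Fi by simp
      show "integrable R (\<lambda>\<omega>. L * d + indicator ?Bad \<omega>)"
        by (intro Bochner_Integration.integrable_add R.integrable_const integrable_real_indicator Bad) (simp add: R.emeasure_eq_measure)
    qed
    also have "\<dots> = L * d + measure R ?Bad"
    proof -
      have "integrable R (indicator ?Bad :: _ \<Rightarrow> real)"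
        by (intro integrable_real_indicator Bad) (simp add: R.emeasure_eq_measure)
      moreover have "?Bad \<inter> space R = ?Bad" by (simp only: space_eq_UNIV[OF R(2)] Int_UNIV_right)
      ultimately show ?thesis by (simp add: R.prob_space del: UN_iff)
    qed
    also have "\<dots> \<le> 2 * e / 5" using Ld bad by simp
    finally show ?thesis .
  qed
  have "(\<lambda>m. \<integral>\<omega>. F (?G \<omega>) \<partial>Pm m) \<longlonglongrightarrow> (\<integral>\<omega>. F (?G \<omega>) \<partial>P)"
    by (rule skeleton_expectation_tendsto) (use f in \<open>auto simp: F_def\<close>)
  from tendstoD[OF this, of "e / 5"] e
  have "\<forall>\<^sub>F m in sequentially. dist (\<integral>\<omega>. F (?G \<omega>) \<partial>Pm m) (\<integral>\<omega>. F (?G \<omega>) \<partial>P) < e / 5" by simp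
  with bad_Pm show "\<forall>\<^sub>F m in sequentially. dist (\<integral>\<omega>. f \<omega> \<partial>Pm m) (\<integral>\<omega>. f \<omega> \<partial>P) < e"
  proof eventually_elim
    case (elim m)
    from approx[OF Pm_prob Pm_sets elim(1)] approx[OF P_prob P_sets bad_P] elim(2)
    show ?case unfolding dist_real_def by linarith
  qed
qed

end

theorem theorem4p1:
  fixes b \<sigma> :: real
    and \<mu> :: "'p::prime_card padic measure"
    and M :: "'s measure"
    and X :: "nat \<Rightarrow> 's \<Rightarrow> 'p padic_quot"
    and Pm :: "nat \<Rightarrow> 'p padic cadlag measure"
    and P :: "'p padic cadlag measure"
  assumes "b > 0" and "\<sigma> > 0"
    and "is_padic_haar \<mu>"
    and "is_primitive_walk b M X"
    and "\<And>m. is_scaled_walk_law b \<sigma> M X m (Pm m)"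
    and "is_padic_brownian_motion \<mu> b \<sigma> P"
  shows "weakly_converges Pm P"
proof -
  interpret prob_space M using assms(4) by (simp add: is_primitive_walk_def)
  interpret padic_walk_limit M b X \<mu> \<sigma> Pm P
    by unfold_locales (use assms in auto)
  show ?thesis
    by (rule weakly_converges_lipschitz[OF Pm_prob Pm_sets P_prob P_sets lipschitz_limit])
qed

end
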